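(* Let $\mathcal X$ be a quantum set. Let $T$ be the binary relation on $`[0,\infty]$ defined by $T = `(\leq)$. Consider the one-to-one correspondence between quantum pseudometrics $(V_\beta\,|\, \beta \in [0,\infty))$ on $\ell^\infty(\mathcal X)$ and functions $F: \mathcal X \times \mathcal X^* \to `[0, \infty]$ such that (1) $[\![(\forall (x_1 = x_{1*}) \in \mathcal X \times \mathcal X^* )\, E_{`[0,\infty]}(F(x_1,x_{1*}),`0_* )]\!] = \top$; (2) $[\![(\forall (x_1 = x_{1*}) \in \mathcal X \times \mathcal X^* )\, (\forall (x_2 = x_{2*}) \in \mathcal X \times \mathcal X^* )\, E_{`[0,\infty]}( F(x_1, x_{2*}), C_{[0,\infty]}(F(x_{2}, x_{1*})))]\!] = \top$; (3) $[\![(\forall (x_1 = x_{1*}) \in \mathcal X \times \mathcal X^* )\, (\forall (x_2 = x_{2*}) \in \mathcal X \times \mathcal X^* )\,(\forall (x_3 = x_{3*}) \in \mathcal X \times \mathcal X^* )\, \widehat T( F(x_1,x_{2*}), `(+)_*( F_*(x_{1*},x_{3}), F_*(x_{3*}, x_2)))]\!] = \top$; given by $\sum_{\alpha \in [0,\beta]} R_\alpha(X_1, X_2) = \mathrm{inc}^\dagger_{X_2} \cdot V_\beta \cdot \mathrm{inc}_{X_1}$, for $\beta \in [0, \infty)$ and $X_1, X_2 \in \mathrm{At}(\mathcal X)$, where $\widehat R_\alpha = `\alpha^\dagger \circ F$ for each $\alpha \in [0,\infty]$. This correspondence restricts to a one-to-one correspondence between quantum metrics $(V_\beta\,|\,\beta\in[0,\infty))$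 on $\ell^\infty(\mathcal X)$ and functions $F: \mathcal X \times \mathcal X^* \to `[0, \infty]$ satisfying conditions (1), (2) and (3), together with (4) $[\![( \forall x_1 \in \mathcal X)\, (\forall x_{2*} \in \mathcal X^* )\, (E_{`[0,\infty]}(F(x_1, x_{2*}),`0_* ) \to E_{\mathcal X}(x_1, x_{2*}))]\!] = \top$.
   Context: Operators. Hilbert spaces are complex. $L(H,K)$ is the space of bounded operators $H\to K$, $L(H)=L(H,H)$, $H^*=L(H,\mathbb C)$. For $a\in L(H,K)$: $a^\dagger\in L(K,H)$ is the Hermitian adjoint, $a^*\in L(K^*,H^* )$ the transpose, $a_*=(a^\dagger)^*\in L(H^*,K^* )$. Products of subspaces of operators denote linear spans of products. The identifications $X^{**}=X$, $(X\otimes Y)^*=X^*\otimes Y^*$, $\mathbb C^*=\mathbb C$, $X\otimes\mathbb C=X$ are used. Quantum sets. A quantum set $\mathcal X$ is an object uniquely determined by a set $\mathrm{At}(\mathcal X)$ of nonzero finite-dimensional Hilbert spaces, its atoms. $\ell^\infty(\mathcal X)=\bigoplus_{X\in\mathrm{At}(\mathcal X)}L(X)$ is the $\ell^\infty$-direct sum von Neumann algebra, canonically represented on the $\ell^2$-direct sum $\bigoplus\mathrm{At}(\mathcal X)$; $\mathrm{inc}_X\in L(X,\bigoplus\mathrm{At}(\mathcal X))$ is the inclusion isometry. $\mathcal X\times\mathcal Y$ has atoms $X\otimes Y$; $\mathcal X^*$ has atoms $X^*$; $\mathbf 1$ (the empty product) has the single atom $\mathbb C$. For an ordinary set $A$,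 $`A$ has exactly one one-dimensional atom $\mathbb C_a$ for each $a\in A$ (distinct for distinct $a$); $`(A\times B)$ is identified with $`A\times`B$. Quantum (pseudo)metrics. For a von Neumann algebra $M\subseteq L(H)$, a quantum pseudometric on $M$ is a family $(V_\beta\subseteq L(H)\,|\,\beta\in[0,\infty))$ of ultraweakly closed subspaces with $V_\beta^\dagger=V_\beta$, $V_\alpha V_\beta\subseteq V_{\alpha+\beta}$ for all $\alpha,\beta$, $V_\alpha=\bigcap_{\beta>\alpha}V_\beta$ for all $\alpha$, and $M'\subseteq V_0$. It is a quantum metric if moreover $V_0=M'$. Binary relations. A binary relation $R$ from $\mathcal X$ to $\mathcal Y$ (on $\mathcal X$ if $\mathcal Y=\mathcal X$) is a choice of subspaces $R(X,Y)\le L(X,Y)$ for all atoms $X,Y$. Order, joins, meets and complement $\neg$ are componentwise (inclusion, span, intersection, orthogonal complement for $\langle a|b\rangle=\mathrm{Tr}(a^\dagger b)$); $\top$ and $\bot$ (or $\top_{\mathcal X}$, $\bot_{\mathcal X}$ for $\mathcal Y=\mathbf 1$) are the largest and smallest. $(S\circ R)(X,Z)=\sum_Y S(Y,Z)\cdot R(X,Y)$; $(R\times S)(X\otimes X',Y\otimes Y')=R(X,Y)\otimes S(X',Y')$; $R^\dagger(Y,X)=\{r^\dagger: r\in R(X,Y)\}$; $R_*(X^*,Y^* )=\{r_*: r\in R(X,Y)\}$; $I_{\mathcal X}(X,X)=\mathbb C1_X$, with other components $0$. A function $F:\mathcal X\to\mathcal Y$ is a binary relation with $F^\dagger\circ F\ge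 I_{\mathcal X}$ and $F\circ F^\dagger\le I_{\mathcal Y}$. For an ordinary binary relation $r\subseteq A\times B$, $`r(\mathbb C_a,\mathbb C_b)=L(\mathbb C_a,\mathbb C_b)$ if $(a,b)\in r$ and $0$ otherwise; for $a\in A$, $`a:\mathbf 1\to`A$ is the function with $`a(\mathbb C,\mathbb C_a)=L(\mathbb C,\mathbb C_a)$, other components $0$, and $`a_*:\mathbf 1\to(`A)^*$ is its conjugate. $`(+):`[0,\infty]\times`[0,\infty]\to`[0,\infty]$ comes from addition on $[0,\infty]$. $C_A:`A\to(`A)^*$ is the function with $C_A(\mathbb C_a,\mathbb C_a^* )=L(\mathbb C_a,\mathbb C_a^* )$, other components $0$. A relation of arity $(\mathcal X_1,\dots,\mathcal X_n)$ is a binary relation $R$ from $\mathcal X_1\times\cdots\times\mathcal X_n$ to $\mathbf 1$; write $R(X_1\otimes\cdots\otimes X_n)$ for $R(X_1\otimes\cdots\otimes X_n,\mathbb C)$. The equality relation $E_{\mathcal X}$ of arity $(\mathcal X,\mathcal X^* )$ has $E_{\mathcal X}(X\otimes X^* )=\mathbb C\epsilon_X$, with $\epsilon_X:X\otimes X^*\to\mathbb C$ evaluation, and $E_{\mathcal X}(X_1\otimes X_2^* )=0$ for $X_1\ne X_2$. For a binary relation $B$ from $\mathcal X$ to $\mathcal Y$, $\widehat B=E_{\mathcal Y}\circ(B\times I_{\mathcal Y^*})$, of arity $(\mathcal X,\mathcal Y^* )$; $B\mapsto\widehat B$ is a bijection onto relations of arity $(\mathcal X,\mathcal Y^* )$.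 Formulas. Each quantum set is a sort with infinitely many variables. Nonduplicating terms of sort $\mathcal Y$: variables of sort $\mathcal Y$, and $F(s_1,\dots,s_m)$ ($m\ge0$) with $F:\mathcal X_1\times\cdots\times\mathcal X_m\to\mathcal Y$ a function and $s_i$ nonduplicating terms of sorts $\mathcal X_i$, no two sharing a variable. Nonduplicating atomic formulas: $R(t_1,\dots,t_n)$ with $R$ a relation of arity $(\mathcal Y_1,\dots,\mathcal Y_n)$ and $t_i$ nonduplicating terms of sorts $\mathcal Y_i$, no two sharing a variable. Formulas are built from these with connectives and quantifiers. Interpretation. For distinct variables $x_i$ of sorts $\mathcal X_i$ including the free variables of $\phi$, $[\![\phi]\!]=[\![(x_1,\dots,x_n)\in\mathcal X_1\times\cdots\times\mathcal X_n\,|\,\phi]\!]$ is a relation of arity $(\mathcal X_1,\dots,\mathcal X_n)$ (for a sentence, $\top$ or $\bot$), defined recursively. For a permutation $\pi$ of $\{1,\dots,n\}$, $m\le n$ and $R$ of arity $(\mathcal X_{\pi(1)},\dots,\mathcal X_{\pi(m)})$, $[\![R(x_{\pi(1)},\dots,x_{\pi(m)})]\!](X_1\otimes\cdots\otimes X_n)=(R\times\top_{\mathcal X_{\pi(m+1)}}\times\cdots\times\top_{\mathcal X_{\pi(n)}})(X_{\pi(1)}\otimes\cdots\otimes X_{\pi(n)})\cdot u_\pi$, where $u_\pi$ is the unitary permuting tensor factors. $[\![\neg\phi]\!]=\neg[\![\phi]\!]$; $[\![\phi\wedge\psi]\!]=[\![\phi]\!]\wedge[\![\psi]\!]$; $[\![(x_1,\dots,x_n)\,|\,(\forall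 x\in\mathcal X)\,\phi]\!]=\sup\{R \text{ of arity }(\mathcal X_1,\dots,\mathcal X_n): \top_{\mathcal X}\times R\le[\![(x,x_1,\dots,x_n)\,|\,\phi]\!]\}$. Abbreviations: $\phi\vee\psi$ is $\neg(\neg\phi\wedge\neg\psi)$; $\exists$ is $\neg\forall\neg$; $\phi\to\psi$ is $\neg\phi\vee(\phi\wedge\psi)$; $(\forall(x=x_* )\in\mathcal X\times\mathcal X^* )\,\phi$ is $(\forall x_*\in\mathcal X^* )(\forall x\in\mathcal X)(E_{\mathcal X}(x,x_* )\to\phi)$, with $x,x_*$ distinct variables; $(\exists(x=x_* )\in\mathcal X\times\mathcal X^* )\,\phi$ is $\neg(\forall(x=x_* )\in\mathcal X\times\mathcal X^* )\,\neg\phi$. If not all $t_i$ are variables, $R(t_1,\dots,t_n)$ abbreviates $(\exists(y_n=y_{n*})\in\mathcal Y_n\times\mathcal Y_n^* )\cdots(\exists(y_1=y_{1*})\in\mathcal Y_1\times\mathcal Y_1^* )(R(y_1,\dots,y_n)\wedge t_1\curvearrowright y_{1*}\wedge\cdots\wedge t_n\curvearrowright y_{n*})$ with all $y_i,y_{i*}$ new variables, where $t\curvearrowright y_*$ is $E_{\mathcal Y}(t,y_* )$ if $t$ is a variable and $\widehat F(s_1,\dots,s_m,y_* )$ if $t=F(s_1,\dots,s_m)$. *)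

theory Defs
  imports "HOL-Analysis.Analysis" "HOL-Library.Function_Algebras"
begin

section \<open>Complex inner product spaces\<close>

text \<open>Inner products are conjugate-linear in the first argument.\<close>

class complex_inner = real_inner +
  fixes scaleC :: "complex \<Rightarrow> 'a \<Rightarrow> 'a"  (infixr "*\<^sub>C" 75)
    and cinner :: "'a \<Rightarrow> 'a \<Rightarrow> complex"
  assumes scaleC_add_right: "c *\<^sub>C (x + y) = c *\<^sub>C x + c *\<^sub>C y"
    and scaleC_add_left: "(c + d) *\<^sub>C x = c *\<^sub>C x + d *\<^sub>C x"
    and scaleC_scaleC: "c *\<^sub>C d *\<^sub>C x = (c * d) *\<^sub>C x"
    and scaleR_eq_scaleC: "scaleR r x = complex_of_real r *\<^sub>C x"
    and cinner_commute: "cinner x y = cnj (cinner y x)"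
    and cinner_add_right: "cinner x (y + z) = cinner x y + cinner x z"
    and cinner_scaleC_right: "cinner x (c *\<^sub>C y) = c * cinner x y"
    and Re_cinner: "Re (cinner x y) = inner x y"

global_interpretation complex_vector:
  vector_space "scaleC :: complex \<Rightarrow> 'a \<Rightarrow> 'a::complex_inner"
proof
  fix x :: 'a
  show "1 *\<^sub>C x = x"
    using scaleR_eq_scaleC [of 1 x] by simp
qed (rule scaleC_add_right scaleC_add_left scaleC_scaleC)+

lemma cinner_zero_right [simp]: "cinner x 0 = 0"
  using cinner_add_right [of x 0 0] by simp

lemma cinner_zero_left [simp]: "cinner 0 x = 0"
  using cinner_commute [of 0 x] by simp

lemma cinner_add_left: "cinner (x + y) z = cinner x z + cinner y z"
  using cinner_commute [of "x + y" z] cinner_commute [of x z] cinner_commute [of y z]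
  by (simp add: cinner_add_right)

lemma cinner_scaleC_left: "cinner (c *\<^sub>C x) y = cnj c * cinner x y"
  using cinner_commute [of "c *\<^sub>C x" y] cinner_commute [of x y]
  by (simp add: cinner_scaleC_right)

lemma cinner_diff_right: "cinner x (y - z) = cinner x y - cinner x z"
  using cinner_add_right [of x "y - z" z] by simp

lemma cinner_sum_right: "cinner x (sum f S) = (\<Sum>i\<in>S. cinner x (f i))"
  by (induction S rule: infinite_finite_induct) (simp_all add: cinner_add_right)

lemma cinner_self: "cinner x x = complex_of_real ((norm x)\<^sup>2)"
proof (rule complex_eqI)
  show "Re (cinner x x) = Re (complex_of_real ((norm x)\<^sup>2))"
    by (simp add: Re_cinner power2_norm_eq_inner)
  have "Im (cinner x x) = Im (cnj (cinner x x))"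
    using cinner_commute [of x x] by simp
  then show "Im (cinner x x) = Im (complex_of_real ((norm x)\<^sup>2))"
    by simp
qed

lemma norm_scaleC: "norm (c *\<^sub>C x) = cmod c * norm x"
proof -
  have "complex_of_real ((norm (c *\<^sub>C x))\<^sup>2) = cnj c * c * complex_of_real ((norm x)\<^sup>2)"
    unfolding cinner_self [symmetric] by (simp add: cinner_scaleC_left cinner_scaleC_right)
  also have "\<dots> = complex_of_real ((cmod c * norm x)\<^sup>2)"
    using complex_norm_square [of c] by (simp add: power_mult_distrib mult.commute)
  finally have "(norm (c *\<^sub>C x))\<^sup>2 = (cmod c * norm x)\<^sup>2"
    by (simp only: of_real_eq_iff)
  then show ?thesis
    by (simp add: power2_eq_iff_nonneg)
qed

lemma cmod_cinner_le: "cmod (cinner x y) \<le> (norm x)\<^sup>2 + (norm y)\<^sup>2"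
proof -
  have "2 * (norm x * norm y) \<le> (norm x)\<^sup>2 + (norm y)\<^sup>2"
    using sum_squares_bound [of "norm x" "norm y"] by simp
  moreover have "\<bar>Re (cinner x y)\<bar> \<le> norm x * norm y"
    by (simp add: Re_cinner Cauchy_Schwarz_ineq2)
  moreover have "Im (cinner x y) = inner x ((- \<i>) *\<^sub>C y)"
    unfolding Re_cinner [symmetric] cinner_scaleC_right by simp
  then have "\<bar>Im (cinner x y)\<bar> \<le> norm x * norm y"
    using Cauchy_Schwarz_ineq2 [of x "(- \<i>) *\<^sub>C y"] by (simp add: norm_scaleC)
  ultimately show ?thesis
    using cmod_le [of "cinner x y"] by linarith
qed

instantiation complex :: complex_inner
begin

definition scaleC_complex :: "complex \<Rightarrow> complex \<Rightarrow> complex"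
  where "scaleC_complex c x = c * x"

definition cinner_complex :: "complex \<Rightarrow> complex \<Rightarrow> complex"
  where "cinner_complex x y = cnj x * y"

instance
  by standard
    (auto simp: scaleC_complex_def cinner_complex_def algebra_simps inner_complex_def
      scaleR_conv_of_real)

end


subsection \<open>The space of square summable families\<close>

typedef (overloaded) ('i, 'v) l2 =
    "{\<xi> :: 'i \<Rightarrow> 'v::complex_inner. (\<lambda>i. (norm (\<xi> i))\<^sup>2) summable_on UNIV}"
  morphisms coord Abs_l2
  by (rule exI [of _ "\<lambda>_. 0"]) simp

setup_lifting type_definition_l2

lemma coord_summable: "(\<lambda>i. (norm (coord \<xi> i))\<^sup>2) summable_on UNIV"
  using coord [of \<xi>] by simp

lemma norm_add_sq_le: "(norm (x + y))\<^sup>2 \<le> 2 * (norm x)\<^sup>2 + 2 * (norm y)\<^sup>2"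
  for x y :: "'a::real_inner"
proof -
  have "(norm (x + y))\<^sup>2 + (norm (x - y))\<^sup>2 = 2 * (norm x)\<^sup>2 + 2 * (norm y)\<^sup>2"
    by (simp add: power2_norm_eq_inner inner_add_left inner_add_right inner_diff_left
        inner_diff_right)
  then show ?thesis
    by (smt (verit) zero_le_power2)
qed

lemma sq_summable_add:
  fixes f g :: "'i \<Rightarrow> 'v::complex_inner"
  assumes "(\<lambda>i. (norm (f i))\<^sup>2) summable_on UNIV" "(\<lambda>i. (norm (g i))\<^sup>2) summable_on UNIV"
  shows "(\<lambda>i. (norm (f i + g i))\<^sup>2) summable_on UNIV"
proof (rule summable_on_comparison_test)
  show "(\<lambda>i. 2 * (norm (f i))\<^sup>2 + 2 * (norm (g i))\<^sup>2) summable_on UNIV"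
    by (intro summable_on_add summable_on_cmult_right assms)
qed (use norm_add_sq_le in auto)

lemma sq_summable_scaleC:
  fixes f :: "'i \<Rightarrow> 'v::complex_inner"
  assumes "(\<lambda>i. (norm (f i))\<^sup>2) summable_on UNIV"
  shows "(\<lambda>i. (norm (c *\<^sub>C f i))\<^sup>2) summable_on UNIV"
  using summable_on_cmult_right [OF assms, of "(cmod c)\<^sup>2"]
  by (simp add: norm_scaleC power_mult_distrib)

lemma summable_cinner: "(\<lambda>i. cinner (coord \<xi> i) (coord \<eta> i)) summable_on UNIV"
proof (rule abs_summable_summable, rule summable_on_comparison_test)
  show "(\<lambda>i. (norm (coord \<xi> i))\<^sup>2 + (norm (coord \<eta> i))\<^sup>2) summable_on UNIV"
    by (intro summable_on_add coord_summable)
qed (auto simp: cmod_cinner_le)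

instantiation l2 :: (type, complex_inner) complex_inner
begin

lift_definition zero_l2 :: "('a, 'b) l2" is "\<lambda>_. 0" by simp

lift_definition plus_l2 :: "('a, 'b) l2 \<Rightarrow> ('a, 'b) l2 \<Rightarrow> ('a, 'b) l2"
  is "\<lambda>\<xi> \<eta> i. \<xi> i + \<eta> i"
  by (simp add: sq_summable_add)

lift_definition uminus_l2 :: "('a, 'b) l2 \<Rightarrow> ('a, 'b) l2"
  is "\<lambda>\<xi> i. - \<xi> i"
  by simp

definition minus_l2 :: "('a, 'b) l2 \<Rightarrow> ('a, 'b) l2 \<Rightarrow> ('a, 'b) l2"
  where "minus_l2 \<xi> \<eta> = \<xi> + (- \<eta>)"

lift_definition scaleC_l2 :: "complex \<Rightarrow> ('a, 'b) l2 \<Rightarrow> ('a, 'b) l2"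
  is "\<lambda>c \<xi> i. c *\<^sub>C \<xi> i"
  by (simp add: sq_summable_scaleC)

definition scaleR_l2 :: "real \<Rightarrow> ('a, 'b) l2 \<Rightarrow> ('a, 'b) l2"
  where "scaleR_l2 r \<xi> = complex_of_real r *\<^sub>C \<xi>"

definition cinner_l2 :: "('a, 'b) l2 \<Rightarrow> ('a, 'b) l2 \<Rightarrow> complex"
  where "cinner_l2 \<xi> \<eta> = (\<Sum>\<^sub>\<infinity>i. cinner (coord \<xi> i) (coord \<eta> i))"

definition inner_l2 :: "('a, 'b) l2 \<Rightarrow> ('a, 'b) l2 \<Rightarrow> real"
  where "inner_l2 \<xi> \<eta> = Re (cinner \<xi> \<eta>)"

definition norm_l2 :: "('a, 'b) l2 \<Rightarrow> real"
  where "norm_l2 \<xi> = sqrt (inner \<xi> \<xi>)"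

definition sgn_l2 :: "('a, 'b) l2 \<Rightarrow> ('a, 'b) l2"
  where "sgn_l2 \<xi> = inverse (norm \<xi>) *\<^sub>R \<xi>"

definition dist_l2 :: "('a, 'b) l2 \<Rightarrow> ('a, 'b) l2 \<Rightarrow> real"
  where "dist_l2 \<xi> \<eta> = norm (\<xi> - \<eta>)"

definition uniformity_l2 :: "(('a, 'b) l2 \<times> ('a, 'b) l2) filter"
  where "uniformity_l2 = (INF e\<in>{0<..}. principal {(\<xi>, \<eta>). dist \<xi> \<eta> < e})"

definition open_l2 :: "('a, 'b) l2 set \<Rightarrow> bool"
  where "open_l2 U \<longleftrightarrow> (\<forall>\<xi>\<in>U. eventually (\<lambda>(\<xi>', \<eta>). \<xi>' = \<xi> \<longrightarrow> \<eta> \<in> U) uniformity)"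

instance
proof
  fix x y z :: "('a, 'b) l2" and r s :: real and c d :: complex
  show "x + y + z = x + (y + z)" "x + y = y + x" "0 + x = x" "- x + x = 0"
    by (transfer; simp add: algebra_simps)+
  show "x - y = x + - y"
    by (rule minus_l2_def)
  show addr: "c *\<^sub>C (x + y) = c *\<^sub>C x + c *\<^sub>C y" for c :: complex and x y :: "('a, 'b) l2"
    by (transfer; simp add: scaleC_add_right)
  show addl: "(c + d) *\<^sub>C x = c *\<^sub>C x + d *\<^sub>C x" for c d :: complex
    by (transfer; simp add: scaleC_add_left)
  show assoc: "c *\<^sub>C d *\<^sub>C x = (c * d) *\<^sub>C x" for c d :: complex
    by (transfer; simp add: scaleC_scaleC)
  show conv: "r *\<^sub>R x = complex_of_real r *\<^sub>C x" for r
    by (rule scaleR_l2_def)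
  show "r *\<^sub>R (x + y) = r *\<^sub>R x + r *\<^sub>R y" "(r + s) *\<^sub>R x = r *\<^sub>R x + s *\<^sub>R x"
    "r *\<^sub>R s *\<^sub>R x = (r * s) *\<^sub>R x"
    by (simp_all add: scaleR_l2_def addr addl assoc)
  show "1 *\<^sub>R x = x"
    unfolding scaleR_l2_def by (transfer; simp)
  show comm: "cinner x y = cnj (cinner y x)" for x y :: "('a, 'b) l2"
    unfolding cinner_l2_def infsum_cnj [symmetric] by (simp flip: cinner_commute)
  show add: "cinner x (y + z) = cinner x y + cinner x z" for x y z :: "('a, 'b) l2"
    unfolding cinner_l2_def
    by (simp add: plus_l2.rep_eq cinner_add_right infsum_add summable_cinner)
  show scale: "cinner x (c *\<^sub>C y) = c * cinner x y" for c and x y :: "('a, 'b) l2"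
    unfolding cinner_l2_def
    by (simp add: scaleC_l2.rep_eq cinner_scaleC_right infsum_cmult_right summable_cinner)
  show "Re (cinner x y) = inner x y"
    by (simp add: inner_l2_def)
  show ic: "inner x y = inner y x" for x y :: "('a, 'b) l2"
    using comm [of x y] by (simp add: inner_l2_def)
  show "inner (x + y) z = inner x z + inner y z"
    unfolding ic [of _ z] by (simp add: inner_l2_def add)
  show "inner (r *\<^sub>R x) y = r * inner x y"
    unfolding ic [of _ y] by (simp add: inner_l2_def scaleR_l2_def scale)
  have self: "inner x x = (\<Sum>\<^sub>\<infinity>i. (norm (coord x i))\<^sup>2)"
    unfolding inner_l2_def cinner_l2_def cinner_self
    by (subst infsumI [OF has_sum_of_real [OF has_sum_infsum [OF coord_summable]]]) simp
  show "0 \<le> inner x x"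
    unfolding self by (intro infsum_nonneg) simp
  show "inner x x = 0 \<longleftrightarrow> x = 0"
  proof
    assume "inner x x = 0"
    then have "(norm (coord x i))\<^sup>2 = 0" for i
      using nonneg_infsum_le_0D [OF _ coord_summable, of x i] by (simp add: self)
    then show "x = 0"
      by (transfer; auto)
  qed (simp add: inner_l2_def cinner_l2_def zero_l2.rep_eq)
qed (simp_all add: norm_l2_def sgn_l2_def dist_l2_def uniformity_l2_def open_l2_def)

end


section \<open>Operators on Hilbert spaces\<close>

text \<open>
  A Hilbert space is a complete linear subspace of a type of class \<^class>\<open>complex_inner\<close>.  Elements
  of \<open>L(H, K)\<close> are extended by \<open>0\<close> outside of \<open>H\<close>, so that composition and linear combinations of
  operators are those of functions.
\<close>

definition bounded_ops :: "'h::complex_inner set \<Rightarrow> 'k::complex_inner set \<Rightarrow> ('h \<Rightarrow> 'k) set" where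
  "bounded_ops H K = {a.
     (\<forall>x\<in>H. a x \<in> K) \<and> (\<forall>x. x \<notin> H \<longrightarrow> a x = 0) \<and>
     (\<forall>x\<in>H. \<forall>y\<in>H. a (x + y) = a x + a y) \<and> (\<forall>c. \<forall>x\<in>H. a (c *\<^sub>C x) = c *\<^sub>C a x) \<and>
     (\<exists>C. \<forall>x\<in>H. norm (a x) \<le> C * norm x)}"

definition op_scale :: "complex \<Rightarrow> ('h \<Rightarrow> 'k::complex_inner) \<Rightarrow> ('h \<Rightarrow> 'k)" where
  "op_scale c a = (\<lambda>x. c *\<^sub>C a x)"

global_interpretation op: vector_space op_scale
  by standard
    (auto simp: op_scale_def fun_eq_iff scaleC_add_right scaleC_add_left scaleC_scaleC)

definition adjoint_ops :: "'h::complex_inner set \<Rightarrow> ('h \<Rightarrow> 'h) set \<Rightarrow> ('h \<Rightarrow> 'h) set" where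
  "adjoint_ops H V =
     {b \<in> bounded_ops H H. \<exists>a\<in>V. \<forall>x\<in>H. \<forall>y\<in>H. cinner (a x) y = cinner x (b y)}"

definition op_prod :: "('h \<Rightarrow> 'h::complex_inner) set \<Rightarrow> ('h \<Rightarrow> 'h) set \<Rightarrow> ('h \<Rightarrow> 'h) set" where
  "op_prod V W = op.span {a \<circ> b | a b. a \<in> V \<and> b \<in> W}"

definition commutant :: "'h::complex_inner set \<Rightarrow> ('h \<Rightarrow> 'h) set \<Rightarrow> ('h \<Rightarrow> 'h) set" where
  "commutant H M = {b \<in> bounded_ops H H. \<forall>a\<in>M. a \<circ> b = b \<circ> a}"

text \<open>
  The coarsest topology on \<open>L(H)\<close> for which all functionals
  \<open>a \<mapsto> \<Sum>\<^sub>n \<langle>\<xi>\<^sub>n | a \<eta>\<^sub>n\<rangle>\<close> with \<open>\<Sum>\<^sub>n \<parallel>\<xi>\<^sub>n\<parallel>\<^sup>2 < \<infinity>\<close> and \<open>\<Sum>\<^sub>n \<parallel>\<eta>\<^sub>n\<parallel>\<^sup>2 < \<infinity>\<close> are continuous.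
\<close>

definition ultraweak :: "'h::complex_inner set \<Rightarrow> ('h \<Rightarrow> 'h) topology" where
  "ultraweak H = topology_generated_by
     {{a \<in> bounded_ops H H. (\<Sum>n. cinner (\<xi> n) (a (\<eta> n))) \<in> U} | (\<xi> :: nat \<Rightarrow> 'h) \<eta> U.
        range \<xi> \<subseteq> H \<and> range \<eta> \<subseteq> H \<and>
        summable (\<lambda>n. (norm (\<xi> n))\<^sup>2) \<and> summable (\<lambda>n. (norm (\<eta> n))\<^sup>2) \<and> open U}"

text \<open>
  The family is indexed by the nonnegative reals; \<^const>\<open>extensional\<close> fixes its irrelevant values at
  negative reals, so that equality of functions is equality of families.
\<close>

definition quantum_pseudometric ::
  "'h::complex_inner set \<Rightarrow> ('h \<Rightarrow> 'h) set \<Rightarrow> (real \<Rightarrow> ('h \<Rightarrow> 'h) set) \<Rightarrow> bool" where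
  "quantum_pseudometric H M V \<longleftrightarrow>
     V \<in> extensional {0..} \<and>
     (\<forall>\<beta>\<ge>0. V \<beta> \<subseteq> bounded_ops H H \<and> op.subspace (V \<beta>) \<and> closedin (ultraweak H) (V \<beta>)) \<and>
     (\<forall>\<beta>\<ge>0. adjoint_ops H (V \<beta>) = V \<beta>) \<and>
     (\<forall>\<alpha>\<ge>0. \<forall>\<beta>\<ge>0. op_prod (V \<alpha>) (V \<beta>) \<subseteq> V (\<alpha> + \<beta>)) \<and>
     (\<forall>\<alpha>\<ge>0. V \<alpha> = (\<Inter>\<beta>\<in>{\<alpha><..}. V \<beta>)) \<and>
     commutant H M \<subseteq> V 0"

definition quantum_metric ::
  "'h::complex_inner set \<Rightarrow> ('h \<Rightarrow> 'h) set \<Rightarrow> (real \<Rightarrow> ('h \<Rightarrow> 'h) set) \<Rightarrow> bool" where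
  "quantum_metric H M V \<longleftrightarrow> quantum_pseudometric H M V \<and> V 0 = commutant H M"


section \<open>Quantum sets\<close>

text \<open>
  A quantum set is given by its set \<open>A\<close> of atoms.  Any set of finite-dimensional Hilbert spaces is,
  up to isometry, a set of distinct subspaces of a single complex inner product space.
\<close>

definition quantum_set :: "'v::complex_inner set set \<Rightarrow> bool" where
  "quantum_set A \<longleftrightarrow>
     (\<forall>X\<in>A. X \<noteq> {0} \<and> (\<exists>B. finite B \<and> X = complex_vector.span B))"

definition direct_sum :: "'v::complex_inner set set \<Rightarrow> ('v set, 'v) l2 set" where
  "direct_sum A = {\<xi>. (\<forall>X\<in>A. coord \<xi> X \<in> X) \<and> (\<forall>X. X \<notin> A \<longrightarrow> coord \<xi> X = 0)}"

definition inc :: "'v::complex_inner set \<Rightarrow> 'v \<Rightarrow> ('v set, 'v) l2" where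
  "inc X x = Abs_l2 (\<lambda>Y. if Y = X then x else 0)"

definition linfty ::
  "'v::complex_inner set set \<Rightarrow> (('v set, 'v) l2 \<Rightarrow> ('v set, 'v) l2) set" where
  "linfty A = {a \<in> bounded_ops (direct_sum A) (direct_sum A).
     \<exists>b C. (\<forall>X\<in>A. b X \<in> bounded_ops X X \<and> (\<forall>x\<in>X. norm (b X x) \<le> C * norm x)) \<and>
           (\<forall>\<xi>\<in>direct_sum A. \<forall>X\<in>A. coord (a \<xi>) X = b X (coord \<xi> X))}"


subsection \<open>Atoms of the quantum sets used as sorts\<close>

text \<open>
  \<open>Sub X\<close> is the Hilbert space \<open>X\<close>, \<open>Pt a\<close> is the one-dimensional Hilbert space \<open>\<complex>\<^sub>a\<close>, and
  \<open>Dual\<close> marks dual Hilbert spaces, so that the identification of the double dual with the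
  original space is the equation \<open>dual (dual X) = X\<close>.
\<close>

datatype ('v, 'p) base = Sub "'v set" | Pt 'p

datatype ('v, 'p) atom = Prim "('v, 'p) base" | Dual "('v, 'p) base"

fun dual :: "('v, 'p) atom \<Rightarrow> ('v, 'p) atom" where
  "dual (Prim X) = Dual X"
| "dual (Dual X) = Prim X"

text \<open>A quantum set, and hence a sort, is a set of atoms.\<close>

type_synonym ('v, 'p) qset = "('v, 'p) atom set"

definition qset :: "'v set set \<Rightarrow> ('v, 'p) qset" where
  "qset A = (\<lambda>X. Prim (Sub X)) ` A"

definition dual_qset :: "('v, 'p) qset \<Rightarrow> ('v, 'p) qset" where
  "dual_qset \<X> = dual ` \<X>"

abbreviation pt :: "'p \<Rightarrow> ('v, 'p) atom" where
  "pt a \<equiv> Prim (Pt a)"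

definition classical :: "'p set \<Rightarrow> ('v, 'p) qset" where
  "classical S = pt ` S"

text \<open>
  Finite products of quantum sets are lists of quantum sets: the atoms of
  \<open>\<X>\<^sub>1 \<times> \<dots> \<times> \<X>\<^sub>n\<close> are the elements \<open>[X\<^sub>1, \<dots>, X\<^sub>n]\<close> of \<open>listset [\<X>\<^sub>1, \<dots>, \<X>\<^sub>n]\<close>, standing
  for \<open>X\<^sub>1 \<otimes> \<dots> \<otimes> X\<^sub>n\<close>, and \<open>[]\<close> is the
  quantum set \<open>\<one>\<close> with the single atom \<open>\<complex>\<close>.
\<close>


subsection \<open>Operators between tensor products of atoms\<close>

text \<open>
  Each atom \<open>X\<close> carries a fixed orthonormal basis; \<open>X\<^sup>*\<close> carries the dual basis, \<open>\<complex>\<^sub>a\<close> the basis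
  \<open>{1}\<close>, and tensor products carry the product bases.  Operators are identified with their matrices
  for these bases (row index first).  So \<open>a\<^sup>\<dagger>\<close> is the conjugate transpose, \<open>a\<^sup>*\<close> the transpose and
  \<open>a\<^sub>*\<close> the entrywise conjugate of \<open>a\<close>.
\<close>

definition orthonormal_basis :: "'v::complex_inner set \<Rightarrow> 'v set \<Rightarrow> bool" where
  "orthonormal_basis X B \<longleftrightarrow>
     finite B \<and> complex_vector.span B = X \<and>
     (\<forall>x\<in>B. \<forall>y\<in>B. cinner x y = (if x = y then 1 else 0))"

lemma orthonormal_basis_exists:
  assumes "finite B"
  shows "\<exists>C. orthonormal_basis (complex_vector.span B) C"
  using assms
proof (induction B)
  case empty
  then show ?case
    by (auto simp: orthonormal_basis_def intro!: exI [of _ "{}"])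
next
  case (insert x B)
  then obtain C where C: "finite C" "complex_vector.span C = complex_vector.span B"
    and on: "\<And>y z. y \<in> C \<Longrightarrow> z \<in> C \<Longrightarrow> cinner y z = (if y = z then 1 else 0)"
    by (auto simp: orthonormal_basis_def)
  define p where "p = (\<Sum>y\<in>C. cinner y x *\<^sub>C y)"
  define q where "q = x - p"
  have p: "p \<in> complex_vector.span C"
    unfolding p_def
    by (intro complex_vector.span_sum complex_vector.span_scale complex_vector.span_base)
  have orth: "cinner y q = 0" if "y \<in> C" for y
  proof -
    have "cinner y p = (\<Sum>z\<in>C. if y = z then cinner z x else 0)"
      unfolding p_def cinner_sum_right using that
      by (intro sum.cong) (auto simp: cinner_scaleC_right on)
    also have "\<dots> = cinner y x"
      using that C(1) by simp
    finally show ?thesis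
      by (simp add: q_def cinner_diff_right)
  qed
  have span_q: "complex_vector.span (insert x B) = complex_vector.span (insert q C)"
  proof -
    have "complex_vector.span (insert x B) = complex_vector.span (insert x C)"
      using C(2) by (simp add: complex_vector.span_insert)
    also have "\<dots> = complex_vector.span (insert q C)"
      unfolding q_def using complex_vector.eq_span_insert_eq [of x q C] p
      by (simp add: complex_vector.eq_span_insert_eq)
    finally show ?thesis .
  qed
  show ?case
  proof (cases "q = 0")
    case True
    then show ?thesis
      using span_q C(1) on by (intro exI [of _ C]) (auto simp: orthonormal_basis_def)
  next
    case False
    define u where "u = complex_of_real (inverse (norm q)) *\<^sub>C q"
    have "complex_vector.span (insert u C) = complex_vector.span (insert q C)"
    proof (rule complex_vector.span_eq [THEN iffD2], intro conjI subsetI)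
      fix y assume "y \<in> insert u C"
      then show "y \<in> complex_vector.span (insert q C)"
        by (auto simp: u_def intro: complex_vector.span_scale complex_vector.span_base)
    next
      fix y assume y: "y \<in> insert q C"
      have "complex_of_real (norm q) *\<^sub>C u = q"
        using False by (simp add: u_def)
      then have "q \<in> complex_vector.span (insert u C)"
        by (metis complex_vector.span_base complex_vector.span_scale insertI1)
      then show "y \<in> complex_vector.span (insert u C)"
        using y by (auto intro: complex_vector.span_base)
    qed
    moreover have "cinner u u = 1"
      using False
      by (simp add: u_def cinner_self norm_scaleC norm_inverse flip: of_real_inverse)
    moreover have "cinner y u = 0" "cinner u y = 0" if "y \<in> C" for y
      using orth [OF that] cinner_commute [of u y] by (simp_all add: u_def cinner_scaleC_right)
    moreover have "u \<notin> C"
      using calculation by (metis zero_neq_one)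
    ultimately show ?thesis
      using span_q C(1) on
      by (intro exI [of _ "insert u C"]) (auto simp: orthonormal_basis_def)
  qed
qed

definition onb :: "'v::complex_inner set \<Rightarrow> 'v set" where
  "onb X = (SOME B. orthonormal_basis X B)"

text \<open>The unique basis vector of \<open>\<complex>\<^sub>a\<close> is named \<^const>\<open>None\<close>.\<close>

fun base_basis :: "('v::complex_inner, 'p) base \<Rightarrow> 'v option set" where
  "base_basis (Sub X) = Some ` onb X"
| "base_basis (Pt a) = {None}"

fun atom_basis :: "('v::complex_inner, 'p) atom \<Rightarrow> 'v option set" where
  "atom_basis (Prim X) = base_basis X"
| "atom_basis (Dual X) = base_basis X"

definition basis :: "('v::complex_inner, 'p) atom list \<Rightarrow> 'v option list set" where
  "basis X = listset (map atom_basis X)"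

type_synonym 'v mat = "'v option list \<Rightarrow> 'v option list \<Rightarrow> complex"

definition mat_scale :: "complex \<Rightarrow> 'v mat \<Rightarrow> 'v mat" where
  "mat_scale c a = (\<lambda>i j. c * a i j)"

global_interpretation mat: vector_space mat_scale
  by standard (auto simp: mat_scale_def fun_eq_iff algebra_simps)

definition ops :: "('v::complex_inner, 'p) atom list \<Rightarrow> ('v, 'p) atom list \<Rightarrow> 'v mat set" where
  "ops X Y = {a. \<forall>i j. a i j \<noteq> 0 \<longrightarrow> i \<in> basis Y \<and> j \<in> basis X}"

definition mat_one :: "('v::complex_inner, 'p) atom list \<Rightarrow> 'v mat" where
  "mat_one X = (\<lambda>i j. if i = j \<and> j \<in> basis X then 1 else 0)"

text \<open>\<open>mat_mult Y b a\<close> is the product \<open>b \<cdot> a\<close> for \<open>a : X \<rightarrow> Y\<close> and \<open>b : Y \<rightarrow> Z\<close>.\<close>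

definition mat_mult :: "('v::complex_inner, 'p) atom list \<Rightarrow> 'v mat \<Rightarrow> 'v mat \<Rightarrow> 'v mat" where
  "mat_mult Y b a = (\<lambda>i k. \<Sum>j\<in>basis Y. b i j * a j k)"

definition mat_trace :: "('v::complex_inner, 'p) atom list \<Rightarrow> 'v mat \<Rightarrow> complex" where
  "mat_trace X a = (\<Sum>i\<in>basis X. a i i)"

definition mat_dagger :: "'v mat \<Rightarrow> 'v mat" where
  "mat_dagger a = (\<lambda>i j. cnj (a j i))"

definition mat_star :: "'v mat \<Rightarrow> 'v mat" where
  "mat_star a = (\<lambda>i j. cnj (a i j))"

text \<open>
  \<open>mat_tensor m n a b\<close> is \<open>a \<otimes> b\<close> where \<open>a\<close> is an operator from a product of \<open>m\<close> factors to a
  product of \<open>n\<close> factors.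
\<close>

definition mat_tensor :: "nat \<Rightarrow> nat \<Rightarrow> 'v mat \<Rightarrow> 'v mat \<Rightarrow> 'v mat" where
  "mat_tensor m n a b = (\<lambda>i j. a (take n i) (take m j) * b (drop n i) (drop m j))"

text \<open>
  The unitary \<open>X\<^sub>0 \<otimes> \<dots> \<otimes> X\<^sub>n\<^sub>-\<^sub>1 \<rightarrow> X\<^bsub>\<pi> 0\<^esub> \<otimes> \<dots> \<otimes> X\<^bsub>\<pi> (n - 1)\<^esub>\<close> permuting the tensor factors; the
  permutation \<open>\<pi>\<close> of \<open>{0, \<dots>, n - 1}\<close> is given as the list of its values.
\<close>

definition permute :: "nat list \<Rightarrow> 'a list \<Rightarrow> 'a list" where
  "permute \<pi> xs = map (\<lambda>k. xs ! k) \<pi>"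

definition mat_permute :: "nat list \<Rightarrow> ('v::complex_inner, 'p) atom list \<Rightarrow> 'v mat" where
  "mat_permute \<pi> X = (\<lambda>i j. if j \<in> basis X \<and> i = permute \<pi> j then 1 else 0)"

text \<open>The evaluation functional \<open>\<epsilon>\<^sub>X : X \<otimes> X\<^sup>* \<rightarrow> \<complex>\<close>.\<close>

definition mat_eval :: "('v::complex_inner, 'p) atom \<Rightarrow> 'v mat" where
  "mat_eval X = (\<lambda>i j. if i = [] \<and> (\<exists>e\<in>atom_basis X. j = [e, e]) then 1 else 0)"


section \<open>Binary relations\<close>

text \<open>
  Components at lists that are not atoms are set to \<open>{0}\<close>; hence equality and the order \<open>\<le>\<close> of
  functions are those of binary relations, and the meet is \<^const>\<open>inf\<close> of functions.
\<close>

type_synonym ('v, 'p) brel = "('v, 'p) atom list \<Rightarrow> ('v, 'p) atom list \<Rightarrow> 'v mat set"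

definition binary_relation ::
  "('v::complex_inner, 'p) qset list \<Rightarrow> ('v, 'p) qset list \<Rightarrow> ('v, 'p) brel \<Rightarrow> bool" where
  "binary_relation \<X> \<Y> R \<longleftrightarrow>
     (\<forall>X Y. if X \<in> listset \<X> \<and> Y \<in> listset \<Y> then R X Y \<subseteq> ops X Y \<and> mat.subspace (R X Y)
            else R X Y = {0})"

definition top_rel ::
  "('v::complex_inner, 'p) qset list \<Rightarrow> ('v, 'p) qset list \<Rightarrow> ('v, 'p) brel" where
  "top_rel \<X> \<Y> = (\<lambda>X Y. if X \<in> listset \<X> \<and> Y \<in> listset \<Y> then ops X Y else {0})"

definition neg_rel ::
  "('v::complex_inner, 'p) qset list \<Rightarrow> ('v, 'p) qset list \<Rightarrow> ('v, 'p) brel \<Rightarrow> ('v, 'p) brel" where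
  "neg_rel \<X> \<Y> R = (\<lambda>X Y. if X \<in> listset \<X> \<and> Y \<in> listset \<Y>
     then {b \<in> ops X Y. \<forall>a\<in>R X Y. mat_trace X (mat_mult Y (mat_dagger a) b) = 0} else {0})"

definition sup_rel :: "('v, 'p) brel set \<Rightarrow> ('v, 'p) brel" where
  "sup_rel \<R> = (\<lambda>X Y. mat.span (\<Union>R\<in>\<R>. R X Y))"

text \<open>\<open>comp_rel \<Y> S R\<close> is \<open>S \<circ> R\<close> for \<open>R\<close> from \<open>\<X>\<close> to \<open>\<Y>\<close> and \<open>S\<close> from \<open>\<Y>\<close> to \<open>\<Z>\<close>.\<close>

definition comp_rel ::
  "('v::complex_inner, 'p) qset list \<Rightarrow> ('v, 'p) brel \<Rightarrow> ('v, 'p) brel \<Rightarrow> ('v, 'p) brel" where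
  "comp_rel \<Y> S R = (\<lambda>X Z. mat.span
     {mat_mult Y s r | Y s r. Y \<in> listset \<Y> \<and> s \<in> S Y Z \<and> r \<in> R X Y})"

text \<open>\<open>prod_rel m n R S\<close> is \<open>R \<times> S\<close>, where \<open>R\<close> goes from \<open>m\<close> factors to \<open>n\<close> factors.\<close>

definition prod_rel ::
  "nat \<Rightarrow> nat \<Rightarrow> ('v, 'p) brel \<Rightarrow> ('v, 'p) brel \<Rightarrow> ('v, 'p) brel" where
  "prod_rel m n R S = (\<lambda>X Y. mat.span
     {mat_tensor m n r s | r s. r \<in> R (take m X) (take n Y) \<and> s \<in> S (drop m X) (drop n Y)})"

definition dagger_rel :: "('v, 'p) brel \<Rightarrow> ('v, 'p) brel" where
  "dagger_rel R = (\<lambda>Y X. mat_dagger ` R X Y)"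

definition star_rel :: "('v, 'p) brel \<Rightarrow> ('v, 'p) brel" where
  "star_rel R = (\<lambda>X Y. mat_star ` R (map dual X) (map dual Y))"

definition id_rel :: "('v::complex_inner, 'p) qset list \<Rightarrow> ('v, 'p) brel" where
  "id_rel \<X> = (\<lambda>X Y. if X \<in> listset \<X> \<and> Y = X then mat.span {mat_one X} else {0})"

definition is_function ::
  "('v::complex_inner, 'p) qset list \<Rightarrow> ('v, 'p) qset list \<Rightarrow> ('v, 'p) brel \<Rightarrow> bool" where
  "is_function \<X> \<Y> F \<longleftrightarrow> binary_relation \<X> \<Y> F \<and>
     id_rel \<X> \<le> comp_rel \<Y> (dagger_rel F) F \<and> comp_rel \<X> F (dagger_rel F) \<le> id_rel \<Y>"

text \<open>
  The relation induced by an ordinary relation \<open>r\<close> from \<open>S\<^sub>1 \<times> \<dots> \<times> S\<^sub>m\<close> to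
  \<open>T\<^sub>1 \<times> \<dots> \<times> T\<^sub>n\<close>; tuples are lists.
\<close>

definition classical_rel ::
  "'p set list \<Rightarrow> 'p set list \<Rightarrow> ('p list \<Rightarrow> 'p list \<Rightarrow> bool) \<Rightarrow> ('v::complex_inner, 'p) brel" where
  "classical_rel S T r = (\<lambda>X Y.
     if \<exists>a\<in>listset S. \<exists>b\<in>listset T. r a b \<and> X = map pt a \<and> Y = map pt b then ops X Y else {0})"

definition classical_elem :: "'p set \<Rightarrow> 'p \<Rightarrow> ('v::complex_inner, 'p) brel" where
  "classical_elem S a = classical_rel [] [S] (\<lambda>_ b. b = [a])"

definition conj_fun :: "'p set \<Rightarrow> ('v::complex_inner, 'p) brel" where
  "conj_fun S = (\<lambda>X Y. if \<exists>a\<in>S. X = [pt a] \<and> Y = [dual (pt a)] then ops X Y else {0})"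

definition eq_rel :: "('v::complex_inner, 'p) qset \<Rightarrow> ('v, 'p) brel" where
  "eq_rel \<X> = (\<lambda>X Y. if \<exists>x\<in>\<X>. X = [x, dual x] \<and> Y = [] then mat.span {mat_eval (hd X)} else {0})"

text \<open>\<open>hat \<X> \<Y> B\<close> is the relation of arity \<open>(\<X>, \<Y>\<^sup>*)\<close> obtained from \<open>B\<close> from \<open>\<X>\<close> to \<open>\<Y>\<close>.\<close>

definition hat ::
  "('v::complex_inner, 'p) qset list \<Rightarrow> ('v, 'p) qset \<Rightarrow> ('v, 'p) brel \<Rightarrow> ('v, 'p) brel" where
  "hat \<X> \<Y> B = comp_rel [\<Y>, dual_qset \<Y>] (eq_rel \<Y>)
     (prod_rel (length \<X>) 1 B (id_rel [dual_qset \<Y>]))"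


section \<open>Formulas\<close>

text \<open>
  A variable consists of a name and a sort.  The names \<open>New\<close> and \<open>New_star\<close> are reserved for the new
  variables needed to eliminate function symbols.
\<close>

datatype vname = User nat | New "nat list" | New_star "nat list"

type_synonym ('v, 'p) var = "vname \<times> ('v, 'p) qset"

text \<open>\<open>Fn F \<X> \<Y> [s\<^sub>1, \<dots>, s\<^sub>m]\<close> is the term \<open>F(s\<^sub>1, \<dots>, s\<^sub>m)\<close> for \<open>F : \<X>\<^sub>1 \<times> \<dots> \<times> \<X>\<^sub>m \<rightarrow> \<Y>\<close>.\<close>

datatype ('v, 'p) trm =
  Var "('v, 'p) var"
| Fn "('v, 'p) brel" "('v, 'p) qset list" "('v, 'p) qset" "('v, 'p) trm list"

fun sort_of :: "('v, 'p) trm \<Rightarrow> ('v, 'p) qset" where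
  "sort_of (Var v) = snd v"
| "sort_of (Fn F \<X> \<Y> ts) = \<Y>"

fun is_Var :: "('v, 'p) trm \<Rightarrow> bool" where
  "is_Var (Var v) = True"
| "is_Var (Fn F \<X> \<Y> ts) = False"

fun the_Var :: "('v, 'p) trm \<Rightarrow> ('v, 'p) var" where
  "the_Var (Var v) = v"

text \<open>Primitive formulas; the arity of \<open>R\<close> in \<open>Rel R vs\<close> is the list of the sorts of \<open>vs\<close>.\<close>

datatype ('v, 'p) form =
  Rel "('v, 'p) brel" "('v, 'p) var list"
| Neg "('v, 'p) form"
| Conj "('v, 'p) form" "('v, 'p) form"
| All "('v, 'p) var" "('v, 'p) form"

definition Disj :: "('v, 'p) form \<Rightarrow> ('v, 'p) form \<Rightarrow> ('v, 'p) form" where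
  "Disj \<phi> \<psi> = Neg (Conj (Neg \<phi>) (Neg \<psi>))"

definition Impl :: "('v, 'p) form \<Rightarrow> ('v, 'p) form \<Rightarrow> ('v, 'p) form" where
  "Impl \<phi> \<psi> = Disj (Neg \<phi>) (Conj \<phi> \<psi>)"

text \<open>\<open>All_eq x x' \<phi>\<close> is \<open>(\<forall>(x = x') \<in> \<X> \<times> \<X>\<^sup>*) \<phi>\<close>, where \<open>\<X>\<close> and \<open>\<X>\<^sup>*\<close> are the sorts of
  \<open>x\<close> and \<open>x'\<close>.\<close>

definition All_eq ::
  "('v::complex_inner, 'p) var \<Rightarrow> ('v, 'p) var \<Rightarrow> ('v, 'p) form \<Rightarrow> ('v, 'p) form" where
  "All_eq x x' \<phi> = All x' (All x (Impl (Rel (eq_rel (snd x)) [x, x']) \<phi>))"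

definition Ex_eq ::
  "('v::complex_inner, 'p) var \<Rightarrow> ('v, 'p) var \<Rightarrow> ('v, 'p) form \<Rightarrow> ('v, 'p) form" where
  "Ex_eq x x' \<phi> = Neg (All_eq x x' (Neg \<phi>))"

fun num_funs :: "('v, 'p) trm \<Rightarrow> nat" where
  "num_funs (Var v) = 0"
| "num_funs (Fn F \<X> \<Y> ts) = Suc (sum_list (map num_funs ts))"

text \<open>
  \<open>atomic p R ts\<close> is the formula \<open>R(t\<^sub>0, \<dots>, t\<^sub>n\<^sub>-\<^sub>1)\<close>.  The list \<open>p\<close> records the position of nested
  occurrences and serves only to make the bound variables distinct; it is \<open>[]\<close> in formulas.
\<close>

function (sequential) atomic ::
  "nat list \<Rightarrow> ('v::complex_inner, 'p) brel \<Rightarrow> ('v, 'p) trm list \<Rightarrow> ('v, 'p) form" where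
  "atomic p R ts =
     (if \<forall>t\<in>set ts. is_Var t then Rel R (map the_Var ts)
      else
        let y = (\<lambda>i. (New (i # p), sort_of (ts ! i)));
            y' = (\<lambda>i. (New_star (i # p), dual_qset (sort_of (ts ! i))))
        in fold (\<lambda>i. Ex_eq (y i) (y' i)) [0..<length ts]
             (foldl Conj (Rel R (map y [0..<length ts]))
               (map (\<lambda>i. case ts ! i of
                   Var v \<Rightarrow> Rel (eq_rel (snd v)) [v, y' i]
                 | Fn F \<X> \<Y> ss \<Rightarrow> atomic (i # p) (hat \<X> \<Y> F) (ss @ [Var (y' i)]))
                 [0..<length ts])))"
  by pat_completeness auto
termination
proof (relation "Wellfounded.measure (\<lambda>(p, R, ts). sum_list (map num_funs ts))")
  fix p :: "nat list" and R :: "('v::complex_inner, 'p) brel" and ts :: "('v, 'p) trm list"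
    and y y' :: "nat \<Rightarrow> ('v, 'p) var" and i F \<X> \<Y> ss
  assume i: "i \<in> set [0..<length ts]" and eq: "ts ! i = Fn F \<X> \<Y> ss"
  have "num_funs (ts ! i) \<le> sum_list (map num_funs ts)"
    using i by (intro member_le_sum_list) auto
  then show "((i # p, hat \<X> \<Y> F, ss @ [Var (y' i)]), p, R, ts)
      \<in> Wellfounded.measure (\<lambda>(p, R, ts). sum_list (map num_funs ts))"
    by (simp add: eq)
qed simp

declare atomic.simps [simp del]


subsection \<open>Interpretation\<close>

text \<open>
  The list of indices in \<open>xs\<close> of the variables \<open>vs\<close>, continued to a permutation of
  \<open>{0, \<dots>, length xs - 1}\<close>.
\<close>

definition perm_of :: "'x list \<Rightarrow> 'x list \<Rightarrow> nat list" where
  "perm_of vs xs = map (\<lambda>v. length (takeWhile (\<lambda>x. x \<noteq> v) xs)) vs @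
     filter (\<lambda>k. xs ! k \<notin> set vs) [0..<length xs]"

definition interp_rel ::
  "('v::complex_inner, 'p) brel \<Rightarrow> ('v, 'p) var list \<Rightarrow> ('v, 'p) var list \<Rightarrow> ('v, 'p) brel" where
  "interp_rel R vs xs = (\<lambda>X Y.
     let \<pi> = perm_of vs xs; m = length vs;
         R' = prod_rel m 0 R (top_rel (map snd (permute (drop m \<pi>) xs)) [])
     in if X \<in> listset (map snd xs) \<and> Y = []
        then (\<lambda>r. mat_mult (permute \<pi> X) r (mat_permute \<pi> X)) ` R' (permute \<pi> X) []
        else {0})"

text \<open>
  \<open>interp \<phi> xs\<close> is \<open>\<lbrakk>(x\<^sub>1, \<dots>, x\<^sub>n) \<in> \<X>\<^sub>1 \<times> \<dots> \<times> \<X>\<^sub>n | \<phi>\<rbrakk>\<close>, where \<open>xs\<close> lists the distinct variables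
  \<open>x\<^sub>1, \<dots>, x\<^sub>n\<close>, which include the free variables of \<open>\<phi>\<close>.
\<close>

primrec interp ::
  "('v::complex_inner, 'p) form \<Rightarrow> ('v, 'p) var list \<Rightarrow> ('v, 'p) brel" where
  "interp (Rel R vs) xs = interp_rel R vs xs"
| "interp (Neg \<phi>) xs = neg_rel (map snd xs) [] (interp \<phi> xs)"
| "interp (Conj \<phi> \<psi>) xs = inf (interp \<phi> xs) (interp \<psi> xs)"
| "interp (All x \<phi>) xs = sup_rel
     {R. binary_relation (map snd xs) [] R \<and>
         prod_rel 1 0 (top_rel [snd x] []) R \<le> interp \<phi> (x # xs)}"

definition holds :: "('v::complex_inner, 'p) form \<Rightarrow> bool" where
  "holds \<phi> \<longleftrightarrow> interp \<phi> [] = top_rel [] []"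


section \<open>Distance functions\<close>

type_synonym 'v drel = "('v, ennreal) brel"

text \<open>The ordinary set \<open>[0, \<infinity>]\<close> is the type \<^typ>\<open>ennreal\<close>.\<close>

abbreviation dists :: "('v, ennreal) qset" where
  "dists \<equiv> classical UNIV"

definition dist_elem :: "ennreal \<Rightarrow> 'v::complex_inner drel" where
  "dist_elem \<alpha> = classical_elem UNIV \<alpha>"

definition dist_le :: "'v::complex_inner drel" where
  "dist_le = classical_rel [UNIV] [UNIV] (\<lambda>a b. a ! 0 \<le> b ! 0)"

definition dist_plus :: "'v::complex_inner drel" where
  "dist_plus = classical_rel [UNIV, UNIV] [UNIV] (\<lambda>a b. b ! 0 = a ! 0 + a ! 1)"

text \<open>The variables \<open>x\<^sub>n\<close> of sort \<open>\<X>\<close> and \<open>x\<^sub>n\<^sub>*\<close> of sort \<open>\<X>\<^sup>*\<close>.\<close>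

definition var :: "('v, 'p) qset \<Rightarrow> nat \<Rightarrow> ('v, 'p) var" where
  "var \<X> n = (User (2 * n), \<X>)"

definition var_star :: "('v, 'p) qset \<Rightarrow> nat \<Rightarrow> ('v, 'p) var" where
  "var_star \<X> n = (User (2 * n + 1), dual_qset \<X>)"

definition All_diag ::
  "('v::complex_inner, 'p) qset \<Rightarrow> nat \<Rightarrow> ('v, 'p) form \<Rightarrow> ('v, 'p) form" where
  "All_diag \<X> n \<phi> = All_eq (var \<X> n) (var_star \<X> n) \<phi>"

definition dist_term ::
  "('v, ennreal) qset \<Rightarrow> 'v drel \<Rightarrow> nat \<Rightarrow> nat \<Rightarrow> ('v, ennreal) trm" where
  "dist_term \<X> F m n =
     Fn F [\<X>, dual_qset \<X>] dists [Var (var \<X> m), Var (var_star \<X> n)]"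

text \<open>The term \<open>F\<^sub>*(x\<^sub>m\<^sub>*, x\<^sub>n)\<close>.\<close>

definition dist_term_star ::
  "('v, ennreal) qset \<Rightarrow> 'v drel \<Rightarrow> nat \<Rightarrow> nat \<Rightarrow> ('v, ennreal) trm" where
  "dist_term_star \<X> F m n =
     Fn (star_rel F) [dual_qset \<X>, \<X>] (dual_qset dists) [Var (var_star \<X> m), Var (var \<X> n)]"

definition zero_star_term :: "('v::complex_inner, ennreal) trm" where
  "zero_star_term = Fn (star_rel (dist_elem 0)) [] (dual_qset dists) []"

definition refl_formula :: "('v::complex_inner, ennreal) qset \<Rightarrow> 'v drel \<Rightarrow> ('v, ennreal) form" where
  "refl_formula \<X> F =
     All_diag \<X> 1 (atomic [] (eq_rel dists) [dist_term \<X> F 1 1, zero_star_term])"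

definition sym_formula :: "('v::complex_inner, ennreal) qset \<Rightarrow> 'v drel \<Rightarrow> ('v, ennreal) form" where
  "sym_formula \<X> F =
     All_diag \<X> 1 (All_diag \<X> 2 (atomic [] (eq_rel dists)
       [dist_term \<X> F 1 2,
        Fn (conj_fun UNIV) [dists] (dual_qset dists) [dist_term \<X> F 2 1]]))"

definition triangle_formula ::
  "('v::complex_inner, ennreal) qset \<Rightarrow> 'v drel \<Rightarrow> ('v, ennreal) form" where
  "triangle_formula \<X> F =
     All_diag \<X> 1 (All_diag \<X> 2 (All_diag \<X> 3 (atomic [] (hat [dists] dists dist_le)
       [dist_term \<X> F 1 2,
        Fn (star_rel dist_plus) [dual_qset dists, dual_qset dists] (dual_qset dists)
          [dist_term_star \<X> F 1 3, dist_term_star \<X> F 3 2]])))"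

definition separation_formula ::
  "('v::complex_inner, ennreal) qset \<Rightarrow> 'v drel \<Rightarrow> ('v, ennreal) form" where
  "separation_formula \<X> F =
     All (var \<X> 1) (All (var_star \<X> 2) (Impl
       (atomic [] (eq_rel dists) [dist_term \<X> F 1 2, zero_star_term])
       (atomic [] (eq_rel \<X>) [Var (var \<X> 1), Var (var_star \<X> 2)])))"


subsection \<open>The correspondence\<close>

text \<open>
  The matrix of \<open>inc\<^bsub>Y\<^esub>\<^sup>\<dagger> \<cdot> v \<cdot> inc\<^bsub>X\<^esub> : X \<rightarrow> Y\<close>; its entries are
  \<open>\<langle>y | inc\<^bsub>Y\<^esub>\<^sup>\<dagger> v inc\<^bsub>X\<^esub> x\<rangle> = \<langle>inc\<^bsub>Y\<^esub> y | v inc\<^bsub>X\<^esub> x\<rangle>\<close> for basis vectors \<open>x\<close> and \<open>y\<close>.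
\<close>

definition corner ::
  "'v::complex_inner set \<Rightarrow> 'v set \<Rightarrow> (('v set, 'v) l2 \<Rightarrow> ('v set, 'v) l2) \<Rightarrow> 'v mat" where
  "corner X Y v = (\<lambda>i j. if \<exists>y\<in>onb Y. \<exists>x\<in>onb X. i = [Some y] \<and> j = [Some x]
     then cinner (inc Y (the (hd i))) (v (inc X (the (hd j)))) else 0)"

definition corresponds ::
  "'v::complex_inner set set \<Rightarrow> (real \<Rightarrow> (('v set, 'v) l2 \<Rightarrow> ('v set, 'v) l2) set) \<Rightarrow>
    'v drel \<Rightarrow> bool" where
  "corresponds A V F \<longleftrightarrow> (\<exists>R.
     (\<forall>\<alpha>. binary_relation [qset A] [qset A] (R \<alpha>) \<and>
          hat [qset A] (qset A) (R \<alpha>) = comp_rel [dists] (dagger_rel (dist_elem \<alpha>)) F) \<and>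
     (\<forall>\<beta>\<ge>0. \<forall>X\<in>A. \<forall>Y\<in>A.
        mat.span (\<Union>\<alpha>\<in>{0..ennreal \<beta>}. R \<alpha> [Prim (Sub X)] [Prim (Sub Y)]) = corner X Y ` V \<beta>))"

end

theory Submission
  imports Defs
begin

text \<open>
  The theorem is about the spaces \<open>L(X, Y)\<close> of operators between two atoms: all data on both sides
  decompose into data on these finite-dimensional spaces, with the Hilbert-Schmidt inner product.

  A function \<open>F\<close> into the classical quantum set of distances is, for each pair of atoms, an orthogonal
  decomposition of \<open>L(X, Y)\<close> into spaces \<open>R\<^sub>\<alpha>(X, Y)\<close> with \<open>\<alpha> \<in> [0, \<infinity>]\<close>: that \<open>F\<close> is single valued
  is orthogonality, and that it is total says that the spaces span (\<open>is_function_iff\<close>).  Orthogonal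
  decompositions correspond to right continuous increasing families of subspaces
  \<open>W\<^sub>\<beta>(X, Y) = \<Sum>\<^bsub>\<alpha> \<le> \<beta>\<^esub> R\<^sub>\<alpha>(X, Y)\<close>, where \<open>R\<^sub>\<alpha>\<close> is recovered as the part of \<open>W\<^sub>\<alpha>\<close> that is orthogonal to all
  \<open>W\<^sub>\<beta>\<close> with \<open>\<beta> < \<alpha>\<close> (\<open>graded_piece_level\<close>, \<open>graded_piece_decomposition\<close>).

  A quantum pseudometric is in turn determined by its corners \<open>W\<^sub>\<beta>(X, Y) = inc\<^sub>Y\<^sup>\<dagger> V\<^sub>\<beta> inc\<^sub>X\<close>.  The projections
  onto the atoms commute with \<open>\<ell>\<^sup>\<infinity>\<close> and hence lie in \<open>V\<^sub>0\<close>, so \<open>V\<^sub>\<beta>\<close> contains each corner of its elements as a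
  block operator; finite sums of blocks of a bounded operator converge to it ultraweakly, so that \<open>V\<^sub>\<beta>\<close>
  consists of all bounded operators with corners in \<open>W\<^sub>\<beta>\<close>.  Families of corners of pseudometrics are
  those that are right continuous, closed under adjoints and products (with addition of indices), and
  contain the identities at index \<open>0\<close> (\<open>metric_blocks_corners\<close>, \<open>pseudometric_metric_of\<close>).

  It remains to see that the three formulas express these closure properties.  Quantification over
  the diagonal tensors a functional with the evaluation functional \<open>\<epsilon>\<^sub>X\<close> (\<open>in_interp_All_eq\<close>), and distances
  are one-dimensional atoms, so that variables of that sort can be evaluated at each \<open>\<alpha>\<close> and then
  dropped.  In this way a formula says that a product of functionals \<open>\<epsilon>\<^sub>X\<close> is in a span of
  intersections of spaces attached to disjoint sets of tensor factors.  As these spaces form orthogonal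
  decompositions, membership can be tested against products of their elements (\<open>orthogonal_test\<close>,
  \<open>lift_meet_2\<close>, \<open>lift_meet_3\<close>), and contraction with the \<open>\<epsilon>\<^sub>X\<close> turns such a product into a Hilbert-Schmidt
  inner product (\<open>hs_eps_2\<close>, \<open>hs_eps_3\<close>).  The conditions become \<open>1\<^sub>X \<in> R\<^sub>0(X, X)\<close>; orthogonality of
  \<open>R\<^sub>\<alpha>(X, Y)\<^sup>\<dagger>\<close> and \<open>R\<^sub>\<beta>(Y, X)\<close> for \<open>\<alpha> \<noteq> \<beta>\<close>; orthogonality of \<open>R\<^sub>\<delta>(Z, Y) R\<^sub>\<beta>(X, Z)\<close> and \<open>R\<^sub>\<alpha>(X, Y)\<close> unless
  \<open>\<alpha> \<le> \<beta> + \<delta>\<close>; and, for separation, \<open>R\<^sub>0 \<le> I\<close>.  In terms of the \<open>W\<^sub>\<beta>\<close> these are the closure properties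
  (\<open>dagger_levels_iff\<close>, \<open>mult_levels_iff\<close>) and the condition for a quantum metric.
\<close>

section \<open>The Hilbert-Schmidt inner product\<close>

definition hs :: "('v::complex_inner, 'p) atom list \<Rightarrow> ('v, 'p) atom list \<Rightarrow> 'v mat \<Rightarrow> 'v mat \<Rightarrow> complex"
  where "hs X Y a b = mat_trace X (mat_mult Y (mat_dagger a) b)"

lemma hs_eq: "hs X Y a b = (\<Sum>j\<in>basis X. \<Sum>i\<in>basis Y. cnj (a i j) * b i j)"
  by (simp add: hs_def mat_trace_def mat_mult_def mat_dagger_def)

lemma hs_add: "hs X Y a (b + c) = hs X Y a b + hs X Y a c" by (simp add: hs_eq algebra_simps sum.distrib)

lemma hs_diff: "hs X Y a (b - c) = hs X Y a b - hs X Y a c" by (simp add: hs_eq algebra_simps sum_subtractf)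

lemma hs_scale: "hs X Y a (mat_scale c b) = c * hs X Y a b"
  by (simp add: hs_eq mat_scale_def sum_distrib_left mult.left_commute)

lemma hs_zero [simp]: "hs X Y a 0 = 0" by (simp add: hs_eq)

lemma hs_commute: "hs X Y b a = cnj (hs X Y a b)" by (simp add: hs_eq mult.commute)

lemma hs_eq_0_commute: "hs X Y b a = 0 \<longleftrightarrow> hs X Y a b = 0" by (subst hs_commute) simp

lemma hs_add_left: "hs X Y (a + b) c = hs X Y a c + hs X Y b c" by (simp add: hs_eq algebra_simps sum.distrib)

lemma subspace_hs_0: "mat.subspace {b. \<forall>a\<in>U. hs X Y a b = 0}"
  by (auto simp: mat.subspace_def hs_add hs_scale)

lemma hs_span_0:
  assumes "a \<in> mat.span U" "\<And>u. u \<in> U \<Longrightarrow> hs X Y u b = 0"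
  shows "hs X Y a b = 0"
proof -
  have "mat.span U \<subseteq> {a. \<forall>c\<in>{b}. hs X Y c a = 0}"
    using assms(2) by (intro mat.span_minimal subspace_hs_0) (auto simp: hs_eq_0_commute)
  then show ?thesis using assms(1) by (auto simp: hs_eq_0_commute)
qed

lemma subspace_ops: "mat.subspace (ops X Y)"
proof (rule mat.subspaceI)
  fix a b assume "a \<in> ops X Y" "b \<in> ops X Y"
  then show "a + b \<in> ops X Y"
    unfolding ops_def mem_Collect_eq plus_fun_def by (metis add.right_neutral)
qed (auto simp: ops_def mat_scale_def)

lemma ops_ext:
  assumes "a \<in> ops X Y" "b \<in> ops X Y" "\<And>i j. i \<in> basis Y \<Longrightarrow> j \<in> basis X \<Longrightarrow> a i j = b i j"
  shows "a = b"
proof (intro ext)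
  fix i j
  show "a i j = b i j"
  proof (cases "i \<in> basis Y \<and> j \<in> basis X")
    case False
    then have "a i j = 0" "b i j = 0" using assms(1,2) by (auto simp: ops_def)
    then show ?thesis by simp
  qed (use assms(3) in auto)
qed

definition mat_unit :: "'v option list \<Rightarrow> 'v option list \<Rightarrow> 'v mat" where
  "mat_unit i j = (\<lambda>i' j'. if i' = i \<and> j' = j then 1 else 0)"

lemma mat_unit_ops: "i \<in> basis Y \<Longrightarrow> j \<in> basis X \<Longrightarrow> mat_unit i j \<in> ops X Y"
  by (auto simp: mat_unit_def ops_def)

lemma sum_fun2_apply: "(\<Sum>x\<in>S. f x) i j = (\<Sum>x\<in>S. f x i j)"
  for f :: "'c \<Rightarrow> 'a \<Rightarrow> 'b \<Rightarrow> 'd::comm_monoid_add"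
  by (induction S rule: infinite_finite_induct) auto

lemma ops_span_units:
  assumes "finite (basis X)" "finite (basis Y)"
  shows "mat.span ((\<lambda>(i, j). mat_unit i j) ` (basis Y \<times> basis X)) = ops X Y"
proof (rule mat.span_unique)
  show "(\<lambda>(i, j). mat_unit i j) ` (basis Y \<times> basis X) \<subseteq> ops X Y" by (auto intro: mat_unit_ops)
  show "mat.subspace (ops X Y)" by (rule subspace_ops)
  fix T :: "'a mat set"
  assume T: "(\<lambda>(i, j). mat_unit i j) ` (basis Y \<times> basis X) \<subseteq> T" "mat.subspace T"
  show "ops X Y \<subseteq> T"
  proof
    fix a assume a: "a \<in> ops X Y"
    define b where "b = (\<Sum>p\<in>basis Y \<times> basis X. mat_scale (a (fst p) (snd p)) (mat_unit (fst p) (snd p)))"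
    have "b \<in> T"
      unfolding b_def using T by (intro mat.subspace_sum mat.subspace_scale) auto
    moreover have "b i j = a i j" if "i \<in> basis Y" "j \<in> basis X" for i j
    proof -
      have "b i j = (\<Sum>p\<in>basis Y \<times> basis X. if p = (i, j) then a i j else 0)"
        unfolding b_def sum_fun2_apply
        by (intro sum.cong) (auto simp: mat_scale_def mat_unit_def)
      also have "\<dots> = a i j" using that assms by (simp add: finite_cartesian_product)
      finally show ?thesis .
    qed
    moreover have "b \<in> ops X Y"
      unfolding b_def
      by (intro mat.subspace_sum mat.subspace_scale subspace_ops) (auto intro: mat_unit_ops)
    ultimately show "a \<in> T" using ops_ext [OF a] by metis
  qed
qed

lemma hs_self_0:
  assumes "finite (basis X)" "finite (basis Y)" "a \<in> ops X Y" "hs X Y a a = 0"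
  shows "a = 0"
proof -
  have "complex_of_real (\<Sum>j\<in>basis X. \<Sum>i\<in>basis Y. (cmod (a i j))\<^sup>2) = hs X Y a a"
    unfolding hs_eq by (simp add: complex_norm_square mult.commute del: of_real_power)
  then have *: "(\<Sum>j\<in>basis X. \<Sum>i\<in>basis Y. (cmod (a i j))\<^sup>2) = 0"
    unfolding assms(4) of_real_eq_0_iff .
  have "(\<Sum>i\<in>basis Y. (cmod (a i j))\<^sup>2) = 0" if "j \<in> basis X" for j
    using * that by (subst (asm) sum_nonneg_eq_0_iff) (auto intro: sum_nonneg assms)
  then have "a i j = 0" if "i \<in> basis Y" "j \<in> basis X" for i j
    using that by (subst (asm) sum_nonneg_eq_0_iff) (auto intro: assms)
  then show ?thesis by (intro ops_ext [OF assms(3) mat.subspace_0 [OF subspace_ops]]) auto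
qed

lemma subspace_finite_basis:
  assumes "finite (basis X)" "finite (basis Y)" "mat.subspace U" "U \<subseteq> ops X Y"
  obtains B where "finite B" "mat.independent B" "mat.span B = U"
proof -
  obtain B where B: "B \<subseteq> U" "mat.independent B" "U \<subseteq> mat.span B"
    using mat.maximal_independent_subset by blast
  have "finite B" using B(1) assms ops_span_units [OF assms(1,2)]
    by (intro conjunct1 [OF mat.independent_span_bound [OF _ B(2),
          of "(\<lambda>(i, j). mat_unit i j) ` (basis Y \<times> basis X)"]]) auto
  moreover have "mat.span B = U" using B assms(3) by (metis mat.span_minimal subset_antisym)
  ultimately show ?thesis using B(2) that by blast
qed

text \<open>By Gram-Schmidt orthogonalization along a finite basis of the subspace.\<close>

lemma orthogonal_projection:
  assumes fin: "finite (basis X)" "finite (basis Y)" and U: "mat.subspace U" "U \<subseteq> ops X Y"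
  shows "\<exists>u\<in>U. \<forall>a\<in>U. hs X Y a (v - u) = 0"
proof -
  obtain B where B: "finite B" "mat.span B = U" using subspace_finite_basis [OF assms] by metis
  have "B \<subseteq> ops X Y" using B(2) U(2) mat.span_superset by blast
  with B(1) have "\<exists>u\<in>mat.span B. \<forall>a\<in>B. hs X Y a (v - u) = 0"
  proof (induction B arbitrary: v)
    case (insert x B)
    have "B \<subseteq> ops X Y" using insert.prems by simp
    note IH = insert.IH [OF this]
    obtain p where p: "p \<in> mat.span B" "\<forall>a\<in>B. hs X Y a (x - p) = 0" using IH [of x] by blast
    obtain w where w: "w \<in> mat.span B" "\<forall>a\<in>B. hs X Y a (v - w) = 0" using IH [of v] by blast
    define q where "q = x - p"
    define c where "c = (if hs X Y q q = 0 then 0 else hs X Y q (v - w) / hs X Y q q)"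
    have ops: "q \<in> ops X Y" using insert.prems p(1) mat.span_minimal [OF _ subspace_ops, of B X Y] unfolding q_def
      by (intro mat.subspace_diff subspace_ops) auto
    have q: "hs X Y q (v - (w + mat_scale c q)) = 0"
    proof (cases "hs X Y q q = 0")
      case True
      then have "q = 0" using hs_self_0 [OF fin ops] by simp
      then have "hs X Y q y = 0" for y by (simp add: hs_eq)
      then show ?thesis by simp
    next
      case False
      then show ?thesis by (simp add: hs_diff hs_add hs_scale c_def)
    qed
    have B0: "hs X Y a (v - (w + mat_scale c q)) = 0" if "a \<in> B" for a using w(2) p(2) that
      by (simp add: hs_diff hs_add hs_scale q_def algebra_simps)
    have x: "x = p + q" by (simp add: q_def)
    have "hs X Y x (v - (w + mat_scale c q)) = 0"
      unfolding x hs_add_left using q hs_span_0 [OF p(1) B0] by simp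
    moreover have "w + mat_scale c q \<in> mat.span (insert x B)"
    proof -
      have "mat.span B \<subseteq> mat.span (insert x B)" by (intro mat.span_mono) auto
      then show ?thesis using w(1) p(1) unfolding q_def
        by (intro mat.span_add mat.span_scale mat.span_diff mat.span_base [of x]) auto
    qed
    ultimately show ?case using B0 by blast
  qed (use mat.span_zero in blast)
  then show ?thesis using hs_span_0 [of _ B] unfolding B(2) by metis
qed

definition perp :: "('v::complex_inner, 'p) atom list \<Rightarrow> ('v, 'p) atom list \<Rightarrow> 'v mat set \<Rightarrow> 'v mat set" where
  "perp X Y U = {b \<in> ops X Y. \<forall>a\<in>U. hs X Y a b = 0}"

lemma subspace_perp: "mat.subspace (perp X Y U)" using mat.subspace_inter [OF subspace_ops subspace_hs_0]
  by (simp add: perp_def Int_def)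

lemma perp_perp:
  assumes fin: "finite (basis X)" "finite (basis Y)" and U: "U \<subseteq> ops X Y"
  shows "perp X Y (perp X Y U) = mat.span U"
proof
  have sub: "mat.span U \<subseteq> ops X Y" using U by (intro mat.span_minimal subspace_ops)
  show "mat.span U \<subseteq> perp X Y (perp X Y U)"
    using U by (intro mat.span_minimal subspace_perp) (auto simp: perp_def hs_eq_0_commute)
  show "perp X Y (perp X Y U) \<subseteq> mat.span U"
  proof
    fix v assume v: "v \<in> perp X Y (perp X Y U)"
    obtain u where u: "u \<in> mat.span U" "\<forall>a\<in>mat.span U. hs X Y a (v - u) = 0"
      using orthogonal_projection [OF fin mat.subspace_span sub] by blast
    have ops: "v - u \<in> ops X Y" using v u(1) sub by (intro mat.subspace_diff subspace_ops) (auto simp: perp_def)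
    then have "v - u \<in> perp X Y U" using u(2) by (auto simp: perp_def mat.span_base)
    then have "hs X Y (v - u) v = 0" "hs X Y (v - u) u = 0" using v u by (auto simp: perp_def hs_eq_0_commute)
    then have "hs X Y (v - u) (v - u) = 0" by (simp add: hs_diff)
    then have "v - u = 0" using hs_self_0 [OF fin ops] by simp
    then show "v \<in> mat.span U" using u(1) by simp
  qed
qed

lemma perp_eqI:
  assumes "finite (basis X)" "finite (basis Y)" "mat.subspace U" "U \<subseteq> ops X Y" "v \<in> ops X Y"
    and "\<And>b. b \<in> perp X Y U \<Longrightarrow> hs X Y b v = 0"
  shows "v \<in> U"
proof -
  have "v \<in> perp X Y (perp X Y U)"
    unfolding perp_def [of X Y "perp X Y U"] using assms(5,6) by blast
  then show ?thesis using perp_perp [OF assms(1,2,4)] assms(3) mat.span_eq_iff [of U] by blast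
qed

lemma orthogonal_all_0:
  assumes "finite (basis X)" "finite (basis Y)" "t \<in> ops X Y" "ops X Y \<subseteq> mat.span P"
    and "\<And>p. p \<in> P \<Longrightarrow> hs X Y p t = 0"
  shows "t = 0" using hs_span_0 [of t P X Y t] assms by (intro hs_self_0 [OF assms(1-3)]) auto

text \<open>The component of \<open>r\<close> orthogonal to \<open>S\<close> is orthogonal to the \<open>P i\<close> inside \<open>S\<close>, and to the others if \<open>r\<close>
  is, so it is orthogonal to a spanning set.\<close>

lemma orthogonal_test:
  assumes fin: "finite (basis X)" "finite (basis Y)" and S: "mat.subspace S" "S \<subseteq> ops X Y"
    and P: "ops X Y \<subseteq> mat.span (\<Union>i. P i)"
    and J: "\<And>i. J i \<Longrightarrow> P i \<subseteq> S"
    and N: "\<And>i p s. \<not> J i \<Longrightarrow> p \<in> P i \<Longrightarrow> s \<in> S \<Longrightarrow> hs X Y p s = 0"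
    and r: "r \<in> ops X Y"
  shows "r \<in> S \<longleftrightarrow> (\<forall>i. \<not> J i \<longrightarrow> (\<forall>p\<in>P i. hs X Y p r = 0))"
proof
  assume R: "\<forall>i. \<not> J i \<longrightarrow> (\<forall>p\<in>P i. hs X Y p r = 0)"
  obtain u where u: "u \<in> S" "\<forall>a\<in>S. hs X Y a (r - u) = 0" using orthogonal_projection [OF fin S] by blast
  have "r - u = 0"
  proof (rule orthogonal_all_0 [OF fin _ P])
    show "r - u \<in> ops X Y" using r u S by (intro mat.subspace_diff subspace_ops) auto
    fix p assume "p \<in> (\<Union>i. P i)"
    then obtain i where i: "p \<in> P i" by blast
    show "hs X Y p (r - u) = 0"
    proof (cases "J i")
      case True
      then show ?thesis using J i u by blast
    next
      case False
      then show ?thesis using R N i u by (simp add: hs_diff)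
    qed
  qed
  then show "r \<in> S" using u by simp
qed (use N in blast)

lemma span_bilinear:
  assumes x: "x \<in> mat.span A" and y: "y \<in> mat.span B"
    and addl: "\<And>u v w. (h :: 'a mat \<Rightarrow> 'b mat \<Rightarrow> 'c mat) (u + v) w = h u w + h v w" and scl: "\<And>c u w. h (mat_scale c u) w = mat_scale c (h u w)"
    and addr: "\<And>u v w. h w (u + v) = h w u + h w v" and scr: "\<And>c u w. h w (mat_scale c u) = mat_scale c (h w u)"
  shows "(h x y :: 'c mat) \<in> mat.span {h a b | a b. a \<in> A \<and> b \<in> B}"
proof -
  let ?S = "mat.span {h a b | a b. a \<in> A \<and> b \<in> B}"
  have z: "h 0 w = 0" "h w' 0 = 0" for w w' using scl [of 0 0 w] scr [of w' 0 0] by simp_all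
  have 1: "h a y \<in> ?S" if "a \<in> A" for a
  proof -
    have "mat.span B \<subseteq> {y. h a y \<in> ?S}" using that by (intro mat.span_minimal mat.subspaceI)
        (auto simp: z addr scr intro: mat.span_add mat.span_scale mat.span_zero mat.span_base)
    then show ?thesis using y by blast
  qed
  have "mat.span A \<subseteq> {x. h x y \<in> ?S}" using 1 by (intro mat.span_minimal mat.subspaceI)
      (auto simp: z addl scl intro: mat.span_add mat.span_scale mat.span_zero)
  then show ?thesis using x by blast
qed

section \<open>Lists of atoms\<close>

lemma listset_iff: "xs \<in> listset As \<longleftrightarrow> length xs = length As \<and> (\<forall>i<length As. xs ! i \<in> As ! i)"
proof (induction As arbitrary: xs)
  case (Cons A As)
  then show ?case by (cases xs) (auto simp: set_Cons_def nth_Cons less_Suc_eq_0_disj)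
qed auto

lemma listset_Cons: "x # xs \<in> listset (A # As) \<longleftrightarrow> x \<in> A \<and> xs \<in> listset As"
  by (auto simp: set_Cons_def)

lemma listset_append:
  assumes "length xs = length As"
  shows "xs @ ys \<in> listset (As @ Bs) \<longleftrightarrow> xs \<in> listset As \<and> ys \<in> listset Bs"
  using assms by (induction xs As rule: list_induct2) (auto simp: set_Cons_def)

lemma finite_listset: "(\<And>A. A \<in> set As \<Longrightarrow> finite A) \<Longrightarrow> finite (listset As)"
proof (induction As)
  case (Cons A As)
  have "listset (A # As) = (\<lambda>(x, xs). x # xs) ` (A \<times> listset As)" by (auto simp: set_Cons_def)
  with Cons show ?case by simp
qed simp

lemma basis_iff: "j \<in> basis X \<longleftrightarrow> length j = length X \<and> (\<forall>i<length X. j ! i \<in> atom_basis (X ! i))"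
  by (simp add: basis_def listset_iff)

lemma basis_Nil [simp]: "basis [] = {[]}" by (simp add: basis_def)

lemma basis_Cons: "basis (x # X) = (\<lambda>(e, j). e # j) ` (atom_basis x \<times> basis X)"
  by (auto simp: basis_def set_Cons_def)

lemma Cons_in_basis [simp]: "e # j \<in> basis (x # X) \<longleftrightarrow> e \<in> atom_basis x \<and> j \<in> basis X"
  by (auto simp: basis_Cons)

lemma sum_basis_Cons: "(\<Sum>j\<in>basis (x # X). f j) = (\<Sum>e\<in>atom_basis x. \<Sum>j\<in>basis X. f (e # j))"
  unfolding basis_Cons sum.cartesian_product
  by (subst sum.reindex) (auto simp: inj_on_def case_prod_beta)

lemma basis_append: "length j = length X \<Longrightarrow> j @ k \<in> basis (X @ Y) \<longleftrightarrow> j \<in> basis X \<and> k \<in> basis Y"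
  by (simp add: basis_def listset_append)

lemma basis_length: "j \<in> basis X \<Longrightarrow> length j = length X" by (simp add: basis_iff)

lemma finite_basis: "(\<And>x. x \<in> set X \<Longrightarrow> finite (atom_basis x)) \<Longrightarrow> finite (basis X)"
  unfolding basis_def by (intro finite_listset) auto

lemma atom_basis_dual [simp]: "atom_basis (dual X) = atom_basis X" by (cases X) auto

lemma dual_dual [simp]: "dual (dual X) = X" by (cases X) auto

lemma dual_qset_dual_qset [simp]: "dual_qset (dual_qset S) = S" by (simp add: dual_qset_def image_image)

lemma dual_eq_iff [simp]: "dual X = dual Y \<longleftrightarrow> X = Y" by (metis dual_dual)

lemma in_dual_qset: "X \<in> dual_qset S \<longleftrightarrow> dual X \<in> S"
  unfolding dual_qset_def by (metis dual_dual image_iff)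

abbreviation functionals :: "('v::complex_inner, 'p) atom list \<Rightarrow> 'v mat set" where
  "functionals X \<equiv> ops X []"

lemma in_rows: "s \<in> functionals X \<longleftrightarrow> (\<forall>i j. s i j \<noteq> 0 \<longrightarrow> i = [] \<and> j \<in> basis X)"
  by (simp add: ops_def)

lemma rows_ext:
  assumes "a \<in> functionals X" "b \<in> functionals X" "\<And>j. j \<in> basis X \<Longrightarrow> a [] j = b [] j"
  shows "a = b" by (rule ops_ext [OF assms(1,2)]) (auto intro: assms(3))

lemma hs_rows: "hs X [] a b = (\<Sum>j\<in>basis X. cnj (a [] j) * b [] j)" by (simp add: hs_eq)

definition linear_map :: "('v mat \<Rightarrow> 'w mat) \<Rightarrow> bool" where
  "linear_map f \<longleftrightarrow> (\<forall>a b. f (a + b) = f a + f b) \<and> (\<forall>c a. f (mat_scale c a) = mat_scale c (f a))"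

lemma linear_map_hom: "linear_map f \<Longrightarrow> module_hom mat_scale mat_scale f" by unfold_locales
    (auto simp: linear_map_def mat.scale_right_distrib mat.scale_left_distrib)

lemmas linear_map_span = module_hom.span_image [OF linear_map_hom]
lemmas linear_map_subspace = module_hom.subspace_image [OF linear_map_hom]

lemma linear_map_0: "linear_map f \<Longrightarrow> f 0 = 0"
  unfolding linear_map_def by (metis mat.scale_zero_left)

section \<open>Interpretation of formulas\<close>

lemma permute_append: "permute (p @ q) X = permute p X @ permute q X" by (simp add: permute_def)

lemma length_permute [simp]: "length (permute p X) = length p" by (simp add: permute_def)

lemma permute_basis:
  assumes "j \<in> basis X" "\<forall>k\<in>set p. k < length X"
  shows "permute p j \<in> basis (permute p X)" using assms by (auto simp: basis_iff permute_def)

definition pos :: "'x list \<Rightarrow> 'x list \<Rightarrow> nat list" where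
  "pos vs xs = map (\<lambda>v. length (takeWhile (\<lambda>x. x \<noteq> v) xs)) vs"

lemma index_less: "v \<in> set xs \<Longrightarrow> length (takeWhile (\<lambda>x. x \<noteq> v) xs) < length xs"
  by (induction xs) auto

lemma nth_index: "v \<in> set xs \<Longrightarrow> xs ! length (takeWhile (\<lambda>x. x \<noteq> v) xs) = v"
  by (induction xs) auto

lemma set_pos:
  assumes "distinct xs" "set vs \<subseteq> set xs"
  shows "k \<in> set (pos vs xs) \<longleftrightarrow> k < length xs \<and> xs ! k \<in> set vs"
proof
  assume "k \<in> set (pos vs xs)"
  then show "k < length xs \<and> xs ! k \<in> set vs" using assms index_less nth_index by (fastforce simp: pos_def)
next
  assume k: "k < length xs \<and> xs ! k \<in> set vs"
  then have "length (takeWhile (\<lambda>x. x \<noteq> xs ! k) xs) = k"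
    using assms(1) by (metis index_less nth_eq_iff_index_eq nth_index nth_mem)
  then show "k \<in> set (pos vs xs)" using k by (force simp: pos_def)
qed

lemma permute_pos: "set vs \<subseteq> set xs \<Longrightarrow> permute (pos vs xs) xs = vs"
  by (auto simp: permute_def pos_def o_def nth_index subset_iff intro: map_idI)

lemma permute_listset:
  assumes "X \<in> listset (map snd xs)" "\<forall>k\<in>set p. k < length xs"
  shows "permute p X \<in> listset (map snd (permute p xs))" using assms by (auto simp: listset_iff permute_def)

abbreviation agree_off :: "nat list \<Rightarrow> 'b list \<Rightarrow> 'a list \<Rightarrow> 'a list \<Rightarrow> bool" where
  "agree_off p X j k \<equiv> \<forall>i<length X. i \<notin> set p \<longrightarrow> j ! i = k ! i"

text \<open>The functionals on the tensor product of \<open>X\<close> all of whose slices along the factors with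
  indices \<open>p\<close> are in \<open>U\<close>.  This is \<open>U\<close> tensored with all functionals on the other factors.\<close>

definition lift :: "nat list \<Rightarrow> 'v mat set \<Rightarrow> ('v::complex_inner, 'p) atom list \<Rightarrow> 'v mat set" where
  "lift p U X = {s \<in> functionals X. \<forall>k\<in>basis X. \<exists>r\<in>U. \<forall>j\<in>basis X.
     agree_off p X j k \<longrightarrow> s [] j = r [] (permute p j)}"

lemma liftD:
  assumes "s \<in> lift p U X" "k \<in> basis X"
  obtains r where "r \<in> U"
    "\<forall>j\<in>basis X. agree_off p X j k \<longrightarrow> s [] j = r [] (permute p j)"
  using assms that unfolding lift_def by blast

lemma subspace_lift:
  assumes "mat.subspace U"
  shows "mat.subspace (lift p U X)"
proof (rule mat.subspaceI)
  show "0 \<in> lift p U X" using mat.subspace_0 [OF subspace_ops] unfolding lift_def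
    by (intro CollectI conjI ballI bexI [OF _ mat.subspace_0 [OF assms]]) simp_all
  show "a + b \<in> lift p U X" if ab: "a \<in> lift p U X" "b \<in> lift p U X" for a b
    unfolding lift_def
  proof (intro CollectI conjI ballI)
    show "a + b \<in> functionals X" using that by (intro mat.subspace_add [OF subspace_ops]) (auto simp: lift_def)
    fix k assume "k \<in> basis X"
    note k = this
    obtain r where r: "r \<in> U" "\<forall>j\<in>basis X. agree_off p X j k \<longrightarrow> a [] j = r [] (permute p j)"
      using liftD [OF ab(1) k] by blast
    obtain r' where r': "r' \<in> U" "\<forall>j\<in>basis X. agree_off p X j k \<longrightarrow> b [] j = r' [] (permute p j)"
      using liftD [OF ab(2) k] by blast
    from r r' show "\<exists>r\<in>U. \<forall>j\<in>basis X. agree_off p X j k \<longrightarrow> (a + b) [] j = r [] (permute p j)"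
      by (intro bexI [of _ "r + r'"]) (auto intro: mat.subspace_add [OF assms])
  qed
  show "mat_scale c a \<in> lift p U X" if "a \<in> lift p U X" for c a
    unfolding lift_def
  proof (intro CollectI conjI ballI)
    show "mat_scale c a \<in> functionals X"
      using that by (intro mat.subspace_scale [OF subspace_ops]) (auto simp: lift_def)
    fix k assume "k \<in> basis X"
    with that obtain r where "r \<in> U" "\<forall>j\<in>basis X. agree_off p X j k \<longrightarrow> a [] j = r [] (permute p j)"
      by (rule liftD)
    then show "\<exists>r\<in>U. \<forall>j\<in>basis X. agree_off p X j k \<longrightarrow> mat_scale c a [] j = r [] (permute p j)"
      by (intro bexI [of _ "mat_scale c r"] mat.subspace_scale [OF assms]) (simp_all add: mat_scale_def)
  qed
qed

lemma lift_rows: "lift p U X \<subseteq> functionals X" by (auto simp: lift_def)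

definition fin_atoms :: "('v::complex_inner, 'p) atom list \<Rightarrow> bool" where
  "fin_atoms X \<longleftrightarrow> (\<forall>x\<in>set X. finite (atom_basis x))"

lemma fin_atoms_basis: "fin_atoms X \<Longrightarrow> finite (basis X)"
  by (intro finite_basis) (auto simp: fin_atoms_def)

lemma fin_atoms_simps [simp]:
  "fin_atoms []" "fin_atoms (x # X) \<longleftrightarrow> finite (atom_basis x) \<and> fin_atoms X"
  "fin_atoms (X @ Y) \<longleftrightarrow> fin_atoms X \<and> fin_atoms Y" by (auto simp: fin_atoms_def)

lemma fin_atoms_permute: "fin_atoms X \<Longrightarrow> \<forall>k\<in>set p. k < length X \<Longrightarrow> fin_atoms (permute p X)"
  by (auto simp: fin_atoms_def permute_def)

lemma linear_mapI:
  "(\<And>a b. f (a + b) = f a + f b) \<Longrightarrow> (\<And>c a. f (mat_scale c a) = mat_scale c (f a)) \<Longrightarrow> linear_map f"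
  by (simp add: linear_map_def)

text \<open>A product of \<open>r \<in> R\<close> with a functional on the other factors has slices proportional to \<open>r\<close>; conversely
  a functional is the sum of its slices, each multiplied with a matrix unit on the other factors.\<close>

lemma interp_rel_lift:
  assumes dist: "distinct xs" and vs: "set vs \<subseteq> set xs" and R: "binary_relation (map snd vs) [] R"
    and X: "X \<in> listset (map snd xs)" and fin: "fin_atoms X"
  shows "interp_rel R vs xs X [] = lift (pos vs xs) (R (permute (pos vs xs) X) []) X"
proof -
  define p where "p = pos vs xs"
  define q where "q = filter (\<lambda>k. xs ! k \<notin> set vs) [0..<length xs]"
  define U where "U = R (permute p X) []"
  have len: "length X = length xs" using X by (simp add: listset_iff)
  have pi: "perm_of vs xs = p @ q" by (simp add: perm_of_def p_def pos_def q_def)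
  have lp: "length p = length vs" by (simp add: p_def pos_def)
  have pl: "\<forall>k\<in>set p. k < length X" and ql: "\<forall>k\<in>set q. k < length X"
    using set_pos [OF dist vs] by (auto simp: p_def q_def len)
  have pq: "i \<notin> set p \<longleftrightarrow> i \<in> set q" if "i < length X" for i
    using set_pos [OF dist vs] that by (auto simp: p_def q_def len)
  have "permute p X \<in> listset (map snd vs)"
    using permute_listset [OF X, of p] pl permute_pos [OF vs] by (simp add: p_def len)
  then have U: "mat.subspace U" "U \<subseteq> functionals (permute p X)"
    using R by (auto simp: binary_relation_def U_def)
  have top: "top_rel (map snd (permute q xs)) [] (permute q X) [] = functionals (permute q X)"
    using permute_listset [OF X, of q] ql by (simp add: top_rel_def len)
  define T where "T = (\<lambda>(r :: 'a mat) i j. if j \<in> basis X then r i (permute (p @ q) j) else (0::complex))"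
  have T: "mat_mult (permute (p @ q) X) r (mat_permute (p @ q) X) = T r" for r
  proof (intro ext)
    fix i j
    have fin': "finite (basis (permute (p @ q) X))" using fin pl ql by (intro fin_atoms_basis fin_atoms_permute) auto
    have "mat_mult (permute (p @ q) X) r (mat_permute (p @ q) X) i j =
      (\<Sum>k\<in>basis (permute (p @ q) X). if k = permute (p @ q) j then (if j \<in> basis X then r i k else 0) else 0)"
      unfolding mat_mult_def mat_permute_def by (intro sum.cong) auto
    also have "\<dots> = T r i j" using fin' permute_basis [of j X "p @ q"] pl ql by (auto simp: T_def)
    finally show "mat_mult (permute (p @ q) X) r (mat_permute (p @ q) X) i j = T r i j" .
  qed
  have lin: "linear_map T" by (rule linear_mapI) (auto simp: T_def mat_scale_def fun_eq_iff)
  define G where "G = {mat_tensor (length vs) 0 r t | r t. r \<in> U \<and> t \<in> functionals (permute q X)}"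
  have tk: "take (length p) (permute (p @ q) Z) = permute p Z" "drop (length p) (permute (p @ q) Z) = permute q Z" for Z :: "('a, 'b) atom list"
    by (simp_all add: permute_append)
  have I: "interp_rel R vs xs X [] = T ` mat.span G"
    using X by (simp add: interp_rel_def Let_def pi T prod_rel_def G_def U_def top tk flip: lp)
  have eval: "T (mat_tensor (length vs) 0 r t) i j =
      (if j \<in> basis X then r [] (permute p j) * t i (permute q j) else 0)" for r t i j
    by (simp add: T_def mat_tensor_def permute_append flip: lp)
  have "T ` mat.span G \<subseteq> lift p U X"
    unfolding linear_map_span [OF lin, symmetric]
  proof (intro mat.span_minimal subspace_lift U subsetI)
    fix s assume "s \<in> T ` G"
    then obtain r t where rt: "r \<in> U" "t \<in> functionals (permute q X)"
      and s: "s = T (mat_tensor (length vs) 0 r t)" by (auto simp: G_def)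
    have "s i j = 0" if "i \<noteq> []" for i j using rt(2) that by (auto simp: s eval in_rows)
    then have "s \<in> functionals X"
      unfolding in_rows by (metis eval s)
    moreover have "\<exists>r\<in>U. \<forall>j\<in>basis X. agree_off p X j k \<longrightarrow> s [] j = r [] (permute p j)"
      if k: "k \<in> basis X" for k
    proof (intro bexI [of _ "mat_scale (t [] (permute q k)) r"] ballI impI)
      fix j assume j: "j \<in> basis X" "agree_off p X j k"
      then have "permute q j = permute q k" using pq ql by (auto simp: permute_def)
      then show "s [] j = mat_scale (t [] (permute q k)) r [] (permute p j)" using j by (simp add: s eval mat_scale_def)
    qed (rule mat.subspace_scale [OF U(1) rt(1)])
    ultimately show "s \<in> lift p U X"
      unfolding lift_def by blast
  qed
  moreover have "lift p U X \<subseteq> T ` mat.span G"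
  proof
    fix s assume s: "s \<in> lift p U X"
    have "\<exists>r\<in>U. \<forall>j\<in>basis X. permute q j = \<kappa> \<longrightarrow> s [] j = r [] (permute p j)" for \<kappa>
    proof (cases "\<exists>k\<in>basis X. permute q k = \<kappa>")
      case True
      then obtain k where k: "k \<in> basis X" "permute q k = \<kappa>" by blast
      obtain r where r: "r \<in> U" "\<forall>j\<in>basis X. agree_off p X j k \<longrightarrow> s [] j = r [] (permute p j)"
        using liftD [OF s k(1)] by blast
      moreover have "agree_off p X j k" if "permute q j = permute q k" for j
        using that pq unfolding permute_def map_eq_conv by blast
      ultimately show ?thesis using k by blast
    next
      case False
      then show ?thesis using mat.subspace_0 [OF U(1)] by blast
    qed
    then obtain r where r: "\<And>\<kappa>. r \<kappa> \<in> U"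
      "\<And>\<kappa> j. j \<in> basis X \<Longrightarrow> permute q j = \<kappa> \<Longrightarrow> s [] j = r \<kappa> [] (permute p j)"
      by metis
    define t where "t = (\<Sum>\<kappa>\<in>basis (permute q X). mat_tensor (length vs) 0 (r \<kappa>) (mat_unit [] \<kappa>))"
    have "t \<in> mat.span G"
      unfolding t_def
    proof (intro mat.span_sum mat.span_base)
      fix \<kappa> assume "\<kappa> \<in> basis (permute q X)"
      then show "mat_tensor (length vs) 0 (r \<kappa>) (mat_unit [] \<kappa>) \<in> G"
        unfolding G_def using r(1) mat_unit_ops [of "[]" "[]" \<kappa>] by fastforce
    qed
    moreover have "T t = s"
    proof (intro ext)
      fix i j
      show "T t i j = s i j"
      proof (cases "i = [] \<and> j \<in> basis X")
        case True
        have fq: "finite (basis (permute q X))" using fin ql by (intro fin_atoms_basis fin_atoms_permute)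
        have "T t i j = (\<Sum>\<kappa>\<in>basis (permute q X). if \<kappa> = permute q j then r \<kappa> [] (permute p j) else 0)"
          using True unfolding T_def t_def sum_fun2_apply
          by (auto simp: mat_tensor_def permute_append mat_unit_def simp flip: lp intro!: sum.cong)
        also have "\<dots> = s i j" using True fq permute_basis [of j X q] ql r(2) [of j] by auto
        finally show ?thesis .
      next
        case False
        then have "T t i j = 0" by (auto simp: T_def t_def sum_fun2_apply mat_tensor_def mat_unit_def)
        moreover have "s i j = 0" using s False by (auto simp: lift_def in_rows)
        ultimately show ?thesis by simp
      qed
    qed
    ultimately show "s \<in> T ` mat.span G" by blast
  qed
  ultimately show ?thesis
    unfolding I p_def U_def by blast
qed

definition fin_vars :: "('v::complex_inner, 'p) var list \<Rightarrow> bool" where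
  "fin_vars xs \<longleftrightarrow> (\<forall>x\<in>set xs. \<forall>a\<in>snd x. finite (atom_basis a))"

lemma fin_vars_simps [simp]: "fin_vars []"
  "fin_vars (x # xs) \<longleftrightarrow> (\<forall>a\<in>snd x. finite (atom_basis a)) \<and> fin_vars xs"
  "fin_vars (xs @ ys) \<longleftrightarrow> fin_vars xs \<and> fin_vars ys" by (auto simp: fin_vars_def)

lemma fin_vars_atoms: "fin_vars xs \<Longrightarrow> X \<in> listset (map snd xs) \<Longrightarrow> fin_atoms X"
  unfolding fin_vars_def fin_atoms_def listset_iff
  by (metis in_set_conv_nth length_map nth_map nth_mem)

abbreviation well_formed :: "('v::complex_inner, 'p) form \<Rightarrow> ('v, 'p) var list \<Rightarrow> bool" where
  "well_formed \<phi> xs \<equiv> binary_relation (map snd xs) [] (interp \<phi> xs)"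

lemma binary_relation_rowsD:
  assumes "binary_relation \<X> [] R" "X \<in> listset \<X>"
  shows "R X [] \<subseteq> functionals X" "mat.subspace (R X [])" using assms by (auto simp: binary_relation_def)

lemma binary_relation_0: "binary_relation \<X> \<Y> R \<Longrightarrow> 0 \<in> R X Y"
  unfolding binary_relation_def by (metis mat.subspace_0 singletonI)

lemma well_formed_Rel:
  assumes "distinct xs" "set vs \<subseteq> set xs" "binary_relation (map snd vs) [] R" "fin_vars xs"
  shows "well_formed (Rel R vs) xs"
  unfolding binary_relation_def
proof (intro allI)
  fix X Y :: "('a, 'b) atom list"
  show "if X \<in> listset (map snd xs) \<and> Y \<in> listset []
           then interp (Rel R vs) xs X Y \<subseteq> ops X Y \<and> mat.subspace (interp (Rel R vs) xs X Y)
           else interp (Rel R vs) xs X Y = {0}"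
  proof (cases "X \<in> listset (map snd xs) \<and> Y \<in> listset []")
    case True
    then have "interp_rel R vs xs X [] = lift (pos vs xs) (R (permute (pos vs xs) X) []) X"
      using assms by (intro interp_rel_lift) (auto intro: fin_vars_atoms)
    moreover have "permute (pos vs xs) X \<in> listset (map snd vs)"
      using True permute_listset [of X xs "pos vs xs"] permute_pos [OF assms(2)] set_pos [OF assms(1,2)] by simp
    then have "mat.subspace (R (permute (pos vs xs) X) [])" using assms(3) by (rule binary_relation_rowsD(2) [rotated])
    ultimately show ?thesis using True by (auto simp: subspace_lift dest: subsetD [OF lift_rows])
  qed (auto simp: interp_rel_def Let_def)
qed

lemma well_formed_Neg: "well_formed (Neg \<phi>) xs"
  unfolding binary_relation_def
  using subspace_perp by (auto simp: neg_rel_def perp_def hs_def)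

lemma well_formed_Conj: "well_formed \<phi> xs \<Longrightarrow> well_formed \<psi> xs \<Longrightarrow> well_formed (Conj \<phi> \<psi>) xs"
  unfolding binary_relation_def by (auto simp: mat.subspace_inter split: if_splits)

lemma well_formed_All: "well_formed (All x \<phi>) xs"
  unfolding binary_relation_def
proof (intro allI)
  fix X Y :: "('a, 'b) atom list"
  let ?F = "{R. binary_relation (map snd xs) [] R \<and>
         prod_rel 1 0 (top_rel [snd x] []) R \<le> interp \<phi> (x # xs)}"
  show "if X \<in> listset (map snd xs) \<and> Y \<in> listset []
           then interp (All x \<phi>) xs X Y \<subseteq> ops X Y \<and> mat.subspace (interp (All x \<phi>) xs X Y)
           else interp (All x \<phi>) xs X Y = {0}"
  proof (cases "X \<in> listset (map snd xs) \<and> Y \<in> listset []")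
    case True
    then have "(\<Union>R\<in>?F. R X Y) \<subseteq> ops X Y" by (auto simp: binary_relation_def)
    then show ?thesis using True mat.span_minimal [OF _ subspace_ops] by (simp add: sup_rel_def)
  next
    case False
    then have "(\<Union>R\<in>?F. R X Y) \<subseteq> {0}"
      unfolding binary_relation_def by auto
    from mat.span_minimal [OF this mat.subspace_single_0] have "mat.span (\<Union>R\<in>?F. R X Y) = {0}"
      using mat.span_zero by blast
    then show ?thesis using False by (auto simp add: sup_rel_def)
  qed
qed

lemma well_formed_Impl: "well_formed (Impl \<phi> \<psi>) xs"
  unfolding Impl_def Disj_def by (rule well_formed_Neg)

lemma well_formed_All_eq: "well_formed (All_eq x x' \<phi>) xs"
  unfolding All_eq_def by (rule well_formed_All)

lemma well_formed_Ex_eq: "well_formed (Ex_eq x x' \<phi>) xs"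
  unfolding Ex_eq_def by (rule well_formed_Neg)

lemma interp_Neg: "X \<in> listset (map snd xs) \<Longrightarrow> interp (Neg \<phi>) xs X [] = perp X [] (interp \<phi> xs X [])"
  by (simp add: neg_rel_def perp_def hs_def)

lemma linear_mat_tensor: "linear_map (mat_tensor m n t)"
  by (rule linear_mapI) (auto simp: mat_tensor_def mat_scale_def fun_eq_iff algebra_simps)

text \<open>The interpretation is defined as a largest relation; it can be described atom by atom because the
  functionals on the right-hand side form a relation themselves.\<close>

lemma in_interp_All:
  assumes wf: "well_formed \<phi> (x # xs)" and X: "X \<in> listset (map snd xs)"
  shows "s \<in> interp (All x \<phi>) xs X [] \<longleftrightarrow> s \<in> functionals X \<and>
    (\<forall>X0\<in>snd x. \<forall>t\<in>functionals [X0]. mat_tensor 1 0 t s \<in> interp \<phi> (x # xs) (X0 # X) [])"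
proof -
  define K where "K = (\<lambda>X. {s \<in> functionals X.
    \<forall>X0\<in>snd x. \<forall>t\<in>functionals [X0]. mat_tensor 1 0 t s \<in> interp \<phi> (x # xs) (X0 # X) []})"
  have K: "mat.subspace (K X)" if "X \<in> listset (map snd xs)" for X
  proof -
    have sub: "mat.subspace (interp \<phi> (x # xs) (X0 # X) [])" if "X0 \<in> snd x" for X0
      using wf by (rule binary_relation_rowsD) (use that \<open>X \<in> _\<close> in \<open>auto simp: listset_Cons simp del: listset.simps\<close>)
    have lin: "mat_tensor 1 0 t (a + b) = mat_tensor 1 0 t a + mat_tensor 1 0 t b"
      "mat_tensor 1 0 t (mat_scale c a) = mat_scale c (mat_tensor 1 0 t a)" "mat_tensor 1 0 t 0 = 0"
      for t a b :: "'a mat" and c using linear_mat_tensor [of 1 0 t] linear_map_0 [OF linear_mat_tensor [of 1 0 t]]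
      by (simp_all add: linear_map_def)
    note lin = lin [unfolded One_nat_def]
    show ?thesis
      unfolding K_def
    proof (rule mat.subspaceI, goal_cases)
      case 1
      then show ?case using mat.subspace_0 [OF sub] by (simp add: lin mat.subspace_0 [OF subspace_ops])
    next
      case (2 a b)
      then show ?case using mat.subspace_add [OF sub] mat.subspace_add [OF subspace_ops, of a X "[]" b] by (simp add: lin)
    next
      case (3 c a)
      then show ?case using mat.subspace_scale [OF sub] mat.subspace_scale [OF subspace_ops, of a X "[]"] by (simp add: lin)
    qed
  qed
  let ?F = "{R. binary_relation (map snd xs) [] R \<and>
         prod_rel 1 0 (top_rel [snd x] []) R \<le> interp \<phi> (x # xs)}"
  have "R X [] \<subseteq> K X" if R: "R \<in> ?F" for R
  proof
    fix r assume r: "r \<in> R X []"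
    have "mat_tensor 1 0 t r \<in> interp \<phi> (x # xs) (X0 # X) []" if "X0 \<in> snd x" "t \<in> functionals [X0]" for X0 t
    proof -
      have "t \<in> top_rel [snd x] [] (take 1 (X0 # X)) (take 0 [])"
        using that by (auto simp: top_rel_def set_Cons_def)
      then have "mat_tensor 1 0 t r \<in> prod_rel 1 0 (top_rel [snd x] []) R (X0 # X) []"
        unfolding prod_rel_def using r by (intro mat.span_base) auto
      then show ?thesis using R by (auto simp: le_fun_def)
    qed
    moreover have "r \<in> functionals X" using R r X binary_relation_rowsD(1) by blast
    ultimately show "r \<in> K X" unfolding K_def by blast
  qed
  then have "(\<Union>R\<in>?F. R X []) \<subseteq> K X" by blast
  from mat.span_minimal [OF this K [OF X]] have "interp (All x \<phi>) xs X [] \<subseteq> K X"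
    by (simp add: sup_rel_def)
  moreover have "K X \<subseteq> interp (All x \<phi>) xs X []"
  proof -
    define R where "R = (\<lambda>X (Y :: ('a, 'b) atom list). if X \<in> listset (map snd xs) \<and> Y = [] then K X else {0})"
    have "binary_relation (map snd xs) [] R"
      unfolding binary_relation_def R_def using K by (auto simp: K_def)
    moreover have "prod_rel 1 0 (top_rel [snd x] []) R Z Y \<subseteq> interp \<phi> (x # xs) Z Y" for Z Y
    proof -
      have "mat_tensor 1 0 t r \<in> interp \<phi> (x # xs) Z Y"
        if t: "t \<in> top_rel [snd x] [] (take 1 Z) []" and r: "r \<in> R (drop 1 Z) Y" for t r
      proof (cases "t = 0 \<or> r = 0")
        case True
        then have "mat_tensor 1 0 t r = 0" by (auto simp: mat_tensor_def fun_eq_iff)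
        then show ?thesis using binary_relation_0 [OF wf] by simp
      next
        case False
        with t have "take 1 Z \<in> listset [snd x]" by (auto simp: top_rel_def split: if_splits)
        then obtain X0 X' where Z: "Z = X0 # X'" "X0 \<in> snd x" by (cases Z) (auto simp: set_Cons_def)
        with False r t show ?thesis by (auto simp: R_def K_def top_rel_def split: if_splits)
      qed
      moreover have "mat.subspace (interp \<phi> (x # xs) Z Y)"
        using wf unfolding binary_relation_def by (metis mat.subspace_single_0)
      ultimately show ?thesis
        unfolding prod_rel_def by (intro mat.span_minimal) auto
    qed
    ultimately have "R \<in> ?F" by (auto simp: le_fun_def)
    then have "R X [] \<subseteq> (\<Union>R\<in>?F. R X [])" by blast
    then have "R X [] \<subseteq> interp (All x \<phi>) xs X []" using mat.span_superset by (auto simp: sup_rel_def)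
    then show ?thesis using X by (simp add: R_def)
  qed
  ultimately show ?thesis by (auto simp: K_def)
qed

lemma projection_unique:
  assumes fin: "finite (basis X)" "finite (basis Y)" and U: "mat.subspace U" "U \<subseteq> ops X Y"
    and u: "u \<in> U" "\<forall>a\<in>U. hs X Y a (s - u) = 0" and w: "w \<in> U" "\<forall>a\<in>U. hs X Y a (s - w) = 0"
  shows "u = w"
proof -
  have m: "u - w \<in> U" by (intro mat.subspace_diff U u w)
  have "hs X Y (u - w) (u - w) = hs X Y (u - w) (s - w) - hs X Y (u - w) (s - u)" by (simp add: hs_diff)
  then have "u - w = 0" using m u w U(2) by (intro hs_self_0 [OF fin]) auto
  then show ?thesis by simp
qed

text \<open>The implication abbreviates \<open>\<not>\<phi> \<or> (\<phi> \<and> \<psi>)\<close>, so a functional is allowed iff its orthogonal projection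
  \<open>u\<close> to \<open>\<phi>\<close> is in \<open>\<psi>\<close>.\<close>

lemma in_interp_Impl:
  assumes wf: "well_formed \<phi> xs" "well_formed \<psi> xs" and X: "X \<in> listset (map snd xs)" and fin: "fin_atoms X"
  shows "s \<in> interp (Impl \<phi> \<psi>) xs X [] \<longleftrightarrow> s \<in> functionals X \<and>
    (\<exists>u \<in> interp \<phi> xs X [] \<inter> interp \<psi> xs X []. \<forall>a\<in>interp \<phi> xs X []. hs X [] a (s - u) = 0)"
proof -
  define P where "P = interp \<phi> xs X []"
  define Q where "Q = interp \<psi> xs X []"
  note PQ = binary_relation_rowsD [OF wf(1) X, folded P_def] binary_relation_rowsD [OF wf(2) X, folded Q_def]
  have fX: "finite (basis X)" using fin by (rule fin_atoms_basis)
  have f0: "finite (basis ([] :: ('a, 'b) atom list))" by simp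
  have "interp (Impl \<phi> \<psi>) xs X [] = perp X [] (perp X [] (perp X [] P) \<inter> perp X [] (P \<inter> Q))"
    unfolding Impl_def Disj_def interp_Neg [OF X] interp.simps(3) inf_fun_def P_def Q_def by simp
  also have "perp X [] (perp X [] P) = P" using perp_perp [OF fX f0 PQ(1)] PQ(2) by simp
  finally have I: "interp (Impl \<phi> \<psi>) xs X [] = perp X [] (P \<inter> perp X [] (P \<inter> Q))" .
  show ?thesis
    unfolding I P_def [symmetric] Q_def [symmetric]
  proof (intro iffI conjI)
    assume s: "s \<in> perp X [] (P \<inter> perp X [] (P \<inter> Q))"
    then show "s \<in> functionals X" by (simp add: perp_def)
    obtain u where u: "u \<in> P" "\<forall>a\<in>P. hs X [] a (s - u) = 0"
      using orthogonal_projection [OF fX f0 PQ(2,1)] by blast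
    have sub: "mat.subspace (P \<inter> Q)" "P \<inter> Q \<subseteq> functionals X"
      using PQ by (auto intro: mat.subspace_inter)
    obtain w where w: "w \<in> P \<inter> Q" "\<forall>a\<in>P \<inter> Q. hs X [] a (u - w) = 0"
      using orthogonal_projection [OF fX f0 sub] by blast
    have m: "u - w \<in> P" using u w PQ(2) by (auto intro: mat.subspace_diff)
    then have "hs X [] (u - w) s = 0" using s w PQ(1) by (auto simp: perp_def)
    moreover have "hs X [] (u - w) w = 0" using w by (simp add: hs_eq_0_commute)
    ultimately have "hs X [] (u - w) (u - w) = 0" using u(2) m by (auto simp: hs_diff)
    then have "u - w = 0" using m PQ(1) by (intro hs_self_0 [OF fX f0]) auto
    then have "u \<in> P \<inter> Q" using u w by simp
    then show "\<exists>u\<in>P \<inter> Q. \<forall>a\<in>P. hs X [] a (s - u) = 0" using u(2) by blast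
  next
    assume "s \<in> functionals X \<and> (\<exists>u\<in>P \<inter> Q. \<forall>a\<in>P. hs X [] a (s - u) = 0)"
    then obtain u where u: "s \<in> functionals X" "u \<in> P \<inter> Q" "\<forall>a\<in>P. hs X [] a (s - u) = 0" by blast
    have "hs X [] a s = 0" if "a \<in> P \<inter> perp X [] (P \<inter> Q)" for a
      using that u by (auto simp: perp_def hs_diff hs_eq_0_commute [of X "[]" a])
    then show "s \<in> perp X [] (P \<inter> perp X [] (P \<inter> Q))" using u(1) by (auto simp: perp_def)
  qed
qed

section \<open>Quantification over the diagonal\<close>

text \<open>The functional \<open>\<epsilon>\<^sub>x \<otimes> s\<close>, and the adjoint \<open>contr\<close> of the map \<open>s \<mapsto> \<epsilon>\<^sub>x \<otimes> s\<close>.\<close>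

definition eps :: "('v::complex_inner, 'p) atom \<Rightarrow> 'v mat \<Rightarrow> 'v mat" where
  "eps x s = (\<lambda>i j. if i = [] \<and> (\<exists>e k. j = e # e # k \<and> e \<in> atom_basis x) then s [] (tl (tl j)) else 0)"

definition contr :: "('v::complex_inner, 'p) atom \<Rightarrow> 'v mat \<Rightarrow> 'v mat" where
  "contr x s = (\<lambda>i j. \<Sum>e\<in>atom_basis x. s i (e # e # j))"

lemma eps_functionals: "s \<in> functionals X \<Longrightarrow> eps x s \<in> functionals (x # dual x # X)"
  by (auto simp: eps_def in_rows split: if_splits)

lemma contr_functionals:
  assumes "s \<in> functionals (x # x' # X)"
  shows "contr x s \<in> functionals X"
  unfolding in_rows
proof (intro allI impI)
  fix i j assume "contr x s i j \<noteq> 0"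
  then obtain e where "s i (e # e # j) \<noteq> 0"
    unfolding contr_def by (meson sum.neutral)
  then have "i = [] \<and> e # e # j \<in> basis (x # x' # X)" using assms unfolding in_rows by blast
  then show "i = [] \<and> j \<in> basis X" by simp
qed

lemma eps_apply: "e \<in> atom_basis x \<Longrightarrow> eps x s [] (e # e' # j) = (if e = e' then s [] j else 0)"
  by (auto simp: eps_def)

lemma linear_eps: "linear_map (eps x)" by (rule linear_mapI) (auto simp: eps_def mat_scale_def fun_eq_iff)

lemma hs_eps:
  assumes "finite (atom_basis x)"
  shows "hs (x # dual x # X) [] a (eps x s) = hs X [] (contr x a) s"
proof -
  have "hs (x # dual x # X) [] a (eps x s) =
    (\<Sum>e\<in>atom_basis x. \<Sum>e'\<in>atom_basis x. if e' = e then (\<Sum>j\<in>basis X. cnj (a [] (e # e # j)) * s [] j) else 0)"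
    unfolding hs_rows sum_basis_Cons atom_basis_dual
    by (intro sum.cong refl) (auto simp: eps_apply)
  also have "\<dots> = (\<Sum>e\<in>atom_basis x. \<Sum>j\<in>basis X. cnj (a [] (e # e # j)) * s [] j)"
    using assms by simp
  also have "\<dots> = hs X [] (contr x a) s"
    unfolding hs_rows contr_def by (subst sum.swap) (simp add: sum_distrib_right)
  finally show ?thesis .
qed

lemma binary_relation_eq_rel:
  "binary_relation [S, dual_qset S] [] (eq_rel S)"
  unfolding binary_relation_def
proof (intro allI)
  fix X Y :: "('a, 'b) atom list"
  have "mat_eval x \<in> functionals [x, dual x]" for x :: "('a, 'b) atom" by (auto simp: mat_eval_def in_rows)
  then have sub: "mat.span {mat_eval x} \<subseteq> functionals [x, dual x]" for x :: "('a, 'b) atom"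
    by (intro mat.span_minimal subspace_ops) auto
  show "if X \<in> listset [S, dual_qset S] \<and> Y \<in> listset []
        then eq_rel S X Y \<subseteq> ops X Y \<and> mat.subspace (eq_rel S X Y) else eq_rel S X Y = {0}"
    by (auto simp: eq_rel_def set_Cons_def in_dual_qset mat.subspace_0 [OF subspace_ops] dest: subsetD [OF sub])
qed

lemma eq_rel_pair: "eq_rel S [x, y] [] = (if x \<in> S \<and> y = dual x then mat.span {mat_eval x} else {0})"
  by (auto simp: eq_rel_def)

lemma lift_zero: "lift p {0} X = {0}"
proof -
  have "s = 0" if s: "s \<in> lift p {0} X" for s
  proof (rule rows_ext)
    show "s \<in> functionals X" using s by (simp add: lift_def)
    show "s [] j = 0 [] j" if "j \<in> basis X" for j using liftD [OF s that] that by auto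
  qed (rule mat.subspace_0 [OF subspace_ops])
  then show ?thesis using mat.subspace_0 [OF subspace_lift [OF mat.subspace_single_0], of p X] by blast
qed

lemma lift_eval: "lift [0, Suc 0] (mat.span {mat_eval x}) (x # dual x # X) = eps x ` functionals X"
proof
  show "lift [0, Suc 0] (mat.span {mat_eval x}) (x # dual x # X) \<subseteq> eps x ` functionals X"
  proof
    fix s assume s: "s \<in> lift [0, Suc 0] (mat.span {mat_eval x}) (x # dual x # X)"
    show "s \<in> eps x ` functionals X"
    proof (cases "atom_basis x = {}")
      case True
      then have "basis (x # dual x # X) = {}" by (simp add: basis_Cons)
      then have "s = eps x 0" using s True by (intro rows_ext [of _ "x # dual x # X"])
          (auto simp: lift_def intro!: eps_functionals mat.subspace_0 [OF subspace_ops])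
      then show ?thesis using mat.subspace_0 [OF subspace_ops] by blast
    next
      case False
      then obtain e where e: "e \<in> atom_basis x" by blast
      define r where "r = (\<lambda>(i :: 'a option list) j. if i = [] \<and> j \<in> basis X then s [] (e # e # j) else 0)"
      have "r \<in> functionals X" by (auto simp: r_def in_rows)
      moreover have "s = eps x r"
      proof (rule rows_ext [of _ "x # dual x # X"])
        fix j assume "j \<in> basis (x # dual x # X)"
        then obtain a b k where j: "j = a # b # k" "a \<in> atom_basis x" "b \<in> atom_basis x" "k \<in> basis X"
          by (auto simp: basis_Cons)
        have "e # e # k \<in> basis (x # dual x # X)" using e j by simp
        from liftD [OF s this] obtain t where t: "t \<in> mat.span {mat_eval x}"
          "\<forall>j\<in>basis (x # dual x # X). (\<forall>i<length (x # dual x # X). i \<notin> set [0, Suc 0] \<longrightarrow> j ! i = (e # e # k) ! i) \<longrightarrow>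
            s [] j = t [] (permute [0, Suc 0] j)" by blast
        obtain c where "t = mat_scale c (mat_eval x)" using t(1) by (auto simp: mat.span_singleton)
        with t(2) have
          c: "j \<in> basis (x # dual x # X) \<Longrightarrow> (\<forall>i<length (x # dual x # X). i \<notin> {0, Suc 0} \<longrightarrow> j ! i = (e # e # k) ! i) \<Longrightarrow>
            s [] j = c * mat_eval x [] (permute [0, Suc 0] j)" for j
          unfolding mat_scale_def by simp
        have nth: "(u # v # k) ! i = (e # e # k) ! i" if "i \<notin> {0, Suc 0}" for i u v
        proof -
          obtain l where "i = Suc (Suc l)" using \<open>i \<notin> _\<close> by (metis insert_iff not0_implies_Suc)
          then show ?thesis by simp
        qed
        have "s [] (e # e # k) = c" using c [of "e # e # k"] e j by (simp add: permute_def mat_eval_def)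
        moreover have "\<forall>i<length (x # dual x # X). i \<notin> {0, Suc 0} \<longrightarrow> j ! i = (e # e # k) ! i"
          unfolding j(1) using nth by blast
        from c [OF _ this] have "s [] j = c * mat_eval x [] (permute [0, Suc 0] j)" using j by simp
        then have "s [] j = c * mat_eval x [] [a, b]" by (simp add: permute_def j(1))
        ultimately show "s [] j = eps x r [] j" using j by (auto simp: eps_apply r_def mat_eval_def)
      qed (use s in \<open>auto simp: lift_def intro!: eps_functionals \<open>r \<in> functionals X\<close>\<close>)
      ultimately show ?thesis by blast
    qed
  qed
next
  show "eps x ` functionals X \<subseteq> lift [0, Suc 0] (mat.span {mat_eval x}) (x # dual x # X)"
  proof
    fix s assume "s \<in> eps x ` functionals X"
    then obtain r where r: "r \<in> functionals X" "s = eps x r" by blast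
    have "\<exists>t\<in>mat.span {mat_eval x}. \<forall>j\<in>basis (x # dual x # X).
        (\<forall>i<length (x # dual x # X). i \<notin> set [0, Suc 0] \<longrightarrow> j ! i = k ! i) \<longrightarrow> s [] j = t [] (permute [0, Suc 0] j)"
      if k: "k \<in> basis (x # dual x # X)" for k
    proof (intro bexI ballI impI)
      show "mat_scale (r [] (tl (tl k))) (mat_eval x) \<in> mat.span {mat_eval x}"
        by (intro mat.span_scale mat.span_base) simp
      fix j assume j: "j \<in> basis (x # dual x # X)"
        "\<forall>i<length (x # dual x # X). i \<notin> set [0, Suc 0] \<longrightarrow> j ! i = k ! i"
      obtain a b l where l: "j = a # b # l" "a \<in> atom_basis x" "b \<in> atom_basis x" "l \<in> basis X"
        using j(1) by (auto simp: basis_Cons)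
      obtain a' b' l' where l': "k = a' # b' # l'" "l' \<in> basis X" using k by (auto simp: basis_Cons)
      have "l = l'" using j(2) l l' by (intro nth_equalityI) (auto simp: basis_iff dest: spec [of _ "Suc (Suc _)"])
      then show "s [] j = mat_scale (r [] (tl (tl k))) (mat_eval x) [] (permute [0, Suc 0] j)"
        using l l' r by (auto simp: eps_apply mat_scale_def permute_def mat_eval_def)
    qed
    moreover have "s \<in> functionals (x # dual x # X)" using r by (simp add: eps_functionals)
    ultimately show "s \<in> lift [0, Suc 0] (mat.span {mat_eval x}) (x # dual x # X)"
      unfolding lift_def by blast
  qed
qed

lemma interp_eq_diagonal:
  assumes "distinct (x # x' # xs)" "snd x' = dual_qset (snd x)" "fin_vars (x # x' # xs)"
    and X: "X0 # X1 # X \<in> listset (map snd (x # x' # xs))"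
  shows "interp (Rel (eq_rel (snd x)) [x, x']) (x # x' # xs) (X0 # X1 # X) [] =
    (if X1 = dual X0 then eps X0 ` functionals X else {0})"
proof -
  have p: "pos [x, x'] (x # x' # xs) = [0, Suc 0]" using assms(1) by (simp add: pos_def)
  have "interp (Rel (eq_rel (snd x)) [x, x']) (x # x' # xs) (X0 # X1 # X) [] =
    lift [0, Suc 0] (eq_rel (snd x) [X0, X1] []) (X0 # X1 # X)"
    unfolding interp.simps
    by (subst interp_rel_lift)
      (use assms binary_relation_eq_rel [of "snd x"] fin_vars_atoms [OF assms(3) X] in
        \<open>simp_all add: p permute_def\<close>)
  also have "\<dots> = (if X1 = dual X0 then eps X0 ` functionals X else {0})"
    using X by (auto simp: eq_rel_pair lift_eval lift_zero listset_Cons simp del: listset.simps)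
  finally show ?thesis .
qed

lemma tensor_functionals:
  assumes t: "t \<in> functionals [x]" and s: "s \<in> functionals X"
  shows "mat_tensor 1 0 t s \<in> functionals (x # X)"
  unfolding in_rows
proof (intro allI impI)
  fix i j assume "mat_tensor 1 0 t s i j \<noteq> 0"
  then have "t [] (take 1 j) \<noteq> 0" "s i (drop 1 j) \<noteq> 0" by (auto simp: mat_tensor_def)
  then have "take 1 j \<in> basis [x]" "i = []" "drop 1 j \<in> basis X" using t s unfolding in_rows by blast+
  then show "i = [] \<and> j \<in> basis (x # X)" by (cases j) (auto simp: basis_Cons)
qed

text \<open>The diagonal formula is interpreted as \<open>\<epsilon>\<^bsub>X0\<^esub> \<otimes> L(X, \<complex>)\<close>.  The projection of \<open>t\<^sub>0 \<otimes> t\<^sub>1 \<otimes> s\<close> to this space is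
  a multiple of \<open>\<epsilon>\<^bsub>X0\<^esub> \<otimes> s\<close>, with a factor that is nonzero for a suitable choice of \<open>t\<^sub>0\<close> and \<open>t\<^sub>1\<close>, so the
  implication holds for all \<open>t\<^sub>0\<close> and \<open>t\<^sub>1\<close> iff \<open>\<epsilon>\<^bsub>X0\<^esub> \<otimes> s\<close> satisfies \<open>\<phi>\<close>.\<close>

lemma in_interp_All_eq:
  assumes dist: "distinct (x # x' # xs)" and sorts: "snd x' = dual_qset (snd x)" and fin: "fin_vars (x # x' # xs)"
    and wf: "well_formed \<phi> (x # x' # xs)" and X: "X \<in> listset (map snd xs)"
  shows "s \<in> interp (All_eq x x' \<phi>) xs X [] \<longleftrightarrow> s \<in> functionals X \<and>
    (\<forall>X0\<in>snd x. eps X0 s \<in> interp \<phi> (x # x' # xs) (X0 # dual X0 # X) [])"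
proof -
  define E where "E = Rel (eq_rel (snd x)) [x, x']"
  have wE: "well_formed E (x # x' # xs)"
    unfolding E_def using dist sorts binary_relation_eq_rel [of "snd x"] by (intro well_formed_Rel fin) auto
  have Xs: "X0 # X1 # X \<in> listset (map snd (x # x' # xs)) \<longleftrightarrow> X0 \<in> snd x \<and> X1 \<in> snd x'" for X0 X1
    using X by (auto simp: listset_Cons simp del: listset.simps)
  have X1: "X1 # X \<in> listset (map snd (x' # xs)) \<longleftrightarrow> X1 \<in> snd x'" for X1
    using X by (auto simp: listset_Cons simp del: listset.simps)
  have finX: "fin_atoms X" using fin X by (intro fin_vars_atoms) auto
  have fd: "finite (atom_basis X0)" if "X0 \<in> snd x" for X0 using fin that by auto
  have fX: "finite (basis (X0 # dual X0 # X))" if "X0 \<in> snd x" for X0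
    using finX fd [OF that] by (intro fin_atoms_basis) simp
  have I: "s \<in> interp (All_eq x x' \<phi>) xs X [] \<longleftrightarrow> s \<in> functionals X \<and>
    (\<forall>X1\<in>snd x'. \<forall>t1\<in>functionals [X1]. mat_tensor 1 0 t1 s \<in> functionals (X1 # X) \<and> (\<forall>X0\<in>snd x. \<forall>t0\<in>functionals [X0].
       mat_tensor 1 0 t0 (mat_tensor 1 0 t1 s) \<in> interp (Impl E \<phi>) (x # x' # xs) (X0 # X1 # X) []))"
    unfolding All_eq_def E_def [symmetric]
    by (subst in_interp_All [OF well_formed_All X], intro conj_cong refl ball_cong)
      (simp only: in_interp_All [OF well_formed_Impl X1 [THEN iffD2]])
  define Q where "Q X0 X1 = interp \<phi> (x # x' # xs) (X0 # X1 # X) []" for X0 X1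
  have Q: "Q X0 X1 \<subseteq> functionals (X0 # X1 # X)" "mat.subspace (Q X0 X1)" if "X0 \<in> snd x" "X1 \<in> snd x'" for X0 X1
    using binary_relation_rowsD [OF wf] Xs that unfolding Q_def by blast+
  have t1: "mat_tensor 1 0 t1 s \<in> functionals (X1 # X)" if "t1 \<in> functionals [X1]" "s \<in> functionals X" for X1 t1
    using that by (rule tensor_functionals)
  have imp: "u \<in> interp (Impl E \<phi>) (x # x' # xs) (X0 # X1 # X) [] \<longleftrightarrow> u \<in> functionals (X0 # X1 # X) \<and>
    (X1 = dual X0 \<longrightarrow> (\<exists>r\<in>functionals X. eps X0 r \<in> Q X0 X1 \<and> (\<forall>a\<in>functionals X. hs (X0 # X1 # X) [] (eps X0 a) (u - eps X0 r) = 0)))"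
    if mem: "X0 \<in> snd x" "X1 \<in> snd x'" for X0 X1 u
  proof -
    have Xm: "X0 # X1 # X \<in> listset (map snd (x # x' # xs))" using Xs mem by blast
    have fi: "fin_atoms (X0 # X1 # X)" using fin Xm by (rule fin_vars_atoms)
    have int: "interp E (x # x' # xs) (X0 # X1 # X) [] = (if X1 = dual X0 then eps X0 ` functionals X else {0})"
      unfolding E_def using dist sorts fin Xm by (rule interp_eq_diagonal)
    show ?thesis
      unfolding in_interp_Impl [OF wE wf Xm fi] int Q_def
      using binary_relation_0 [OF wf] by (auto simp: hs_eq_0_commute [of _ _ 0])
  qed
  have tens: "mat_tensor 1 0 t0 (mat_tensor 1 0 t1 s) [] (e # e' # j) = t0 [] [e] * t1 [] [e'] * s [] j" for t0 t1 e e' j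
    by (simp add: mat_tensor_def)
  have proj: "hs (X0 # dual X0 # X) [] (eps X0 a) (mat_tensor 1 0 t0 (mat_tensor 1 0 t1 s) - eps X0 (mat_scale c s)) = 0"
    if X0: "X0 \<in> snd x" and c: "c = (\<Sum>e\<in>atom_basis X0. t0 [] [e] * t1 [] [e]) / of_nat (card (atom_basis X0))"
    for X0 t0 t1 a c
  proof -
    let ?B = "atom_basis X0"
    have "hs (X0 # dual X0 # X) [] (eps X0 a) (eps X0 (mat_scale c s)) =
       of_nat (card ?B) * c * hs X [] a s"
    proof -
      have "contr X0 (eps X0 a) [] j = of_nat (card ?B) * a [] j" for j by (simp add: contr_def eps_apply)
      then show ?thesis
        unfolding hs_eps [OF fd [OF X0]]
        by (simp add: hs_rows mat_scale_def sum_distrib_left mult.assoc mult.left_commute)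
    qed
    also have "of_nat (card ?B) * c = (\<Sum>e\<in>?B. t0 [] [e] * t1 [] [e])"
      using fd [OF X0] by (cases "?B = {}") (simp_all add: c)
    also have "\<dots> * hs X [] a s = hs (X0 # dual X0 # X) [] (eps X0 a) (mat_tensor 1 0 t0 (mat_tensor 1 0 t1 s))"
    proof -
      have "hs (X0 # dual X0 # X) [] (eps X0 a) (mat_tensor 1 0 t0 (mat_tensor 1 0 t1 s)) =
        (\<Sum>e\<in>?B. \<Sum>e'\<in>?B. if e' = e then t0 [] [e] * t1 [] [e] * hs X [] a s else 0)"
        unfolding hs_rows sum_basis_Cons atom_basis_dual
      proof (intro sum.cong refl)
        fix e e' assume "e \<in> ?B" "e' \<in> ?B"
        then show "(\<Sum>j\<in>basis X. cnj (eps X0 a [] (e # e' # j)) * mat_tensor 1 0 t0 (mat_tensor 1 0 t1 s) [] (e # e' # j)) =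
          (if e' = e then t0 [] [e] * t1 [] [e] * (\<Sum>j\<in>basis X. cnj (a [] j) * s [] j) else 0)"
          by (auto simp: eps_apply tens [unfolded One_nat_def] sum_distrib_left intro!: sum.cong)
      qed
      also have "\<dots> = (\<Sum>e\<in>?B. t0 [] [e] * t1 [] [e]) * hs X [] a s"
        using fd [OF X0] by (simp add: sum_distrib_right)
      finally show ?thesis by simp
    qed
    finally show ?thesis by (simp add: hs_diff)
  qed
  have lin: "eps X0 (mat_scale c r) = mat_scale c (eps X0 r)" for X0 :: "('a, 'b) atom" and c r
    using linear_eps [of X0] by (simp add: linear_map_def)
  show ?thesis
  proof (intro iffI conjI ballI)
    assume s: "s \<in> interp (All_eq x x' \<phi>) xs X []"
    then show sX: "s \<in> functionals X" unfolding I by blast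
    fix X0 assume X0: "X0 \<in> snd x"
    then have dX0: "dual X0 \<in> snd x'" by (simp add: sorts in_dual_qset)
    let ?B = "atom_basis X0"
    have "eps X0 s \<in> Q X0 (dual X0)"
    proof (cases "?B = {}")
      case True
      then have "eps X0 s = 0" by (simp add: eps_def fun_eq_iff)
      then show ?thesis using Q(2) [OF X0 dX0] by (simp add: mat.subspace_0)
    next
      case False
      then obtain e where e: "e \<in> ?B" by blast
      define t where "t = (mat_unit [] [e] :: 'a mat)"
      define c where "c = (\<Sum>e\<in>?B. t [] [e] * t [] [e]) / of_nat (card ?B)"
      have "(\<Sum>e\<in>?B. t [] [e] * t [] [e]) = (\<Sum>e'\<in>?B. if e' = e then 1 else 0)"
        by (intro sum.cong) (auto simp: t_def mat_unit_def)
      then have c0: "c \<noteq> 0" using e fd [OF X0] by (auto simp: c_def)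
      have t: "t \<in> functionals [X0]" "t \<in> functionals [dual X0]"
        using e by (auto simp: t_def intro!: mat_unit_ops)
      let ?u = "mat_tensor 1 0 t (mat_tensor 1 0 t s)"
      have "?u \<in> interp (Impl E \<phi>) (x # x' # xs) (X0 # dual X0 # X) []" using s X0 dX0 t unfolding I by blast
      then obtain r where r: "r \<in> functionals X" "eps X0 r \<in> Q X0 (dual X0)"
        "\<forall>a\<in>functionals X. hs (X0 # dual X0 # X) [] (eps X0 a) (?u - eps X0 r) = 0"
        unfolding imp [OF X0 dX0] by blast
      have "eps X0 r = eps X0 (mat_scale c s)"
      proof (rule projection_unique [OF fX [OF X0], of "[]"])
        show "mat.subspace (eps X0 ` functionals X)" by (intro linear_map_subspace linear_eps subspace_ops)
        show "eps X0 ` functionals X \<subseteq> functionals (X0 # dual X0 # X)" using eps_functionals by blast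
        show "\<forall>a\<in>eps X0 ` functionals X. hs (X0 # dual X0 # X) [] a (?u - eps X0 (mat_scale c s)) = 0"
          using proj [where ?t0.0 = t and ?t1.0 = t, OF X0 c_def] by blast
      qed (use r sX in \<open>auto intro: mat.subspace_scale [OF subspace_ops]\<close>)
      then have "mat_scale c (eps X0 s) \<in> Q X0 (dual X0)" using r(2) by (simp add: lin)
      then have "mat_scale (1 / c) (mat_scale c (eps X0 s)) \<in> Q X0 (dual X0)"
        by (rule mat.subspace_scale [OF Q(2) [OF X0 dX0]])
      then show ?thesis using c0 by simp
    qed
    then show "eps X0 s \<in> interp \<phi> (x # x' # xs) (X0 # dual X0 # X) []" by (simp add: Q_def)
  next
    assume s: "s \<in> functionals X \<and> (\<forall>X0\<in>snd x. eps X0 s \<in> interp \<phi> (x # x' # xs) (X0 # dual X0 # X) [])"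
    then have sX: "s \<in> functionals X" by blast
    have "mat_tensor 1 0 t0 (mat_tensor 1 0 t1 s) \<in> interp (Impl E \<phi>) (x # x' # xs) (X0 # X1 # X) []"
      if X0: "X0 \<in> snd x" and X1: "X1 \<in> snd x'" and t: "t0 \<in> functionals [X0]" "t1 \<in> functionals [X1]" for X0 X1 t0 t1
      unfolding imp [OF X0 X1]
    proof (intro conjI impI)
      show "mat_tensor 1 0 t0 (mat_tensor 1 0 t1 s) \<in> functionals (X0 # X1 # X)"
        using t sX by (intro tensor_functionals)
      assume X1': "X1 = dual X0"
      define c where "c = (\<Sum>e\<in>atom_basis X0. t0 [] [e] * t1 [] [e]) / of_nat (card (atom_basis X0))"
      have "eps X0 s \<in> Q X0 X1" using s X0 by (simp add: Q_def X1')
      then have "eps X0 (mat_scale c s) \<in> Q X0 X1"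
        unfolding lin by (intro mat.subspace_scale Q X0 X1)
      then show "\<exists>r\<in>functionals X. eps X0 r \<in> Q X0 X1 \<and> (\<forall>a\<in>functionals X.
         hs (X0 # X1 # X) [] (eps X0 a) (mat_tensor 1 0 t0 (mat_tensor 1 0 t1 s) - eps X0 r) = 0)"
        using proj [where ?t0.0 = t0 and ?t1.0 = t1, OF X0 c_def] mat.subspace_scale [OF subspace_ops sX, of c]
        unfolding X1' by blast
    qed
    then show "s \<in> interp (All_eq x x' \<phi>) xs X []"
      unfolding I using sX t1 by blast
  qed
qed

text \<open>Dual to the universal quantifier, as \<open>contr\<close> is adjoint to tensoring with \<open>\<epsilon>\<close>.\<close>

lemma interp_Ex_eq:
  assumes dist: "distinct (x # x' # xs)" and sorts: "snd x' = dual_qset (snd x)" and fin: "fin_vars (x # x' # xs)"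
    and wf: "well_formed \<phi> (x # x' # xs)" and X: "X \<in> listset (map snd xs)"
  shows "interp (Ex_eq x x' \<phi>) xs X [] =
    mat.span (\<Union>X0\<in>snd x. contr X0 ` interp \<phi> (x # x' # xs) (X0 # dual X0 # X) [])"
proof -
  let ?C = "\<Union>X0\<in>snd x. contr X0 ` interp \<phi> (x # x' # xs) (X0 # dual X0 # X) []"
  have Xs: "X0 # dual X0 # X \<in> listset (map snd (x # x' # xs))" if "X0 \<in> snd x" for X0
    using X that sorts by (auto simp: listset_Cons in_dual_qset simp del: listset.simps)
  have sub: "interp \<phi> (x # x' # xs) (X0 # dual X0 # X) [] \<subseteq> functionals (X0 # dual X0 # X)" if "X0 \<in> snd x" for X0
    using binary_relation_rowsD(1) [OF wf Xs [OF that]] .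
  have finX: "fin_atoms X" using fin X by (intro fin_vars_atoms) auto
  have C: "?C \<subseteq> functionals X" using sub contr_functionals by blast
  have "interp (All_eq x x' (Neg \<phi>)) xs X [] = perp X [] ?C"
  proof (intro set_eqI)
    fix s
    have "eps X0 s \<in> interp (Neg \<phi>) (x # x' # xs) (X0 # dual X0 # X) [] \<longleftrightarrow>
        (\<forall>a\<in>interp \<phi> (x # x' # xs) (X0 # dual X0 # X) []. hs X [] (contr X0 a) s = 0)"
      if s: "s \<in> functionals X" and X0: "X0 \<in> snd x" for X0
    proof -
      have "finite (atom_basis X0)" using fin X0 by auto
      then show ?thesis
        unfolding interp_Neg [OF Xs [OF X0]] using eps_functionals [OF s] by (simp add: perp_def hs_eps)
    qed
    then show "s \<in> interp (All_eq x x' (Neg \<phi>)) xs X [] \<longleftrightarrow> s \<in> perp X [] ?C"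
      unfolding in_interp_All_eq [OF dist sorts fin well_formed_Neg X] by (auto simp: perp_def)
  qed
  then show ?thesis
    unfolding Ex_eq_def interp_Neg [OF X]
    using perp_perp [OF fin_atoms_basis [OF finX] _ C, of ] by simp
qed

section \<open>Atomic formulas with values in classical sorts\<close>

text \<open>The functional on \<open>X \<otimes> Y\<^sup>*\<close> that corresponds to an operator \<open>b : X \<rightarrow> Y\<close>.\<close>

definition flat :: "'v mat \<Rightarrow> 'v mat" where
  "flat b = (\<lambda>i j. if i = [] \<and> j \<noteq> [] then b [last j] (butlast j) else 0)"

lemma linear_flat: "linear_map flat" by (rule linear_mapI) (auto simp: flat_def mat_scale_def fun_eq_iff)

lemma flat_functionals:
  assumes "b \<in> ops X [y]"
  shows "flat b \<in> functionals (X @ [dual y])"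
  unfolding in_rows
proof (intro allI impI)
  fix i j assume "flat b i j \<noteq> 0"
  then have *: "i = []" "j \<noteq> []" "b [last j] (butlast j) \<noteq> 0" by (auto simp: flat_def split: if_splits)
  then have "[last j] \<in> basis [y]" "butlast j \<in> basis X" using assms unfolding ops_def by blast+
  then have "butlast j @ [last j] \<in> basis (X @ [dual y])"
    using basis_append [OF basis_length, of "butlast j" X "[last j]" "[dual y]"] by simp
  then show "i = [] \<and> j \<in> basis (X @ [dual y])" using * by simp
qed

lemma mat_mult_eval_tensor:
  assumes b: "b \<in> ops X [y]" and n: "length X = n" and fin: "finite (atom_basis y)"
  shows "mat_mult [y, dual y] (mat_eval y) (mat_tensor n 1 b (mat_one [dual y])) = flat b"
proof (intro ext)
  fix i j
  have fb: "flat b i j = 0" if "j \<notin> basis (X @ [dual y])"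
    using flat_functionals [OF b] that by (auto simp: in_rows)
  have "mat_mult [y, dual y] (mat_eval y) (mat_tensor n 1 b (mat_one [dual y])) i j =
    (\<Sum>u\<in>atom_basis y. \<Sum>v\<in>atom_basis y. if v = u then (if i = [] \<and> drop n j = [u] then b [u] (take n j) else 0) else 0)"
    unfolding mat_mult_def sum_basis_Cons atom_basis_dual
    by (intro sum.cong refl) (auto simp: mat_eval_def mat_tensor_def mat_one_def)
  also have "\<dots> = (\<Sum>u\<in>atom_basis y. if i = [] \<and> drop n j = [u] then b [u] (take n j) else 0)"
    using fin by simp
  also have "\<dots> = flat b i j"
  proof (cases "j \<in> basis (X @ [dual y])")
    case True
    define k where "k = butlast j"
    define e where "e = last j"
    have "j \<noteq> []" using True by (auto dest: basis_length)
    then have j: "j = k @ [e]" by (simp add: k_def e_def)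
    have k: "length k = n" using True n by (auto simp: j dest: basis_length)
    then have "e \<in> atom_basis y" using True n unfolding j by (subst (asm) basis_append) auto
    then show ?thesis using fin k by (cases "i = []") (auto simp: j flat_def eq_commute)
  next
    case False
    have "(if i = [] \<and> drop n j = [u] then b [u] (take n j) else 0) = 0" if "u \<in> atom_basis y" for u
    proof (rule ccontr)
      assume "(if i = [] \<and> drop n j = [u] then b [u] (take n j) else 0) \<noteq> 0"
      then have d: "drop n j = [u]" "b [u] (take n j) \<noteq> 0" by (auto split: if_splits)
      then have "take n j \<in> basis X" using b by (auto simp: ops_def)
      then have "take n j @ drop n j \<in> basis (X @ [dual y])"
        unfolding d(1) using that by (subst basis_append) (auto dest: basis_length)
      then show False using False by simp
    qed
    then show ?thesis using fb [OF False] by (simp add: sum.neutral)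
  qed
  finally show "mat_mult [y, dual y] (mat_eval y) (mat_tensor n 1 b (mat_one [dual y])) i j = flat b i j" .
qed

lemma binary_relation_ops:
  assumes "binary_relation \<X> [\<Y>] B" "X \<in> listset \<X>" "y \<in> \<Y>"
  shows "B X [y] \<subseteq> ops X [y]"
proof -
  have "[y] \<in> listset [\<Y>]" using assms(3) by (auto simp: set_Cons_def)
  then show ?thesis using assms(1,2) unfolding binary_relation_def by meson
qed

lemma linear_mat_mult: "linear_map (mat_mult Y s)" by (rule linear_mapI)
    (auto simp: mat_mult_def mat_scale_def fun_eq_iff algebra_simps sum.distrib sum_distrib_left)

lemma hat_eq:
  assumes B: "binary_relation \<X> [\<Y>] B" and fin: "\<And>y. y \<in> \<Y> \<Longrightarrow> finite (atom_basis y)"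
  shows "hat \<X> \<Y> B Z W = (if Z \<in> listset (\<X> @ [dual_qset \<Y>]) \<and> W = []
    then flat ` B (butlast Z) [dual (last Z)] else {0})"
    (is "_ = ?R")
proof -
  define n where "n = length \<X>"
  let ?I = "id_rel [dual_qset \<Y>]"
  have sub: "mat.subspace (B X [y])" for X y using B unfolding binary_relation_def by (metis mat.subspace_single_0)
  have R: "mat.subspace ?R" using linear_map_subspace [OF linear_flat sub] mat.subspace_single_0 by auto
  have "mat_mult Y s r \<in> ?R"
    if Y: "Y \<in> listset [\<Y>, dual_qset \<Y>]" and s: "s \<in> eq_rel \<Y> Y W" and r: "r \<in> prod_rel n 1 B ?I Z Y" for Y s r
  proof (cases "s = 0")
    case True
    then have "mat_mult Y s r = 0" by (simp add: mat_mult_def fun_eq_iff)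
    then show ?thesis using mat.subspace_0 [OF R] by simp
  next
    case False
    then obtain y where y: "y \<in> \<Y>" "Y = [y, dual y]" "W = []" using s by (auto simp: eq_rel_def split: if_splits)
    then obtain c where c: "s = mat_scale c (mat_eval y)"
      using s by (auto simp: eq_rel_def mat.span_singleton split: if_splits)
    have "mat_mult Y s (mat_tensor n 1 b k) \<in> ?R"
      if b: "b \<in> B (take n Z) [y]" and k: "k \<in> ?I (drop n Z) [dual y]" for b k
    proof (cases "b = 0 \<or> k = 0")
      case True
      then have "mat_tensor n 1 b k = 0" by (auto simp: mat_tensor_def fun_eq_iff)
      then have "mat_mult Y s (mat_tensor n 1 b k) = 0" using linear_map_0 [OF linear_mat_mult] by simp
      then show ?thesis using mat.subspace_0 [OF R] by (simp only:)
    next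
      case False
      then have d: "drop n Z = [dual y]" "take n Z \<in> listset \<X>"
        using b k B by (auto simp: id_rel_def binary_relation_def split: if_splits)
      then obtain d where d': "k = mat_scale d (mat_one [dual y])"
        using k by (auto simp: id_rel_def mat.span_singleton split: if_splits)
      have Z: "Z = take n Z @ [dual y]" using d(1) by (metis append_take_drop_id)
      have lt: "length (take n Z) = n" using d(2) by (simp add: listset_iff n_def)
      have "mat_tensor n 1 b k = mat_scale d (mat_tensor n 1 b (mat_one [dual y]))"
        unfolding d' using linear_mat_tensor [of n 1 b] by (simp add: linear_map_def)
      moreover have "mat_mult Y (mat_scale c u) (mat_scale d v) = mat_scale (c * d) (mat_mult Y u v)" for u v :: "'a mat"
        by (simp add: mat_mult_def mat_scale_def fun_eq_iff sum_distrib_left algebra_simps)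
      moreover have "b \<in> ops (take n Z) [y]" using binary_relation_ops [OF B d(2) y(1)] b by blast
      ultimately have m: "mat_mult Y s (mat_tensor n 1 b k) = mat_scale (c * d) (flat b)"
        using mat_mult_eval_tensor [OF _ lt fin [OF y(1)]] by (simp add: c y(2))
      have "Z \<in> listset (\<X> @ [dual_qset \<Y>])"
        using d(2) y(1) lt by (subst Z, subst listset_append) (auto simp: n_def in_dual_qset set_Cons_def)
      moreover have "flat b \<in> flat ` B (butlast Z) [dual (last Z)]"
      proof -
        have "butlast Z = take n Z" "last Z = dual y" using Z by (metis butlast_snoc, metis last_snoc)
        then show ?thesis using b by simp
      qed
      ultimately have "flat b \<in> ?R" using y(3) by simp
      then show ?thesis unfolding m by (intro mat.subspace_scale [OF R])
    qed
    then have "mat_mult Y s ` {mat_tensor n 1 b k | b k. b \<in> B (take n Z) (take 1 Y) \<and> k \<in> ?I (drop n Z) (drop 1 Y)} \<subseteq> ?R"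
      using y by auto
    then have "mat_mult Y s ` prod_rel n 1 B ?I Z Y \<subseteq> ?R"
      unfolding prod_rel_def linear_map_span [OF linear_mat_mult, symmetric]
      by (intro mat.span_minimal R) auto
    then show ?thesis using r by blast
  qed
  then have "hat \<X> \<Y> B Z W \<subseteq> ?R"
    unfolding hat_def comp_rel_def n_def by (intro mat.span_minimal R [unfolded n_def]) auto
  moreover have "?R \<subseteq> hat \<X> \<Y> B Z W"
  proof (cases "Z \<in> listset (\<X> @ [dual_qset \<Y>]) \<and> W = []")
    case True
    have "Z \<noteq> []" using True by (auto simp: listset_iff)
    then obtain X y where Z: "Z = X @ [dual y]" by (metis append_butlast_last_id dual_dual)
    have lX: "length X = n" using True by (simp add: Z n_def listset_iff)
    then have XY: "X \<in> listset \<X>" "y \<in> \<Y>"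
      using True unfolding Z by (auto simp: listset_append n_def in_dual_qset)
    have "flat b \<in> hat \<X> \<Y> B Z W" if b: "b \<in> B X [y]" for b
    proof -
      have "mat_tensor n 1 b (mat_one [dual y]) \<in> prod_rel n 1 B ?I Z [y, dual y]"
        unfolding prod_rel_def using b XY lX
        by (intro mat.span_base) (auto simp: Z id_rel_def set_Cons_def in_dual_qset intro: mat.span_base)
      moreover have "mat_eval y \<in> eq_rel \<Y> [y, dual y] W"
        using XY True by (auto simp: eq_rel_def intro: mat.span_base)
      moreover have "flat b = mat_mult [y, dual y] (mat_eval y) (mat_tensor n 1 b (mat_one [dual y]))"
        using b binary_relation_ops [OF B XY] XY by (intro mat_mult_eval_tensor [OF _ lX fin, symmetric]) auto
      moreover have "[y, dual y] \<in> listset [\<Y>, dual_qset \<Y>]"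
        using XY by (auto simp: set_Cons_def in_dual_qset)
      ultimately show ?thesis
        unfolding hat_def comp_rel_def n_def [symmetric] by (intro mat.span_base) blast
    qed
    then show ?thesis using True by (auto simp: Z)
  next
    case False
    then show ?thesis by (auto simp: hat_def comp_rel_def mat.span_zero)
  qed
  ultimately show ?thesis by blast
qed

lemma binary_relation_hat:
  assumes B: "binary_relation \<X> [\<Y>] B" and fin: "\<And>y. y \<in> \<Y> \<Longrightarrow> finite (atom_basis y)"
  shows "binary_relation (\<X> @ [dual_qset \<Y>]) [] (hat \<X> \<Y> B)"
  unfolding binary_relation_def
proof (intro allI)
  fix Z W :: "('a, 'b) atom list"
  have sub: "mat.subspace (B X [y])" for X y using B unfolding binary_relation_def by (metis mat.subspace_single_0)
  show "if Z \<in> listset (\<X> @ [dual_qset \<Y>]) \<and> W \<in> listset []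
        then hat \<X> \<Y> B Z W \<subseteq> ops Z W \<and> mat.subspace (hat \<X> \<Y> B Z W) else hat \<X> \<Y> B Z W = {0}"
  proof (cases "Z \<in> listset (\<X> @ [dual_qset \<Y>]) \<and> W = []")
    case True
    have "Z \<noteq> []" using True by (auto simp: listset_iff)
    then obtain X y where Z: "Z = X @ [dual y]" by (metis append_butlast_last_id dual_dual)
    have lX: "length X = length \<X>" using True by (simp add: Z listset_iff)
    then have XY: "X \<in> listset \<X>" "y \<in> \<Y>"
      using True unfolding Z by (auto simp: listset_append in_dual_qset)
    then have "B X [y] \<subseteq> ops X [y]" by (rule binary_relation_ops [OF B])
    then have "flat ` B X [y] \<subseteq> functionals Z" using flat_functionals unfolding Z by blast
    moreover have "hat \<X> \<Y> B Z W = flat ` B X [y]"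
      by (subst hat_eq [OF assms]) (use True in \<open>simp_all add: Z\<close>)
    ultimately show ?thesis using True linear_map_subspace [OF linear_flat sub, of X y] by simp
  qed (auto simp: hat_eq [OF assms])
qed

text \<open>Lists of atoms that can be dropped from a tensor product.\<close>

definition points :: "('v::complex_inner, 'p) atom list \<Rightarrow> bool" where
  "points c \<longleftrightarrow> (\<forall>x\<in>set c. atom_basis x = {None})"

lemma points_simps [simp]: "points []" "points (x # c) \<longleftrightarrow> atom_basis x = {None} \<and> points c"
  by (auto simp: points_def)

lemma basis_points: "points c \<Longrightarrow> basis (c @ X) = (\<lambda>j. replicate (length c) None @ j) ` basis X"
proof (induction c)
  case (Cons x c)
  then show ?case by (auto simp add: basis_Cons)
qed simp

lemma replicate_in_basis: "points c \<Longrightarrow> replicate (length c) None @ j \<in> basis (c @ X) \<longleftrightarrow> j \<in> basis X"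
  by (auto simp: basis_points)

definition strip :: "nat \<Rightarrow> 'v mat \<Rightarrow> 'v mat" where
  "strip n s = (\<lambda>i j. s i (replicate n None @ j))"

lemma linear_strip: "linear_map (strip n)" by (rule linear_mapI) (auto simp: strip_def mat_scale_def fun_eq_iff)

lemma strip_functionals: "points c \<Longrightarrow> length c = n \<Longrightarrow> s \<in> functionals (c @ X) \<Longrightarrow> strip n s \<in> functionals X"
  unfolding in_rows strip_def using replicate_in_basis by blast

lemma inj_on_strip: "points c \<Longrightarrow> length c = n \<Longrightarrow> inj_on (strip n) (functionals (c @ X))"
  by (rule inj_onI, rule rows_ext) (auto simp: basis_points strip_def fun_eq_iff)

lemma contr_point: "atom_basis x = {None} \<Longrightarrow> contr x s = strip 2 s"
  by (simp add: contr_def strip_def numeral_2_eq_2)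

lemma strip_strip: "strip m (strip n s) = strip (n + m) s" by (simp add: strip_def replicate_add)

text \<open>The value of a formula in the variables \<open>ys @ xs\<close> at the atoms \<open>c @ X\<close>, where the factors
  in \<open>c\<close> are one-dimensional and may thus be omitted.\<close>

definition sem :: "('v::complex_inner, 'p) form \<Rightarrow> ('v, 'p) var list \<Rightarrow> ('v, 'p) var list \<Rightarrow>
    ('v, 'p) atom list \<Rightarrow> ('v, 'p) atom list \<Rightarrow> 'v mat set" where
  "sem \<phi> ys xs c X = strip (length ys) ` interp \<phi> (ys @ xs) (c @ X) []"

definition context_at :: "('v::complex_inner, 'p) var list \<Rightarrow> ('v, 'p) var list \<Rightarrow>
    ('v, 'p) atom list \<Rightarrow> ('v, 'p) atom list \<Rightarrow> bool" where
  "context_at ys xs c X \<longleftrightarrow> distinct (ys @ xs) \<and> fin_vars (ys @ xs) \<and>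
     c \<in> listset (map snd ys) \<and> X \<in> listset (map snd xs) \<and> points c"

lemma context_atD:
  assumes "context_at ys xs c X"
  shows "distinct (ys @ xs)" "fin_vars (ys @ xs)" "length c = length ys" "length X = length xs"
    "points c" "c @ X \<in> listset (map snd (ys @ xs))"
    "c \<in> listset (map snd ys)" "X \<in> listset (map snd xs)"
proof -
  show len: "length c = length ys" "length X = length xs" using assms by (auto simp: context_at_def listset_iff)
  show "c @ X \<in> listset (map snd (ys @ xs))" using assms len by (simp add: context_at_def listset_append)
qed (use assms in \<open>auto simp: context_at_def\<close>)

lemma context_at_Cons2:
  "context_at (y # y' # ys) xs (Y # Y' # c) X \<longleftrightarrow> context_at ys xs c X \<and> y \<noteq> y' \<and> y \<notin> set (ys @ xs) \<and> y' \<notin> set (ys @ xs) \<and>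
     (\<forall>a\<in>snd y \<union> snd y'. finite (atom_basis a)) \<and> Y \<in> snd y \<and> Y' \<in> snd y' \<and> atom_basis Y = {None} \<and> atom_basis Y' = {None}"
  by (auto simp: context_at_def listset_Cons simp del: listset.simps)

lemma sem_subspace:
  assumes "context_at ys xs c X" "well_formed \<phi> (ys @ xs)"
  shows "sem \<phi> ys xs c X \<subseteq> functionals X" "mat.subspace (sem \<phi> ys xs c X)"
  unfolding sem_def
  using binary_relation_rowsD [OF assms(2) context_atD(6) [OF assms(1)]] context_atD [OF assms(1)]
  by (auto intro: strip_functionals linear_map_subspace [OF linear_strip])

lemma sem_Conj:
  assumes "context_at ys xs c X" "well_formed \<phi> (ys @ xs)" "well_formed \<psi> (ys @ xs)"
  shows "sem (Conj \<phi> \<psi>) ys xs c X = sem \<phi> ys xs c X \<inter> sem \<psi> ys xs c X"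
proof -
  note D = context_atD [OF assms(1)]
  show ?thesis using inj_on_image_Int [OF inj_on_strip [OF D(5,3)],
        of "interp \<phi> (ys @ xs) (c @ X) []" X "interp \<psi> (ys @ xs) (c @ X) []"]
      binary_relation_rowsD(1) [OF assms(2) D(6)] binary_relation_rowsD(1) [OF assms(3) D(6)]
    by (simp add: sem_def)
qed

lemma sem_Ex_eq:
  assumes ctx: "context_at ys xs c X" and dist: "distinct (y # y' # ys @ xs)"
    and sorts: "snd y' = dual_qset (snd y)" "\<And>a. a \<in> snd y \<Longrightarrow> atom_basis a = {None}"
    and wf: "well_formed \<phi> (y # y' # ys @ xs)"
  shows "sem (Ex_eq y y' \<phi>) ys xs c X =
    mat.span (\<Union>Y\<in>snd y. sem \<phi> (y # y' # ys) xs (Y # dual Y # c) X)"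
proof -
  note D = context_atD [OF ctx]
  have fin: "fin_vars (y # y' # ys @ xs)"
    using sorts D(2) by (auto simp: in_dual_qset) (metis atom_basis_dual finite.emptyI finite_insert)+
  have "sem (Ex_eq y y' \<phi>) ys xs c X =
    mat.span (strip (length ys) ` (\<Union>Y\<in>snd y. contr Y ` interp \<phi> (y # y' # ys @ xs) (Y # dual Y # c @ X) []))"
    unfolding sem_def linear_map_span [OF linear_strip]
    by (subst interp_Ex_eq [OF dist sorts(1) fin wf D(6)]) simp
  also have "strip (length ys) ` (\<Union>Y\<in>snd y. contr Y ` interp \<phi> (y # y' # ys @ xs) (Y # dual Y # c @ X) []) =
    (\<Union>Y\<in>snd y. sem \<phi> (y # y' # ys) xs (Y # dual Y # c) X)"
    unfolding image_UN sem_def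
    by (intro SUP_cong refl) (simp add: contr_point [OF sorts(2)] image_image strip_strip)
  finally show ?thesis .
qed

lemma pos_append:
  assumes "set vs \<inter> set ys = {}" "set ws \<subseteq> set ys"
  shows "pos (vs @ ws) (ys @ xs) = map ((+) (length ys)) (pos vs xs) @ pos ws ys"
proof -
  have "takeWhile (\<lambda>x. x \<noteq> v) (ys @ xs) = ys @ takeWhile (\<lambda>x. x \<noteq> v) xs" if "v \<in> set vs" for v
    using assms(1) that by (subst takeWhile_append2) auto
  moreover have "takeWhile (\<lambda>x. x \<noteq> v) (ys @ xs) = takeWhile (\<lambda>x. x \<noteq> v) ys" if "v \<in> set ws" for v
    using assms(2) that by (subst takeWhile_append1 [of v]) auto
  ultimately show ?thesis by (simp add: pos_def)
qed

lemma permute_shift: "length c = n \<Longrightarrow> permute (map ((+) n) p) (c @ X) = permute p X"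
  by (simp add: permute_def nth_append)

lemma permute_prefix: "\<forall>k\<in>set p. k < length c \<Longrightarrow> permute p (c @ X) = permute p c"
  by (simp add: permute_def nth_append)

lemma permute_replicate: "\<forall>k\<in>set p. k < n \<Longrightarrow> permute p (replicate n a) = replicate (length p) a"
  by (induction p) (auto simp: permute_def)

definition restrict_points :: "nat \<Rightarrow> 'v mat \<Rightarrow> 'v mat" where
  "restrict_points m r = (\<lambda>i j. if i = [] then r [] (j @ replicate m None) else 0)"

lemma strip_lift:
  assumes c: "points c" "length c = n" and q: "\<forall>k\<in>set q. k < n"
  shows "strip n ` lift (map ((+) n) p @ q) U (c @ X) = lift p (restrict_points (length q) ` U) X"
proof -
  let ?p = "map ((+) n) p @ q"
  let ?N = "replicate n None :: 'a option list"
  have perm: "permute ?p (?N @ j) = permute p j @ replicate (length q) None" for j :: "'a option list"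
    using q by (simp add: permute_append permute_shift permute_prefix permute_replicate)
  have inN: "?N @ j \<in> basis (c @ X) \<longleftrightarrow> j \<in> basis X" for j
    using replicate_in_basis [OF c(1)] c(2) by simp
  have agree: "(\<forall>i<length (c @ X). i \<notin> set ?p \<longrightarrow> (?N @ j) ! i = (?N @ k) ! i) \<longleftrightarrow>
      agree_off p X j k" for j k
  proof (intro iffI allI impI)
    fix i assume a: "\<forall>i<length (c @ X). i \<notin> set ?p \<longrightarrow> (?N @ j) ! i = (?N @ k) ! i" "i < length X" "i \<notin> set p"
    have "n + i \<notin> set ?p" using q a(3) by auto
    then have "(?N @ j) ! (n + i) = (?N @ k) ! (n + i)" using a(1,2) c(2) by simp
    then show "j ! i = k ! i" by (simp add: nth_append)
  next
    fix i assume a: "agree_off p X j k" "i < length (c @ X)" "i \<notin> set ?p"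
    show "(?N @ j) ! i = (?N @ k) ! i"
    proof (cases "i < n")
      case False
      then have "i - n < length X" "i - n \<notin> set p" using a c(2) by force+
      then show ?thesis using a(1) False by (simp add: nth_append)
    qed (simp add: nth_append)
  qed
  show ?thesis
  proof (intro subset_antisym subsetI)
    fix t assume "t \<in> strip n ` lift ?p U (c @ X)"
    then obtain s where s: "s \<in> lift ?p U (c @ X)" "t = strip n s" by blast
    have "\<exists>r\<in>restrict_points (length q) ` U. \<forall>j\<in>basis X. agree_off p X j k \<longrightarrow> t [] j = r [] (permute p j)"
      if k: "k \<in> basis X" for k
    proof -
      from k have "?N @ k \<in> basis (c @ X)" by (simp add: inN)
      from liftD [OF s(1) this] obtain r where r: "r \<in> U" "\<forall>j\<in>basis (c @ X).
          (\<forall>i<length (c @ X). i \<notin> set ?p \<longrightarrow> j ! i = (?N @ k) ! i) \<longrightarrow> s [] j = r [] (permute ?p j)" by blast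
      have "t [] j = restrict_points (length q) r [] (permute p j)"
        if "j \<in> basis X" "agree_off p X j k" for j using r(2) [rule_format, of "?N @ j"] that agree [of j k]
        by (simp add: s(2) strip_def inN restrict_points_def perm del: set_append)
      then show ?thesis using r(1) by blast
    qed
    moreover have "t \<in> functionals X" using s c by (auto simp: lift_def intro: strip_functionals)
    ultimately show "t \<in> lift p (restrict_points (length q) ` U) X"
      unfolding lift_def by blast
  next
    fix t assume t: "t \<in> lift p (restrict_points (length q) ` U) X"
    define s where "s = (\<lambda>i j. if j \<in> basis (c @ X) then t i (drop n j) else 0)"
    have tX: "t \<in> functionals X" using t by (simp add: lift_def)
    have "s \<in> functionals (c @ X)" using tX by (auto simp: s_def in_rows split: if_splits)
    moreover have "\<exists>r\<in>U. \<forall>j\<in>basis (c @ X). (\<forall>i<length (c @ X). i \<notin> set ?p \<longrightarrow> j ! i = k ! i) \<longrightarrow> s [] j = r [] (permute ?p j)"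
      if k: "k \<in> basis (c @ X)" for k
    proof -
      obtain k' where k': "k = ?N @ k'" "k' \<in> basis X" using k c basis_points [OF c(1)] by auto
      from liftD [OF t k'(2)] obtain r where r: "r \<in> U" "\<forall>j\<in>basis X. agree_off p X j k' \<longrightarrow>
          t [] j = restrict_points (length q) r [] (permute p j)" by blast
      have "s [] j = r [] (permute ?p j)"
        if j: "j \<in> basis (c @ X)" "\<forall>i<length (c @ X). i \<notin> set ?p \<longrightarrow> j ! i = k ! i" for j
      proof -
        obtain j' where j': "j = ?N @ j'" "j' \<in> basis X" using j(1) c basis_points [OF c(1)] by auto
        have "s [] j = t [] j'" using j(1) by (simp add: s_def j')
        also have "\<dots> = restrict_points (length q) r [] (permute p j')"
          using r(2) j'(2) j(2) agree [of j' k'] unfolding j'(1) k'(1) by blast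
        finally show ?thesis by (simp add: restrict_points_def j'(1) perm)
      qed
      then show ?thesis using r(1) by blast
    qed
    ultimately have "s \<in> lift ?p U (c @ X)" unfolding lift_def by blast
    moreover have "t = strip n s" using tX by (auto simp: strip_def s_def inN in_rows fun_eq_iff)
    ultimately show "t \<in> strip n ` lift ?p U (c @ X)" by blast
  qed
qed

lemma sem_Rel:
  assumes ctx: "context_at ys xs c X" and vs: "set vs \<subseteq> set xs" "set ws \<subseteq> set ys"
    and R: "binary_relation (map snd (vs @ ws)) [] R"
  shows "sem (Rel R (vs @ ws)) ys xs c X = lift (pos vs xs)
    (restrict_points (length ws) ` R (permute (pos vs xs) X @ permute (pos ws ys) c) []) X"
proof -
  note D = context_atD [OF ctx]
  have dist: "set vs \<inter> set ys = {}" using D(1) vs by auto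
  have len: "length (pos ws ys) = length ws" by (simp add: pos_def)
  have q: "\<forall>k\<in>set (pos ws ys). k < length ys" using vs(2) index_less by (fastforce simp: pos_def)
  have "interp (Rel R (vs @ ws)) (ys @ xs) (c @ X) [] =
    lift (pos (vs @ ws) (ys @ xs)) (R (permute (pos (vs @ ws) (ys @ xs)) (c @ X)) []) (c @ X)"
    unfolding interp.simps
    by (rule interp_rel_lift [OF D(1) _ R D(6) fin_vars_atoms [OF D(2,6)]]) (use vs in auto)
  then show ?thesis
    unfolding sem_def pos_append [OF dist vs(2)] using q D(3)
    by (simp add: strip_lift [OF D(5,3)] len permute_append permute_shift permute_prefix)
qed

lemma lift_Nil:
  assumes C: "points C" "length C = m" and U: "mat.subspace U" "U \<subseteq> functionals C"
  shows "lift [] (restrict_points m ` U) X = (if U = {0} then {0} else functionals X)"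
proof (cases "U = {0}")
  case True
  have "restrict_points m (0 :: 'a mat) = 0" by (simp add: restrict_points_def fun_eq_iff)
  then show ?thesis using True by (simp add: lift_zero)
next
  case False
  then obtain r where r: "r \<in> U" "r \<noteq> 0" using mat.subspace_0 [OF U(1)] by blast
  have "basis C = {replicate m None}" using basis_points [OF C(1), of "[]"] C(2) by simp
  then have r0: "r [] (replicate m None) \<noteq> 0"
    using rows_ext [of r C 0] r U(2) mat.subspace_0 [OF subspace_ops, of C "[]"] by auto
  have "s \<in> lift [] (restrict_points m ` U) X" if s: "s \<in> functionals X" for s
    unfolding lift_def
  proof (intro CollectI conjI ballI)
    fix k assume k: "k \<in> basis X"
    let ?r = "mat_scale (s [] k / r [] (replicate m None)) r"
    have "?r \<in> U" by (intro mat.subspace_scale U r)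
    moreover have "s [] j = restrict_points m ?r [] (permute [] j)"
      if "j \<in> basis X" "\<forall>i<length X. i \<notin> set [] \<longrightarrow> j ! i = k ! i" for j
    proof -
      have "j = k" using that k by (intro nth_equalityI) (auto simp: basis_iff)
      then show ?thesis using r0 by (simp add: restrict_points_def mat_scale_def permute_def)
    qed
    ultimately show "\<exists>r\<in>restrict_points m ` U. \<forall>j\<in>basis X.
        (\<forall>i<length X. i \<notin> set [] \<longrightarrow> j ! i = k ! i) \<longrightarrow> s [] j = r [] (permute [] j)"
      by blast
  qed (rule s)
  then have "lift [] (restrict_points m ` U) X = functionals X" by (intro subset_antisym lift_rows) blast
  then show ?thesis using False by simp
qed

lemma sem_Rel_points:
  assumes ctx: "context_at ys xs c X" and ws: "set ws \<subseteq> set ys" and R: "binary_relation (map snd ws) [] R"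
  shows "sem (Rel R ws) ys xs c X = (if R (permute (pos ws ys) c) [] = {0} then {0} else functionals X)"
proof -
  note D = context_atD [OF ctx]
  let ?C = "permute (pos ws ys) c"
  have q: "\<forall>k\<in>set (pos ws ys). k < length ys" using ws index_less by (fastforce simp: pos_def)
  have len: "length (pos ws ys) = length ws" by (simp add: pos_def)
  have C: "points ?C" using D(3,5) q by (auto simp: points_def permute_def)
  have "?C \<in> listset (map snd ws)" using permute_listset [OF D(7), of "pos ws ys"] q permute_pos [OF ws] by simp
  then have U: "mat.subspace (R ?C [])" "R ?C [] \<subseteq> functionals ?C"
    using binary_relation_rowsD [OF R] by blast+
  have "sem (Rel R ([] @ ws)) ys xs c X = lift [] (restrict_points (length ws) ` R ?C []) X"
    by (subst sem_Rel [OF ctx]) (use ws R in \<open>simp_all add: pos_def permute_def\<close>)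
  also have "\<dots> = (if R ?C [] = {0} then {0} else functionals X)" by (rule lift_Nil [OF C _ U]) (simp add: len)
  finally show ?thesis by simp
qed

definition at_point :: "'v mat \<Rightarrow> 'v mat" where
  "at_point b = (\<lambda>i j. if i = [] then b [None] j else 0)"

abbreviation fiber :: "(('v::complex_inner, ennreal) atom list \<Rightarrow> ('v, ennreal) atom list \<Rightarrow> 'v mat set) \<Rightarrow>
    ('v, ennreal) atom \<Rightarrow> ('v, ennreal) atom \<Rightarrow> ennreal \<Rightarrow> 'v mat set" where
  "fiber F x y \<alpha> \<equiv> at_point ` F [x, dual y] [pt \<alpha>]"

lemma sem_Rel_hat:
  assumes ctx: "context_at ys xs c X" and vs: "set vs \<subseteq> set xs" and y: "y \<in> set ys" "snd y = dual_qset \<Y>"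
    and B: "binary_relation (map snd vs) [\<Y>] B" and fin: "\<And>y. y \<in> \<Y> \<Longrightarrow> finite (atom_basis y)"
    and p: "permute (pos [y] ys) c = [Y]"
  shows "sem (Rel (hat (map snd vs) \<Y> B) (vs @ [y])) ys xs c X =
    lift (pos vs xs) (at_point ` B (permute (pos vs xs) X) [dual Y]) X"
proof -
  note D = context_atD [OF ctx]
  have R: "binary_relation (map snd (vs @ [y])) [] (hat (map snd vs) \<Y> B)"
    using binary_relation_hat [OF B fin] y(2) by simp
  have "permute (pos vs xs) X \<in> listset (map snd vs)"
    using permute_listset [OF D(8), of "pos vs xs"] set_pos [OF _ vs] D(1) permute_pos [OF vs] by simp
  moreover have "[Y] \<in> listset (map snd [y])"
    using permute_listset [OF D(7), of "pos [y] ys"] set_pos [of ys "[y]"] D(1) permute_pos [of "[y]" ys] y p by simp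
  ultimately have "permute (pos vs xs) X @ [Y] \<in> listset (map snd vs @ [dual_qset \<Y>])"
    using y(2) by (subst listset_append) (auto simp: pos_def)
  then have "hat (map snd vs) \<Y> B (permute (pos vs xs) X @ [Y]) [] = flat ` B (permute (pos vs xs) X) [dual Y]"
    by (simp add: hat_eq [OF B fin])
  moreover have "restrict_points (Suc 0) (flat b) = at_point b" for b :: "'a mat"
    by (simp add: restrict_points_def flat_def at_point_def fun_eq_iff)
  ultimately show ?thesis using sem_Rel [OF ctx vs _ R] y(1) p by (simp add: image_image)
qed

definition arg_form :: "nat list \<Rightarrow> ('v::complex_inner, 'p) trm \<Rightarrow> ('v, 'p) var \<Rightarrow> ('v, 'p) form" where
  "arg_form q t y' = (case t of Var v \<Rightarrow> Rel (eq_rel (snd v)) [v, y']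
     | Fn F \<X> \<Y> ss \<Rightarrow> atomic q (hat \<X> \<Y> F) (ss @ [Var y']))"

definition new_var :: "nat \<Rightarrow> nat list \<Rightarrow> ('v, 'p) trm \<Rightarrow> ('v, 'p) var" where
  "new_var i p t = (New (i # p), sort_of t)"

definition new_star :: "nat \<Rightarrow> nat list \<Rightarrow> ('v, 'p) trm \<Rightarrow> ('v, 'p) var" where
  "new_star i p t = (New_star (i # p), dual_qset (sort_of t))"

lemma atomic_Vars: "atomic p R (map Var vs) = Rel R vs"
proof -
  have "map the_Var (map Var vs) = vs" by (induction vs) auto
  then show ?thesis by (subst atomic.simps) auto
qed

lemma atomic2:
  assumes "\<not> (is_Var t0 \<and> is_Var t1)"
  shows "atomic p R [t0, t1] = Ex_eq (new_var 1 p t1) (new_star 1 p t1) (Ex_eq (new_var 0 p t0) (new_star 0 p t0)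
    (Conj (Conj (Rel R [new_var 0 p t0, new_var 1 p t1]) (arg_form (0 # p) t0 (new_star 0 p t0)))
      (arg_form (1 # p) t1 (new_star 1 p t1))))"
  using assms by (subst atomic.simps) (auto simp: Let_def arg_form_def new_var_def new_star_def cong: trm.case_cong)

lemma atomic3:
  assumes "\<not> is_Var t0"
  shows "atomic p R [t0, t1, t2] = Ex_eq (new_var 2 p t2) (new_star 2 p t2) (Ex_eq (new_var 1 p t1) (new_star 1 p t1)
    (Ex_eq (new_var 0 p t0) (new_star 0 p t0)
    (Conj (Conj (Conj (Rel R [new_var 0 p t0, new_var 1 p t1, new_var 2 p t2]) (arg_form (0 # p) t0 (new_star 0 p t0)))
      (arg_form (1 # p) t1 (new_star 1 p t1))) (arg_form (2 # p) t2 (new_star 2 p t2)))))" using assms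
  by (subst atomic.simps) (simp add: Let_def arg_form_def new_var_def new_star_def numeral_2_eq_2 cong: trm.case_cong)

definition has_value :: "('v::complex_inner, 'p) form \<Rightarrow> ('v, 'p) var list \<Rightarrow> ('v, 'p) var list \<Rightarrow>
    ('v, 'p) atom list \<Rightarrow> ('v, 'p) atom list \<Rightarrow> 'v mat set \<Rightarrow> bool" where
  "has_value \<phi> ys xs c X T \<longleftrightarrow> well_formed \<phi> (ys @ xs) \<and> sem \<phi> ys xs c X = T"

lemma has_value_subspace:
  assumes "context_at ys xs c X" "has_value \<phi> ys xs c X T"
  shows "mat.subspace T" "T \<subseteq> functionals X"
  using sem_subspace [OF assms(1)] assms(2) by (auto simp: has_value_def)

lemma has_value_Conj:
  "context_at ys xs c X \<Longrightarrow> has_value \<phi> ys xs c X T \<Longrightarrow> has_value \<psi> ys xs c X T' \<Longrightarrow>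
    has_value (Conj \<phi> \<psi>) ys xs c X (T \<inter> T')"
  unfolding has_value_def by (metis sem_Conj well_formed_Conj)

text \<open>At one-dimensional atoms contraction only drops two factors, so that an existential quantifier
  over such a sort is the span of the values at its atoms.\<close>

lemma has_value_Ex_eq:
  assumes ctx: "context_at ys xs c X" and fresh: "y \<noteq> y'" "y \<notin> set (ys @ xs)" "y' \<notin> set (ys @ xs)"
    and sorts: "snd y = range f" "snd y' = dual_qset (range f)" "\<And>\<alpha>. atom_basis (f \<alpha>) = {None}"
    and val: "\<And>\<alpha>. context_at (y # y' # ys) xs (f \<alpha> # dual (f \<alpha>) # c) X \<Longrightarrow>
      has_value \<phi> (y # y' # ys) xs (f \<alpha> # dual (f \<alpha>) # c) X (T \<alpha>)"
  shows "has_value (Ex_eq y y' \<phi>) ys xs c X (mat.span (\<Union>\<alpha>. T \<alpha>))"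
proof -
  have fin: "\<forall>a\<in>snd y \<union> snd y'. finite (atom_basis a)"
    unfolding sorts dual_qset_def by (auto simp: sorts(3))
  have ctx': "context_at (y # y' # ys) xs (f \<alpha> # dual (f \<alpha>) # c) X" for \<alpha>
    unfolding context_at_Cons2 using ctx fresh fin sorts by (simp add: dual_qset_def)
  note val = val [OF ctx']
  have "sem (Ex_eq y y' \<phi>) ys xs c X =
      mat.span (\<Union>Y\<in>snd y. sem \<phi> (y # y' # ys) xs (Y # dual Y # c) X)"
    using val fresh ctx sorts by (intro sem_Ex_eq ctx) (auto simp: has_value_def context_at_def)
  also have "(\<Union>Y\<in>snd y. sem \<phi> (y # y' # ys) xs (Y # dual Y # c) X) = (\<Union>\<alpha>. T \<alpha>)"
    using val by (auto simp: has_value_def sorts(1))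
  finally show ?thesis using well_formed_Ex_eq unfolding has_value_def by blast
qed

lemma span_UN_span: "mat.span (\<Union>i\<in>I. mat.span (S i)) = mat.span (\<Union>i\<in>I. S i)"
proof (rule subset_antisym)
  show "mat.span (\<Union>i\<in>I. mat.span (S i)) \<subseteq> mat.span (\<Union>i\<in>I. S i)"
    by (intro mat.span_minimal mat.subspace_span UN_least mat.span_mono) blast
  show "mat.span (\<Union>i\<in>I. S i) \<subseteq> mat.span (\<Union>i\<in>I. mat.span (S i))"
    by (intro mat.span_mono UN_mono mat.span_superset) simp
qed

lemma span_UN_if:
  assumes "\<And>i. i \<in> I \<Longrightarrow> 0 \<in> S i"
  shows "mat.span (\<Union>i\<in>I. (if P i then {0} else functionals X) \<inter> S i) =
    mat.span (\<Union>i\<in>{i\<in>I. \<not> P i}. functionals X \<inter> S i)"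
proof -
  have "mat.span (\<Union>i\<in>I. (if P i then {0} else functionals X) \<inter> S i) =
    mat.span (insert 0 (\<Union>i\<in>I. (if P i then {0} else functionals X) \<inter> S i))"
    by (simp add: mat.span_insert_0)
  also have "insert 0 (\<Union>i\<in>I. (if P i then {0} else functionals X) \<inter> S i) =
    insert 0 (\<Union>i\<in>{i\<in>I. \<not> P i}. functionals X \<inter> S i)" by (auto split: if_splits)
  finally show ?thesis by (simp add: mat.span_insert_0)
qed

lemma has_value_Rel_points:
  assumes ctx: "context_at ys xs c X" and ws: "set ws \<subseteq> set ys" and R: "binary_relation (map snd ws) [] R"
  shows "has_value (Rel R ws) ys xs c X (if R (permute (pos ws ys) c) [] = {0} then {0} else functionals X)"
proof -
  have "well_formed (Rel R ws) (ys @ xs)" using ctx ws R by (intro well_formed_Rel) (auto simp: context_at_def)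
  then show ?thesis
    unfolding has_value_def using sem_Rel_points [OF assms] by blast
qed

lemma has_value_Rel_hat:
  assumes ctx: "context_at ys xs c X" and vs: "set vs \<subseteq> set xs" and y: "y \<in> set ys" "snd y = dual_qset \<Y>"
    and B: "binary_relation (map snd vs) [\<Y>] B" and fin: "\<And>y. y \<in> \<Y> \<Longrightarrow> finite (atom_basis y)"
    and p: "permute (pos [y] ys) c = [Y]"
  shows "has_value (Rel (hat (map snd vs) \<Y> B) (vs @ [y])) ys xs c X
    (lift (pos vs xs) (at_point ` B (permute (pos vs xs) X) [dual Y]) X)"
proof -
  have "binary_relation (map snd (vs @ [y])) [] (hat (map snd vs) \<Y> B)"
    using binary_relation_hat [OF B fin] y(2) by simp
  then have "well_formed (Rel (hat (map snd vs) \<Y> B) (vs @ [y])) (ys @ xs)"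
    using ctx vs y by (intro well_formed_Rel) (auto simp: context_at_def)
  then show ?thesis
    unfolding has_value_def using sem_Rel_hat [OF assms] by blast
qed

definition fresh :: "nat list \<Rightarrow> ('v, 'p) var list \<Rightarrow> bool" where
  "fresh p xs \<longleftrightarrow> (\<forall>i. New (i # p) \<notin> fst ` set xs \<and> New_star (i # p) \<notin> fst ` set xs)"

lemma new_var_notin [simp]: "fresh p xs \<Longrightarrow> new_var i p t \<notin> set xs" "fresh p xs \<Longrightarrow> new_star i p t \<notin> set xs"
  unfolding fresh_def new_var_def new_star_def image_iff by (metis fst_conv)+

lemma fst_new_var [simp]: "fst (new_var i p t) = New (i # p)" "fst (new_star i p t) = New_star (i # p)"
  "snd (new_var i p t) = sort_of t" "snd (new_star i p t) = dual_qset (sort_of t)"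
  by (simp_all add: new_var_def new_star_def)

lemma new_var_eq [simp]: "new_var i p t \<noteq> new_star i' p' t'" "new_star i' p' t' \<noteq> new_var i p t"
  "i \<noteq> i' \<Longrightarrow> new_var i p t \<noteq> new_var i' p' t'" "i \<noteq> i' \<Longrightarrow> new_star i p t \<noteq> new_star i' p' t'"
  by (auto simp: new_var_def new_star_def)

text \<open>All terms have values in sorts with one-dimensional atoms, at which \<open>R\<close> is either zero or everything.
  The existential quantifiers that the atomic formula abbreviates therefore amount to a span over the
  atoms at which \<open>R\<close> is not zero.\<close>

lemma has_value_atomic2:
  assumes ctx: "context_at ys xs c X" and nv: "\<not> (is_Var t0 \<and> is_Var t1)" and fresh: "fresh p (ys @ xs)"
    and sorts: "sort_of t0 = range f0" "sort_of t1 = range f1"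
      "\<And>\<alpha>. atom_basis (f0 \<alpha>) = {None}" "\<And>\<beta>. atom_basis (f1 \<beta>) = {None}"
    and R: "binary_relation [range f0, range f1] [] R"
    and ys': "ys' = new_var 0 p t0 # new_star 0 p t0 # new_var 1 p t1 # new_star 1 p t1 # ys"
    and c': "\<And>\<alpha> \<beta>. c' \<alpha> \<beta> = f0 \<alpha> # dual (f0 \<alpha>) # f1 \<beta> # dual (f1 \<beta>) # c"
    and T0: "\<And>\<alpha> \<beta>. context_at ys' xs (c' \<alpha> \<beta>) X \<Longrightarrow>
      has_value (arg_form (0 # p) t0 (new_star 0 p t0)) ys' xs (c' \<alpha> \<beta>) X (T0 \<alpha>)"
    and T1: "\<And>\<alpha> \<beta>. context_at ys' xs (c' \<alpha> \<beta>) X \<Longrightarrow>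
      has_value (arg_form (1 # p) t1 (new_star 1 p t1)) ys' xs (c' \<alpha> \<beta>) X (T1 \<beta>)"
  shows "has_value (atomic p R [t0, t1]) ys xs c X
    (mat.span (\<Union>(\<beta>, \<alpha>)\<in>{(\<beta>, \<alpha>). R [f0 \<alpha>, f1 \<beta>] [] \<noteq> {0}}. T0 \<alpha> \<inter> T1 \<beta>))"
proof -
  let ?K = "\<lambda>\<alpha> \<beta>. (if R [f0 \<alpha>, f1 \<beta>] [] = {0} then {0} else functionals X) \<inter> T0 \<alpha> \<inter> T1 \<beta>"
  have fresh': "fresh p ys" "fresh p xs" using fresh by (auto simp: fresh_def)
  have p: "pos [new_var 0 p t0, new_var 1 p t1] ys' = [0, 2]" by (simp add: ys' pos_def)
  have ctx': "context_at ys' xs (c' \<alpha> \<beta>) X" for \<alpha> \<beta>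
    unfolding ys' c' context_at_Cons2
    using ctx fresh' sorts by (auto simp: dual_qset_def)
  have "has_value (atomic p R [t0, t1]) ys xs c X (mat.span (\<Union>\<beta>. mat.span (\<Union>\<alpha>. ?K \<alpha> \<beta>)))"
    unfolding atomic2 [OF nv]
  proof (intro has_value_Ex_eq [where f = f1] has_value_Ex_eq [where f = f0])
    fix \<alpha> \<beta>
    have "has_value (Rel R [new_var 0 p t0, new_var 1 p t1]) ys' xs (c' \<alpha> \<beta>) X
      (if R (permute [0, 2] (c' \<alpha> \<beta>)) [] = {0} then {0} else functionals X)"
      unfolding p [symmetric] using ctx' R sorts by (intro has_value_Rel_points) (auto simp: ys')
    then have "has_value (Conj (Conj (Rel R [new_var 0 p t0, new_var 1 p t1]) (arg_form (0 # p) t0 (new_star 0 p t0)))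
        (arg_form (1 # p) t1 (new_star 1 p t1))) ys' xs (c' \<alpha> \<beta>) X (?K \<alpha> \<beta>)"
      using T0 T1 ctx' by (intro has_value_Conj) (auto simp: c' permute_def)
    then show "has_value (Conj (Conj (Rel R [new_var 0 p t0, new_var 1 p t1]) (arg_form (0 # p) t0 (new_star 0 p t0)))
        (arg_form (1 # p) t1 (new_star 1 p t1)))
        (new_var 0 p t0 # new_star 0 p t0 # new_var 1 p t1 # new_star 1 p t1 # ys) xs
        (f0 \<alpha> # dual (f0 \<alpha>) # f1 \<beta> # dual (f1 \<beta>) # c) X (?K \<alpha> \<beta>)"
      by (simp add: ys' c')
  qed (use ctx fresh' sorts in auto)
  moreover have sub: "T0 \<alpha> \<subseteq> functionals X" "0 \<in> T0 \<alpha>" "0 \<in> T1 \<beta>" for \<alpha> \<beta>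
    using has_value_subspace [OF ctx' T0 [OF ctx']] has_value_subspace [OF ctx' T1 [OF ctx']]
    by (auto intro: mat.subspace_0)
  have "mat.span (\<Union>\<beta>. mat.span (\<Union>\<alpha>. ?K \<alpha> \<beta>)) = mat.span (\<Union>(\<beta>, \<alpha>)\<in>UNIV.
      (if R [f0 \<alpha>, f1 \<beta>] [] = {0} then {0} else functionals X) \<inter> (T0 \<alpha> \<inter> T1 \<beta>))"
    unfolding span_UN_span by (intro arg_cong [where f = mat.span]) auto
  also have "\<dots> = mat.span (\<Union>(\<beta>, \<alpha>)\<in>{(\<beta>, \<alpha>). R [f0 \<alpha>, f1 \<beta>] [] \<noteq> {0}}. T0 \<alpha> \<inter> T1 \<beta>)"
    using sub span_UN_if [of UNIV "\<lambda>(\<beta>, \<alpha>). T0 \<alpha> \<inter> T1 \<beta>" "\<lambda>(\<beta>, \<alpha>). R [f0 \<alpha>, f1 \<beta>] [] = {0}" X]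
    by (simp add: case_prod_beta' Int_absorb1 subset_iff Int_assoc [symmetric])
  ultimately show ?thesis by simp
qed

lemma has_value_atomic3:
  assumes ctx: "context_at ys xs c X" and nv: "\<not> is_Var t0" and fresh: "fresh p (ys @ xs)"
    and sorts: "sort_of t0 = range f0" "sort_of t1 = range f1" "sort_of t2 = range f2"
      "\<And>\<alpha>. atom_basis (f0 \<alpha>) = {None}" "\<And>\<beta>. atom_basis (f1 \<beta>) = {None}" "\<And>\<gamma>. atom_basis (f2 \<gamma>) = {None}"
    and R: "binary_relation [range f0, range f1, range f2] [] R"
    and ys': "ys' = new_var 0 p t0 # new_star 0 p t0 # new_var 1 p t1 # new_star 1 p t1 # new_var 2 p t2 # new_star 2 p t2 # ys"
    and c': "\<And>\<alpha> \<beta> \<gamma>. c' \<alpha> \<beta> \<gamma> = f0 \<alpha> # dual (f0 \<alpha>) # f1 \<beta> # dual (f1 \<beta>) # f2 \<gamma> # dual (f2 \<gamma>) # c"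
    and T0: "\<And>\<alpha> \<beta> \<gamma>. context_at ys' xs (c' \<alpha> \<beta> \<gamma>) X \<Longrightarrow>
      has_value (arg_form (0 # p) t0 (new_star 0 p t0)) ys' xs (c' \<alpha> \<beta> \<gamma>) X (T0 \<alpha>)"
    and T1: "\<And>\<alpha> \<beta> \<gamma>. context_at ys' xs (c' \<alpha> \<beta> \<gamma>) X \<Longrightarrow>
      has_value (arg_form (1 # p) t1 (new_star 1 p t1)) ys' xs (c' \<alpha> \<beta> \<gamma>) X (T1 \<beta>)"
    and T2: "\<And>\<alpha> \<beta> \<gamma>. context_at ys' xs (c' \<alpha> \<beta> \<gamma>) X \<Longrightarrow>
      has_value (arg_form (2 # p) t2 (new_star 2 p t2)) ys' xs (c' \<alpha> \<beta> \<gamma>) X (T2 \<gamma>)"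
  shows "has_value (atomic p R [t0, t1, t2]) ys xs c X
    (mat.span (\<Union>(\<gamma>, \<beta>, \<alpha>)\<in>{(\<gamma>, \<beta>, \<alpha>). R [f0 \<alpha>, f1 \<beta>, f2 \<gamma>] [] \<noteq> {0}}. T0 \<alpha> \<inter> T1 \<beta> \<inter> T2 \<gamma>))"
proof -
  let ?K = "\<lambda>\<alpha> \<beta> \<gamma>. (if R [f0 \<alpha>, f1 \<beta>, f2 \<gamma>] [] = {0} then {0} else functionals X) \<inter> T0 \<alpha> \<inter> T1 \<beta> \<inter> T2 \<gamma>"
  have fresh': "fresh p ys" "fresh p xs" using fresh by (auto simp: fresh_def)
  have p: "pos [new_var 0 p t0, new_var 1 p t1, new_var 2 p t2] ys' = [0, 2, 4]" by (simp add: ys' pos_def)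
  have ctx': "context_at ys' xs (c' \<alpha> \<beta> \<gamma>) X" for \<alpha> \<beta> \<gamma>
    unfolding ys' c' context_at_Cons2
    using ctx fresh' sorts by (auto simp: dual_qset_def)
  have "has_value (atomic p R [t0, t1, t2]) ys xs c X
      (mat.span (\<Union>\<gamma>. mat.span (\<Union>\<beta>. mat.span (\<Union>\<alpha>. ?K \<alpha> \<beta> \<gamma>))))"
    unfolding atomic3 [OF nv]
  proof (intro has_value_Ex_eq [where f = f2] has_value_Ex_eq [where f = f1] has_value_Ex_eq [where f = f0])
    fix \<alpha> \<beta> \<gamma>
    let ?body = "Conj (Conj (Conj (Rel R [new_var 0 p t0, new_var 1 p t1, new_var 2 p t2]) (arg_form (0 # p) t0 (new_star 0 p t0)))
        (arg_form (1 # p) t1 (new_star 1 p t1))) (arg_form (2 # p) t2 (new_star 2 p t2))"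
    have "has_value (Rel R [new_var 0 p t0, new_var 1 p t1, new_var 2 p t2]) ys' xs (c' \<alpha> \<beta> \<gamma>) X
      (if R (permute [0, 2, 4] (c' \<alpha> \<beta> \<gamma>)) [] = {0} then {0} else functionals X)"
      unfolding p [symmetric] using ctx' R sorts by (intro has_value_Rel_points) (auto simp: ys')
    then have "has_value ?body ys' xs (c' \<alpha> \<beta> \<gamma>) X (?K \<alpha> \<beta> \<gamma>)"
      using T0 T1 T2 ctx' by (intro has_value_Conj) (auto simp: c' permute_def)
    then show "has_value ?body
        (new_var 0 p t0 # new_star 0 p t0 # new_var 1 p t1 # new_star 1 p t1 # new_var 2 p t2 # new_star 2 p t2 # ys) xs
        (f0 \<alpha> # dual (f0 \<alpha>) # f1 \<beta> # dual (f1 \<beta>) # f2 \<gamma> # dual (f2 \<gamma>) # c) X (?K \<alpha> \<beta> \<gamma>)"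
      by (simp add: ys' c')
  qed (use ctx fresh' sorts in auto)
  moreover have sub: "T0 \<alpha> \<subseteq> functionals X" "0 \<in> T0 \<alpha>" "0 \<in> T1 \<beta>" "0 \<in> T2 \<gamma>" for \<alpha> \<beta> \<gamma>
    using has_value_subspace [OF ctx' T0 [OF ctx']] has_value_subspace [OF ctx' T1 [OF ctx']]
      has_value_subspace [OF ctx' T2 [OF ctx']]
    by (auto intro: mat.subspace_0)
  have "mat.span (\<Union>\<gamma>. mat.span (\<Union>\<beta>. mat.span (\<Union>\<alpha>. ?K \<alpha> \<beta> \<gamma>))) = mat.span (\<Union>(\<gamma>, \<beta>, \<alpha>)\<in>UNIV.
      (if R [f0 \<alpha>, f1 \<beta>, f2 \<gamma>] [] = {0} then {0} else functionals X) \<inter> (T0 \<alpha> \<inter> T1 \<beta> \<inter> T2 \<gamma>))"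
    unfolding span_UN_span UN_UN_flatten [symmetric]
    by (intro arg_cong [where f = mat.span]) auto
  also have "\<dots> = mat.span (\<Union>(\<gamma>, \<beta>, \<alpha>)\<in>{(\<gamma>, \<beta>, \<alpha>). R [f0 \<alpha>, f1 \<beta>, f2 \<gamma>] [] \<noteq> {0}}. T0 \<alpha> \<inter> T1 \<beta> \<inter> T2 \<gamma>)"
    using sub span_UN_if [of UNIV "\<lambda>(\<gamma>, \<beta>, \<alpha>). T0 \<alpha> \<inter> T1 \<beta> \<inter> T2 \<gamma>" "\<lambda>(\<gamma>, \<beta>, \<alpha>). R [f0 \<alpha>, f1 \<beta>, f2 \<gamma>] [] = {0}" X]
    by (simp add: case_prod_beta' Int_absorb1 subset_iff Int_assoc [symmetric])
  ultimately show ?thesis by simp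
qed

section \<open>The axioms of distance functions\<close>

lemma range_pt: "(dists :: ('v, ennreal) qset) = range pt" by (simp add: classical_def)

lemma range_dual_pt: "dual_qset (dists :: ('v, ennreal) qset) = range (\<lambda>\<beta>. dual (pt \<beta>))"
  by (simp add: classical_def dual_qset_def image_image)

lemma ops_points:
  assumes "points X" "points Y"
  shows "ops X Y \<noteq> {0}"
proof -
  have "basis X = {replicate (length X) None}" "basis Y = {replicate (length Y) None}"
    using basis_points [OF assms(1), of "[]"] basis_points [OF assms(2), of "[]"] by simp_all
  then have m: "mat_unit (replicate (length Y) None) (replicate (length X) None) \<in> ops X Y"
    by (intro mat_unit_ops) auto
  moreover have "mat_unit i j \<noteq> 0" for i j :: "'a option list" by (auto simp: mat_unit_def fun_eq_iff)
  ultimately show ?thesis by blast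
qed

lemma eq_rel_dists:
  "eq_rel (dists :: ('v::complex_inner, ennreal) qset) [pt \<alpha>, dual (pt \<beta>)] [] = {0} \<longleftrightarrow> \<alpha> \<noteq> \<beta>"
proof -
  have "mat_eval (pt \<alpha> :: ('v, ennreal) atom) [] [None, None] = 1" by (simp add: mat_eval_def)
  then have "mat_eval (pt \<alpha> :: ('v, ennreal) atom) \<noteq> 0" by auto
  then have "mat.span {mat_eval (pt \<alpha> :: ('v, ennreal) atom)} \<noteq> {0}"
    using mat.span_base [of "mat_eval (pt \<alpha> :: ('v, ennreal) atom)" "{mat_eval (pt \<alpha> :: ('v, ennreal) atom)}"] by auto
  then show ?thesis by (auto simp: eq_rel_pair range_pt)
qed

lemma binary_relation_mat_star:
  assumes "binary_relation \<X> \<Y> R"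
  shows "binary_relation (map dual_qset \<X>) (map dual_qset \<Y>) (star_rel R)"
proof -
  have l: "map dual X \<in> listset \<Z> \<longleftrightarrow> X \<in> listset (map dual_qset \<Z>)" for X and \<Z> :: "('a, 'b) qset list"
    by (auto simp: listset_iff in_dual_qset)
  have b: "basis (map dual X) = basis X" for X :: "('a, 'b) atom list" by (auto simp: basis_iff)
  have o: "mat_star a \<in> ops X Y" if "a \<in> ops (map dual X) (map dual Y)" for a X and Y :: "('a, 'b) atom list"
    using that by (simp add: ops_def mat_star_def b)
  have s: "mat.subspace (mat_star ` U)" if U: "mat.subspace U" for U :: "'a mat set"
  proof (rule mat.subspaceI)
    show "0 \<in> mat_star ` U"
      using mat.subspace_0 [OF U] by (intro image_eqI [of _ _ 0]) (auto simp: mat_star_def fun_eq_iff)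
    show "a + b \<in> mat_star ` U" if "a \<in> mat_star ` U" "b \<in> mat_star ` U" for a b
      using that mat.subspace_add [OF U]
      by (elim imageE) (rule image_eqI [rotated], assumption, auto simp: mat_star_def fun_eq_iff)
    show "mat_scale c a \<in> mat_star ` U" if "a \<in> mat_star ` U" for c a
      using that mat.subspace_scale [OF U, of _ "cnj c"]
      by (elim imageE) (rule image_eqI [rotated], assumption, auto simp: mat_star_def mat_scale_def fun_eq_iff)
  qed
  have z: "mat_star ` {0} = {0 :: 'a mat}" by (auto simp: mat_star_def fun_eq_iff)
  show ?thesis
    using assms o s z unfolding binary_relation_def star_rel_def l [symmetric] by (auto split: if_splits) blast+
qed

lemma has_value_Fn:
  assumes ctx: "context_at ys xs c X" and vs: "set vs \<subseteq> set xs" and y: "y \<in> set ys" "snd y = dual_qset \<Y>"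
    and B: "binary_relation (map snd vs) [\<Y>] B" and fin: "\<And>y. y \<in> \<Y> \<Longrightarrow> finite (atom_basis y)"
    and p: "permute (pos [y] ys) c = [Y]" and Z: "permute (pos vs xs) X = Z"
  shows "has_value (arg_form q (Fn B (map snd vs) \<Y> (map Var vs)) y) ys xs c X
    (lift (pos vs xs) (at_point ` B Z [dual Y]) X)"
proof -
  have "arg_form q (Fn B (map snd vs) \<Y> (map Var vs)) y = Rel (hat (map snd vs) \<Y> B) (vs @ [y])"
    using atomic_Vars [of q "hat (map snd vs) \<Y> B" "vs @ [y]"] by (simp add: arg_form_def)
  then show ?thesis using has_value_Rel_hat [OF ctx vs y B fin p] Z by simp
qed

lemma binary_relation_zero:
  "binary_relation [] [dual_qset dists] (star_rel (dist_elem 0 :: ('v::complex_inner, ennreal) brel))"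
proof -
  have "binary_relation [] [dists] (dist_elem 0 :: ('v, ennreal) brel)"
    unfolding binary_relation_def dist_elem_def classical_elem_def classical_rel_def
    by (auto simp: set_Cons_def classical_def subspace_ops mat.subspace_0 [OF subspace_ops])
  then show ?thesis using binary_relation_mat_star by fastforce
qed

lemma star_ops: "mat_star ` ops X Y = ops X Y"
proof -
  have "mat_star a \<in> ops X Y" if "a \<in> ops X Y" for a :: "'a mat" using that by (simp add: ops_def mat_star_def)
  note s = this
  have "a \<in> mat_star ` ops X Y" if "a \<in> ops X Y" for a :: "'a mat"
    by (rule image_eqI [of _ _ "mat_star a"]) (use s [OF that] in \<open>simp_all add: mat_star_def\<close>)
  with s show ?thesis by blast
qed

lemma zero_value:
  "lift [] (at_point ` star_rel (dist_elem 0) [] [dual (pt \<beta>)]) (X :: ('v::complex_inner, ennreal) atom list) =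
    (if \<beta> = 0 then functionals X else {0})"
proof -
  have z: "star_rel (dist_elem 0) [] [dual (pt \<beta>)] = (if \<beta> = 0 then ops [] [pt \<beta> :: ('v, ennreal) atom] else {0 :: 'v mat})"
    using star_ops [of "[]" "[pt \<beta> :: ('v, ennreal) atom]"]
    by (auto simp: star_rel_def dist_elem_def classical_elem_def classical_rel_def set_Cons_def mat_star_def fun_eq_iff)
  show ?thesis
  proof (cases "\<beta> = 0")
    case True
    have "at_point ` ops [] [pt \<beta> :: ('v, ennreal) atom] = restrict_points 0 ` functionals ([] :: ('v, ennreal) atom list)"
    proof (intro subset_antisym image_subsetI)
      fix b assume "b \<in> ops [] [pt \<beta> :: ('v, ennreal) atom]"
      then have "at_point b \<in> functionals ([] :: ('v, ennreal) atom list)"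
        by (auto simp: at_point_def ops_def split: if_splits)
      moreover have "at_point b = restrict_points 0 (at_point b)"
        by (auto simp: at_point_def restrict_points_def fun_eq_iff)
      ultimately show "at_point b \<in> restrict_points 0 ` functionals ([] :: ('v, ennreal) atom list)" by blast
    next
      fix r assume r: "r \<in> functionals ([] :: ('v, ennreal) atom list)"
      define b where "b = (\<lambda>(i :: 'v option list) j. if i = [None] then r [] j else 0)"
      have "b \<in> ops [] [pt \<beta> :: ('v, ennreal) atom]" using r by (auto simp: b_def ops_def split: if_splits)
      moreover have "restrict_points 0 r = at_point b" by (auto simp: at_point_def restrict_points_def b_def fun_eq_iff)
      ultimately show "restrict_points 0 r \<in> at_point ` ops [] [pt \<beta> :: ('v, ennreal) atom]" by blast
    qed
    then show ?thesis using True z ops_points [of "[] :: ('v, ennreal) atom list" "[] :: ('v, ennreal) atom list"]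
        lift_Nil [of "[] :: ('v, ennreal) atom list" 0 "functionals ([] :: ('v, ennreal) atom list)" X]
      by (simp add: subspace_ops)
  next
    case False
    have "at_point 0 = (0 :: 'v mat)" by (simp add: at_point_def fun_eq_iff)
    then show ?thesis using False z by (simp add: lift_zero)
  qed
qed

lemma permute_Cons [simp]: "permute (k # p) X = (X ! k) # permute p X" "permute [] X = []"
  by (simp_all add: permute_def)

lemma interp_eq_value:
  assumes "has_value \<phi> [] xs [] X T"
  shows "interp \<phi> xs X [] = T" "well_formed \<phi> xs"
  using assms by (simp_all add: has_value_def sem_def strip_def)

lemma span_subspace_eq: "mat.subspace T \<Longrightarrow> mat.span T = T" by (simp add: mat.span_eq_iff)

lemma subspace_lift_at_point:
  assumes "binary_relation \<Z> \<W> B"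
  shows "mat.subspace (lift q (at_point ` B Z W) X)"
proof -
  have "mat.subspace (B Z W)" using assms unfolding binary_relation_def by (metis mat.subspace_single_0)
  then have "mat.subspace (at_point ` B Z W)"
    by (intro linear_map_subspace linear_mapI) (auto simp: at_point_def mat_scale_def fun_eq_iff)
  then show ?thesis by (rule subspace_lift)
qed

lemma flat_ops_points:
  assumes "points X" "atom_basis y = {None}"
  shows "flat ` ops X [y] \<noteq> {0}"
proof -
  let ?N = "replicate (length X) None"
  have "?N \<in> basis X" using basis_points [OF assms(1), of "[]"] by simp
  then have "mat_unit [None] ?N \<in> ops X [y]" using assms(2) by (intro mat_unit_ops) auto
  moreover have "flat (mat_unit [None] ?N) [] (?N @ [None]) = 1" by (simp add: flat_def mat_unit_def)
  then have "flat (mat_unit [None] ?N) \<noteq> 0" by (metis zero_fun_def zero_neq_one)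
  ultimately show ?thesis by blast
qed

lemma flat_points_iff:
  assumes "points X" "atom_basis y = {None}"
  shows "flat ` (if P then ops X [y] else {0}) = {0} \<longleftrightarrow> \<not> P"
  using flat_ops_points [OF assms] linear_map_0 [OF linear_flat] by auto

lemma binary_relation_classical:
  "binary_relation (map classical S) (map classical T) (classical_rel S T r)"
proof -
  have "map pt a \<in> listset (map classical S)" if "a \<in> listset S" for S :: "'b set list" and a
    using that by (auto simp: listset_iff classical_def)
  then show ?thesis
    unfolding binary_relation_def classical_rel_def
    by (auto simp: subspace_ops mat.subspace_0 [OF subspace_ops])
qed

lemma classical_rel_pt:
  "classical_rel S T r (map pt a) (map pt b) =
    (if a \<in> listset S \<and> b \<in> listset T \<and> r a b then ops (map pt a) (map pt b) else {0})"
proof -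
  have "map pt a = (map pt a' :: ('a, 'b) atom list) \<longleftrightarrow> a = a'" for a a' :: "'b list"
    by (simp add: inj_map_eq_map inj_def)
  then show ?thesis by (auto simp: classical_rel_def)
qed

lemma has_value_Var:
  fixes v y :: "('v::complex_inner, ennreal) var"
  assumes ctx: "context_at ys xs c X" and v: "v \<in> set ys" "y \<in> set ys" "snd v = dists" "snd y = dual_qset dists"
    and p: "permute (pos [v, y] ys) c = [pt \<beta>, dual (pt \<gamma>)]"
  shows "has_value (arg_form q' (Var v) y) ys xs c X (if \<gamma> = \<beta> then functionals X else {0})"
proof -
  have "has_value (Rel (eq_rel (snd v)) [v, y]) ys xs c X
    (if eq_rel (snd v) (permute (pos [v, y] ys) c) [] = {0} then {0} else functionals X)"
    using v binary_relation_eq_rel [of "dists :: ('v, ennreal) qset"] by (intro has_value_Rel_points ctx) auto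
  then show ?thesis
    unfolding p v(3) eq_rel_dists by (simp add: arg_form_def v(3) split: if_splits)
qed

lemma binary_relation_conj_fun:
  "binary_relation [dists] [dual_qset dists] (conj_fun UNIV :: ('v::complex_inner, ennreal) brel)"
  unfolding binary_relation_def conj_fun_def
  by (auto simp: set_Cons_def subspace_ops mat.subspace_0 [OF subspace_ops] range_pt in_dual_qset)

lemma UN_restrict:
  assumes "\<And>i. mat.subspace (T i)" "\<And>i. T i \<subseteq> functionals X"
  shows "mat.span (\<Union>i\<in>{i. P i}. T i \<inter> (if Q i then functionals X else {0})) = mat.span (\<Union>i\<in>{i. P i \<and> Q i}. T i)"
proof -
  have "mat.span (\<Union>i\<in>{i. P i}. T i \<inter> (if Q i then functionals X else {0})) =
    mat.span (insert 0 (\<Union>i\<in>{i. P i}. T i \<inter> (if Q i then functionals X else {0})))"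
    by (simp add: mat.span_insert_0)
  also have "insert 0 (\<Union>i\<in>{i. P i}. T i \<inter> (if Q i then functionals X else {0})) = insert 0 (\<Union>i\<in>{i. P i \<and> Q i}. T i)"
    using assms(2) by (fastforce split: if_splits)
  finally show ?thesis by (simp add: mat.span_insert_0)
qed

context
  fixes \<X> :: "('v::complex_inner, ennreal) qset" and F :: "'v drel"
  assumes F: "binary_relation [\<X>, dual_qset \<X>] [dists] F"
    and fin: "\<And>x. x \<in> \<X> \<Longrightarrow> finite (atom_basis x)"
begin

lemma finite_sorts:
  "\<forall>a\<in>\<X>. finite (atom_basis a)" "\<forall>a\<in>dual_qset \<X>. finite (atom_basis a)"
  "x \<in> dists \<Longrightarrow> finite (atom_basis x)" "x' \<in> dual_qset dists \<Longrightarrow> finite (atom_basis x')"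
  using fin by (auto simp: dual_qset_def classical_def)

lemma has_value_dist_term:
  assumes ctx: "context_at ys xs c X" and vs: "var \<X> m \<in> set xs" "var_star \<X> n \<in> set xs"
    and y: "y \<in> set ys" "snd y = dual_qset dists" and p: "permute (pos [y] ys) c = [Y]"
    and q: "pos [var \<X> m, var_star \<X> n] xs = q" and Z: "permute q X = Z" and Y: "dual Y = Y'"
  shows "has_value (arg_form q' (dist_term \<X> F m n) y) ys xs c X (lift q (at_point ` F Z [Y']) X)"
proof -
  let ?vs = "[var \<X> m, var_star \<X> n]"
  have "has_value (arg_form q' (Fn F (map snd ?vs) dists (map Var ?vs)) y) ys xs c X
    (lift (pos ?vs xs) (at_point ` F Z [dual Y]) X)"
    using vs F q Z finite_sorts(3) by (intro has_value_Fn ctx y p) (auto simp: var_def var_star_def)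
  then show ?thesis by (simp add: dist_term_def q Y) (simp add: var_def var_star_def)
qed

lemma has_value_dist_term_star:
  assumes ctx: "context_at ys xs c X" and vs: "var_star \<X> m \<in> set xs" "var \<X> n \<in> set xs"
    and y: "y \<in> set ys" "snd y = dists" and p: "permute (pos [y] ys) c = [Y]"
    and q: "pos [var_star \<X> m, var \<X> n] xs = q" and Z: "permute q X = Z" and Y: "dual Y = Y'"
  shows "has_value (arg_form q' (dist_term_star \<X> F m n) y) ys xs c X (lift q (at_point ` star_rel F Z [Y']) X)"
proof -
  let ?vs = "[var_star \<X> m, var \<X> n]"
  have "has_value (arg_form q' (Fn (star_rel F) (map snd ?vs) (dual_qset dists) (map Var ?vs)) y) ys xs c X
    (lift (pos ?vs xs) (at_point ` star_rel F Z [dual Y]) X)"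
    using vs binary_relation_mat_star [OF F] q Z y(2) finite_sorts(4)
    by (intro has_value_Fn ctx y(1) p) (auto simp: var_def var_star_def)
  then show ?thesis by (simp add: dist_term_star_def q Y) (simp add: var_def var_star_def)
qed

lemma has_value_zero:
  fixes y :: "('v, ennreal) var"
  assumes ctx: "context_at ys xs c X"
    and y: "y \<in> set ys" "snd y = dists" and p: "permute (pos [y] ys) c = [pt \<beta>]"
  shows "has_value (arg_form q' zero_star_term y) ys xs c X (if \<beta> = 0 then functionals X else {0})"
proof -
  let ?vs = "[] :: ('v, ennreal) var list"
  have "has_value (arg_form q' (Fn (star_rel (dist_elem 0)) (map snd ?vs) (dual_qset dists) (map Var ?vs)) y) ys xs c X
    (lift (pos ?vs xs) (at_point ` star_rel (dist_elem 0) [] [dual (pt \<beta>)]) X)"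
    using binary_relation_zero y(2) finite_sorts(4) by (intro has_value_Fn ctx y(1) p) (auto simp: pos_def)
  moreover have "pos ?vs xs = []" by (simp add: pos_def)
  ultimately show ?thesis unfolding zero_star_term_def by (simp only: zero_value list.map)
qed

lemma has_value_dist_zero:
  assumes ctx: "context_at [] xs [] X" and vs: "var \<X> m \<in> set xs" "var_star \<X> n \<in> set xs" and fr: "fresh [] xs"
    and q: "pos [var \<X> m, var_star \<X> n] xs = q" and Z: "permute q X = Z"
  shows "has_value (atomic [] (eq_rel dists) [dist_term \<X> F m n, zero_star_term]) [] xs [] X
    (lift q (at_point ` F Z [pt 0]) X)"
proof -
  let ?L = "\<lambda>\<alpha>. lift q (at_point ` F Z [pt \<alpha>]) X"
  let ?t0 = "dist_term \<X> F m n" and ?t1 = "zero_star_term :: ('v, ennreal) trm"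
  define ys' where "ys' = [new_var 0 [] ?t0, new_star 0 [] ?t0, new_var 1 [] ?t1, new_star 1 [] ?t1]"
  define c' :: "ennreal \<Rightarrow> ennreal \<Rightarrow> ('v, ennreal) atom list" where "c' = (\<lambda>\<alpha> \<beta>. [pt \<alpha>, dual (pt \<alpha>), dual (pt \<beta>), pt \<beta>])"
  have sorts: "sort_of ?t0 = dists" "sort_of ?t1 = dual_qset dists" by (simp_all add: dist_term_def zero_star_term_def)
  have val: "has_value (atomic [] (eq_rel dists) [?t0, ?t1]) [] xs [] X
    (mat.span (\<Union>(\<beta>, \<alpha>)\<in>{(\<beta>, \<alpha>). eq_rel dists [pt \<alpha>, dual (pt \<beta>) :: ('v, ennreal) atom] [] \<noteq> {0}}.
      ?L \<alpha> \<inter> (if \<beta> = 0 then functionals X else {0})))"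
  proof (rule has_value_atomic2 [where ys' = ys' and c' = c'])
    show "context_at [] xs [] X" by (rule ctx)
    show "sort_of ?t0 = range pt" "sort_of ?t1 = range (\<lambda>\<beta>. dual (pt \<beta>))"
      unfolding sorts by (rule range_pt, rule range_dual_pt)
    show "binary_relation [range pt, range (\<lambda>\<beta>. dual (pt \<beta>))] [] (eq_rel (dists :: ('v, ennreal) qset))"
      using binary_relation_eq_rel [of "dists :: ('v, ennreal) qset"]
      unfolding range_pt [symmetric] range_dual_pt [symmetric] .
    fix \<alpha> \<beta> assume ctx': "context_at ys' xs (c' \<alpha> \<beta>) X"
    show "has_value (arg_form [0] ?t0 (new_star 0 [] ?t0)) ys' xs (c' \<alpha> \<beta>) X (?L \<alpha>)"
      using ctx' vs q Z by (intro has_value_dist_term [where Y = "dual (pt \<alpha>)"])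
        (auto simp: ys'_def c'_def pos_def sorts)
    show "has_value (arg_form [1] ?t1 (new_star 1 [] ?t1)) ys' xs (c' \<alpha> \<beta>) X (if \<beta> = 0 then functionals X else {0})"
      using ctx' by (intro has_value_zero) (auto simp: ys'_def c'_def pos_def sorts)
  qed (use fr in \<open>auto simp: ys'_def c'_def dist_term_def\<close>)
  have "?L 0 \<subseteq> functionals X" by (rule lift_rows)
  have sub: "mat.subspace (?L \<alpha>)" for \<alpha>
  proof -
    have "mat.subspace (at_point ` F Z [pt \<alpha>])" using F unfolding binary_relation_def
      by (intro linear_map_subspace linear_mapI) (auto simp: at_point_def mat_scale_def fun_eq_iff, metis mat.subspace_single_0)
    then show ?thesis by (rule subspace_lift)
  qed
  have "(\<Union>(\<beta>, \<alpha>)\<in>{(\<beta>, \<alpha>). eq_rel dists [pt \<alpha>, dual (pt \<beta>) :: ('v, ennreal) atom] [] \<noteq> {0}}.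
      ?L \<alpha> \<inter> (if \<beta> = 0 then functionals X else {0})) = (\<Union>\<alpha>. ?L \<alpha> \<inter> (if \<alpha> = 0 then functionals X else {0}))"
    by (auto simp: eq_rel_dists simp del: dual.simps)
  also have "\<dots> = ?L 0"
  proof (intro subset_antisym subsetI)
    fix x assume "x \<in> ?L 0"
    then have "x \<in> ?L 0 \<inter> (if (0 :: ennreal) = 0 then functionals X else {0})" using lift_rows by auto
    then show "x \<in> (\<Union>\<alpha>. ?L \<alpha> \<inter> (if \<alpha> = 0 then functionals X else {0}))" by blast
  qed (use mat.subspace_0 [OF sub] in \<open>auto split: if_splits\<close>)
  finally show ?thesis using val by (simp add: span_subspace_eq sub)
qed

text \<open>The conjugation function only renames the point \<open>\<beta>\<close>, so it can be dropped from the term.\<close>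

lemma has_value_conj_fun:
  assumes ctx: "context_at ys xs c X" and vs: "var \<X> m \<in> set xs" "var_star \<X> n \<in> set xs" and fr: "fresh p (ys @ xs)"
    and y: "y \<in> set ys" "snd y = dists" and p: "permute (pos [y] ys) c = [pt \<beta>]"
    and q: "pos [var \<X> m, var_star \<X> n] xs = q" and Z: "permute q X = Z"
  shows "has_value (arg_form p (Fn (conj_fun UNIV) [dists] (dual_qset dists) [dist_term \<X> F m n]) y) ys xs c X
    (lift q (at_point ` F Z [pt \<beta>]) X)"
proof -
  let ?L = "\<lambda>\<alpha>. lift q (at_point ` F Z [pt \<alpha>]) X"
  let ?t0 = "dist_term \<X> F m n" and ?t1 = "Var y"
  let ?R = "hat [dists] (dual_qset dists) (conj_fun UNIV :: ('v, ennreal) brel)"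
  define ys' where "ys' = new_var 0 p ?t0 # new_star 0 p ?t0 # new_var 1 p ?t1 # new_star 1 p ?t1 # ys"
  define c' :: "ennreal \<Rightarrow> ennreal \<Rightarrow> ('v, ennreal) atom list" where
    "c' = (\<lambda>\<alpha> \<beta>. pt \<alpha> # dual (pt \<alpha>) # pt \<beta> # dual (pt \<beta>) # c)"
  have sorts: "sort_of ?t0 = dists" "sort_of ?t1 = dists" by (simp_all add: dist_term_def y)
  have y': "y \<noteq> new_var i p t" "y \<noteq> new_star i p t" for i t
    using y(1) fr new_var_notin [of p "ys @ xs" i t] by auto
  have R: "?R [pt \<alpha>, pt \<gamma>] [] = {0} \<longleftrightarrow> \<alpha> \<noteq> \<gamma>" for \<alpha> \<gamma>
  proof -
    have "?R [pt \<alpha>, pt \<gamma>] [] = flat ` conj_fun UNIV [pt \<alpha>] [dual (pt \<gamma>)]"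
      by (subst hat_eq [OF binary_relation_conj_fun]) (auto simp: range_pt set_Cons_def finite_sorts(4))
    also have "conj_fun UNIV [pt \<alpha>] [dual (pt \<gamma>)] = (if \<alpha> = \<gamma> then ops [pt \<alpha>] [dual (pt \<gamma>) :: ('v, ennreal) atom] else {0})"
      by (auto simp: conj_fun_def)
    finally show ?thesis using flat_points_iff [of "[pt \<alpha> :: ('v, ennreal) atom]" "dual (pt \<gamma>)" "\<alpha> = \<gamma>"] by simp
  qed
  have val: "has_value (atomic p ?R [?t0, ?t1]) ys xs c X
    (mat.span (\<Union>(\<gamma>, \<alpha>)\<in>{(\<gamma>, \<alpha>). ?R [pt \<alpha>, pt \<gamma>] [] \<noteq> {0}}.
      ?L \<alpha> \<inter> (if \<gamma> = \<beta> then functionals X else {0})))"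
  proof (rule has_value_atomic2 [where ys' = ys' and c' = c'])
    show "context_at ys xs c X" by (rule ctx)
    show "sort_of ?t0 = range pt" "sort_of ?t1 = range pt"
      unfolding sorts by (rule range_pt, rule range_pt)
    show "binary_relation [range pt, range pt] [] ?R"
      using binary_relation_hat [OF binary_relation_conj_fun finite_sorts(4)]
      unfolding range_pt [symmetric] by simp
    fix \<alpha> \<gamma> assume ctx': "context_at ys' xs (c' \<alpha> \<gamma>) X"
    show "has_value (arg_form (0 # p) ?t0 (new_star 0 p ?t0)) ys' xs (c' \<alpha> \<gamma>) X (?L \<alpha>)"
      using ctx' vs q Z by (intro has_value_dist_term [where Y = "dual (pt \<alpha>)"])
        (auto simp: ys'_def c'_def pos_def sorts)
    show "has_value (arg_form (1 # p) ?t1 (new_star 1 p ?t1)) ys' xs (c' \<alpha> \<gamma>) X (if \<gamma> = \<beta> then functionals X else {0})"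
      using ctx' y p y' y' [symmetric] by (intro has_value_Var) (auto simp: ys'_def c'_def pos_def)
  qed (use fr in \<open>auto simp: ys'_def c'_def dist_term_def\<close>)
  have sub: "mat.subspace (?L \<alpha>)" for \<alpha> using subspace_lift_at_point [OF F] .
  have "mat.span (\<Union>(\<gamma>, \<alpha>)\<in>{(\<gamma>, \<alpha>). ?R [pt \<alpha>, pt \<gamma>] [] \<noteq> {0}}.
      ?L \<alpha> \<inter> (if \<gamma> = \<beta> then functionals X else {0})) = mat.span (\<Union>i\<in>{i. case i of (\<gamma>, \<alpha>) \<Rightarrow> \<alpha> = \<gamma>}.
      (case i of (\<gamma>, \<alpha>) \<Rightarrow> ?L \<alpha>) \<inter> (if fst i = \<beta> then functionals X else {0}))"
    by (intro arg_cong [where f = mat.span] SUP_cong) (auto simp: R)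
  also have "\<dots> = mat.span (\<Union>i\<in>{i. (case i of (\<gamma>, \<alpha>) \<Rightarrow> \<alpha> = \<gamma>) \<and> fst i = \<beta>}. case i of (\<gamma>, \<alpha>) \<Rightarrow> ?L \<alpha>)"
    using sub by (intro UN_restrict) (auto split: prod.splits dest: subsetD [OF lift_rows])
  also have "(\<Union>i\<in>{i. (case i of (\<gamma>, \<alpha>) \<Rightarrow> \<alpha> = \<gamma>) \<and> fst i = \<beta>}. case i of (\<gamma>, \<alpha>) \<Rightarrow> ?L \<alpha>) = ?L \<beta>"
    by auto
  finally have "mat.span (\<Union>(\<gamma>, \<alpha>)\<in>{(\<gamma>, \<alpha>). ?R [pt \<alpha>, pt \<gamma>] [] \<noteq> {0}}.
      ?L \<alpha> \<inter> (if \<gamma> = \<beta> then functionals X else {0})) = ?L \<beta>"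
    unfolding span_subspace_eq [OF sub] .
  moreover have "arg_form p (Fn (conj_fun UNIV) [dists] (dual_qset dists) [?t0]) y = atomic p ?R [?t0, ?t1]"
    by (simp add: arg_form_def)
  ultimately show ?thesis using val by (simp only:)
qed

lemma has_value_sym:
  assumes ctx: "context_at [] xs [] X" and fr: "fresh [] xs" "fresh [1] xs"
    and vs: "var \<X> m \<in> set xs" "var_star \<X> n \<in> set xs" "var \<X> m' \<in> set xs" "var_star \<X> n' \<in> set xs"
    and q: "pos [var \<X> m, var_star \<X> n] xs = q" and Z: "permute q X = Z"
    and q': "pos [var \<X> m', var_star \<X> n'] xs = q'" and Z': "permute q' X = Z'"
  shows "has_value (atomic [] (eq_rel dists) [dist_term \<X> F m n,
      Fn (conj_fun UNIV) [dists] (dual_qset dists) [dist_term \<X> F m' n']]) [] xs [] X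
    (mat.span (\<Union>\<alpha>. lift q (at_point ` F Z [pt \<alpha>]) X \<inter> lift q' (at_point ` F Z' [pt \<alpha>]) X))"
proof -
  let ?L = "\<lambda>\<alpha>. lift q (at_point ` F Z [pt \<alpha>]) X" and ?M = "\<lambda>\<alpha>. lift q' (at_point ` F Z' [pt \<alpha>]) X"
  let ?t0 = "dist_term \<X> F m n"
    and ?t1 = "Fn (conj_fun UNIV) [dists] (dual_qset dists) [dist_term \<X> F m' n'] :: ('v, ennreal) trm"
  define ys' where "ys' = [new_var 0 [] ?t0, new_star 0 [] ?t0, new_var 1 [] ?t1, new_star 1 [] ?t1]"
  define c' :: "ennreal \<Rightarrow> ennreal \<Rightarrow> ('v, ennreal) atom list" where "c' = (\<lambda>\<alpha> \<beta>. [pt \<alpha>, dual (pt \<alpha>), dual (pt \<beta>), pt \<beta>])"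
  have sorts: "sort_of ?t0 = dists" "sort_of ?t1 = dual_qset dists" by (simp_all add: dist_term_def)
  have val: "has_value (atomic [] (eq_rel dists) [?t0, ?t1]) [] xs [] X
    (mat.span (\<Union>(\<beta>, \<alpha>)\<in>{(\<beta>, \<alpha>). eq_rel dists [pt \<alpha>, dual (pt \<beta>) :: ('v, ennreal) atom] [] \<noteq> {0}}. ?L \<alpha> \<inter> ?M \<beta>))"
  proof (rule has_value_atomic2 [where ys' = ys' and c' = c'])
    show "context_at [] xs [] X" by (rule ctx)
    show "sort_of ?t0 = range pt" "sort_of ?t1 = range (\<lambda>\<beta>. dual (pt \<beta>))"
      unfolding sorts by (rule range_pt, rule range_dual_pt)
    show "binary_relation [range pt, range (\<lambda>\<beta>. dual (pt \<beta>))] [] (eq_rel (dists :: ('v, ennreal) qset))"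
      using binary_relation_eq_rel [of "dists :: ('v, ennreal) qset"]
      unfolding range_pt [symmetric] range_dual_pt [symmetric] .
    fix \<alpha> \<beta> assume ctx': "context_at ys' xs (c' \<alpha> \<beta>) X"
    show "has_value (arg_form [0] ?t0 (new_star 0 [] ?t0)) ys' xs (c' \<alpha> \<beta>) X (?L \<alpha>)"
      using ctx' vs q Z by (intro has_value_dist_term [where Y = "dual (pt \<alpha>)"])
        (auto simp: ys'_def c'_def pos_def sorts)
    show "has_value (arg_form [1] ?t1 (new_star 1 [] ?t1)) ys' xs (c' \<alpha> \<beta>) X (?M \<beta>)"
      using ctx' vs q' Z' fr by (intro has_value_conj_fun)
        (auto simp: ys'_def c'_def pos_def sorts fresh_def)
  qed (use fr in \<open>auto simp: ys'_def c'_def dist_term_def\<close>)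
  have "(\<Union>(\<beta>, \<alpha>)\<in>{(\<beta>, \<alpha>). eq_rel dists [pt \<alpha>, dual (pt \<beta>) :: ('v, ennreal) atom] [] \<noteq> {0}}. ?L \<alpha> \<inter> ?M \<beta>) =
      (\<Union>\<alpha>. ?L \<alpha> \<inter> ?M \<alpha>)" by (auto simp: eq_rel_dists simp del: dual.simps)
  then show ?thesis using val by simp
qed

lemma has_value_plus:
  assumes ctx: "context_at ys xs c X" and fr: "fresh p (ys @ xs)"
    and vs: "var_star \<X> m \<in> set xs" "var \<X> n \<in> set xs" "var_star \<X> m' \<in> set xs" "var \<X> n' \<in> set xs"
    and y: "y \<in> set ys" "snd y = dists" and p: "permute (pos [y] ys) c = [pt \<gamma>]"
    and q: "pos [var_star \<X> m, var \<X> n] xs = q" and Z: "permute q X = Z"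
    and q': "pos [var_star \<X> m', var \<X> n'] xs = q'" and Z': "permute q' X = Z'"
  shows "has_value (arg_form p (Fn (star_rel dist_plus) [dual_qset dists, dual_qset dists] (dual_qset dists)
      [dist_term_star \<X> F m n, dist_term_star \<X> F m' n']) y) ys xs c X
    (mat.span (\<Union>(\<alpha>, \<beta>)\<in>{(\<alpha>, \<beta>). \<gamma> = \<alpha> + \<beta>}.
      lift q (at_point ` star_rel F Z [dual (pt \<alpha>)]) X \<inter> lift q' (at_point ` star_rel F Z' [dual (pt \<beta>)]) X))"
proof -
  let ?L = "\<lambda>\<alpha>. lift q (at_point ` star_rel F Z [dual (pt \<alpha>)]) X"
    and ?M = "\<lambda>\<beta>. lift q' (at_point ` star_rel F Z' [dual (pt \<beta>)]) X"
  let ?t0 = "dist_term_star \<X> F m n" and ?t1 = "dist_term_star \<X> F m' n'" and ?t2 = "Var y"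
  let ?R = "hat [dual_qset dists, dual_qset dists] (dual_qset dists) (star_rel dist_plus :: ('v, ennreal) brel)"
  define ys' where "ys' = new_var 0 p ?t0 # new_star 0 p ?t0 # new_var 1 p ?t1 # new_star 1 p ?t1 #
    new_var 2 p ?t2 # new_star 2 p ?t2 # ys"
  define c' :: "ennreal \<Rightarrow> ennreal \<Rightarrow> ennreal \<Rightarrow> ('v, ennreal) atom list" where
    "c' = (\<lambda>\<alpha> \<beta> \<gamma>. dual (pt \<alpha>) # pt \<alpha> # dual (pt \<beta>) # pt \<beta> # pt \<gamma> # dual (pt \<gamma>) # c)"
  have sorts: "sort_of ?t0 = dual_qset dists" "sort_of ?t1 = dual_qset dists" "sort_of ?t2 = dists"
    by (simp_all add: dist_term_star_def y)
  have y': "y \<noteq> new_var i p t" "y \<noteq> new_star i p t" for i t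
    using y(1) fr new_var_notin [of p "ys @ xs" i t] by auto
  have plus: "binary_relation [dual_qset dists, dual_qset dists] [dual_qset dists] (star_rel dist_plus :: ('v, ennreal) brel)"
    using binary_relation_mat_star [OF binary_relation_classical [of "[UNIV, UNIV]" "[UNIV]"]]
    unfolding dist_plus_def by simp
  have R: "?R [dual (pt \<alpha>), dual (pt \<beta>), pt \<delta>] [] = {0} \<longleftrightarrow> \<delta> \<noteq> \<alpha> + \<beta>" for \<alpha> \<beta> \<delta>
  proof -
    have "?R [dual (pt \<alpha>), dual (pt \<beta>), pt \<delta>] [] = flat ` star_rel dist_plus [dual (pt \<alpha>), dual (pt \<beta>)] [dual (pt \<delta>)]"
      by (subst hat_eq [OF plus]) (auto simp: range_pt set_Cons_def finite_sorts(4) in_dual_qset)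
    also have "star_rel dist_plus [dual (pt \<alpha>), dual (pt \<beta>)] [dual (pt \<delta>)] =
      (if \<delta> = \<alpha> + \<beta> then ops [dual (pt \<alpha>), dual (pt \<beta>)] [dual (pt \<delta>) :: ('v, ennreal) atom] else {0})"
    proof -
      have "dist_plus [pt \<alpha>, pt \<beta>] [pt \<delta>] = (if \<delta> = \<alpha> + \<beta> then ops [pt \<alpha>, pt \<beta>] [pt \<delta> :: ('v, ennreal) atom] else {0})"
        using classical_rel_pt [of "[UNIV, UNIV]" "[UNIV]" "\<lambda>a b. b ! 0 = a ! 0 + a ! 1" "[\<alpha>, \<beta>]" "[\<delta>]"]
        by (simp add: dist_plus_def set_Cons_def cong: if_cong)
      moreover have "ops [pt \<alpha>, pt \<beta>] [pt \<delta> :: ('v, ennreal) atom] = ops [dual (pt \<alpha>), dual (pt \<beta>)] [dual (pt \<delta>) :: ('v, ennreal) atom]"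
        by (simp add: ops_def basis_def)
      moreover have "mat_star ` {0} = {0 :: 'v mat}" by (auto simp: mat_star_def fun_eq_iff)
      ultimately show ?thesis
        using star_ops [of "[dual (pt \<alpha>), dual (pt \<beta>)]" "[dual (pt \<delta>) :: ('v, ennreal) atom]"]
        by (cases "\<delta> = \<alpha> + \<beta>") (simp_all add: star_rel_def)
    qed
    finally show ?thesis
      using flat_points_iff [of "[dual (pt \<alpha>), dual (pt \<beta>) :: ('v, ennreal) atom]" "dual (pt \<delta>)" "\<delta> = \<alpha> + \<beta>"] by simp
  qed
  have val: "has_value (atomic p ?R [?t0, ?t1, ?t2]) ys xs c X
    (mat.span (\<Union>(\<delta>, \<beta>, \<alpha>)\<in>{(\<delta>, \<beta>, \<alpha>). ?R [dual (pt \<alpha>), dual (pt \<beta>), pt \<delta>] [] \<noteq> {0}}.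
      ?L \<alpha> \<inter> ?M \<beta> \<inter> (if \<delta> = \<gamma> then functionals X else {0})))"
  proof (rule has_value_atomic3 [where ys' = ys' and c' = c'])
    show "context_at ys xs c X" by (rule ctx)
    show "sort_of ?t0 = range (\<lambda>\<beta>. dual (pt \<beta>))" "sort_of ?t1 = range (\<lambda>\<beta>. dual (pt \<beta>))" "sort_of ?t2 = range pt"
      unfolding sorts by (rule range_dual_pt, rule range_dual_pt, rule range_pt)
    show "binary_relation [range (\<lambda>\<beta>. dual (pt \<beta>)), range (\<lambda>\<beta>. dual (pt \<beta>)), range pt] [] ?R"
      using binary_relation_hat [OF plus finite_sorts(4)]
      unfolding range_pt [symmetric] range_dual_pt [symmetric] by simp
    fix \<alpha> \<beta> \<delta> assume ctx': "context_at ys' xs (c' \<alpha> \<beta> \<delta>) X"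
    show "has_value (arg_form (0 # p) ?t0 (new_star 0 p ?t0)) ys' xs (c' \<alpha> \<beta> \<delta>) X (?L \<alpha>)"
      using ctx' vs q Z by (intro has_value_dist_term_star [where Y = "pt \<alpha>"])
        (auto simp: ys'_def c'_def pos_def sorts)
    show "has_value (arg_form (1 # p) ?t1 (new_star 1 p ?t1)) ys' xs (c' \<alpha> \<beta> \<delta>) X (?M \<beta>)"
      using ctx' vs q' Z' by (intro has_value_dist_term_star [where Y = "pt \<beta>"])
        (auto simp: ys'_def c'_def pos_def sorts)
    show "has_value (arg_form (2 # p) ?t2 (new_star 2 p ?t2)) ys' xs (c' \<alpha> \<beta> \<delta>) X (if \<delta> = \<gamma> then functionals X else {0})"
      using ctx' y p y' y' [symmetric] by (intro has_value_Var) (auto simp: ys'_def c'_def pos_def)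
  qed (use fr in \<open>auto simp: ys'_def c'_def dist_term_star_def\<close>)
  have sub: "mat.subspace (?L \<alpha>)" "mat.subspace (?M \<alpha>)" for \<alpha>
    by (rule subspace_lift_at_point [OF binary_relation_mat_star [OF F]])+
  have "mat.span (\<Union>(\<delta>, \<beta>, \<alpha>)\<in>{(\<delta>, \<beta>, \<alpha>). ?R [dual (pt \<alpha>), dual (pt \<beta>), pt \<delta>] [] \<noteq> {0}}.
      ?L \<alpha> \<inter> ?M \<beta> \<inter> (if \<delta> = \<gamma> then functionals X else {0})) =
     mat.span (\<Union>i\<in>{i. case i of (\<delta>, \<beta>, \<alpha>) \<Rightarrow> \<delta> = \<alpha> + \<beta>}.
      (case i of (\<delta>, \<beta>, \<alpha>) \<Rightarrow> ?L \<alpha> \<inter> ?M \<beta>) \<inter> (if fst i = \<gamma> then functionals X else {0}))"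
    by (intro arg_cong [where f = mat.span] SUP_cong) (auto simp: R simp del: dual.simps)
  also have "\<dots> = mat.span (\<Union>i\<in>{i. (case i of (\<delta>, \<beta>, \<alpha>) \<Rightarrow> \<delta> = \<alpha> + \<beta>) \<and> fst i = \<gamma>}. case i of (\<delta>, \<beta>, \<alpha>) \<Rightarrow> ?L \<alpha> \<inter> ?M \<beta>)"
    using sub by (intro UN_restrict)
      (auto split: prod.splits intro: mat.subspace_inter dest: subsetD [OF lift_rows] simp del: dual.simps)
  also have "(\<Union>i\<in>{i. (case i of (\<delta>, \<beta>, \<alpha>) \<Rightarrow> \<delta> = \<alpha> + \<beta>) \<and> fst i = \<gamma>}. case i of (\<delta>, \<beta>, \<alpha>) \<Rightarrow> ?L \<alpha> \<inter> ?M \<beta>) =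
      (\<Union>(\<alpha>, \<beta>)\<in>{(\<alpha>, \<beta>). \<gamma> = \<alpha> + \<beta>}. ?L \<alpha> \<inter> ?M \<beta>)"
    by (auto; blast)
  finally have "mat.span (\<Union>(\<delta>, \<beta>, \<alpha>)\<in>{(\<delta>, \<beta>, \<alpha>). ?R [dual (pt \<alpha>), dual (pt \<beta>), pt \<delta>] [] \<noteq> {0}}.
      ?L \<alpha> \<inter> ?M \<beta> \<inter> (if \<delta> = \<gamma> then functionals X else {0})) =
    mat.span (\<Union>(\<alpha>, \<beta>)\<in>{(\<alpha>, \<beta>). \<gamma> = \<alpha> + \<beta>}. ?L \<alpha> \<inter> ?M \<beta>)" .
  moreover have "arg_form p (Fn (star_rel dist_plus) [dual_qset dists, dual_qset dists] (dual_qset dists) [?t0, ?t1]) y =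
      atomic p ?R [?t0, ?t1, ?t2]" by (simp add: arg_form_def)
  ultimately show ?thesis using val by (simp only:)
qed

lemma has_value_triangle:
  assumes ctx: "context_at [] xs [] X" and fr: "fresh [] xs" "fresh [1] xs"
    and vs0: "var \<X> k \<in> set xs" "var_star \<X> l \<in> set xs"
    and vs: "var_star \<X> m \<in> set xs" "var \<X> n \<in> set xs" "var_star \<X> m' \<in> set xs" "var \<X> n' \<in> set xs"
    and r: "pos [var \<X> k, var_star \<X> l] xs = r" and W: "permute r X = W"
    and q: "pos [var_star \<X> m, var \<X> n] xs = q" and Z: "permute q X = Z"
    and q': "pos [var_star \<X> m', var \<X> n'] xs = q'" and Z': "permute q' X = Z'"
  shows "has_value (atomic [] (hat [dists] dists dist_le) [dist_term \<X> F k l,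
        Fn (star_rel dist_plus) [dual_qset dists, dual_qset dists] (dual_qset dists)
          [dist_term_star \<X> F m n, dist_term_star \<X> F m' n']]) [] xs [] X
    (mat.span (\<Union>(\<gamma>, \<alpha>)\<in>{(\<gamma>, \<alpha>). \<alpha> \<le> \<gamma>}. lift r (at_point ` F W [pt \<alpha>]) X \<inter>
      mat.span (\<Union>(\<alpha>, \<beta>)\<in>{(\<alpha>, \<beta>). \<gamma> = \<alpha> + \<beta>}.
      lift q (at_point ` star_rel F Z [dual (pt \<alpha>)]) X \<inter> lift q' (at_point ` star_rel F Z' [dual (pt \<beta>)]) X)))"
proof -
  let ?L = "\<lambda>\<alpha>. lift r (at_point ` F W [pt \<alpha>]) X"
    and ?M = "\<lambda>\<gamma>. mat.span (\<Union>(\<alpha>, \<beta>)\<in>{(\<alpha>, \<beta>). \<gamma> = \<alpha> + \<beta>}.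
      lift q (at_point ` star_rel F Z [dual (pt \<alpha>)]) X \<inter> lift q' (at_point ` star_rel F Z' [dual (pt \<beta>)]) X)"
  let ?t0 = "dist_term \<X> F k l"
    and ?t1 = "Fn (star_rel dist_plus) [dual_qset dists, dual_qset dists] (dual_qset dists)
          [dist_term_star \<X> F m n, dist_term_star \<X> F m' n'] :: ('v, ennreal) trm"
  let ?R = "hat [dists] dists (dist_le :: ('v, ennreal) brel)"
  define ys' where "ys' = [new_var 0 [] ?t0, new_star 0 [] ?t0, new_var 1 [] ?t1, new_star 1 [] ?t1]"
  define c' :: "ennreal \<Rightarrow> ennreal \<Rightarrow> ('v, ennreal) atom list" where "c' = (\<lambda>\<alpha> \<beta>. [pt \<alpha>, dual (pt \<alpha>), dual (pt \<beta>), pt \<beta>])"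
  have sorts: "sort_of ?t0 = dists" "sort_of ?t1 = dual_qset dists" by (simp_all add: dist_term_def)
  have le: "binary_relation [dists] [dists] (dist_le :: ('v, ennreal) brel)"
    using binary_relation_classical [of "[UNIV]" "[UNIV]"] unfolding dist_le_def by simp
  have R: "?R [pt \<alpha>, dual (pt \<gamma>)] [] = {0} \<longleftrightarrow> \<not> \<alpha> \<le> \<gamma>" for \<alpha> \<gamma>
  proof -
    have "?R [pt \<alpha>, dual (pt \<gamma>)] [] = flat ` dist_le [pt \<alpha>] [pt \<gamma>]"
      by (subst hat_eq [OF le]) (auto simp: range_pt set_Cons_def finite_sorts(3) in_dual_qset)
    also have "dist_le [pt \<alpha>] [pt \<gamma>] = (if \<alpha> \<le> \<gamma> then ops [pt \<alpha>] [pt \<gamma> :: ('v, ennreal) atom] else {0})"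
      using classical_rel_pt [of "[UNIV]" "[UNIV]" "\<lambda>a b. a ! 0 \<le> b ! 0" "[\<alpha>]" "[\<gamma>]"]
      by (simp add: dist_le_def set_Cons_def cong: if_cong)
    finally show ?thesis
      using flat_points_iff [of "[pt \<alpha> :: ('v, ennreal) atom]" "pt \<gamma>" "\<alpha> \<le> \<gamma>"] by simp
  qed
  have "has_value (atomic [] ?R [?t0, ?t1]) [] xs [] X
    (mat.span (\<Union>(\<beta>, \<alpha>)\<in>{(\<beta>, \<alpha>). ?R [pt \<alpha>, dual (pt \<beta>)] [] \<noteq> {0}}. ?L \<alpha> \<inter> ?M \<beta>))"
  proof (rule has_value_atomic2 [where ys' = ys' and c' = c'])
    show "context_at [] xs [] X" by (rule ctx)
    show "sort_of ?t0 = range pt" "sort_of ?t1 = range (\<lambda>\<beta>. dual (pt \<beta>))"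
      unfolding sorts by (rule range_pt, rule range_dual_pt)
    show "binary_relation [range pt, range (\<lambda>\<beta>. dual (pt \<beta>))] [] ?R"
      using binary_relation_hat [OF le finite_sorts(3)]
      unfolding range_pt [symmetric] range_dual_pt [symmetric] by simp
    fix \<alpha> \<beta> assume ctx': "context_at ys' xs (c' \<alpha> \<beta>) X"
    show "has_value (arg_form [0] ?t0 (new_star 0 [] ?t0)) ys' xs (c' \<alpha> \<beta>) X (?L \<alpha>)"
      using ctx' vs0 r W by (intro has_value_dist_term [where Y = "dual (pt \<alpha>)"])
        (auto simp: ys'_def c'_def pos_def sorts)
    show "has_value (arg_form [1] ?t1 (new_star 1 [] ?t1)) ys' xs (c' \<alpha> \<beta>) X (?M \<beta>)"
      using ctx' vs q Z q' Z' fr by (intro has_value_plus)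
        (auto simp: ys'_def c'_def pos_def sorts fresh_def)
  qed (use fr in \<open>auto simp: ys'_def c'_def dist_term_def\<close>)
  then show ?thesis unfolding R by simp
qed

end

definition unit_form :: "'v mat" where
  "unit_form = mat_unit [] []"

lemma unit_form [simp]: "unit_form \<in> functionals []" by (simp add: unit_form_def mat_unit_ops)

lemma holds_iff:
  fixes \<phi> :: "('v::complex_inner, 'p) form"
  assumes wf: "well_formed \<phi> []"
  shows "holds \<phi> \<longleftrightarrow> unit_form \<in> interp \<phi> [] [] []"
proof
  assume "holds \<phi>"
  then show "unit_form \<in> interp \<phi> [] [] []" by (simp add: holds_def top_rel_def)
next
  assume u: "unit_form \<in> interp \<phi> [] [] []"
  have "interp \<phi> [] X Y = top_rel [] [] X Y" for X Y
  proof (cases "X = [] \<and> Y = []")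
    case True
    have s: "mat.subspace (interp \<phi> [] [] [])" "interp \<phi> [] [] [] \<subseteq> functionals ([] :: ('v, 'p) atom list)"
      using binary_relation_rowsD [OF wf, of "[]"] by simp_all
    have "functionals ([] :: ('v, 'p) atom list) = mat.span {unit_form}"
      using ops_span_units [of "[] :: ('v, 'p) atom list" "[] :: ('v, 'p) atom list"] by (simp add: unit_form_def)
    also have "\<dots> \<subseteq> interp \<phi> [] [] []" using u s(1) by (intro mat.span_minimal) auto
    finally show ?thesis using True s(2) by (simp add: top_rel_def subset_antisym)
  next
    case False
    then show ?thesis using wf by (auto simp add: binary_relation_def top_rel_def)
  qed
  then show "holds \<phi>" unfolding holds_def by blast
qed

lemma well_formed_atomic2: "\<not> (is_Var t0 \<and> is_Var t1) \<Longrightarrow> well_formed (atomic p R [t0, t1]) xs"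
  unfolding atomic2 by (rule well_formed_Ex_eq)

context
  fixes \<X> :: "('v::complex_inner, ennreal) qset" and F :: "'v drel"
  assumes F: "binary_relation [\<X>, dual_qset \<X>] [dists] F"
    and fin: "\<And>x. x \<in> \<X> \<Longrightarrow> finite (atom_basis x)"
begin

lemma in_interp_All_diag:
  assumes "distinct (var \<X> n # var_star \<X> n # xs)" "fin_vars xs"
    and "well_formed \<phi> (var \<X> n # var_star \<X> n # xs)" "X \<in> listset (map snd xs)"
  shows "s \<in> interp (All_diag \<X> n \<phi>) xs X [] \<longleftrightarrow> s \<in> functionals X \<and>
    (\<forall>X0\<in>\<X>. eps X0 s \<in> interp \<phi> (var \<X> n # var_star \<X> n # xs) (X0 # dual X0 # X) [])"
  unfolding All_diag_def
  by (subst in_interp_All_eq [OF assms(1)])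
    (use assms finite_sorts(1,2) [OF F fin] in \<open>auto simp: var_def var_star_def\<close>)

lemma well_formed_All_diag: "well_formed (All_diag \<X> n \<phi>) xs"
  unfolding All_diag_def by (rule well_formed_All_eq)

lemma holds_refl_formula:
  "holds (refl_formula \<X> F) \<longleftrightarrow>
    (\<forall>x\<in>\<X>. eps x unit_form \<in> lift [0, 1] (fiber F x x 0) [x, dual x])"
proof -
  let ?\<phi> = "atomic [] (eq_rel dists) [dist_term \<X> F 1 1, zero_star_term]"
  let ?xs = "[var \<X> 1, var_star \<X> 1]"
  have "interp ?\<phi> ?xs [x, dual x] [] = lift [0, 1] (fiber F x x 0) [x, dual x]" if x: "x \<in> \<X>" for x
  proof (rule interp_eq_value(1) [OF has_value_dist_zero [OF F fin]])
    show "context_at [] ?xs [] [x, dual x]"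
      using x finite_sorts(1,2) [OF F fin] by (auto simp: context_at_def var_def var_star_def set_Cons_def in_dual_qset)
  qed (auto simp: pos_def var_def var_star_def fresh_def)
  moreover have wf: "well_formed ?\<phi> ?xs" by (rule well_formed_atomic2) (simp add: dist_term_def)
  have "unit_form \<in> interp (All_diag \<X> 1 ?\<phi>) [] [] [] \<longleftrightarrow> (unit_form :: 'v mat) \<in> functionals ([] :: ('v, ennreal) atom list) \<and>
     (\<forall>x\<in>\<X>. eps x unit_form \<in> interp ?\<phi> ?xs [x, dual x] [])"
    using wf by (intro in_interp_All_diag) (auto simp: var_def var_star_def)
  ultimately show ?thesis
    unfolding refl_formula_def holds_iff [OF well_formed_All_diag] by simp
qed

lemma holds_sym_formula:
  "holds (sym_formula \<X> F) \<longleftrightarrow>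
    (\<forall>x\<in>\<X>. \<forall>y\<in>\<X>. eps y (eps x unit_form) \<in>
      mat.span (\<Union>\<alpha>. lift [2, 1] (fiber F x y \<alpha>) [y, dual y, x, dual x] \<inter>
        lift [0, 3] (fiber F y x \<alpha>) [y, dual y, x, dual x]))"
proof -
  let ?\<phi> = "atomic [] (eq_rel dists) [dist_term \<X> F 1 2,
        Fn (conj_fun UNIV) [dists] (dual_qset dists) [dist_term \<X> F 2 1]]"
  let ?xs = "[var \<X> 2, var_star \<X> 2, var \<X> 1, var_star \<X> 1]"
  have v: "interp ?\<phi> ?xs [y, dual y, x, dual x] [] =
      mat.span (\<Union>\<alpha>. lift [2, 1] (fiber F x y \<alpha>) [y, dual y, x, dual x] \<inter>
        lift [0, 3] (fiber F y x \<alpha>) [y, dual y, x, dual x])"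
    if x: "x \<in> \<X>" and y: "y \<in> \<X>" for x y
  proof (rule interp_eq_value(1) [OF has_value_sym [OF F fin]])
    show "context_at [] ?xs [] [y, dual y, x, dual x]"
      using x y finite_sorts(1,2) [OF F fin] by (auto simp: context_at_def var_def var_star_def set_Cons_def in_dual_qset)
  qed (auto simp: pos_def var_def var_star_def fresh_def)
  have wf: "well_formed ?\<phi> ?xs" by (rule well_formed_atomic2) (simp add: dist_term_def)
  have in1: "s \<in> interp (All_diag \<X> 2 ?\<phi>) [var \<X> 1, var_star \<X> 1] [x, dual x] [] \<longleftrightarrow> s \<in> functionals [x, dual x] \<and>
     (\<forall>y\<in>\<X>. eps y s \<in> interp ?\<phi> ?xs [y, dual y, x, dual x] [])" if "x \<in> \<X>" for x s
    using wf that finite_sorts(1,2) [OF F fin]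
    by (intro in_interp_All_diag) (auto simp: var_def var_star_def set_Cons_def in_dual_qset)
  have in2: "unit_form \<in> interp (All_diag \<X> 1 (All_diag \<X> 2 ?\<phi>)) [] [] [] \<longleftrightarrow> (unit_form :: 'v mat) \<in> functionals ([] :: ('v, ennreal) atom list) \<and>
     (\<forall>x\<in>\<X>. eps x unit_form \<in> interp (All_diag \<X> 2 ?\<phi>) [var \<X> 1, var_star \<X> 1] [x, dual x] [])"
    by (intro in_interp_All_diag well_formed_All_diag) (auto simp: var_def var_star_def)
  show ?thesis
    unfolding sym_formula_def holds_iff [OF well_formed_All_diag] in2
    using in1 v by (auto intro: eps_functionals)
qed

lemma holds_triangle_formula:
  "holds (triangle_formula \<X> F) \<longleftrightarrow>
    (\<forall>x\<in>\<X>. \<forall>y\<in>\<X>. \<forall>z\<in>\<X>. eps z (eps y (eps x unit_form)) \<in>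
      mat.span (\<Union>(\<gamma>, \<alpha>)\<in>{(\<gamma>, \<alpha>). \<alpha> \<le> \<gamma>}. lift [4, 3] (fiber F x y \<alpha>) [z, dual z, y, dual y, x, dual x] \<inter>
        mat.span (\<Union>(\<alpha>, \<beta>)\<in>{(\<alpha>, \<beta>). \<gamma> = \<alpha> + \<beta>}.
          lift [5, 0] (at_point ` star_rel F [dual x, z] [dual (pt \<alpha>)]) [z, dual z, y, dual y, x, dual x] \<inter>
          lift [1, 2] (at_point ` star_rel F [dual z, y] [dual (pt \<beta>)]) [z, dual z, y, dual y, x, dual x])))"
proof -
  let ?\<phi> = "atomic [] (hat [dists] dists dist_le)
       [dist_term \<X> F 1 2,
        Fn (star_rel dist_plus) [dual_qset dists, dual_qset dists] (dual_qset dists)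
          [dist_term_star \<X> F 1 3, dist_term_star \<X> F 3 2]]"
  let ?xs = "[var \<X> 3, var_star \<X> 3, var \<X> 2, var_star \<X> 2, var \<X> 1, var_star \<X> 1]"
  have v: "interp ?\<phi> ?xs [z, dual z, y, dual y, x, dual x] [] =
      mat.span (\<Union>(\<gamma>, \<alpha>)\<in>{(\<gamma>, \<alpha>). \<alpha> \<le> \<gamma>}. lift [4, 3] (fiber F x y \<alpha>) [z, dual z, y, dual y, x, dual x] \<inter>
        mat.span (\<Union>(\<alpha>, \<beta>)\<in>{(\<alpha>, \<beta>). \<gamma> = \<alpha> + \<beta>}.
          lift [5, 0] (at_point ` star_rel F [dual x, z] [dual (pt \<alpha>)]) [z, dual z, y, dual y, x, dual x] \<inter>
          lift [1, 2] (at_point ` star_rel F [dual z, y] [dual (pt \<beta>)]) [z, dual z, y, dual y, x, dual x]))"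
    if x: "x \<in> \<X>" and y: "y \<in> \<X>" and z: "z \<in> \<X>" for x y z
  proof (rule interp_eq_value(1) [OF has_value_triangle [OF F fin]])
    show "context_at [] ?xs [] [z, dual z, y, dual y, x, dual x]"
      using x y z finite_sorts(1,2) [OF F fin] by (auto simp: context_at_def var_def var_star_def set_Cons_def in_dual_qset)
  qed (auto simp: pos_def var_def var_star_def fresh_def)
  have wf: "well_formed ?\<phi> ?xs" by (rule well_formed_atomic2) (simp add: dist_term_def)
  have in0: "s \<in> interp (All_diag \<X> 3 ?\<phi>) [var \<X> 2, var_star \<X> 2, var \<X> 1, var_star \<X> 1] [y, dual y, x, dual x] [] \<longleftrightarrow>
     s \<in> functionals [y, dual y, x, dual x] \<and>
     (\<forall>z\<in>\<X>. eps z s \<in> interp ?\<phi> ?xs [z, dual z, y, dual y, x, dual x] [])" if "x \<in> \<X>" "y \<in> \<X>" for x y s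
    using wf that finite_sorts(1,2) [OF F fin]
    by (intro in_interp_All_diag) (auto simp: var_def var_star_def set_Cons_def in_dual_qset)
  have in1: "s \<in> interp (All_diag \<X> 2 (All_diag \<X> 3 ?\<phi>)) [var \<X> 1, var_star \<X> 1] [x, dual x] [] \<longleftrightarrow> s \<in> functionals [x, dual x] \<and>
     (\<forall>y\<in>\<X>. eps y s \<in> interp (All_diag \<X> 3 ?\<phi>) [var \<X> 2, var_star \<X> 2, var \<X> 1, var_star \<X> 1] [y, dual y, x, dual x] [])"
    if "x \<in> \<X>" for x s using that finite_sorts(1,2) [OF F fin]
    by (intro in_interp_All_diag well_formed_All_diag) (auto simp: var_def var_star_def set_Cons_def in_dual_qset)
  have in2: "unit_form \<in> interp (All_diag \<X> 1 (All_diag \<X> 2 (All_diag \<X> 3 ?\<phi>))) [] [] [] \<longleftrightarrow> (unit_form :: 'v mat) \<in> functionals ([] :: ('v, ennreal) atom list) \<and>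
     (\<forall>x\<in>\<X>. eps x unit_form \<in> interp (All_diag \<X> 2 (All_diag \<X> 3 ?\<phi>)) [var \<X> 1, var_star \<X> 1] [x, dual x] [])"
    by (intro in_interp_All_diag well_formed_All_diag) (auto simp: var_def var_star_def)
  have ef: "eps x unit_form \<in> functionals [x, dual x]"
    "eps y (eps x unit_form) \<in> functionals [y, dual y, x, dual x]" for x y :: "('v, ennreal) atom"
    by (intro eps_functionals unit_form)+
  show ?thesis
    unfolding triangle_formula_def holds_iff [OF well_formed_All_diag] in2
    using in0 in1 v ef by simp
qed

lemma holds_separation_formula:
  "holds (separation_formula \<X> F) \<longleftrightarrow>
    (\<forall>x\<in>\<X>. \<forall>y\<in>\<X>. lift [1, 0] (fiber F x y 0) [dual y, x] \<subseteq>
      lift [1, 0] (eq_rel \<X> [x, dual y] []) [dual y, x])"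
proof -
  let ?\<phi> = "atomic [] (eq_rel dists) [dist_term \<X> F 1 2, zero_star_term]"
  let ?\<psi> = "atomic [] (eq_rel \<X>) [Var (var \<X> 1), Var (var_star \<X> 2)]"
  let ?xs = "[var_star \<X> 2, var \<X> 1]"
  have psi: "?\<psi> = Rel (eq_rel \<X>) [var \<X> 1, var_star \<X> 2]"
    using atomic_Vars [of "[]" "eq_rel \<X>" "[var \<X> 1, var_star \<X> 2]"] by simp
  have d: "distinct ?xs" by (simp add: var_def var_star_def)
  have fv: "fin_vars ?xs" using finite_sorts(1,2) [OF F fin] by (auto simp: var_def var_star_def)
  have p: "pos [var \<X> 1, var_star \<X> 2] ?xs = [1, 0]" by (simp add: pos_def var_def var_star_def)
  have R: "binary_relation (map snd [var \<X> 1, var_star \<X> 2]) [] (eq_rel \<X>)"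
    using binary_relation_eq_rel [of \<X>] by (simp add: var_def var_star_def)
  have wf: "well_formed ?\<phi> ?xs" by (rule well_formed_atomic2) (simp add: dist_term_def)
  have wf': "well_formed ?\<psi> ?xs" unfolding psi using d R fv by (intro well_formed_Rel) auto
  have mem: "[dual y, x] \<in> listset (map snd ?xs)" if "x \<in> \<X>" "y \<in> \<X>" for x y
    using that by (auto simp: var_def var_star_def set_Cons_def in_dual_qset)
  have v: "interp ?\<phi> ?xs [dual y, x] [] = lift [1, 0] (fiber F x y 0) [dual y, x]"
    if x: "x \<in> \<X>" and y: "y \<in> \<X>" for x y
  proof (rule interp_eq_value(1) [OF has_value_dist_zero [OF F fin]])
    show "context_at [] ?xs [] [dual y, x]" using d fv mem [OF x y] by (auto simp: context_at_def)
  qed (auto simp: pos_def var_def var_star_def fresh_def)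
  have v': "interp ?\<psi> ?xs [dual y, x] [] = lift [1, 0] (eq_rel \<X> [x, dual y] []) [dual y, x]"
    if x: "x \<in> \<X>" and y: "y \<in> \<X>" for x y
  proof -
    have "set [var \<X> 1, var_star \<X> 2] \<subseteq> set ?xs" by auto
    from interp_rel_lift [OF d this R mem [OF x y] fin_vars_atoms [OF fv mem [OF x y]]]
    show ?thesis unfolding psi interp.simps p by simp
  qed
  have Impl: "(\<forall>t0\<in>functionals [dual y]. \<forall>t1\<in>functionals [x]. mat_tensor 1 0 t0 (mat_tensor 1 0 t1 unit_form) \<in>
        interp (Impl ?\<phi> ?\<psi>) ?xs [dual y, x] []) \<longleftrightarrow> interp ?\<phi> ?xs [dual y, x] [] \<subseteq> interp ?\<psi> ?xs [dual y, x] []"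
    (is "?l \<longleftrightarrow> ?P \<subseteq> ?Q")
    if x: "x \<in> \<X>" and y: "y \<in> \<X>" for x y
  proof -
    note fa = fin_vars_atoms [OF fv mem [OF x y]]
    note P = binary_relation_rowsD [OF wf mem [OF x y]]
    have fb: "finite (basis [dual y, x])" "finite (basis ([] :: ('v, ennreal) atom list))"
      using fin_atoms_basis [OF fa] by simp_all
    note I = in_interp_Impl [OF wf wf' mem [OF x y] fa]
    show ?thesis
    proof
      assume l: ?l
      have sub: "functionals [dual y, x] \<subseteq> interp (Impl ?\<phi> ?\<psi>) ?xs [dual y, x] []"
        unfolding ops_span_units [OF fb, symmetric]
      proof (intro mat.span_minimal subsetI)
        show "mat.subspace (interp (Impl ?\<phi> ?\<psi>) ?xs [dual y, x] [])"
          using binary_relation_rowsD(2) [OF well_formed_Impl mem [OF x y]] .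
        fix s assume "s \<in> (\<lambda>(i, j). mat_unit i j) ` (basis [] \<times> basis [dual y, x])"
        then obtain e e' where s: "s = mat_unit [] [e, e']" "e \<in> atom_basis y" "e' \<in> atom_basis x"
          by (auto simp: basis_Cons)
        have "s = mat_tensor 1 0 (mat_unit [] [e]) (mat_tensor 1 0 (mat_unit [] [e']) unit_form)"
        proof (intro ext)
          fix i j show "s i j = mat_tensor 1 0 (mat_unit [] [e]) (mat_tensor 1 0 (mat_unit [] [e']) unit_form) i j"
            by (cases j; cases "tl j") (auto simp: s mat_tensor_def mat_unit_def unit_form_def)
        qed
        moreover have "mat_unit [] [e] \<in> functionals [dual y]" "mat_unit [] [e'] \<in> functionals [x]"
          using s by (auto intro!: mat_unit_ops)
        ultimately show "s \<in> interp (Impl ?\<phi> ?\<psi>) ?xs [dual y, x] []" using l by blast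
      qed
      show "?P \<subseteq> ?Q"
      proof
        fix s assume s: "s \<in> ?P"
        then have "s \<in> interp (Impl ?\<phi> ?\<psi>) ?xs [dual y, x] []" using P(1) sub by blast
        then obtain u where u: "u \<in> ?P" "u \<in> ?Q" "\<forall>a\<in>?P. hs [dual y, x] [] a (s - u) = 0"
          unfolding I by blast
        have "s = u" using projection_unique [OF fb P(2,1) s _ u(1,3)] by simp
        then show "s \<in> ?Q" using u by simp
      qed
    next
      assume sub: "?P \<subseteq> ?Q"
      show ?l
      proof (intro ballI)
        fix t0 t1 assume t: "t0 \<in> functionals [dual y]" "t1 \<in> functionals [x]"
        have tf: "mat_tensor 1 0 t0 (mat_tensor 1 0 t1 unit_form) \<in> functionals [dual y, x]"
          by (intro tensor_functionals t unit_form)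
        obtain u where "u \<in> ?P" "\<forall>a\<in>?P. hs [dual y, x] [] a (mat_tensor 1 0 t0 (mat_tensor 1 0 t1 unit_form) - u) = 0"
          using orthogonal_projection [OF fb P(2,1)] by blast
        then show "mat_tensor 1 0 t0 (mat_tensor 1 0 t1 unit_form) \<in> interp (Impl ?\<phi> ?\<psi>) ?xs [dual y, x] []"
          unfolding I using tf sub by blast
      qed
    qed
  qed
  have tx: "mat_tensor 1 0 t1 (unit_form :: 'v mat) \<in> functionals [x]" if "t1 \<in> functionals [x]" for t1 and x :: "('v, ennreal) atom"
    using that unit_form by (rule tensor_functionals)
  have in0: "s \<in> interp (All (var_star \<X> 2) (Impl ?\<phi> ?\<psi>)) [var \<X> 1] [x] [] \<longleftrightarrow> s \<in> functionals [x] \<and>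
      (\<forall>y\<in>\<X>. \<forall>t\<in>functionals [dual y]. mat_tensor 1 0 t s \<in> interp (Impl ?\<phi> ?\<psi>) ?xs [dual y, x] [])"
    if "x \<in> \<X>" for x s
    by (subst in_interp_All [OF well_formed_Impl]) (use that in \<open>auto simp: var_def var_star_def dual_qset_def\<close>)
  have in1: "unit_form \<in> interp (All (var \<X> 1) (All (var_star \<X> 2) (Impl ?\<phi> ?\<psi>))) [] [] [] \<longleftrightarrow>
      (\<forall>x\<in>\<X>. \<forall>t\<in>functionals [x]. mat_tensor 1 0 t unit_form \<in> interp (All (var_star \<X> 2) (Impl ?\<phi> ?\<psi>)) [var \<X> 1] [x] [])"
    by (subst in_interp_All [OF well_formed_All]) (auto simp: var_def simp del: interp.simps)
  have "holds (separation_formula \<X> F) \<longleftrightarrow> (\<forall>x\<in>\<X>. \<forall>y\<in>\<X>. interp ?\<phi> ?xs [dual y, x] [] \<subseteq> interp ?\<psi> ?xs [dual y, x] [])"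
    unfolding separation_formula_def holds_iff [OF well_formed_All] in1
    using in0 tx Impl by (simp del: interp.simps) blast
  then show ?thesis using v v' by simp
qed

end

section \<open>Functions into the distances as orthogonal decompositions\<close>

definition decomposition ::
  "('v::complex_inner, 'p) atom list \<Rightarrow> ('v, 'p) atom list \<Rightarrow> (ennreal \<Rightarrow> 'v mat set) \<Rightarrow> bool" where
  "decomposition X Y D \<longleftrightarrow>
     (\<forall>\<alpha>. mat.subspace (D \<alpha>) \<and> D \<alpha> \<subseteq> ops X Y) \<and>
     (\<forall>\<alpha> \<beta>. \<alpha> \<noteq> \<beta> \<longrightarrow> (\<forall>a\<in>D \<alpha>. \<forall>b\<in>D \<beta>. hs X Y a b = 0)) \<and>
     ops X Y \<subseteq> mat.span (\<Union>\<alpha>. D \<alpha>)"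

lemma decompositionD:
  assumes "decomposition X Y D"
  shows "mat.subspace (D \<alpha>)" "D \<alpha> \<subseteq> ops X Y" "ops X Y \<subseteq> mat.span (\<Union>\<alpha>. D \<alpha>)"
    "\<alpha> \<noteq> \<beta> \<Longrightarrow> a \<in> D \<alpha> \<Longrightarrow> b \<in> D \<beta> \<Longrightarrow> hs X Y a b = 0"
  using assms by (auto simp: decomposition_def)

definition off_factor :: "nat list \<Rightarrow> ('v::complex_inner, 'p) atom list \<Rightarrow> ('v option list \<Rightarrow> complex) \<Rightarrow> bool" where
  "off_factor p X G \<longleftrightarrow> (\<forall>j\<in>basis X. \<forall>k\<in>basis X. agree_off p X j k \<longrightarrow> G j = G k)"

text \<open>The functional \<open>f\<close> on the factors \<open>p\<close> times \<open>G\<close>, where \<open>G\<close> is meant to depend on the other factors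
  only.\<close>

definition product_with :: "nat list \<Rightarrow> ('v::complex_inner, 'p) atom list \<Rightarrow> 'v mat \<Rightarrow> ('v option list \<Rightarrow> complex) \<Rightarrow> 'v mat" where
  "product_with p X f G = (\<lambda>i j. if i = [] \<and> j \<in> basis X then f [] (permute p j) * G j else 0)"

lemma product_with_functionals: "product_with p X f G \<in> functionals X" by (auto simp: product_with_def in_rows)

lemma product_with_in_lift:
  assumes U: "mat.subspace U" "f \<in> U" and G: "off_factor p X G"
  shows "product_with p X f G \<in> lift p U X"
  unfolding lift_def
proof (intro CollectI conjI ballI product_with_functionals)
  fix k assume k: "k \<in> basis X"
  show "\<exists>r\<in>U. \<forall>j\<in>basis X. agree_off p X j k \<longrightarrow>
      product_with p X f G [] j = r [] (permute p j)"
  proof (intro bexI [of _ "mat_scale (G k) f"] ballI impI)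
    fix j assume "j \<in> basis X" "agree_off p X j k"
    note j = this
    then have "G j = G k" using G k unfolding off_factor_def by blast
    then show "product_with p X f G [] j = mat_scale (G k) f [] (permute p j)"
      using j(1) by (simp add: product_with_def mat_scale_def)
  qed (intro mat.subspace_scale U)
qed

lemma bij_betw_fiber:
  assumes p: "distinct p" "\<forall>k\<in>set p. k < length X" and k: "k \<in> basis X"
  shows "bij_betw (permute p) {j \<in> basis X. agree_off p X j k} (basis (permute p X))"
    (is "bij_betw _ ?A _")
  unfolding bij_betw_def
proof
  show "inj_on (permute p) ?A"
  proof (rule inj_onI)
    fix j j' assume j: "j \<in> ?A" "j' \<in> ?A" and e: "permute p j = permute p j'"
    have "j ! i = j' ! i" if "i < length X" for i using j e that by (cases "i \<in> set p") (auto simp: permute_def)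
    then show "j = j'" using j by (intro nth_equalityI) (auto simp: basis_iff)
  qed
  show "permute p ` ?A = basis (permute p X)"
  proof (intro subset_antisym image_subsetI subsetI)
    fix l assume l: "l \<in> basis (permute p X)"
    define idx where "idx i = length (takeWhile (\<lambda>x. x \<noteq> i) p)" for i
    have idx: "idx i < length p" "p ! idx i = i" if "i \<in> set p" for i
      using that index_less nth_index by (auto simp: idx_def)
    have idx': "idx (p ! m) = m" if "m < length p" for m
      using idx [of "p ! m"] p(1) that by (simp add: nth_eq_iff_index_eq)
    define j where "j = map (\<lambda>i. if i \<in> set p then l ! idx i else k ! i) [0..<length X]"
    have "j ! i \<in> atom_basis (X ! i)" if i: "i < length X" for i
    proof (cases "i \<in> set p")
      case True
      then have "l ! idx i \<in> atom_basis (permute p X ! idx i)" using l idx by (simp add: basis_iff)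
      then show ?thesis using True idx i by (simp add: j_def permute_def)
    next
      case False
      then show ?thesis using k i by (simp add: j_def basis_iff)
    qed
    then have "j \<in> ?A" by (simp add: basis_iff j_def)
    moreover have "permute p j = l" using l p(2) idx' by (intro nth_equalityI) (auto simp: permute_def j_def basis_iff)
    ultimately show "l \<in> permute p ` ?A" by blast
  qed (use p permute_basis in blast)
qed

text \<open>The sum over the basis is split according to the coordinates outside \<open>p\<close>; on each part it is a
  multiple of the inner product of \<open>f\<close> with a slice of \<open>s\<close>.\<close>

lemma hs_product_lift:
  assumes p: "distinct p" "\<forall>k\<in>set p. k < length X" and fin: "fin_atoms X" and G: "off_factor p X G"
    and s: "s \<in> lift p U X" and f: "\<And>u. u \<in> U \<Longrightarrow> hs (permute p X) [] f u = 0"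
  shows "hs X [] (product_with p X f G) s = 0"
proof -
  define q where "q = filter (\<lambda>i. i \<notin> set p) [0..<length X]"
  have agree: "permute q j = permute q k \<longleftrightarrow> agree_off p X j k" for j k :: "'a option list"
    by (auto simp: permute_def q_def)
  have fb: "finite (basis X)" using fin by (rule fin_atoms_basis)
  have "hs X [] (product_with p X f G) s = (\<Sum>j\<in>basis X. cnj (f [] (permute p j) * G j) * s [] j)"
    by (simp add: hs_rows product_with_def)
  also have "\<dots> = (\<Sum>\<kappa>\<in>permute q ` basis X. \<Sum>j\<in>{j \<in> basis X. permute q j = \<kappa>}. cnj (f [] (permute p j) * G j) * s [] j)"
    using fb by (intro sum.group [symmetric]) auto
  also have "\<dots> = 0"
  proof (rule sum.neutral, rule ballI)
    fix \<kappa> assume "\<kappa> \<in> permute q ` basis X"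
    then obtain k where k: "k \<in> basis X" "\<kappa> = permute q k" by blast
    let ?A = "{j \<in> basis X. agree_off p X j k}"
    obtain r where r: "r \<in> U" "\<forall>j\<in>basis X. agree_off p X j k \<longrightarrow> s [] j = r [] (permute p j)"
      using liftD [OF s k(1)] by blast
    have "(\<Sum>j\<in>{j \<in> basis X. permute q j = \<kappa>}. cnj (f [] (permute p j) * G j) * s [] j) =
      (\<Sum>j\<in>?A. cnj (G k) * (cnj (f [] (permute p j)) * r [] (permute p j)))"
    proof (rule sum.cong)
      show "{j \<in> basis X. permute q j = \<kappa>} = ?A" by (simp add: k(2) agree)
      fix j assume j: "j \<in> ?A"
      then have "G j = G k" using G k(1) unfolding off_factor_def by blast
      then show "cnj (f [] (permute p j) * G j) * s [] j = cnj (G k) * (cnj (f [] (permute p j)) * r [] (permute p j))"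
        using r(2) j by simp
    qed
    also have "\<dots> = cnj (G k) * (\<Sum>l\<in>basis (permute p X). cnj (f [] l) * r [] l)"
      unfolding sum_distrib_left [symmetric]
      using sum.reindex_bij_betw [OF bij_betw_fiber [OF p k(1)], of "\<lambda>l. cnj (f [] l) * r [] l"] by simp
    also have "\<dots> = 0" using f [OF r(1)] by (simp add: hs_rows)
    finally show "(\<Sum>j\<in>{j \<in> basis X. permute q j = \<kappa>}. cnj (f [] (permute p j) * G j) * s [] j) = 0" .
  qed
  finally show ?thesis .
qed

lemma permute_determines_off_factor:
  assumes "set p \<inter> set q = {}" "\<forall>k\<in>set q. k < length X"
  shows "off_factor p X (\<lambda>j. g (permute q j))"
  unfolding off_factor_def
proof (intro ballI impI)
  fix j k :: "'a option list" assume "agree_off p X j k"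
  then have "permute q j = permute q k" using assms unfolding permute_def map_eq_conv by blast
  then show "g (permute q j) = g (permute q k)" by simp
qed

lemma off_factor_mult: "off_factor p X G \<Longrightarrow> off_factor p X H \<Longrightarrow> off_factor p X (\<lambda>j. G j * H j)"
  unfolding off_factor_def by metis

lemma units_in_span:
  assumes "decomposition X [] D" "j \<in> basis X"
  shows "mat_unit [] j \<in> mat.span (\<Union>\<alpha>. D \<alpha>)"
  using decompositionD(3) [OF assms(1)] mat_unit_ops [of "[]" "[]" j X] assms(2) by auto

lemma permute_eq_iff:
  assumes "length j = length k" "\<forall>i<length k. i \<in> set p"
  shows "permute p j = permute p k \<longleftrightarrow> j = k"
  using assms by (auto simp: permute_def intro: nth_equalityI)

text \<open>Products of \<open>f \<in> D \<alpha>\<close> and \<open>g \<in> E \<beta>\<close> lie in the span if \<open>\<alpha> = \<beta>\<close> and are orthogonal to it otherwise, and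
  all such products span; so they can serve as tests.\<close>

lemma lift_meet_2:
  assumes p: "distinct p" "distinct q" "set p \<inter> set q = {}" "set p \<union> set q = {..<length X}"
    and fin: "fin_atoms X"
    and D: "decomposition (permute p X) [] D" and E: "decomposition (permute q X) [] E"
    and r: "r \<in> functionals X"
  shows "r \<in> mat.span (\<Union>\<alpha>. lift p (D \<alpha>) X \<inter> lift q (E \<alpha>) X) \<longleftrightarrow>
    (\<forall>\<alpha> \<beta>. \<alpha> \<noteq> \<beta> \<longrightarrow> (\<forall>f\<in>D \<alpha>. \<forall>g\<in>E \<beta>. hs X [] (product_with p X f (\<lambda>j. g [] (permute q j))) r = 0))"
proof -
  let ?m = "\<lambda>f g. product_with p X f (\<lambda>j. g [] (permute q j))"
  have pl: "\<forall>k\<in>set p. k < length X" "\<forall>k\<in>set q. k < length X" using p(4) by auto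
  define P where "P = (\<lambda>(\<alpha>, \<beta>). {?m f g | f g. f \<in> D \<alpha> \<and> g \<in> E \<beta>})"
  define S where "S = mat.span (\<Union>\<alpha>. lift p (D \<alpha>) X \<inter> lift q (E \<alpha>) X)"
  have swap: "?m f g = product_with q X g (\<lambda>j. f [] (permute p j))" for f g
    by (simp add: product_with_def mult.commute fun_eq_iff)
  have off: "off_factor p X (\<lambda>j. g [] (permute q j))" "off_factor q X (\<lambda>j. f [] (permute p j))" for f g :: "'a mat"
    using p pl by (auto intro: permute_determines_off_factor)
  have "r \<in> S \<longleftrightarrow> (\<forall>i. \<not> (fst i = snd i) \<longrightarrow> (\<forall>m\<in>P i. hs X [] m r = 0))"
  proof (rule orthogonal_test)
    show "finite (basis X)" "finite (basis ([] :: ('a, 'b) atom list))" using fin_atoms_basis [OF fin] by auto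
    show "mat.subspace S" by (simp add: S_def)
    show "S \<subseteq> functionals X" unfolding S_def by (intro mat.span_minimal subspace_ops) (use lift_rows in blast)
    show "P i \<subseteq> S" if ii: "fst i = snd i" for i
    proof
      fix m assume mP: "m \<in> P i"
      obtain \<alpha> where i: "i = (\<alpha>, \<alpha>)" using ii by (cases i) auto
      then obtain f g where m: "m = ?m f g" "f \<in> D (fst i)" "g \<in> E (fst i)" using mP by (auto simp: P_def)
      have "m \<in> lift p (D (fst i)) X"
        unfolding m(1) by (intro product_with_in_lift off m decompositionD(1) [OF D])
      moreover have "m \<in> lift q (E (fst i)) X"
        unfolding m(1) swap by (intro product_with_in_lift off m decompositionD(1) [OF E])
      ultimately show "m \<in> S" unfolding S_def by (intro mat.span_base) blast
    qed
    show "hs X [] m s = 0" if i: "\<not> fst i = snd i" and m: "m \<in> P i" and s: "s \<in> S" for i m s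
    proof -
      obtain f g where m: "m = ?m f g" "f \<in> D (fst i)" "g \<in> E (snd i)"
        using m by (auto simp: P_def split: prod.splits)
      have "hs X [] t m = 0" if "t \<in> lift p (D \<alpha>) X" "t \<in> lift q (E \<alpha>) X" for t \<alpha>
      proof (cases "\<alpha> = fst i")
        case True
        then have "hs (permute q X) [] g u = 0" if "u \<in> E \<alpha>" for u
          using decompositionD(4) [OF E] m(3) that i by metis
        then have "hs X [] m t = 0"
          unfolding m(1) swap using that pl by (intro hs_product_lift p fin off) auto
        then show ?thesis by (simp add: hs_eq_0_commute)
      next
        case False
        then have "hs (permute p X) [] f u = 0" if "u \<in> D \<alpha>" for u
          using decompositionD(4) [OF D] m(2) that by metis
        then have "hs X [] m t = 0"
          unfolding m(1) using that pl by (intro hs_product_lift p fin off) auto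
        then show ?thesis by (simp add: hs_eq_0_commute)
      qed
      then have "hs X [] t m = 0" if "t \<in> (\<Union>\<alpha>. lift p (D \<alpha>) X \<inter> lift q (E \<alpha>) X)" for t using that by blast
      then have "hs X [] s m = 0" using hs_span_0 [OF s [unfolded S_def]] by blast
      then show ?thesis by (simp add: hs_eq_0_commute)
    qed
    show "functionals X \<subseteq> mat.span (\<Union>i. P i)"
    proof -
      have "mat_unit [] k \<in> mat.span (\<Union>i. P i)" if k: "k \<in> basis X" for k
      proof -
        have "mat_unit [] k = ?m (mat_unit [] (permute p k)) (mat_unit [] (permute q k))"
        proof (intro ext)
          fix i j
          have "permute p j = permute p k \<and> permute q j = permute q k \<longleftrightarrow> j = k" if "j \<in> basis X"
            using permute_eq_iff [of j k "p @ q"] that k p(4) by (auto simp: permute_append basis_length set_eq_iff)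
          then show "mat_unit [] k i j = ?m (mat_unit [] (permute p k)) (mat_unit [] (permute q k)) i j"
            using k by (auto simp: mat_unit_def product_with_def)
        qed
        moreover have "?m (mat_unit [] (permute p k)) (mat_unit [] (permute q k)) \<in>
            mat.span {?m a b | a b. a \<in> (\<Union>\<alpha>. D \<alpha>) \<and> b \<in> (\<Union>\<alpha>. E \<alpha>)}"
          using units_in_span [OF D permute_basis [OF k pl(1)]] units_in_span [OF E permute_basis [OF k pl(2)]]
          by (rule span_bilinear) (auto simp: product_with_def mat_scale_def fun_eq_iff algebra_simps)
        moreover have "{?m a b | a b. a \<in> (\<Union>\<alpha>. D \<alpha>) \<and> b \<in> (\<Union>\<alpha>. E \<alpha>)} \<subseteq> (\<Union>i. P i)"
          by (auto simp: P_def)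
        ultimately show ?thesis by (metis (no_types, lifting) mat.span_mono subsetD)
      qed
      then have "(\<lambda>(i, j). mat_unit i j) ` (basis ([] :: ('a, 'b) atom list) \<times> basis X) \<subseteq> mat.span (\<Union>i. P i)"
        by auto
      from mat.span_minimal [OF this mat.subspace_span] show ?thesis
        using ops_span_units [of X "[]"] fin_atoms_basis [OF fin] by simp
    qed
  qed (rule r)
  then show ?thesis unfolding S_def P_def by (simp add: Ball_def) blast
qed

lemma span_trilinear:
  assumes x: "x \<in> mat.span A" and y: "y \<in> mat.span B" and z: "z \<in> mat.span C"
    and 1: "\<And>u v w t. (h :: 'a mat \<Rightarrow> 'b mat \<Rightarrow> 'c mat \<Rightarrow> 'd mat) (u + v) w t = h u w t + h v w t" "\<And>c u w t. h (mat_scale c u) w t = mat_scale c (h u w t)"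
    and 2: "\<And>u v w t. h w (u + v) t = h w u t + h w v t" "\<And>c u w t. h w (mat_scale c u) t = mat_scale c (h w u t)"
    and 3: "\<And>u v w t. h w t (u + v) = h w t u + h w t v" "\<And>c u w t. h w t (mat_scale c u) = mat_scale c (h w t u)"
  shows "h x y z \<in> mat.span {h a b c | a b c. a \<in> A \<and> b \<in> B \<and> c \<in> C}" (is "_ \<in> ?S")
proof -
  have z0: "h w t 0 = 0" for w t using 3(2) [of w t 0 0] by simp
  have "h x y c \<in> ?S" if "c \<in> C" for c
  proof -
    have "h x y c \<in> mat.span {h a b c | a b. a \<in> A \<and> b \<in> B}"
      by (rule span_bilinear [OF x y, of "\<lambda>a b. h a b c"]) (simp_all add: 1 2)
    also have "\<dots> \<subseteq> ?S" using that by (intro mat.span_mono) blast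
    finally show ?thesis .
  qed
  then have "mat.span C \<subseteq> {z. h x y z \<in> ?S}" by (intro mat.span_minimal mat.subspaceI)
      (auto simp: z0 3 intro: mat.span_add mat.span_scale mat.span_zero)
  then show ?thesis using z by blast
qed

text \<open>The same argument for products of three functionals: such a product lies in the span if
  \<open>\<alpha> \<le> \<beta> + \<delta>\<close> and is orthogonal to it otherwise.\<close>

lemma lift_meet_3:
  assumes p: "distinct p" "distinct q" "distinct l" "set p \<inter> set q = {}" "set p \<inter> set l = {}" "set q \<inter> set l = {}"
      "set p \<union> set q \<union> set l = {..<length X}"
    and fin: "fin_atoms X"
    and D: "decomposition (permute p X) [] D" and E: "decomposition (permute q X) [] E"
    and H: "decomposition (permute l X) [] H"
    and r: "r \<in> functionals X"
  shows "r \<in> mat.span (\<Union>(\<gamma>, \<alpha>)\<in>{(\<gamma>, \<alpha>). \<alpha> \<le> \<gamma>}. lift p (D \<alpha>) X \<inter>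
      mat.span (\<Union>(\<beta>, \<delta>)\<in>{(\<beta>, \<delta>). \<gamma> = \<beta> + \<delta>}. lift q (E \<beta>) X \<inter> lift l (H \<delta>) X)) \<longleftrightarrow>
    (\<forall>\<alpha> \<beta> \<delta>. \<not> \<alpha> \<le> \<beta> + \<delta> \<longrightarrow> (\<forall>f\<in>D \<alpha>. \<forall>g\<in>E \<beta>. \<forall>h\<in>H \<delta>.
       hs X [] (product_with p X f (\<lambda>j. g [] (permute q j) * h [] (permute l j))) r = 0))"
proof -
  let ?m = "\<lambda>f g h. product_with p X f (\<lambda>j. g [] (permute q j) * h [] (permute l j))"
  have pl: "\<forall>k\<in>set p. k < length X" "\<forall>k\<in>set q. k < length X" "\<forall>k\<in>set l. k < length X" using p(7) by auto
  define P where "P = (\<lambda>(\<alpha>, \<beta>, \<delta>). {?m f g h | f g h. f \<in> D \<alpha> \<and> g \<in> E \<beta> \<and> h \<in> H \<delta>})"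
  define M where "M \<gamma> = mat.span (\<Union>(\<beta>, \<delta>)\<in>{(\<beta>, \<delta>). \<gamma> = \<beta> + \<delta>}. lift q (E \<beta>) X \<inter> lift l (H \<delta>) X)" for \<gamma>
  define S where "S = mat.span (\<Union>(\<gamma>, \<alpha>)\<in>{(\<gamma>, \<alpha>). \<alpha> \<le> \<gamma>}. lift p (D \<alpha>) X \<inter> M \<gamma>)"
  have swap: "?m f g h = product_with q X g (\<lambda>j. f [] (permute p j) * h [] (permute l j))"
    "?m f g h = product_with l X h (\<lambda>j. f [] (permute p j) * g [] (permute q j))" for f g h
    by (simp_all add: product_with_def mult_ac fun_eq_iff)
  have "set q \<inter> set p = {}" "set l \<inter> set p = {}" "set l \<inter> set q = {}" using p by auto
  note pq = this
  have off: "off_factor p X (\<lambda>j. g [] (permute q j) * h [] (permute l j))"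
    "off_factor q X (\<lambda>j. f [] (permute p j) * h [] (permute l j))"
    "off_factor l X (\<lambda>j. f [] (permute p j) * g [] (permute q j))" for f g h :: "'a mat"
    by (intro off_factor_mult permute_determines_off_factor p pl pq)+
  have "r \<in> S \<longleftrightarrow> (\<forall>i. \<not> (case i of (\<alpha>, \<beta>, \<delta>) \<Rightarrow> \<alpha> \<le> \<beta> + \<delta>) \<longrightarrow> (\<forall>m\<in>P i. hs X [] m r = 0))"
  proof (rule orthogonal_test)
    show "finite (basis X)" "finite (basis ([] :: ('a, 'b) atom list))" using fin_atoms_basis [OF fin] by auto
    show "mat.subspace S" by (simp add: S_def)
    show "S \<subseteq> functionals X" unfolding S_def by (intro mat.span_minimal subspace_ops) (use lift_rows in blast)
    show "P i \<subseteq> S" if i: "case i of (\<alpha>, \<beta>, \<delta>) \<Rightarrow> \<alpha> \<le> \<beta> + \<delta>" for i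
    proof
      fix m assume mP: "m \<in> P i"
      obtain \<alpha> \<beta> \<delta> where i': "i = (\<alpha>, \<beta>, \<delta>)" by (cases i) auto
      obtain f g h where m: "m = ?m f g h" "f \<in> D \<alpha>" "g \<in> E \<beta>" "h \<in> H \<delta>"
        using mP by (auto simp: P_def i')
      have "m \<in> lift p (D \<alpha>) X"
        unfolding m(1) by (intro product_with_in_lift off m decompositionD(1) [OF D])
      moreover have "m \<in> lift q (E \<beta>) X"
        unfolding m(1) swap(1) by (intro product_with_in_lift off m decompositionD(1) [OF E])
      moreover have "m \<in> lift l (H \<delta>) X"
        unfolding m(1) swap(2) by (intro product_with_in_lift off m decompositionD(1) [OF H])
      ultimately have "m \<in> lift p (D \<alpha>) X \<inter> M (\<beta> + \<delta>)"
        unfolding M_def by (intro IntI mat.span_base) auto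
      then show "m \<in> S" using i unfolding S_def i' by (intro mat.span_base) auto
    qed
    show "hs X [] m s = 0" if i: "\<not> (case i of (\<alpha>, \<beta>, \<delta>) \<Rightarrow> \<alpha> \<le> \<beta> + \<delta>)" and mP: "m \<in> P i" and s: "s \<in> S" for i m s
    proof -
      obtain \<alpha> \<beta> \<delta> where i': "i = (\<alpha>, \<beta>, \<delta>)" by (cases i) auto
      obtain f g h where m: "m = ?m f g h" "f \<in> D \<alpha>" "g \<in> E \<beta>" "h \<in> H \<delta>"
        using mP by (auto simp: P_def i')
      have oD: "hs X [] t m = 0" if "t \<in> lift p (D \<alpha>') X" "\<alpha> \<noteq> \<alpha>'" for t \<alpha>'
      proof -
        have "hs (permute p X) [] f u = 0" if "u \<in> D \<alpha>'" for u
          using decompositionD(4) [OF D \<open>\<alpha> \<noteq> \<alpha>'\<close> m(2) that] .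
        then have "hs X [] m t = 0"
          unfolding m(1) using that pl by (intro hs_product_lift p fin off) auto
        then show ?thesis by (simp add: hs_eq_0_commute)
      qed
      have oE: "hs X [] t m = 0" if "t \<in> lift q (E \<beta>') X" "\<beta> \<noteq> \<beta>'" for t \<beta>'
      proof -
        have "hs (permute q X) [] g u = 0" if "u \<in> E \<beta>'" for u
          using decompositionD(4) [OF E \<open>\<beta> \<noteq> \<beta>'\<close> m(3) that] .
        then have "hs X [] m t = 0"
          unfolding m(1) swap(1) using that pl by (intro hs_product_lift p fin off) auto
        then show ?thesis by (simp add: hs_eq_0_commute)
      qed
      have oH: "hs X [] t m = 0" if "t \<in> lift l (H \<delta>') X" "\<delta> \<noteq> \<delta>'" for t \<delta>'
      proof -
        have "hs (permute l X) [] h u = 0" if "u \<in> H \<delta>'" for u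
          using decompositionD(4) [OF H \<open>\<delta> \<noteq> \<delta>'\<close> m(4) that] .
        then have "hs X [] m t = 0"
          unfolding m(1) swap(2) using that pl by (intro hs_product_lift p fin off) auto
        then show ?thesis by (simp add: hs_eq_0_commute)
      qed
      have "hs X [] t m = 0" if "t \<in> lift p (D \<alpha>') X" "t \<in> M \<gamma>" "\<alpha>' \<le> \<gamma>" for t \<alpha>' \<gamma>
      proof (cases "\<alpha> = \<alpha>'")
        case True
        have "hs X [] u m = 0" if "u \<in> lift q (E \<beta>') X" "u \<in> lift l (H \<delta>') X" "\<gamma> = \<beta>' + \<delta>'" for u \<beta>' \<delta>'
        proof (cases "\<beta> = \<beta>'")
          case True
          then have "\<delta> \<noteq> \<delta>'" using \<open>\<alpha> = \<alpha>'\<close> \<open>\<alpha>' \<le> \<gamma>\<close> that i by (auto simp: i')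
          then show ?thesis using oH that by blast
        qed (use oE that in blast)
        then have "hs X [] u m = 0" if "u \<in> (\<Union>(\<beta>, \<delta>)\<in>{(\<beta>, \<delta>). \<gamma> = \<beta> + \<delta>}. lift q (E \<beta>) X \<inter> lift l (H \<delta>) X)" for u
          using that by blast
        then show ?thesis using hs_span_0 [OF \<open>t \<in> M \<gamma>\<close> [unfolded M_def]] by blast
      qed (use oD that in blast)
      then have "hs X [] t m = 0" if "t \<in> (\<Union>(\<gamma>, \<alpha>)\<in>{(\<gamma>, \<alpha>). \<alpha> \<le> \<gamma>}. lift p (D \<alpha>) X \<inter> M \<gamma>)" for t
        using that by blast
      then have "hs X [] s m = 0" using hs_span_0 [OF s [unfolded S_def]] by blast
      then show ?thesis by (simp add: hs_eq_0_commute)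
    qed
    show "functionals X \<subseteq> mat.span (\<Union>i. P i)"
    proof -
      have "mat_unit [] k \<in> mat.span (\<Union>i. P i)" if k: "k \<in> basis X" for k
      proof -
        have "mat_unit [] k = ?m (mat_unit [] (permute p k)) (mat_unit [] (permute q k)) (mat_unit [] (permute l k))"
        proof (intro ext)
          fix i j
          have "permute p j = permute p k \<and> permute q j = permute q k \<and> permute l j = permute l k \<longleftrightarrow> j = k" if "j \<in> basis X"
            using permute_eq_iff [of j k "p @ q @ l"] that k p(7) by (auto simp: permute_append basis_length set_eq_iff)
          then show "mat_unit [] k i j = ?m (mat_unit [] (permute p k)) (mat_unit [] (permute q k)) (mat_unit [] (permute l k)) i j"
            using k by (auto simp: mat_unit_def product_with_def)
        qed
        moreover have "?m (mat_unit [] (permute p k)) (mat_unit [] (permute q k)) (mat_unit [] (permute l k)) \<in>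
            mat.span {?m a b c | a b c. a \<in> (\<Union>\<alpha>. D \<alpha>) \<and> b \<in> (\<Union>\<alpha>. E \<alpha>) \<and> c \<in> (\<Union>\<alpha>. H \<alpha>)}"
          using units_in_span [OF D permute_basis [OF k pl(1)]] units_in_span [OF E permute_basis [OF k pl(2)]]
            units_in_span [OF H permute_basis [OF k pl(3)]]
          by (rule span_trilinear) (auto simp: product_with_def mat_scale_def fun_eq_iff algebra_simps)
        moreover have "{?m a b c | a b c. a \<in> (\<Union>\<alpha>. D \<alpha>) \<and> b \<in> (\<Union>\<alpha>. E \<alpha>) \<and> c \<in> (\<Union>\<alpha>. H \<alpha>)} \<subseteq> (\<Union>i. P i)"
        proof
          fix m assume "m \<in> {?m a b c | a b c. a \<in> (\<Union>\<alpha>. D \<alpha>) \<and> b \<in> (\<Union>\<alpha>. E \<alpha>) \<and> c \<in> (\<Union>\<alpha>. H \<alpha>)}"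
          then obtain a b c \<alpha> \<beta> \<delta> where "m = ?m a b c" "a \<in> D \<alpha>" "b \<in> E \<beta>" "c \<in> H \<delta>" by blast
          then have "m \<in> P (\<alpha>, \<beta>, \<delta>)" by (auto simp: P_def)
          then show "m \<in> (\<Union>i. P i)" by blast
        qed
        ultimately show ?thesis by (metis (no_types, lifting) mat.span_mono subsetD)
      qed
      then have "(\<lambda>(i, j). mat_unit i j) ` (basis ([] :: ('a, 'b) atom list) \<times> basis X) \<subseteq> mat.span (\<Union>i. P i)"
        by auto
      from mat.span_minimal [OF this mat.subspace_span] show ?thesis
        using ops_span_units [of X "[]"] fin_atoms_basis [OF fin] by simp
    qed
  qed (rule r)
  then show ?thesis unfolding S_def M_def P_def by (simp add: Ball_def) blast
qed

section \<open>Orthogonal decompositions and filtrations\<close>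

definition filtration ::
  "('v::complex_inner, 'p) atom list \<Rightarrow> ('v, 'p) atom list \<Rightarrow> (real \<Rightarrow> 'v mat set) \<Rightarrow> bool" where
  "filtration X Y W \<longleftrightarrow> (\<forall>\<beta>\<ge>0. mat.subspace (W \<beta>) \<and> W \<beta> \<subseteq> ops X Y) \<and>
     (\<forall>\<alpha>\<ge>0. W \<alpha> = (\<Inter>\<beta>\<in>{\<alpha><..}. W \<beta>))"

definition level :: "(ennreal \<Rightarrow> 'v mat set) \<Rightarrow> real \<Rightarrow> 'v mat set" where
  "level D \<beta> = mat.span (\<Union>\<alpha>\<in>{0..ennreal \<beta>}. D \<alpha>)"

definition graded_piece :: "('v::complex_inner, 'p) atom list \<Rightarrow> ('v, 'p) atom list \<Rightarrow> (real \<Rightarrow> 'v mat set) \<Rightarrow>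
    ennreal \<Rightarrow> 'v mat set" where
  "graded_piece X Y W \<alpha> = {r \<in> ops X Y. (\<alpha> \<noteq> \<infinity> \<longrightarrow> r \<in> W (enn2real \<alpha>)) \<and>
     (\<forall>\<beta>\<ge>0. ennreal \<beta> < \<alpha> \<longrightarrow> (\<forall>w\<in>W \<beta>. hs X Y w r = 0))}"

lemma in_span_pieces:
  assumes fin: "finite (basis X)" "finite (basis Y)" and D: "decomposition X Y D"
  shows "r \<in> mat.span (\<Union>\<alpha>\<in>I. D \<alpha>) \<longleftrightarrow> r \<in> ops X Y \<and> (\<forall>\<alpha>. \<alpha> \<notin> I \<longrightarrow> (\<forall>a\<in>D \<alpha>. hs X Y a r = 0))"
proof -
  note D' = decompositionD [OF D]
  have sub: "mat.span (\<Union>\<alpha>\<in>I. D \<alpha>) \<subseteq> ops X Y"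
    using D'(2) by (intro mat.span_minimal subspace_ops) blast
  have "r \<in> mat.span (\<Union>\<alpha>\<in>I. D \<alpha>) \<longleftrightarrow> (\<forall>\<alpha>. \<not> \<alpha> \<in> I \<longrightarrow> (\<forall>a\<in>D \<alpha>. hs X Y a r = 0))" if r: "r \<in> ops X Y"
  proof (rule orthogonal_test [OF fin mat.subspace_span sub D'(3) _ _ r])
    show "D \<alpha> \<subseteq> mat.span (\<Union>\<alpha>\<in>I. D \<alpha>)" if "\<alpha> \<in> I" for \<alpha>
      using that by (intro subset_trans [OF _ mat.span_superset]) blast
    show "hs X Y p s = 0" if "\<alpha> \<notin> I" "p \<in> D \<alpha>" "s \<in> mat.span (\<Union>\<alpha>\<in>I. D \<alpha>)" for \<alpha> p s
    proof -
      have "hs X Y u p = 0" if u: "u \<in> (\<Union>\<alpha>\<in>I. D \<alpha>)" for u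
      proof -
        obtain \<gamma> where "\<gamma> \<in> I" "u \<in> D \<gamma>" using u by blast
        then show ?thesis using D'(4) [of \<gamma> \<alpha> u p] \<open>\<alpha> \<notin> I\<close> \<open>p \<in> D \<alpha>\<close> by blast
      qed
      then have "hs X Y s p = 0" by (rule hs_span_0 [OF that(3)])
      then show ?thesis by (simp add: hs_eq_0_commute)
    qed
  qed
  then show ?thesis using sub by blast
qed

lemma in_level:
  assumes fin: "finite (basis X)" "finite (basis Y)" and D: "decomposition X Y D"
  shows "r \<in> level D \<beta> \<longleftrightarrow> r \<in> ops X Y \<and> (\<forall>\<alpha>>ennreal \<beta>. \<forall>a\<in>D \<alpha>. hs X Y a r = 0)"
  unfolding level_def in_span_pieces [OF assms] by (auto simp: not_le)

lemma ennreal_less_real: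
  assumes "ennreal \<beta> < \<alpha>" "0 \<le> \<beta>"
  obtains \<gamma> where "\<beta> < \<gamma>" "ennreal \<gamma> < \<alpha>"
proof -
  obtain c where c: "ennreal \<beta> < c" "c < \<alpha>" using dense [OF assms(1)] by blast
  then have "c = ennreal (enn2real c)" by (metis ennreal_enn2real_if infinity_ennreal_def not_top_less)
  then show ?thesis using c that [of "enn2real c"] assms(2) by (metis ennreal_less_iff)
qed

lemma filtration_level:
  assumes fin: "finite (basis X)" "finite (basis Y)" and D: "decomposition X Y D"
  shows "filtration X Y (level D)"
  unfolding filtration_def
proof (intro conjI allI impI)
  fix \<alpha> :: real assume \<alpha>: "0 \<le> \<alpha>"
  show "mat.subspace (level D \<alpha>)" by (simp add: level_def)
  show "level D \<alpha> \<subseteq> ops X Y" using in_level [OF assms] by blast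
  show "level D \<alpha> = (\<Inter>\<beta>\<in>{\<alpha><..}. level D \<beta>)"
  proof (intro set_eqI iffI)
    fix r assume "r \<in> level D \<alpha>"
    note r = this
    show "r \<in> (\<Inter>\<beta>\<in>{\<alpha><..}. level D \<beta>)"
    proof
      fix \<beta> assume "\<beta> \<in> {\<alpha><..}"
      then have "ennreal \<alpha> \<le> ennreal \<beta>" by (intro ennreal_leI) simp
      then show "r \<in> level D \<beta>" using r unfolding in_level [OF assms] by (meson order_le_less_trans)
    qed
  next
    fix r assume r: "r \<in> (\<Inter>\<beta>\<in>{\<alpha><..}. level D \<beta>)"
    then have "r \<in> level D (\<alpha> + 1)" by simp
    moreover have "hs X Y a r = 0" if "ennreal \<alpha> < \<gamma>" "a \<in> D \<gamma>" for \<gamma> a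
    proof -
      obtain \<beta> where "\<alpha> < \<beta>" "ennreal \<beta> < \<gamma>" using ennreal_less_real [OF \<open>ennreal \<alpha> < \<gamma>\<close> \<alpha>] .
      then have "r \<in> level D \<beta>" using r by simp
      then show ?thesis using \<open>ennreal \<beta> < \<gamma>\<close> \<open>a \<in> D \<gamma>\<close> unfolding in_level [OF assms] by blast
    qed
    ultimately show "r \<in> level D \<alpha>" unfolding in_level [OF assms] by blast
  qed
qed

lemma graded_piece_level:
  assumes fin: "finite (basis X)" "finite (basis Y)" and D: "decomposition X Y D"
  shows "graded_piece X Y (level D) \<alpha> = D \<alpha>"
proof (intro set_eqI iffI)
  note D' = decompositionD [OF D]
  have lev: "D \<gamma> \<subseteq> level D (enn2real \<gamma>)" if "\<gamma> \<noteq> \<infinity>" for \<gamma>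
    using that unfolding level_def by (intro subset_trans [OF _ mat.span_superset]) (auto simp: less_top[symmetric])
  fix r
  {
    assume r: "r \<in> D \<alpha>"
    have "hs X Y w r = 0" if "0 \<le> \<beta>" "ennreal \<beta> < \<alpha>" "w \<in> level D \<beta>" for \<beta> w
      using that(3) unfolding in_level [OF fin D] using that(2) r by (auto simp: hs_eq_0_commute)
    moreover have "\<alpha> \<noteq> \<infinity> \<Longrightarrow> r \<in> level D (enn2real \<alpha>)" using r lev by blast
    ultimately show "r \<in> graded_piece X Y (level D) \<alpha>"
      using r D'(2) [of \<alpha>] unfolding graded_piece_def by blast
  next
    assume r: "r \<in> graded_piece X Y (level D) \<alpha>"
    have "hs X Y a r = 0" if "\<gamma> \<noteq> \<alpha>" "a \<in> D \<gamma>" for \<gamma> a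
    proof (cases "\<gamma> < \<alpha>")
      case True
      then have "\<gamma> \<noteq> \<infinity>" by auto
      then have "ennreal (enn2real \<gamma>) = \<gamma>" by (simp add: less_top)
      then have "ennreal (enn2real \<gamma>) < \<alpha>" using True by simp
      moreover have "a \<in> level D (enn2real \<gamma>)" using lev [OF \<open>\<gamma> \<noteq> \<infinity>\<close>] that(2) by blast
      ultimately show ?thesis using r enn2real_nonneg unfolding graded_piece_def by blast
    next
      case False
      then have "\<alpha> < \<gamma>" using that by simp
      then have "\<alpha> \<noteq> \<infinity>" by auto
      then have "r \<in> level D (enn2real \<alpha>)" "ennreal (enn2real \<alpha>) = \<alpha>"
        using r by (auto simp: graded_piece_def less_top)
      then show ?thesis using \<open>\<alpha> < \<gamma>\<close> that(2) unfolding in_level [OF fin D] by auto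
    qed
    then have "r \<in> mat.span (\<Union>\<gamma>\<in>{\<alpha>}. D \<gamma>)"
      using r unfolding in_span_pieces [OF fin D] by (auto simp: graded_piece_def)
    then show "r \<in> D \<alpha>" using span_subspace_eq [OF D'(1)] by simp
  }
qed

lemma dim_psubset:
  assumes fin: "finite (basis X)" "finite (basis Y)"
    and V: "mat.subspace V" "V \<subset> W" and W: "mat.subspace W" "W \<subseteq> ops X Y"
  shows "mat.dim V < mat.dim W"
proof -
  have "V \<subseteq> ops X Y" using V W by blast
  then obtain B where B: "finite B" "mat.independent B" "mat.span B = V"
    using subspace_finite_basis [OF fin V(1)] by blast
  obtain C where C: "finite C" "mat.independent C" "mat.span C = W" using subspace_finite_basis [OF fin W] by blast
  obtain x where x: "x \<in> W" "x \<notin> V" using V(2) by blast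
  then have "mat.independent (insert x B)" using B by (intro mat.independent_insertI) auto
  moreover have "insert x B \<subseteq> mat.span C" using x V(2) B(3) C(3) mat.span_superset by blast
  ultimately have "card (insert x B) \<le> card C" using mat.independent_span_bound [OF C(1)] by blast
  moreover have "x \<notin> B" using x B(3) mat.span_superset by blast
  ultimately have "card B < card C" using B(1) by simp
  then show ?thesis
    using mat.dim_span_eq_card_independent [OF B(2)] mat.dim_span_eq_card_independent [OF C(2)] B(3) C(3) by simp
qed

lemma filtration_mono:
  assumes "filtration X Y W" "0 \<le> \<alpha>" "\<alpha> \<le> \<beta>"
  shows "W \<alpha> \<subseteq> W \<beta>"
proof (cases "\<alpha> = \<beta>")
  case False
  then have "\<beta> \<in> {\<alpha><..}" using assms by simp
  then show ?thesis using assms(1,2) unfolding filtration_def by blast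
qed simp

text \<open>In finite dimension a right continuous filtration jumps only finitely often.  By induction on the
  dimension of \<open>W \<alpha>\<close>: at the first index \<open>a\<close> with \<open>W a = W \<alpha>\<close>, an element splits into its projection to the
  span of the earlier spaces, which are smaller, and a part in the piece at \<open>a\<close>.  The index \<open>a\<close> exists
  by right continuity.\<close>

lemma graded_piece_decomposition:
  assumes fin: "finite (basis X)" "finite (basis Y)" and W: "filtration X Y W"
  shows "decomposition X Y (graded_piece X Y W)"
    and "0 \<le> \<beta> \<Longrightarrow> level (graded_piece X Y W) \<beta> = W \<beta>"
proof -
  let ?D = "graded_piece X Y W"
  define full where "full \<alpha> = (if \<alpha> = \<infinity> then ops X Y else W (enn2real \<alpha>))" for \<alpha>
  have Ws: "mat.subspace (W \<beta>)" "W \<beta> \<subseteq> ops X Y" if "0 \<le> \<beta>" for \<beta>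
    using W that unfolding filtration_def by blast+
  have fs: "mat.subspace (full \<alpha>)" "full \<alpha> \<subseteq> ops X Y" for \<alpha>
    using Ws [of "enn2real \<alpha>"] subspace_ops [of X Y] by (simp_all add: full_def)
  have mono: "full \<alpha> \<subseteq> full \<beta>" if "\<alpha> \<le> \<beta>" for \<alpha> \<beta>
  proof (cases "\<beta> = \<infinity>")
    case True
    then show ?thesis using fs by (simp add: full_def)
  next
    case False
    then have "\<alpha> \<noteq> \<infinity>" using that by (auto simp: top_unique)
    moreover have "enn2real \<alpha> \<le> enn2real \<beta>"
      using that False by (intro enn2real_mono) (auto simp: less_top)
    ultimately show ?thesis using False filtration_mono [OF W, of "enn2real \<alpha>" "enn2real \<beta>"] by (simp add: full_def)
  qed
  have full_real: "full (ennreal \<beta>) = W \<beta>" if "0 \<le> \<beta>" for \<beta>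
    using that by (simp add: full_def)
  have D: "?D \<alpha> = {r \<in> full \<alpha>. \<forall>\<beta>\<ge>0. ennreal \<beta> < \<alpha> \<longrightarrow> (\<forall>w\<in>W \<beta>. hs X Y w r = 0)}" for \<alpha>
    using Ws(2) [of "enn2real \<alpha>"] by (auto simp: graded_piece_def full_def)
  have sub: "mat.subspace (?D \<alpha>)" for \<alpha> using fs(1) [of \<alpha>] unfolding D
    by (intro mat.subspaceI) (auto simp: hs_add hs_scale mat.subspace_0 mat.subspace_add mat.subspace_scale)
  have orth: "hs X Y a b = 0" if "\<alpha> < \<beta>" "a \<in> ?D \<alpha>" "b \<in> ?D \<beta>" for \<alpha> \<beta> a b
  proof -
    have "\<alpha> \<noteq> \<infinity>" using that(1) by auto
    then have "a \<in> W (enn2real \<alpha>)" "ennreal (enn2real \<alpha>) = \<alpha>"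
      using that(2) by (auto simp: graded_piece_def less_top)
    moreover from this have "ennreal (enn2real \<alpha>) < \<beta>" using that(1) by simp
    ultimately show ?thesis using that(3) enn2real_nonneg unfolding graded_piece_def by blast
  qed
  have exhaust: "full \<alpha> \<subseteq> mat.span (\<Union>\<alpha>'\<in>{0..\<alpha>}. ?D \<alpha>')" for \<alpha>
  proof (induction "mat.dim (full \<alpha>)" arbitrary: \<alpha> rule: less_induct)
    case less
    define a where "a = Inf {\<alpha>'. full \<alpha>' = full \<alpha>}"
    have a\<alpha>: "a \<le> \<alpha>" unfolding a_def by (intro Inf_lower) simp
    have fa: "full a = full \<alpha>"
    proof (cases "a = \<alpha>")
      case False
      then have "a < \<alpha>" using a\<alpha> by simp
      then have afin: "a \<noteq> \<infinity>" by auto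
      have "full \<alpha> \<subseteq> W \<beta>" if "enn2real a < \<beta>" for \<beta>
      proof -
        have "a < ennreal \<beta>"
          using that afin by (metis enn2real_nonneg ennreal_enn2real ennreal_less_iff infinity_ennreal_def less_top)
        then obtain \<alpha>' where "full \<alpha>' = full \<alpha>" "\<alpha>' < ennreal \<beta>"
          unfolding a_def Inf_less_iff by blast
        moreover have "0 \<le> \<beta>" using that enn2real_nonneg [of a] by linarith
        ultimately show ?thesis using mono [of \<alpha>' "ennreal \<beta>"] full_real by auto
      qed
      moreover have "W (enn2real a) = (\<Inter>\<beta>\<in>{enn2real a<..}. W \<beta>)"
        using W enn2real_nonneg unfolding filtration_def by blast
      ultimately have "full \<alpha> \<subseteq> full a" using afin by (auto simp: full_def [of a])
      then show ?thesis using mono [OF a\<alpha>] by blast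
    qed simp
    have IH: "W \<beta> \<subseteq> mat.span (\<Union>\<alpha>'\<in>{0..\<alpha>}. ?D \<alpha>')" if "0 \<le> \<beta>" "ennreal \<beta> < a" for \<beta>
    proof -
      have "full (ennreal \<beta>) \<noteq> full \<alpha>"
      proof
        assume "full (ennreal \<beta>) = full \<alpha>"
        then have "a \<le> ennreal \<beta>" unfolding a_def by (intro Inf_lower) simp
        then show False using that by simp
      qed
      moreover have le: "ennreal \<beta> \<le> \<alpha>" using that(2) a\<alpha> by (metis less_imp_le order_trans)
      ultimately have "full (ennreal \<beta>) \<subset> full \<alpha>" using mono by blast
      then have "mat.dim (full (ennreal \<beta>)) < mat.dim (full \<alpha>)" by (intro dim_psubset [OF fin fs(1) _ fs])
      then have "full (ennreal \<beta>) \<subseteq> mat.span (\<Union>\<alpha>'\<in>{0..ennreal \<beta>}. ?D \<alpha>')" by (rule less)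
      also have "\<dots> \<subseteq> mat.span (\<Union>\<alpha>'\<in>{0..\<alpha>}. ?D \<alpha>')"
        using le by (intro mat.span_mono UN_mono) auto
      finally show ?thesis using full_real that by simp
    qed
    define L where "L = (\<Union>\<beta>\<in>{\<beta>. 0 \<le> \<beta> \<and> ennreal \<beta> < a}. W \<beta>)"
    have "L \<subseteq> full a"
      unfolding L_def using mono full_real by (fastforce dest: less_imp_le)
    then have Lf: "mat.span L \<subseteq> full a" using fs by (intro mat.span_minimal)
    have Ls: "mat.span L \<subseteq> mat.span (\<Union>\<alpha>'\<in>{0..\<alpha>}. ?D \<alpha>')"
      unfolding L_def using IH by (intro mat.span_minimal mat.subspace_span) blast
    show ?case
    proof
      fix r assume r: "r \<in> full \<alpha>"
      obtain u where u: "u \<in> mat.span L" "\<forall>b\<in>mat.span L. hs X Y b (r - u) = 0"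
        using orthogonal_projection [OF fin mat.subspace_span, of L r] Lf fs(2) by blast
      have "r - u \<in> full a" using r u(1) Lf fa by (intro mat.subspace_diff fs) auto
      moreover have "hs X Y w (r - u) = 0" if "0 \<le> \<beta>" "ennreal \<beta> < a" "w \<in> W \<beta>" for \<beta> w
        using u(2) that by (auto simp: L_def intro: mat.span_base)
      ultimately have "r - u \<in> ?D a" unfolding D by blast
      then have "r - u \<in> mat.span (\<Union>\<alpha>'\<in>{0..\<alpha>}. ?D \<alpha>')"
        using a\<alpha> by (intro mat.span_base) auto
      moreover have "u \<in> mat.span (\<Union>\<alpha>'\<in>{0..\<alpha>}. ?D \<alpha>')" using u(1) Ls by blast
      ultimately have "(r - u) + u \<in> mat.span (\<Union>\<alpha>'\<in>{0..\<alpha>}. ?D \<alpha>')" by (rule mat.span_add)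
      then show "r \<in> mat.span (\<Union>\<alpha>'\<in>{0..\<alpha>}. ?D \<alpha>')" by simp
    qed
  qed
  show "decomposition X Y ?D"
    unfolding decomposition_def
  proof (intro conjI allI impI ballI)
    show "mat.subspace (?D \<alpha>)" "?D \<alpha> \<subseteq> ops X Y" for \<alpha>
      using sub by (auto simp: graded_piece_def)
    show "hs X Y a b = 0" if "\<alpha> \<noteq> \<beta>" "a \<in> ?D \<alpha>" "b \<in> ?D \<beta>" for \<alpha> \<beta> a b
      using orth [of \<alpha> \<beta> a b] orth [of \<beta> \<alpha> b a] that by (auto simp: hs_eq_0_commute neq_iff)
    have "ops X Y \<subseteq> mat.span (\<Union>\<alpha>'\<in>{0..\<infinity>}. ?D \<alpha>')" using exhaust [of \<infinity>] by (simp add: full_def)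
    also have "\<dots> \<subseteq> mat.span (\<Union>\<alpha>. ?D \<alpha>)" by (intro mat.span_mono) blast
    finally show "ops X Y \<subseteq> mat.span (\<Union>\<alpha>. ?D \<alpha>)" .
  qed
  show "level ?D \<beta> = W \<beta>" if \<beta>: "0 \<le> \<beta>"
  proof
    show "W \<beta> \<subseteq> level ?D \<beta>" using exhaust [of "ennreal \<beta>"] \<beta> by (simp add: level_def full_real)
    have "?D \<alpha> \<subseteq> W \<beta>" if "\<alpha> \<le> ennreal \<beta>" for \<alpha>
      using mono [OF that] full_real [OF \<beta>] unfolding D by blast
    then show "level ?D \<beta> \<subseteq> W \<beta>"
      unfolding level_def using Ws [OF \<beta>] by (intro mat.span_minimal UN_least) auto
  qed
qed

section \<open>Distance functions in terms of their components\<close>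

text \<open>The spaces \<open>R\<^sub>\<alpha>(x, y)\<close> of the correspondence between functions and pseudometrics.\<close>

definition component :: "'v::complex_inner drel \<Rightarrow> ('v, ennreal) atom \<Rightarrow> ('v, ennreal) atom \<Rightarrow> ennreal \<Rightarrow> 'v mat set" where
  "component F x y \<alpha> = {r \<in> ops [x] [y]. flat r \<in> fiber F x y \<alpha>}"

lemma flat_pair: "flat r [] [a, b] = r [b] [a]" by (simp add: flat_def)

lemma basis_single: "basis [x] = (\<lambda>e. [e]) ` atom_basis x" by (auto simp: basis_Cons)

lemma hs_flat: "hs [x, dual y] [] (flat a) (flat b) = hs [x] [y] a b"
  unfolding hs_rows sum_basis_Cons by (simp add: hs_eq sum_basis_Cons flat_pair)

lemma flat_in_functionals: "r \<in> ops [x] [y] \<Longrightarrow> flat r \<in> functionals [x, dual y]"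
  using flat_functionals [of r "[x]" y] by simp

lemma inj_on_flat: "inj_on flat (ops [x] [y])"
proof (rule inj_onI, rule ops_ext)
  fix a b :: "'a mat" and i j assume "flat a = flat b" "i \<in> basis [y]" "j \<in> basis [x]"
  then show "a i j = b i j" by (auto simp: basis_single simp flip: flat_pair)
qed

lemma flat_surj: "flat ` ops [x] [y] = functionals [x, dual y]"
proof (intro subset_antisym image_subsetI flat_in_functionals subsetI)
  fix s assume s: "s \<in> functionals [x, dual y]"
  define r where "r = (\<lambda>(i :: 'a option list) j. if i \<in> basis [y] \<and> j \<in> basis [x] then s [] (j @ i) else 0)"
  have "r \<in> ops [x] [y]" by (auto simp: r_def ops_def)
  moreover have "flat r = s"
  proof (rule rows_ext [OF flat_in_functionals s])
    fix j assume "j \<in> basis [x, dual y]"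
    then show "flat r [] j = s [] j" by (auto simp: basis_Cons flat_pair r_def)
  qed fact
  ultimately show "s \<in> flat ` ops [x] [y]" by blast
qed

definition pt_row :: "'v mat \<Rightarrow> 'v mat" where
  "pt_row s = (\<lambda>i j. if i = [None] then s [] j else 0)"

lemma linear_at_point: "linear_map at_point" by (rule linear_mapI) (auto simp: at_point_def mat_scale_def fun_eq_iff)

lemma linear_pt_row: "linear_map pt_row" by (rule linear_mapI) (auto simp: pt_row_def mat_scale_def fun_eq_iff)

lemma at_point_pt_row: "s \<in> functionals Z \<Longrightarrow> at_point (pt_row s) = s"
  by (auto simp: at_point_def pt_row_def in_rows fun_eq_iff)

lemma pt_row_at_point: "f \<in> ops Z [pt \<alpha>] \<Longrightarrow> pt_row (at_point f) = f"
  by (auto simp: at_point_def pt_row_def ops_def basis_single fun_eq_iff)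

lemma pt_row_ops: "s \<in> functionals Z \<Longrightarrow> pt_row s \<in> ops Z [pt \<alpha>]"
  by (auto simp: pt_row_def ops_def split: if_splits)

lemma at_point_functionals: "f \<in> ops Z [pt \<alpha>] \<Longrightarrow> at_point f \<in> functionals Z"
  by (auto simp: at_point_def ops_def split: if_splits)

lemma decomposition_flat:
  assumes "decomposition [x] [y] D"
  shows "decomposition [x, dual y] [] (\<lambda>\<alpha>. flat ` D \<alpha>)"
  unfolding decomposition_def
proof (intro conjI allI impI ballI)
  note D = decompositionD [OF assms]
  show "mat.subspace (flat ` D \<alpha>)" for \<alpha> by (intro linear_map_subspace linear_flat D)
  show "flat ` D \<alpha> \<subseteq> functionals [x, dual y]" for \<alpha> using D(2) flat_in_functionals by blast
  show "hs [x, dual y] [] a b = 0" if "\<alpha> \<noteq> \<beta>" "a \<in> flat ` D \<alpha>" "b \<in> flat ` D \<beta>" for \<alpha> \<beta> a b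
    using that D(4) by (auto simp: hs_flat)
  show "functionals [x, dual y] \<subseteq> mat.span (\<Union>\<alpha>. flat ` D \<alpha>)"
    unfolding image_UN [symmetric] linear_map_span [OF linear_flat] flat_surj [symmetric] using D(3) by blast
qed

lemma decomposition_unflat:
  assumes "decomposition [x, dual y] [] U"
  shows "decomposition [x] [y] (\<lambda>\<alpha>. {r \<in> ops [x] [y]. flat r \<in> U \<alpha>})"
    (is "decomposition _ _ ?D")
  unfolding decomposition_def
proof (intro conjI allI impI ballI)
  note D = decompositionD [OF assms]
  have "flat 0 = (0 :: 'a mat)" "flat (a + b) = flat a + flat b" "flat (mat_scale c a) = mat_scale c (flat a)"
    for a b :: "'a mat" and c using linear_flat linear_map_0 [OF linear_flat] unfolding linear_map_def by blast+
  note lin = this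
  show "mat.subspace (?D \<alpha>)" for \<alpha> using D(1) [of \<alpha>] subspace_ops [of "[x]" "[y]"]
    unfolding mat.subspace_def mem_Collect_eq by (simp add: lin)
  show "hs [x] [y] a b = 0" if "\<alpha> \<noteq> \<beta>" "a \<in> ?D \<alpha>" "b \<in> ?D \<beta>" for \<alpha> \<beta> a b
    using that D(4) [of \<alpha> \<beta> "flat a" "flat b"] hs_flat [of x y a b] by simp
  show "ops [x] [y] \<subseteq> mat.span (\<Union>\<alpha>. ?D \<alpha>)"
  proof
    fix r assume r: "r \<in> ops [x] [y]"
    have U: "U \<alpha> = flat ` ?D \<alpha>" for \<alpha>
    proof -
      have "flat ` ?D \<alpha> = flat ` ops [x] [y] \<inter> U \<alpha>" by auto
      then show ?thesis unfolding flat_surj using D(2) [of \<alpha>] by simp blast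
    qed
    have "flat r \<in> flat ` mat.span (\<Union>\<alpha>. ?D \<alpha>)"
      using D(3) flat_in_functionals [OF r] unfolding linear_map_span [OF linear_flat, symmetric] image_UN U [symmetric] by blast
    then obtain r' where r': "r' \<in> mat.span (\<Union>\<alpha>. ?D \<alpha>)" "flat r = flat r'" by blast
    have "mat.span (\<Union>\<alpha>. ?D \<alpha>) \<subseteq> ops [x] [y]" by (intro mat.span_minimal subspace_ops) auto
    then have "r = r'" using r r' inj_onD [OF inj_on_flat] by blast
    then show "r \<in> mat.span (\<Union>\<alpha>. ?D \<alpha>)" using r' by simp
  qed
qed auto

lemma hs_mat_star: "hs X Y (mat_star a) (mat_star b) = cnj (hs X Y a b)" by (simp add: hs_eq mat_star_def)

lemma mat_star_span:
  assumes "s \<in> mat.span S"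
  shows "mat_star s \<in> mat.span (mat_star ` S)"
proof -
  have a: "mat_star (0 :: 'a mat) = 0" "mat_star (a + b) = mat_star a + mat_star b" "mat_star (mat_scale c a) = mat_scale (cnj c) (mat_star a)"
    for a b :: "'a mat" and c by (auto simp: mat_star_def mat_scale_def fun_eq_iff)
  have "mat.span S \<subseteq> {s. mat_star s \<in> mat.span (mat_star ` S)}"
    by (intro mat.span_minimal mat.subspaceI) (auto simp: a mat.span_zero intro: mat.span_add mat.span_scale mat.span_base)
  then show ?thesis using assms by blast
qed

lemma decomposition_star:
  assumes "decomposition X Y D"
  shows "decomposition X Y (\<lambda>\<alpha>. mat_star ` D \<alpha>)"
  unfolding decomposition_def
proof (intro conjI allI impI ballI)
  note D = decompositionD [OF assms]
  show "mat.subspace (mat_star ` D \<alpha>)" for \<alpha>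
  proof (rule mat.subspaceI)
    show "0 \<in> mat_star ` D \<alpha>"
      using mat.subspace_0 [OF D(1)] by (intro image_eqI [of _ _ 0]) (auto simp: mat_star_def fun_eq_iff)
    show "a + b \<in> mat_star ` D \<alpha>" if "a \<in> mat_star ` D \<alpha>" "b \<in> mat_star ` D \<alpha>" for a b
      using that mat.subspace_add [OF D(1)]
      by (elim imageE) (rule image_eqI [rotated], assumption, auto simp: mat_star_def fun_eq_iff)
    show "mat_scale c a \<in> mat_star ` D \<alpha>" if "a \<in> mat_star ` D \<alpha>" for c a
      using that mat.subspace_scale [OF D(1), of _ _ "cnj c"]
      by (elim imageE) (rule image_eqI [rotated], assumption, auto simp: mat_star_def mat_scale_def fun_eq_iff)
  qed
  have st: "mat_star ` ops X Y = ops X Y" by (rule star_ops)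
  then show "mat_star ` D \<alpha> \<subseteq> ops X Y" for \<alpha> using D(2) [of \<alpha>] by blast
  show "hs X Y a b = 0" if "\<alpha> \<noteq> \<beta>" "a \<in> mat_star ` D \<alpha>" "b \<in> mat_star ` D \<beta>" for \<alpha> \<beta> a b
    using that D(4) by (auto simp: hs_mat_star)
  show "ops X Y \<subseteq> mat.span (\<Union>\<alpha>. mat_star ` D \<alpha>)"
  proof
    fix s assume "s \<in> ops X Y"
    then obtain t where t: "t \<in> ops X Y" "s = mat_star t" using st by blast
    then have "t \<in> mat.span (\<Union>\<alpha>. D \<alpha>)" using D(3) by blast
    then show "s \<in> mat.span (\<Union>\<alpha>. mat_star ` D \<alpha>)"
      unfolding t(2) image_UN [symmetric] by (rule mat_star_span)
  qed
qed

text \<open>The operator \<open>f\<^sup>\<dagger> g\<close>.\<close>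

definition dyad :: "'v mat \<Rightarrow> 'v mat \<Rightarrow> 'v mat" where
  "dyad f g = (\<lambda>k l. cnj (f [] k) * g [] l)"

lemma dyad_ops: "f \<in> functionals Z \<Longrightarrow> g \<in> functionals Z \<Longrightarrow> dyad f g \<in> ops Z Z"
  by (auto simp: dyad_def ops_def)

lemma hs_dyad: "hs Z Z (dyad f g) (dyad f' g') = hs Z [] f' f * hs Z [] g g'"
proof -
  have "hs Z Z (dyad f g) (dyad f' g') = (\<Sum>l\<in>basis Z. (cnj (g [] l) * g' [] l) * (\<Sum>k\<in>basis Z. cnj (f' [] k) * f [] k))"
    unfolding hs_eq dyad_def sum_distrib_left by (intro sum.cong refl) (simp add: mult_ac)
  also have "\<dots> = (\<Sum>l\<in>basis Z. cnj (g [] l) * g' [] l) * (\<Sum>k\<in>basis Z. cnj (f' [] k) * f [] k)"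
    by (rule sum_distrib_right [symmetric])
  finally show ?thesis by (simp add: hs_rows mult.commute)
qed

lemma hs_dyad_one:
  assumes "finite (basis Z)"
  shows "hs Z Z (dyad f g) (mat_one Z) = hs Z [] g f"
proof -
  have "hs Z Z (dyad f g) (mat_one Z) = (\<Sum>l\<in>basis Z. \<Sum>k\<in>basis Z. if k = l then cnj (g [] l) * f [] l else 0)"
    unfolding hs_eq dyad_def mat_one_def by (intro sum.cong refl) (auto simp: mult_ac)
  then show ?thesis using assms by (simp add: hs_rows)
qed

text \<open>A functional orthogonal to all \<open>U \<alpha>\<close> is annihilated by the dyads on the left-hand side, so if the
  identity is in their span, the functional is zero.  Conversely, dyads of elements of different spaces
  are orthogonal to the identity, which makes \<open>orthogonal_test\<close> applicable.\<close>

lemma one_in_span_dyads: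
  assumes fin: "finite (basis Z)" and U: "\<And>\<alpha>. mat.subspace (U \<alpha>)" "\<And>\<alpha>. U \<alpha> \<subseteq> functionals Z"
    and orth: "\<And>\<alpha> \<beta> a b. \<alpha> \<noteq> \<beta> \<Longrightarrow> a \<in> U \<alpha> \<Longrightarrow> b \<in> U \<beta> \<Longrightarrow> hs Z [] a b = 0"
  shows "mat_one Z \<in> mat.span (\<Union>\<alpha>::ennreal. {dyad f g | f g. f \<in> U \<alpha> \<and> g \<in> U \<alpha>}) \<longleftrightarrow>
    functionals Z \<subseteq> mat.span (\<Union>\<alpha>. U \<alpha>)"
proof
  have f0: "finite (basis ([] :: ('a, 'b) atom list))" by simp
  assume one: "mat_one Z \<in> mat.span (\<Union>\<alpha>. {dyad f g | f g. f \<in> U \<alpha> \<and> g \<in> U \<alpha>})"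
  have "t = 0" if t: "t \<in> perp Z [] (\<Union>\<alpha>. U \<alpha>)" for t
  proof -
    have "mat.span (\<Union>\<alpha>. {dyad f g | f g. f \<in> U \<alpha> \<and> g \<in> U \<alpha>}) \<subseteq> {M. \<forall>l. (\<Sum>k\<in>basis Z. t [] k * M k l) = 0}"
    proof (intro mat.span_minimal mat.subspaceI subsetI)
      fix M assume "M \<in> (\<Union>\<alpha>. {dyad f g | f g. f \<in> U \<alpha> \<and> g \<in> U \<alpha>})"
      then obtain f g \<alpha> where M: "M = dyad f g" "f \<in> U \<alpha>" by blast
      then have "hs Z [] f t = 0" using t by (auto simp: perp_def)
      moreover have "(\<Sum>k\<in>basis Z. t [] k * M k l) = hs Z [] f t * g [] l" for l
        unfolding M(1) dyad_def hs_rows sum_distrib_right by (intro sum.cong refl) (simp add: mult_ac)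
      ultimately show "M \<in> {M. \<forall>l. (\<Sum>k\<in>basis Z. t [] k * M k l) = 0}" by simp
    qed (auto simp: mat_scale_def algebra_simps sum.distrib simp flip: sum_distrib_left)
    then have o: "(\<Sum>k\<in>basis Z. t [] k * mat_one Z k l) = 0" for l using one by blast
    have "t [] l = 0" if "l \<in> basis Z" for l
    proof -
      have "(\<Sum>k\<in>basis Z. t [] k * mat_one Z k l) = (\<Sum>k\<in>basis Z. if k = l then t [] l else 0)"
        using that by (intro sum.cong) (auto simp: mat_one_def)
      then show ?thesis using o [of l] that fin by simp
    qed
    then show ?thesis using t by (intro rows_ext [of _ Z]) (auto simp: perp_def mat.subspace_0 [OF subspace_ops])
  qed
  note t0 = this
  have "functionals Z \<subseteq> perp Z [] (perp Z [] (\<Union>\<alpha>. U \<alpha>))"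
  proof
    fix s assume s: "s \<in> functionals Z"
    have "hs Z [] a s = 0" if "a \<in> perp Z [] (\<Union>\<alpha>. U \<alpha>)" for a
      using t0 [OF that] by (simp add: hs_eq)
    then show "s \<in> perp Z [] (perp Z [] (\<Union>\<alpha>. U \<alpha>))"
      unfolding perp_def [of Z "[]" "perp Z [] (\<Union>\<alpha>. U \<alpha>)"] using s by blast
  qed
  moreover have "(\<Union>\<alpha>. U \<alpha>) \<subseteq> functionals Z" using U by blast
  ultimately show "functionals Z \<subseteq> mat.span (\<Union>\<alpha>. U \<alpha>)" using perp_perp [OF fin f0] by simp
next
  assume all: "functionals Z \<subseteq> mat.span (\<Union>\<alpha>. U \<alpha>)"
  define P where "P = (\<lambda>(\<alpha>, \<beta>). {dyad f g | f g. f \<in> U \<alpha> \<and> g \<in> U \<beta>})"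
  let ?S = "mat.span (\<Union>\<alpha>. {dyad f g | f g. f \<in> U \<alpha> \<and> g \<in> U \<alpha>})"
  have "mat_one Z \<in> ?S \<longleftrightarrow> (\<forall>i. \<not> (fst i = snd i) \<longrightarrow> (\<forall>p\<in>P i. hs Z Z p (mat_one Z) = 0))"
  proof (rule orthogonal_test [OF fin fin mat.subspace_span])
    show "?S \<subseteq> ops Z Z" using U(2) by (intro mat.span_minimal subspace_ops) (blast intro: dyad_ops)
    show "P i \<subseteq> ?S" if "fst i = snd i" for i
    proof -
      have "P i = {dyad f g | f g. f \<in> U (fst i) \<and> g \<in> U (fst i)}"
        using that by (cases i) (simp add: P_def)
      then show ?thesis by (intro subset_trans [OF _ mat.span_superset]) blast
    qed
    show "hs Z Z p s = 0" if i: "fst i \<noteq> snd i" and p: "p \<in> P i" and s: "s \<in> ?S" for i p s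
    proof -
      obtain \<alpha> \<beta> where i': "i = (\<alpha>, \<beta>)" by (cases i) auto
      obtain f g where fg: "p = dyad f g" "f \<in> U \<alpha>" "g \<in> U \<beta>" using p by (auto simp: P_def i')
      have "hs Z Z u p = 0" if uS: "u \<in> (\<Union>\<alpha>. {dyad f g | f g. f \<in> U \<alpha> \<and> g \<in> U \<alpha>})" for u
      proof -
        obtain f' g' \<gamma> where u: "u = dyad f' g'" "f' \<in> U \<gamma>" "g' \<in> U \<gamma>" using uS by blast
        show ?thesis
        proof (cases "\<gamma> = \<alpha>")
          case True
          then have "hs Z [] g' g = 0" using orth u fg i by (auto simp: i')
          then show ?thesis by (simp add: u(1) fg(1) hs_dyad)
        next
          case False
          then have "hs Z [] f f' = 0" using orth u fg by metis
          then show ?thesis by (simp add: u(1) fg(1) hs_dyad)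
        qed
      qed
      then have "hs Z Z s p = 0" by (rule hs_span_0 [OF s])
      then show ?thesis by (simp add: hs_eq_0_commute)
    qed
    show "ops Z Z \<subseteq> mat.span (\<Union>i. P i)"
      unfolding ops_span_units [OF fin fin, symmetric]
    proof (intro mat.span_minimal mat.subspace_span subsetI)
      fix M assume "M \<in> (\<lambda>(i, j). mat_unit i j) ` (basis Z \<times> basis Z)"
      then obtain k l where kl: "M = mat_unit k l" "k \<in> basis Z" "l \<in> basis Z" by auto
      define h where "h f g = (\<lambda>k l. f [] k * g [] l)" for f g :: "'a mat"
      have u: "mat_unit [] k \<in> mat.span (\<Union>\<alpha>. U \<alpha>)" "mat_unit [] l \<in> mat.span (\<Union>\<alpha>. U \<alpha>)"
        using all mat_unit_ops [of "[]" "[]" _ Z] kl by auto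
      have "mat_star (mat_unit [] k) = (mat_unit [] k :: 'a mat)" by (auto simp: mat_star_def mat_unit_def fun_eq_iff)
      then have "mat_unit [] k \<in> mat.span (mat_star ` (\<Union>\<alpha>. U \<alpha>))" using mat_star_span [OF u(1)] by simp
      from this u(2) have "h (mat_unit [] k) (mat_unit [] l) \<in> mat.span {h a b | a b. a \<in> mat_star ` (\<Union>\<alpha>. U \<alpha>) \<and> b \<in> (\<Union>\<alpha>. U \<alpha>)}"
        by (rule span_bilinear) (auto simp: h_def mat_scale_def fun_eq_iff algebra_simps)
      moreover have "h (mat_unit [] k) (mat_unit [] l) = M" by (auto simp: h_def kl(1) mat_unit_def fun_eq_iff)
      moreover have "{h a b | a b. a \<in> mat_star ` (\<Union>\<alpha>. U \<alpha>) \<and> b \<in> (\<Union>\<alpha>. U \<alpha>)} \<subseteq> (\<Union>i. P i)"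
      proof
        fix m assume "m \<in> {h a b | a b. a \<in> mat_star ` (\<Union>\<alpha>. U \<alpha>) \<and> b \<in> (\<Union>\<alpha>. U \<alpha>)}"
        then obtain f g \<alpha> \<beta> where m: "m = h (mat_star f) g" "f \<in> U \<alpha>" "g \<in> U \<beta>" by blast
        have "m = dyad f g" by (simp add: m(1) h_def dyad_def mat_star_def)
        then have "m \<in> P (\<alpha>, \<beta>)" using m by (auto simp: P_def)
        then show "m \<in> (\<Union>i. P i)" by blast
      qed
      ultimately show "M \<in> mat.span (\<Union>i. P i)" by (metis (no_types, lifting) mat.span_mono subsetD)
    qed
    show "mat_one Z \<in> ops Z Z" by (auto simp: mat_one_def ops_def)
  qed
  moreover have "hs Z Z p (mat_one Z) = 0" if "\<alpha> \<noteq> \<beta>" and p: "p \<in> P (\<alpha>, \<beta>)" for \<alpha> \<beta> p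
  proof -
    obtain f g where "p = dyad f g" "f \<in> U \<alpha>" "g \<in> U \<beta>" using p by (auto simp: P_def)
    then show ?thesis using orth [of \<beta> \<alpha> g f] \<open>\<alpha> \<noteq> \<beta>\<close> by (simp add: hs_dyad_one [OF fin])
  qed
  ultimately show "mat_one Z \<in> ?S" by simp
qed

lemma decomposition_iff_dyads:
  assumes fin: "finite (basis Z)" and U: "\<And>\<alpha>. mat.subspace (U \<alpha>)" "\<And>\<alpha>. U \<alpha> \<subseteq> functionals Z"
  shows "decomposition Z [] U \<longleftrightarrow>
    (\<forall>\<alpha> \<beta>. \<alpha> \<noteq> \<beta> \<longrightarrow> (\<forall>a\<in>U \<alpha>. \<forall>b\<in>U \<beta>. hs Z [] a b = 0)) \<and>
    mat_one Z \<in> mat.span (\<Union>\<alpha>. {dyad f g | f g. f \<in> U \<alpha> \<and> g \<in> U \<alpha>})"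
proof (cases "\<forall>\<alpha> \<beta>. \<alpha> \<noteq> \<beta> \<longrightarrow> (\<forall>a\<in>U \<alpha>. \<forall>b\<in>U \<beta>. hs Z [] a b = 0)")
  case True
  then have o: "hs Z [] a b = 0" if "\<alpha> \<noteq> \<beta>" "a \<in> U \<alpha>" "b \<in> U \<beta>" for \<alpha> \<beta> a b
    using that by blast
  show ?thesis using one_in_span_dyads [OF fin U o] True U by (simp add: decomposition_def)
next
  case False
  then show ?thesis unfolding decomposition_def by blast
qed

lemma mat_mult_pt: "mat_mult [pt \<alpha>] (mat_dagger f) g = dyad (at_point f) (at_point g)"
  by (auto simp: mat_mult_def mat_dagger_def dyad_def at_point_def basis_single fun_eq_iff)

lemma mat_mult_dagger_pt:
  assumes "f \<in> ops Z [pt \<alpha>]" "g \<in> ops Z [pt \<beta>]"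
  shows "mat_mult Z f (mat_dagger g) = mat_scale (hs Z [] (at_point g) (at_point f)) (mat_unit [None] [None])"
proof (intro ext)
  fix i j
  show "mat_mult Z f (mat_dagger g) i j = mat_scale (hs Z [] (at_point g) (at_point f)) (mat_unit [None] [None]) i j"
  proof (cases "i = [None] \<and> j = [None]")
    case True
    then show ?thesis
      by (simp add: mat_mult_def mat_dagger_def hs_rows at_point_def mat_scale_def mat_unit_def mult.commute)
  next
    case False
    have "f i k * cnj (g j k) = 0" for k using assms False by (auto simp: ops_def basis_single)
    then have "(\<Sum>k\<in>basis Z. f i k * cnj (g j k)) = 0" by (rule sum.neutral [OF ballI])
    then show ?thesis using False by (auto simp add: mat_mult_def mat_dagger_def mat_scale_def mat_unit_def)
  qed
qed

lemma mat_one_pt: "mat_one [pt \<alpha>] = mat_unit [None] [None]"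
  by (auto simp: mat_one_def mat_unit_def basis_single fun_eq_iff)

context
  fixes \<X> :: "('v::complex_inner, ennreal) qset" and F :: "'v drel"
  assumes F: "binary_relation [\<X>, dual_qset \<X>] [dists] F"
    and fin: "\<And>x. x \<in> \<X> \<Longrightarrow> finite (atom_basis x)"
begin

lemma F_ops:
  assumes "x \<in> \<X>" "y \<in> \<X>"
  shows "F [x, dual y] [pt \<alpha>] \<subseteq> ops [x, dual y] [pt \<alpha>]" "mat.subspace (F [x, dual y] [pt \<alpha>])"
proof -
  have "[x, dual y] \<in> listset [\<X>, dual_qset \<X>]" "[pt \<alpha>] \<in> listset [dists :: ('v, ennreal) qset]"
    using assms by (auto simp: set_Cons_def in_dual_qset range_pt)
  then show "F [x, dual y] [pt \<alpha>] \<subseteq> ops [x, dual y] [pt \<alpha>]" "mat.subspace (F [x, dual y] [pt \<alpha>])"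
    using F unfolding binary_relation_def by meson+
qed

lemma flat_component:
  assumes "x \<in> \<X>" "y \<in> \<X>"
  shows "flat ` component F x y \<alpha> = fiber F x y \<alpha>"
proof -
  have "fiber F x y \<alpha> \<subseteq> flat ` ops [x] [y]"
    unfolding flat_surj
  proof
    fix s assume "s \<in> fiber F x y \<alpha>"
    then obtain f where "s = at_point f" "f \<in> ops [x, dual y] [pt \<alpha>]"
      using F_ops(1) [OF assms, of \<alpha>] by blast
    then show "s \<in> functionals [x, dual y]" using at_point_functionals by simp
  qed
  moreover have "flat ` component F x y \<alpha> = flat ` ops [x] [y] \<inter> fiber F x y \<alpha>"
    by (auto simp: component_def)
  ultimately show ?thesis by blast
qed

lemma F_component:
  assumes "x \<in> \<X>" "y \<in> \<X>"
  shows "F [x, dual y] [pt \<alpha>] = pt_row ` flat ` component F x y \<alpha>"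
proof -
  have "pt_row (at_point f) = f" if "f \<in> F [x, dual y] [pt \<alpha>]" for f
    by (rule pt_row_at_point [OF subsetD [OF F_ops(1) [OF assms] that]])
  then show ?thesis unfolding flat_component [OF assms] image_image by simp
qed

lemma values_subspace:
  assumes "x \<in> \<X>" "y \<in> \<X>"
  shows "mat.subspace (fiber F x y \<alpha>)" "fiber F x y \<alpha> \<subseteq> functionals [x, dual y]"
proof -
  show "mat.subspace (fiber F x y \<alpha>)" by (intro linear_map_subspace linear_at_point F_ops assms)
  show "fiber F x y \<alpha> \<subseteq> functionals [x, dual y]"
  proof
    fix s assume "s \<in> fiber F x y \<alpha>"
    then obtain f where "s = at_point f" "f \<in> ops [x, dual y] [pt \<alpha>]"
      using F_ops(1) [OF assms, of \<alpha>] by blast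
    then show "s \<in> functionals [x, dual y]" using at_point_functionals by simp
  qed
qed

lemma decomposition_component_iff:
  assumes "x \<in> \<X>" "y \<in> \<X>"
  shows "decomposition [x] [y] (component F x y) \<longleftrightarrow>
    decomposition [x, dual y] [] (\<lambda>\<alpha>. fiber F x y \<alpha>)"
  using decomposition_flat [of x y "component F x y"] decomposition_unflat [of x y "\<lambda>\<alpha>. fiber F x y \<alpha>"]
  unfolding flat_component [OF assms] by (auto simp: component_def [abs_def])

lemma fin_pair: "x \<in> \<X> \<Longrightarrow> y \<in> \<X> \<Longrightarrow> finite (basis [x, dual y])"
  using fin by (intro fin_atoms_basis) simp

lemma total_iff:
  "id_rel [\<X>, dual_qset \<X>] \<le> comp_rel [dists] (dagger_rel F) F \<longleftrightarrow>
    (\<forall>x\<in>\<X>. \<forall>y\<in>\<X>. mat_one [x, dual y] \<in> mat.span (\<Union>\<alpha>. {dyad f g | f g.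
      f \<in> fiber F x y \<alpha> \<and> g \<in> fiber F x y \<alpha>}))"
proof -
  have c: "comp_rel [dists] (dagger_rel F) F Z Z = mat.span (\<Union>\<alpha>. {dyad f g | f g.
      f \<in> at_point ` F Z [pt \<alpha>] \<and> g \<in> at_point ` F Z [pt \<alpha>]})" for Z
  proof -
    have "{mat_mult Y s r | Y s r. Y \<in> listset [dists] \<and> s \<in> dagger_rel F Y Z \<and> r \<in> F Z Y} =
      (\<Union>\<alpha>. {dyad f g | f g. f \<in> at_point ` F Z [pt \<alpha>] \<and> g \<in> at_point ` F Z [pt \<alpha>]})" (is "?A = ?B")
    proof (intro subset_antisym subsetI)
      fix m assume "m \<in> ?A"
      then obtain \<alpha> f g where "m = mat_mult [pt \<alpha>] (mat_dagger f) g" "f \<in> F Z [pt \<alpha>]" "g \<in> F Z [pt \<alpha>]"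
        by (auto simp: dagger_rel_def set_Cons_def range_pt)
      then show "m \<in> ?B" unfolding mat_mult_pt by blast
    next
      fix m assume "m \<in> ?B"
      then obtain \<alpha> f g where m: "m = dyad (at_point f) (at_point g)" "f \<in> F Z [pt \<alpha>]" "g \<in> F Z [pt \<alpha>]"
        by blast
      then have "m = mat_mult [pt \<alpha>] (mat_dagger f) g" "[pt \<alpha>] \<in> listset [dists]" "mat_dagger f \<in> dagger_rel F [pt \<alpha>] Z"
        by (auto simp: mat_mult_pt dagger_rel_def set_Cons_def range_pt)
      then show "m \<in> ?A" using m by blast
    qed
    then show ?thesis unfolding comp_rel_def by simp
  qed
  have z: "0 \<in> comp_rel [dists] (dagger_rel F) F Z W" for Z W by (simp add: comp_rel_def mat.span_zero)
  have "id_rel [\<X>, dual_qset \<X>] \<le> comp_rel [dists] (dagger_rel F) F \<longleftrightarrow>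
      (\<forall>Z\<in>listset [\<X>, dual_qset \<X>]. mat_one Z \<in> comp_rel [dists] (dagger_rel F) F Z Z)"
  proof
    assume l: "id_rel [\<X>, dual_qset \<X>] \<le> comp_rel [dists] (dagger_rel F) F"
    show "\<forall>Z\<in>listset [\<X>, dual_qset \<X>]. mat_one Z \<in> comp_rel [dists] (dagger_rel F) F Z Z"
    proof
      fix Z assume "Z \<in> listset [\<X>, dual_qset \<X>]"
      then have "mat_one Z \<in> id_rel [\<X>, dual_qset \<X>] Z Z"
        unfolding id_rel_def by (auto intro: mat.span_base)
      then show "mat_one Z \<in> comp_rel [dists] (dagger_rel F) F Z Z" using l by (auto simp: le_fun_def)
    qed
  next
    assume r: "\<forall>Z\<in>listset [\<X>, dual_qset \<X>]. mat_one Z \<in> comp_rel [dists] (dagger_rel F) F Z Z"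
    have "id_rel [\<X>, dual_qset \<X>] Z W \<subseteq> comp_rel [dists] (dagger_rel F) F Z W" for Z W
    proof (cases "Z \<in> listset [\<X>, dual_qset \<X>] \<and> W = Z")
      case True
      then have "mat_one Z \<in> comp_rel [dists] (dagger_rel F) F Z W" using r by blast
      moreover have "mat.subspace (comp_rel [dists] (dagger_rel F) F Z W)" by (simp add: comp_rel_def)
      ultimately have "mat.span {mat_one Z} \<subseteq> comp_rel [dists] (dagger_rel F) F Z W"
        by (intro mat.span_minimal) auto
      then show ?thesis using True by (simp add: id_rel_def)
    next
      case False
      then have "id_rel [\<X>, dual_qset \<X>] Z W = {0}" by (auto simp: id_rel_def)
      then show ?thesis using z by simp
    qed
    then show "id_rel [\<X>, dual_qset \<X>] \<le> comp_rel [dists] (dagger_rel F) F" by (simp add: le_fun_def)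
  qed
  also have "\<dots> \<longleftrightarrow> (\<forall>x\<in>\<X>. \<forall>y\<in>\<X>. mat_one [x, dual y] \<in> comp_rel [dists] (dagger_rel F) F [x, dual y] [x, dual y])"
    by (auto simp: set_Cons_def dual_qset_def)
  finally show ?thesis unfolding c .
qed

lemma single_valued_iff:
  "comp_rel [\<X>, dual_qset \<X>] F (dagger_rel F) \<le> id_rel [dists] \<longleftrightarrow>
    (\<forall>x\<in>\<X>. \<forall>y\<in>\<X>. \<forall>\<alpha> \<beta>. \<alpha> \<noteq> \<beta> \<longrightarrow> (\<forall>a\<in>fiber F x y \<alpha>. \<forall>b\<in>fiber F x y \<beta>.
      hs [x, dual y] [] a b = 0))" (is "?l \<longleftrightarrow> ?r")
proof
  assume l: ?l
  show ?r
  proof (intro ballI allI impI)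
    fix x y \<alpha> \<beta> a b
    assume xy: "x \<in> \<X>" "y \<in> \<X>" and ne: "\<alpha> \<noteq> \<beta>"
      and "a \<in> fiber F x y \<alpha>" "b \<in> fiber F x y \<beta>"
    then obtain f g where fg: "a = at_point f" "b = at_point g" "f \<in> F [x, dual y] [pt \<alpha>]" "g \<in> F [x, dual y] [pt \<beta>]"
      by blast
    have "[x, dual y] \<in> listset [\<X>, dual_qset \<X>]" using xy by (auto simp: set_Cons_def in_dual_qset)
    moreover have "mat_dagger f \<in> dagger_rel F [pt \<alpha>] [x, dual y]" using fg by (simp add: dagger_rel_def)
    ultimately have "mat_mult [x, dual y] g (mat_dagger f) \<in> comp_rel [\<X>, dual_qset \<X>] F (dagger_rel F) [pt \<alpha>] [pt \<beta>]"
      using fg unfolding comp_rel_def by (intro mat.span_base) blast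
    also have "\<dots> \<subseteq> id_rel [dists] [pt \<alpha>] [pt \<beta>]" using l by (auto simp: le_fun_def)
    also have "\<dots> = {0}" using ne by (simp add: id_rel_def)
    finally have "mat_mult [x, dual y] g (mat_dagger f) [None] [None] = 0" by simp
    moreover have "mat_mult [x, dual y] g (mat_dagger f) =
        mat_scale (hs [x, dual y] [] (at_point f) (at_point g)) (mat_unit [None] [None])"
      using fg F_ops(1) [OF xy] by (intro mat_mult_dagger_pt) auto
    ultimately show "hs [x, dual y] [] a b = 0" by (simp add: fg mat_scale_def mat_unit_def)
  qed
next
  assume r: ?r
  have "comp_rel [\<X>, dual_qset \<X>] F (dagger_rel F) Z W \<subseteq> id_rel [dists] Z W" for Z W
    unfolding comp_rel_def
  proof (rule mat.span_minimal, safe)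
    show sub: "mat.subspace (id_rel [dists] Z W)" by (simp add: id_rel_def)
    fix Y s t assume Y: "Y \<in> listset [\<X>, dual_qset \<X>]" and s: "s \<in> F Y W" and t: "t \<in> dagger_rel F Z Y"
    obtain x y where xy: "Y = [x, dual y]" "x \<in> \<X>" "y \<in> \<X>"
      using Y by (auto simp: set_Cons_def dual_qset_def)
    obtain f where f: "t = mat_dagger f" "f \<in> F Y Z" using t by (auto simp: dagger_rel_def)
    show "mat_mult Y s t \<in> id_rel [dists] Z W"
    proof (cases "s = 0 \<or> f = 0")
      case True
      then have "mat_mult Y s t = 0" by (auto simp: f mat_mult_def mat_dagger_def fun_eq_iff)
      then show ?thesis using mat.subspace_0 [OF sub] by simp
    next
      case False
      then have "W \<in> listset [dists]" "Z \<in> listset [dists]"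
        using s f(2) F unfolding binary_relation_def by (metis singletonD)+
      then obtain \<alpha> \<beta> where WZ: "W = [pt \<alpha>]" "Z = [pt \<beta>]" by (auto simp: set_Cons_def range_pt)
      have m: "mat_mult Y s t = mat_scale (hs Y [] (at_point f) (at_point s)) (mat_unit [None] [None])"
        using s f(2) F_ops(1) [OF xy(2,3)] unfolding f(1) WZ xy(1) by (intro mat_mult_dagger_pt) auto
      show ?thesis
      proof (cases "\<alpha> = \<beta>")
        case True
        then have "id_rel [dists] Z W = mat.span {mat_unit [None] [None]}"
          by (auto simp: id_rel_def WZ set_Cons_def range_pt mat_one_pt)
        then show ?thesis unfolding m by (auto intro: mat.span_scale mat.span_base)
      next
        case False
        have "hs Y [] (at_point f) (at_point s) = 0" using r xy False f(2) s unfolding WZ by (metis imageI)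
        then show ?thesis using mat.subspace_0 [OF sub] by (simp add: m)
      qed
    qed
  qed
  then show ?l by (simp add: le_fun_def)
qed

text \<open>The operators in \<open>F\<^sup>\<dagger> F\<close> are spanned by dyads, so totality says that the values span; \<open>F F\<^sup>\<dagger>\<close> consists of
  the inner products between values at two distances, so single-valuedness is orthogonality.\<close>

lemma is_function_iff:
  "is_function [\<X>, dual_qset \<X>] [dists] F \<longleftrightarrow> (\<forall>x\<in>\<X>. \<forall>y\<in>\<X>. decomposition [x] [y] (component F x y))"
proof -
  have "decomposition [x] [y] (component F x y) \<longleftrightarrow>
    (\<forall>\<alpha> \<beta>. \<alpha> \<noteq> \<beta> \<longrightarrow> (\<forall>a\<in>fiber F x y \<alpha>. \<forall>b\<in>fiber F x y \<beta>.
      hs [x, dual y] [] a b = 0)) \<and>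
    mat_one [x, dual y] \<in> mat.span (\<Union>\<alpha>. {dyad f g | f g.
      f \<in> fiber F x y \<alpha> \<and> g \<in> fiber F x y \<alpha>})" if "x \<in> \<X>" "y \<in> \<X>" for x y
    unfolding decomposition_component_iff [OF that]
    using decomposition_iff_dyads [OF fin_pair [OF that] values_subspace [OF that]] .
  note dec = this
  have split: "(\<forall>x\<in>S. \<forall>y\<in>S. P x y) \<longleftrightarrow> (\<forall>x\<in>S. \<forall>y\<in>S. Q x y) \<and> (\<forall>x\<in>S. \<forall>y\<in>S. N x y)"
    if "\<And>x y. x \<in> S \<Longrightarrow> y \<in> S \<Longrightarrow> P x y \<longleftrightarrow> N x y \<and> Q x y"
    for S :: "('v, ennreal) qset" and P Q N using that by blast
  have "(\<forall>x\<in>\<X>. \<forall>y\<in>\<X>. decomposition [x] [y] (component F x y)) \<longleftrightarrow>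
      id_rel [\<X>, dual_qset \<X>] \<le> comp_rel [dists] (dagger_rel F) F \<and>
      comp_rel [\<X>, dual_qset \<X>] F (dagger_rel F) \<le> id_rel [dists]"
    unfolding total_iff single_valued_iff by (rule split [OF dec])
  then show ?thesis
    unfolding is_function_def using F by (simp only: simp_thms)
qed

end

lemma in_lift_id:
  assumes U: "mat.subspace U" "U \<subseteq> functionals [x, y]"
  shows "s \<in> lift [0, 1] U [x, y] \<longleftrightarrow> s \<in> U"
proof
  have p: "permute [0, 1] j = j" if "j \<in> basis [x, y]" for j using that by (auto simp: basis_Cons)
  have all: "i \<in> set [0, 1 :: nat]" if "i < length [x, y]" for i using that by auto
  {
    assume s: "s \<in> lift [0, 1] U [x, y]"
    show "s \<in> U"
    proof (cases "basis [x, y] = {}")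
      case True
      have "s = 0"
        using s lift_rows True by (intro rows_ext [of _ "[x, y]"]) (auto simp: mat.subspace_0 [OF subspace_ops])
      then show ?thesis using mat.subspace_0 [OF U(1)] by simp
    next
      case False
      then obtain k where k: "k \<in> basis [x, y]" by blast
      obtain r where r: "r \<in> U" "\<forall>j\<in>basis [x, y]. agree_off [0, 1] [x, y] j k \<longrightarrow>
          s [] j = r [] (permute [0, 1] j)" using liftD [OF s k] by blast
      have "s = r"
      proof (rule rows_ext)
        show "s \<in> functionals [x, y]" "r \<in> functionals [x, y]" using s lift_rows r(1) U(2) by blast+
        show "s [] j = r [] j" if "j \<in> basis [x, y]" for j using r(2) p [OF that] that all by metis
      qed
      then show ?thesis using r by simp
    qed
  next
    assume s: "s \<in> U"
    show "s \<in> lift [0, 1] U [x, y]"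
      unfolding lift_def
    proof (intro CollectI conjI ballI bexI [of _ s] impI)
      show "s \<in> functionals [x, y]" using s U by blast
      show "s [] j = s [] (permute [0, 1] j)" if "j \<in> basis [x, y]" for j using p [OF that] by simp
    qed (rule s)
  }
qed

lemma lift_subset_iff:
  assumes p: "distinct p" "set p = {..<length X}"
    and U: "mat.subspace U" "U \<subseteq> functionals (permute p X)" and U': "mat.subspace U'" "U' \<subseteq> functionals (permute p X)"
  shows "lift p U X \<subseteq> lift p U' X \<longleftrightarrow> U \<subseteq> U'"
proof
  assume "U \<subseteq> U'"
  then show "lift p U X \<subseteq> lift p U' X" unfolding lift_def by blast
next
  assume l: "lift p U X \<subseteq> lift p U' X"
  have pl: "\<forall>k\<in>set p. k < length X" using p by simp
  show "U \<subseteq> U'"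
  proof
    fix r assume r: "r \<in> U"
    let ?s = "product_with p X r (\<lambda>_. 1)"
    have "?s \<in> lift p U X" by (intro product_with_in_lift U r) (simp add: off_factor_def)
    then have s: "?s \<in> lift p U' X" using l by blast
    show "r \<in> U'"
    proof (cases "basis X = {}")
      case True
      have "basis (permute p X) = {}"
      proof (rule ccontr)
        assume "basis (permute p X) \<noteq> {}"
        then obtain m where "m \<in> basis (permute p X)" by blast
        define l where "l = map (\<lambda>i. m ! (length (takeWhile (\<lambda>x. x \<noteq> i) p))) [0..<length X]"
        have "l \<in> basis X"
          unfolding basis_iff
        proof (intro conjI allI impI)
          fix i assume i: "i < length X"
          then have ip: "i \<in> set p" using p by simp
          then have "m ! length (takeWhile (\<lambda>x. x \<noteq> i) p) \<in> atom_basis (permute p X ! length (takeWhile (\<lambda>x. x \<noteq> i) p))"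
            using \<open>m \<in> basis (permute p X)\<close> index_less [OF ip] by (simp add: basis_iff)
          then show "l ! i \<in> atom_basis (X ! i)"
            using i index_less [OF ip] nth_index [OF ip] by (simp add: l_def permute_def)
        qed (simp add: l_def)
        then show False using True by simp
      qed
      then have "r = 0"
        using U(2) r by (intro rows_ext [of _ "permute p X"]) (auto simp: mat.subspace_0 [OF subspace_ops])
      then show ?thesis using mat.subspace_0 [OF U'(1)] by simp
    next
      case False
      then obtain k where k: "k \<in> basis X" by blast
      obtain r' where r': "r' \<in> U'" "\<forall>j\<in>basis X. agree_off p X j k \<longrightarrow>
          ?s [] j = r' [] (permute p j)" using liftD [OF s k] by blast
      have "r = r'"
      proof (rule rows_ext)
        show "r \<in> functionals (permute p X)" "r' \<in> functionals (permute p X)" using r r'(1) U(2) U'(2) by blast+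
        fix m assume "m \<in> basis (permute p X)"
        then obtain j where j: "j \<in> basis X" "agree_off p X j k" "m = permute p j"
          using bij_betw_imp_surj_on [OF bij_betw_fiber [OF p(1) pl k]] by blast
        then show "r [] m = r' [] m" using r'(2) by (simp add: product_with_def)
      qed
      then show ?thesis using r' by simp
    qed
  qed
qed

lemma eps_unit: "eps x unit_form = flat (mat_one [x])"
proof (rule rows_ext)
  show "eps x unit_form \<in> functionals [x, dual x]" by (intro eps_functionals unit_form)
  have "mat_one [x] \<in> ops [x] [x]" by (auto simp: mat_one_def ops_def)
  then show "flat (mat_one [x]) \<in> functionals [x, dual x]" by (rule flat_in_functionals)
  fix j assume "j \<in> basis [x, dual x]"
  then show "eps x unit_form [] j = flat (mat_one [x]) [] j"
    by (auto simp: basis_Cons eps_apply flat_pair mat_one_def unit_form_def mat_unit_def)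
qed

lemma mat_eval_flat: "mat_eval x = flat (mat_one [x])"
proof -
  have "mat_eval x = eps x unit_form" by (auto simp: mat_eval_def eps_def unit_form_def mat_unit_def fun_eq_iff)
  then show ?thesis by (simp add: eps_unit)
qed

lemma hs_unit: "hs [] [] a unit_form = cnj (a [] [])" by (simp add: hs_rows unit_form_def mat_unit_def)

text \<open>Pairing with evaluation functionals identifies the basis index of a factor with that of its dual, and
  what remains is the sum that computes the trace.\<close>

lemma hs_eps_2:
  assumes "finite (atom_basis x)" "finite (atom_basis y)" "r \<in> ops [x] [y]" "s \<in> ops [y] [x]"
  shows "hs [y, dual y, x, dual x] [] (product_with [2, 1] [y, dual y, x, dual x] (flat r) (\<lambda>j. flat s [] (permute [0, 3] j)))
      (eps y (eps x unit_form)) = cnj (hs [y] [x] (mat_dagger r) s)"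
    (is "hs _ _ ?a _ = _")
proof -
  have a: "?a [] [q, q, p, p] = r [q] [p] * s [p] [q]" if "q \<in> atom_basis y" "p \<in> atom_basis x" for p q
    using that by (simp add: product_with_def flat_pair eval_nat_numeral)
  have "hs [y, dual y, x, dual x] [] ?a (eps y (eps x unit_form)) = cnj (\<Sum>p\<in>atom_basis x. \<Sum>q\<in>atom_basis y. ?a [] [q, q, p, p])"
    unfolding hs_eps [OF assms(2)] hs_eps [OF assms(1), of "[]"] hs_unit by (simp add: contr_def)
  also have "(\<Sum>p\<in>atom_basis x. \<Sum>q\<in>atom_basis y. ?a [] [q, q, p, p]) = (\<Sum>p\<in>atom_basis x. \<Sum>q\<in>atom_basis y. r [q] [p] * s [p] [q])"
    using a by (intro sum.cong refl)
  also have "\<dots> = (\<Sum>q\<in>atom_basis y. \<Sum>p\<in>atom_basis x. r [q] [p] * s [p] [q])" by (rule sum.swap)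
  also have "\<dots> = hs [y] [x] (mat_dagger r) s" by (simp add: hs_eq sum_basis_Cons mat_dagger_def)
  finally show ?thesis .
qed

lemma hs_eps_3:
  assumes "finite (atom_basis x)" "finite (atom_basis y)" "finite (atom_basis z)"
  shows "hs [z, dual z, y, dual y, x, dual x] [] (product_with [4, 3] [z, dual z, y, dual y, x, dual x] (flat r)
        (\<lambda>j. mat_star (flat u) [] (permute [5, 0] j) * mat_star (flat w) [] (permute [1, 2] j)))
      (eps z (eps y (eps x unit_form))) = hs [x] [y] r (mat_mult [z] w u)"
    (is "hs _ _ ?a _ = _")
proof -
  have a: "cnj (?a [] [s, s, q, q, p, p]) = cnj (r [q] [p]) * (w [q] [s] * u [s] [p])"
    if "q \<in> atom_basis y" "p \<in> atom_basis x" "s \<in> atom_basis z" for p q s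
    using that by (simp add: product_with_def flat_pair eval_nat_numeral mat_star_def)
  have "hs [z, dual z, y, dual y, x, dual x] [] ?a (eps z (eps y (eps x unit_form))) =
     (\<Sum>p\<in>atom_basis x. \<Sum>q\<in>atom_basis y. \<Sum>s\<in>atom_basis z. cnj (?a [] [s, s, q, q, p, p]))"
    unfolding hs_eps [OF assms(3)] hs_eps [OF assms(2)] hs_eps [OF assms(1), of "[]"] hs_unit by (simp add: contr_def)
  also have "\<dots> = (\<Sum>p\<in>atom_basis x. \<Sum>q\<in>atom_basis y. \<Sum>s\<in>atom_basis z. cnj (r [q] [p]) * (w [q] [s] * u [s] [p]))"
    using a by (intro sum.cong refl)
  also have "\<dots> = hs [x] [y] r (mat_mult [z] w u)"
    by (simp add: hs_eq sum_basis_Cons mat_mult_def sum_distrib_left)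
  finally show ?thesis .
qed

lemma at_point_star: "at_point ` star_rel F [dual x, z] [dual (pt \<beta>)] = mat_star ` fiber F x z \<beta>"
proof -
  have "at_point (mat_star a) = mat_star (at_point a)" for a :: "'a mat"
    by (simp add: at_point_def mat_star_def fun_eq_iff)
  moreover have "star_rel F [dual x, z] [dual (pt \<beta>)] = mat_star ` F [x, dual z] [pt \<beta>]"
    unfolding star_rel_def by (simp only: list.map dual_dual)
  ultimately show ?thesis by (simp add: image_image)
qed

context
  fixes \<X> :: "('v::complex_inner, ennreal) qset" and F :: "'v drel"
  assumes F: "binary_relation [\<X>, dual_qset \<X>] [dists] F"
    and fin: "\<And>x. x \<in> \<X> \<Longrightarrow> finite (atom_basis x)"
    and dec: "\<And>x y. x \<in> \<X> \<Longrightarrow> y \<in> \<X> \<Longrightarrow> decomposition [x] [y] (component F x y)"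
begin

lemma flat_comp: "x \<in> \<X> \<Longrightarrow> y \<in> \<X> \<Longrightarrow> flat ` component F x y \<alpha> = fiber F x y \<alpha>"
  using flat_component [OF F] fin by blast

lemma values_sub:
  assumes "x \<in> \<X>" "y \<in> \<X>"
  shows "mat.subspace (fiber F x y \<alpha>)" "fiber F x y \<alpha> \<subseteq> functionals [x, dual y]"
  using values_subspace [OF F] fin assms by blast+

lemma values_decomposition:
  "x \<in> \<X> \<Longrightarrow> y \<in> \<X> \<Longrightarrow> decomposition [x, dual y] [] (\<lambda>\<alpha>. fiber F x y \<alpha>)"
  using decomposition_component_iff [OF F fin] dec by blast

lemma refl_iff: "holds (refl_formula \<X> F) \<longleftrightarrow> (\<forall>x\<in>\<X>. mat_one [x] \<in> component F x x 0)"
proof -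
  have "eps x unit_form \<in> lift [0, 1] (fiber F x x 0) [x, dual x] \<longleftrightarrow> mat_one [x] \<in> component F x x 0"
    if x: "x \<in> \<X>" for x
  proof -
    have "mat_one [x] \<in> ops [x] [x]" by (auto simp: mat_one_def ops_def)
    then show ?thesis
      unfolding in_lift_id [OF values_sub [OF x x]] eps_unit component_def by blast
  qed
  note eq = this
  show ?thesis by (subst holds_refl_formula [OF F fin], assumption, intro ball_cong refl eq)
qed

lemma sym_iff:
  "holds (sym_formula \<X> F) \<longleftrightarrow> (\<forall>x\<in>\<X>. \<forall>y\<in>\<X>. \<forall>\<alpha> \<beta>. \<alpha> \<noteq> \<beta> \<longrightarrow>
    (\<forall>r\<in>component F x y \<alpha>. \<forall>s\<in>component F y x \<beta>. hs [y] [x] (mat_dagger r) s = 0))"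
proof -
  have "eps y (eps x unit_form) \<in>
      mat.span (\<Union>\<alpha>. lift [2, 1] (fiber F x y \<alpha>) [y, dual y, x, dual x] \<inter>
        lift [0, 3] (fiber F y x \<alpha>) [y, dual y, x, dual x]) \<longleftrightarrow>
    (\<forall>\<alpha> \<beta>. \<alpha> \<noteq> \<beta> \<longrightarrow> (\<forall>r\<in>component F x y \<alpha>. \<forall>s\<in>component F y x \<beta>. hs [y] [x] (mat_dagger r) s = 0))"
    if x: "x \<in> \<X>" and y: "y \<in> \<X>" for x y
  proof -
    let ?X = "[y, dual y, x, dual x]"
    have f: "finite (atom_basis x)" "finite (atom_basis y)" using fin x y by auto
    have D: "decomposition (permute [2, 1] ?X) [] (\<lambda>\<alpha>. fiber F x y \<alpha>)"
      "decomposition (permute [0, 3] ?X) [] (\<lambda>\<alpha>. fiber F y x \<alpha>)"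
      using values_decomposition x y by (simp_all add: eval_nat_numeral)
    have hs: "hs ?X [] (product_with [2, 1] ?X (flat r) (\<lambda>j. flat s [] (permute [0, 3] j))) (eps y (eps x unit_form)) = 0 \<longleftrightarrow>
        hs [y] [x] (mat_dagger r) s = 0" if "r \<in> component F x y \<alpha>" "s \<in> component F y x \<beta>" for r s \<alpha> \<beta>
      using that by (subst hs_eps_2 [OF f]) (auto simp: component_def)
    show ?thesis
      unfolding flat_comp [OF x y, symmetric] flat_comp [OF y x, symmetric]
    proof (subst lift_meet_2)
      show "decomposition (permute [2, 1] ?X) [] (\<lambda>\<alpha>. flat ` component F x y \<alpha>)"
        "decomposition (permute [0, 3] ?X) [] (\<lambda>\<alpha>. flat ` component F y x \<alpha>)"
        using D unfolding flat_comp [OF x y] flat_comp [OF y x] .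
      show "eps y (eps x unit_form) \<in> functionals ?X" by (intro eps_functionals unit_form)
      show "set [2, 1] \<union> set [0, 3] = {..<length ?X}" by auto
      show "(\<forall>\<alpha> \<beta>. \<alpha> \<noteq> \<beta> \<longrightarrow> (\<forall>f\<in>flat ` component F x y \<alpha>. \<forall>g\<in>flat ` component F y x \<beta>.
           hs ?X [] (product_with [2, 1] ?X f (\<lambda>j. g [] (permute [0, 3] j))) (eps y (eps x unit_form)) = 0)) \<longleftrightarrow>
        (\<forall>\<alpha> \<beta>. \<alpha> \<noteq> \<beta> \<longrightarrow> (\<forall>r\<in>component F x y \<alpha>. \<forall>s\<in>component F y x \<beta>. hs [y] [x] (mat_dagger r) s = 0))"
        using hs by (simp add: ball_simps)
    qed (use f in auto)
  qed
  note eq = this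
  show ?thesis by (subst holds_sym_formula [OF F fin], assumption, intro ball_cong refl eq)
qed

lemma triangle_iff:
  "holds (triangle_formula \<X> F) \<longleftrightarrow> (\<forall>x\<in>\<X>. \<forall>y\<in>\<X>. \<forall>z\<in>\<X>. \<forall>\<alpha> \<beta> \<delta>. \<not> \<alpha> \<le> \<beta> + \<delta> \<longrightarrow>
    (\<forall>r\<in>component F x y \<alpha>. \<forall>u\<in>component F x z \<beta>. \<forall>w\<in>component F z y \<delta>. hs [x] [y] r (mat_mult [z] w u) = 0))"
proof -
  have "eps z (eps y (eps x unit_form)) \<in>
      mat.span (\<Union>(\<gamma>, \<alpha>)\<in>{(\<gamma>, \<alpha>). \<alpha> \<le> \<gamma>}. lift [4, 3] (fiber F x y \<alpha>) [z, dual z, y, dual y, x, dual x] \<inter>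
        mat.span (\<Union>(\<alpha>, \<beta>)\<in>{(\<alpha>, \<beta>). \<gamma> = \<alpha> + \<beta>}.
          lift [5, 0] (at_point ` star_rel F [dual x, z] [dual (pt \<alpha>)]) [z, dual z, y, dual y, x, dual x] \<inter>
          lift [1, 2] (at_point ` star_rel F [dual z, y] [dual (pt \<beta>)]) [z, dual z, y, dual y, x, dual x])) \<longleftrightarrow>
    (\<forall>\<alpha> \<beta> \<delta>. \<not> \<alpha> \<le> \<beta> + \<delta> \<longrightarrow>
      (\<forall>r\<in>component F x y \<alpha>. \<forall>u\<in>component F x z \<beta>. \<forall>w\<in>component F z y \<delta>. hs [x] [y] r (mat_mult [z] w u) = 0))"
    if x: "x \<in> \<X>" and y: "y \<in> \<X>" and z: "z \<in> \<X>" for x y z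
  proof -
    let ?X = "[z, dual z, y, dual y, x, dual x]"
    have f: "finite (atom_basis x)" "finite (atom_basis y)" "finite (atom_basis z)" using fin x y z by auto
    have star: "at_point ` star_rel F [dual x, z] [dual (pt \<beta>)] = mat_star ` flat ` component F x z \<beta>" 
      "at_point ` star_rel F [dual z, y] [dual (pt \<beta>)] = mat_star ` flat ` component F z y \<beta>" for \<beta>
      unfolding at_point_star flat_comp [OF x z] flat_comp [OF z y] by (rule refl)+
    have D: "decomposition (permute [4, 3] ?X) [] (\<lambda>\<alpha>. flat ` component F x y \<alpha>)"
      "decomposition (permute [5, 0] ?X) [] (\<lambda>\<alpha>. mat_star ` flat ` component F x z \<alpha>)"
      "decomposition (permute [1, 2] ?X) [] (\<lambda>\<alpha>. mat_star ` flat ` component F z y \<alpha>)"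
    proof -
      have b: "decomposition [dual x, z] [] D \<longleftrightarrow> decomposition [x, dual z] [] D"
        for D :: "ennreal \<Rightarrow> 'v mat set" and x z :: "('v, ennreal) atom"
      proof -
        have "basis [dual x, z] = basis [x, dual z]" by (simp add: basis_Cons)
        then show ?thesis by (simp add: decomposition_def ops_def hs_rows)
      qed
      have "permute [4, 3] ?X = [x, dual y]" "permute [5, 0] ?X = [dual x, z]" "permute [1, 2] ?X = [dual z, y]"
        by (simp_all add: eval_nat_numeral)
      then show "decomposition (permute [4, 3] ?X) [] (\<lambda>\<alpha>. flat ` component F x y \<alpha>)"
        "decomposition (permute [5, 0] ?X) [] (\<lambda>\<alpha>. mat_star ` flat ` component F x z \<alpha>)"
        "decomposition (permute [1, 2] ?X) [] (\<lambda>\<alpha>. mat_star ` flat ` component F z y \<alpha>)"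
        using decomposition_flat [OF dec [OF x y]] decomposition_star [OF decomposition_flat [OF dec [OF x z]]]
          decomposition_star [OF decomposition_flat [OF dec [OF z y]]] by (simp_all only: b)
    qed
    show ?thesis
      unfolding star flat_comp [OF x y, symmetric]
    proof (subst lift_meet_3)
      show "eps z (eps y (eps x unit_form)) \<in> functionals ?X" by (intro eps_functionals unit_form)
      show "set [4, 3] \<union> set [5, 0] \<union> set [1, 2] = {..<length ?X}" by auto
      show "(\<forall>\<alpha> \<beta> \<delta>. \<not> \<alpha> \<le> \<beta> + \<delta> \<longrightarrow> (\<forall>f\<in>flat ` component F x y \<alpha>. \<forall>g\<in>mat_star ` flat ` component F x z \<beta>.
          \<forall>h\<in>mat_star ` flat ` component F z y \<delta>.
           hs ?X [] (product_with [4, 3] ?X f (\<lambda>j. g [] (permute [5, 0] j) * h [] (permute [1, 2] j)))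
             (eps z (eps y (eps x unit_form))) = 0)) \<longleftrightarrow>
        (\<forall>\<alpha> \<beta> \<delta>. \<not> \<alpha> \<le> \<beta> + \<delta> \<longrightarrow>
          (\<forall>r\<in>component F x y \<alpha>. \<forall>u\<in>component F x z \<beta>. \<forall>w\<in>component F z y \<delta>. hs [x] [y] r (mat_mult [z] w u) = 0))"
        using hs_eps_3 [OF f] by (simp add: ball_simps)
    qed (use f D in auto)
  qed
  note eq = this
  show ?thesis by (subst holds_triangle_formula [OF F fin], assumption, intro ball_cong refl eq)
qed

lemma separation_iff:
  "holds (separation_formula \<X> F) \<longleftrightarrow>
    (\<forall>x\<in>\<X>. \<forall>y\<in>\<X>. component F x y 0 \<subseteq> (if x = y then mat.span {mat_one [x]} else {0}))"
proof -
  have "lift [1, 0] (fiber F x y 0) [dual y, x] \<subseteq> lift [1, 0] (eq_rel \<X> [x, dual y] []) [dual y, x] \<longleftrightarrow>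
    component F x y 0 \<subseteq> (if x = y then mat.span {mat_one [x]} else {0})" if x: "x \<in> \<X>" and y: "y \<in> \<X>" for x y
  proof -
    let ?I = "if x = y then mat.span {mat_one [x]} else {0}"
    have I: "?I \<subseteq> ops [x] [y]"
    proof -
      have "mat_one [x] \<in> ops [x] [x]" by (auto simp: mat_one_def ops_def)
      then have "mat.span {mat_one [x]} \<subseteq> ops [x] [x]" by (intro mat.span_minimal subspace_ops) auto
      then show ?thesis using mat.subspace_0 [OF subspace_ops, of "[x]" "[y]"] by (cases "x = y") simp_all
    qed
    have e: "eq_rel \<X> [x, dual y] [] = flat ` ?I"
      using x by (auto simp: eq_rel_pair mat_eval_flat linear_map_0 [OF linear_flat] simp flip: linear_map_span [OF linear_flat])
    have If: "mat.subspace (flat ` ?I)" "flat ` ?I \<subseteq> functionals [x, dual y]"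
    proof -
      have "mat.subspace ?I" by simp
      then show "mat.subspace (flat ` ?I)" by (rule linear_map_subspace [OF linear_flat])
      show "flat ` ?I \<subseteq> functionals [x, dual y]" using image_mono [OF I, of flat] unfolding flat_surj .
    qed
    have "lift [1, 0] (fiber F x y 0) [dual y, x] \<subseteq> lift [1, 0] (flat ` ?I) [dual y, x] \<longleftrightarrow>
        fiber F x y 0 \<subseteq> flat ` ?I" using values_sub [OF x y] If by (intro lift_subset_iff) auto
    also have "\<dots> \<longleftrightarrow> component F x y 0 \<subseteq> ?I"
      unfolding flat_comp [OF x y, symmetric]
      using I inj_on_image_subset_iff [OF inj_on_flat, of "component F x y 0" x y ?I] by (auto simp: component_def)
    finally show ?thesis unfolding e .
  qed
  note eq = this
  show ?thesis by (subst holds_separation_formula [OF F fin], assumption, intro ball_cong refl eq)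
qed

end

definition rel_of_components :: "('v::complex_inner, ennreal) qset \<Rightarrow>
    (('v, ennreal) atom \<Rightarrow> ('v, ennreal) atom \<Rightarrow> ennreal \<Rightarrow> 'v mat set) \<Rightarrow> 'v drel" where
  "rel_of_components \<X> D = (\<lambda>Z W. insert 0 (\<Union>x\<in>\<X>. \<Union>y\<in>\<X>. \<Union>\<alpha>.
     if Z = [x, dual y] \<and> W = [pt \<alpha>] then pt_row ` flat ` D x y \<alpha> else {}))"

lemma listset_pair: "Z \<in> listset [\<X>, dual_qset \<X>] \<longleftrightarrow> (\<exists>x\<in>\<X>. \<exists>y\<in>\<X>. Z = [x, dual y])"
  by (auto simp: set_Cons_def dual_qset_def)

lemma listset_dists: "W \<in> listset [dists :: ('v, ennreal) qset] \<longleftrightarrow> (\<exists>\<alpha>. W = [pt \<alpha>])"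
  by (auto simp: set_Cons_def range_pt)

lemma rel_of_components_pair:
  assumes "x \<in> \<X>" "y \<in> \<X>" "mat.subspace (D x y \<alpha>)"
  shows "rel_of_components \<X> D [x, dual y] [pt \<alpha>] = pt_row ` flat ` D x y \<alpha>"
proof -
  have "0 \<in> pt_row ` flat ` D x y \<alpha>"
    by (intro mat.subspace_0 linear_map_subspace linear_pt_row linear_flat assms)
  then show ?thesis using assms by (auto simp: rel_of_components_def split: if_splits)
qed

lemma binary_relation_of_components:
  assumes D: "\<And>x y. x \<in> \<X> \<Longrightarrow> y \<in> \<X> \<Longrightarrow> decomposition [x] [y] (D x y)"
  shows "binary_relation [\<X>, dual_qset \<X>] [dists] (rel_of_components \<X> D)"
  unfolding binary_relation_def
proof (intro allI)
  fix Z W :: "('a, ennreal) atom list"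
  show "if Z \<in> listset [\<X>, dual_qset \<X>] \<and> W \<in> listset [dists]
       then rel_of_components \<X> D Z W \<subseteq> ops Z W \<and> mat.subspace (rel_of_components \<X> D Z W) else rel_of_components \<X> D Z W = {0}"
  proof (cases "Z \<in> listset [\<X>, dual_qset \<X>] \<and> W \<in> listset [dists]")
    case True
    then obtain x y \<alpha> where xy: "x \<in> \<X>" "y \<in> \<X>" "Z = [x, dual y]" "W = [pt \<alpha>]"
      unfolding listset_pair listset_dists by blast
    note D' = decompositionD [OF D [OF xy(1,2)]]
    have R: "rel_of_components \<X> D Z W = pt_row ` flat ` D x y \<alpha>"
      unfolding xy(3,4) by (rule rel_of_components_pair [where D = D, OF xy(1,2) D'(1)])
    have "pt_row (flat r) \<in> ops Z W" if r: "r \<in> D x y \<alpha>" for r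
      unfolding xy(3,4) by (rule pt_row_ops [OF flat_in_functionals [OF subsetD [OF D'(2) r]]])
    moreover have "mat.subspace (pt_row ` flat ` D x y \<alpha>)"
      by (intro linear_map_subspace linear_pt_row linear_flat D'(1))
    ultimately show ?thesis using True unfolding R by auto
  next
    case False
    then have "rel_of_components \<X> D Z W = {0}"
      unfolding rel_of_components_def listset_pair listset_dists by auto
    then show ?thesis using False by (simp only: if_False)
  qed
qed

lemma component_of_components:
  assumes D: "\<And>x y. x \<in> \<X> \<Longrightarrow> y \<in> \<X> \<Longrightarrow> decomposition [x] [y] (D x y)" and xy: "x \<in> \<X>" "y \<in> \<X>"
  shows "component (rel_of_components \<X> D) x y = D x y"
proof
  fix \<alpha>
  note D' = decompositionD [OF D [OF xy]]
  have "at_point (pt_row (flat r)) = flat r" if r: "r \<in> D x y \<alpha>" for r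
    by (rule at_point_pt_row [OF flat_in_functionals [OF subsetD [OF D'(2) r]]])
  then have "at_point ` rel_of_components \<X> D [x, dual y] [pt \<alpha>] = flat ` D x y \<alpha>"
    unfolding rel_of_components_pair [where D = D, OF xy D'(1)] image_image by simp
  then have "component (rel_of_components \<X> D) x y \<alpha> = {r \<in> ops [x] [y]. flat r \<in> flat ` D x y \<alpha>}"
    by (simp add: component_def)
  also have "\<dots> = D x y \<alpha>" using D'(2) [of \<alpha>] inj_on_flat [of x y] by (auto simp: inj_on_def)
  finally show "component (rel_of_components \<X> D) x y \<alpha> = D x y \<alpha>" .
qed

lemma relation_eqI:
  assumes F: "binary_relation [\<X>, dual_qset \<X>] [dists] F" and G: "binary_relation [\<X>, dual_qset \<X>] [dists] G"
    and fin: "\<And>x. x \<in> \<X> \<Longrightarrow> finite (atom_basis x)"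
    and eq: "\<And>x y. x \<in> \<X> \<Longrightarrow> y \<in> \<X> \<Longrightarrow> component F x y = component G x y"
  shows "F = G"
proof (intro ext)
  fix Z W
  show "F Z W = G Z W"
  proof (cases "Z \<in> listset [\<X>, dual_qset \<X>] \<and> W \<in> listset [dists]")
    case True
    then obtain x y \<alpha> where xy: "x \<in> \<X>" "y \<in> \<X>" "Z = [x, dual y]" "W = [pt \<alpha>]"
      unfolding listset_pair listset_dists by blast
    have "F Z W = pt_row ` flat ` component F x y \<alpha>"
      unfolding xy(3,4) using F fin xy(1,2) by (rule F_component)
    moreover have "G Z W = pt_row ` flat ` component G x y \<alpha>"
      unfolding xy(3,4) using G fin xy(1,2) by (rule F_component)
    ultimately show ?thesis by (simp add: eq [OF xy(1,2)])
  next
    case False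
    then have "F Z W = {0}" "G Z W = {0}" using F G unfolding binary_relation_def by meson+
    then show ?thesis by simp
  qed
qed

lemma dagger_dist_elem:
  fixes F :: "'v::complex_inner drel"
  assumes F: "binary_relation [\<X>, dual_qset \<X>] [dists] F"
  shows "comp_rel [dists] (dagger_rel (dist_elem \<alpha>)) F Z W =
    (if Z \<in> listset [\<X>, dual_qset \<X>] \<and> W = [] then at_point ` F Z [pt \<alpha>] else {0})"
    (is "?C = ?R")
proof -
  have e: "dist_elem \<alpha> [] [pt \<beta>] = (if \<beta> = \<alpha> then ops [] [pt \<beta> :: ('v, ennreal) atom] else {0})" for \<beta>
    using classical_rel_pt [of "[]" "[UNIV]" "\<lambda>_ b. b = [\<alpha>]" "[]" "[\<beta>]"]
    by (simp add: dist_elem_def classical_elem_def set_Cons_def cong: if_cong)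
  have e0: "dist_elem \<alpha> X Y = {0 :: 'v mat}" if "X \<noteq> []" for X Y
    using that by (auto simp: dist_elem_def classical_elem_def classical_rel_def)
  have R: "mat.subspace ?R"
  proof -
    have "mat.subspace (F Z [pt \<alpha>])" using F unfolding binary_relation_def by (metis mat.subspace_single_0)
    then show ?thesis by (simp add: linear_map_subspace linear_at_point)
  qed
  have prod: "mat_mult [pt \<beta>] (mat_dagger s) r = mat_scale (cnj (s [None] [])) (at_point r)"
    if "s \<in> ops [] [pt \<beta>]" for s r and \<beta> :: ennreal
  proof (intro ext)
    fix i j
    have "i = [] \<or> s [None] i = 0" using that by (auto simp: ops_def)
    then show "mat_mult [pt \<beta>] (mat_dagger s) r i j = mat_scale (cnj (s [None] [])) (at_point r) i j"
      by (auto simp: mat_mult_def mat_dagger_def mat_scale_def at_point_def basis_single)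
  qed
  have "?C \<subseteq> ?R"
    unfolding comp_rel_def
  proof (rule mat.span_minimal [OF _ R], safe)
    fix Y s t assume Y: "Y \<in> listset [dists]" and s: "s \<in> dagger_rel (dist_elem \<alpha>) Y W" and t: "t \<in> F Z Y"
    obtain \<beta> where \<beta>: "Y = [pt \<beta>]" using Y unfolding listset_dists by blast
    obtain s' where s': "s = mat_dagger s'" "s' \<in> dist_elem \<alpha> W Y" using s by (auto simp: dagger_rel_def)
    show "mat_mult Y s t \<in> ?R"
    proof (cases "s' = 0 \<or> t = 0")
      case True
      then have "mat_mult Y s t = 0" by (auto simp: s' mat_mult_def mat_dagger_def fun_eq_iff)
      then show ?thesis using mat.subspace_0 [OF R] by (simp only:)
    next
      case False
      then have W: "W = []" using e0 s'(2) by blast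
      then have "\<beta> = \<alpha>" "s' \<in> ops [] [pt \<beta>]" using s'(2) False unfolding \<beta> W e by (auto split: if_splits)
      moreover have "Z \<in> listset [\<X>, dual_qset \<X>]" using F t False unfolding binary_relation_def by (metis singletonD)
      ultimately have "at_point t \<in> ?R" using t W by (auto simp: \<beta>)
      then have "mat_scale (cnj (s' [None] [])) (at_point t) \<in> ?R" by (rule mat.subspace_scale [OF R])
      then show ?thesis unfolding s'(1) \<beta> prod [OF \<open>s' \<in> ops [] [pt \<beta>]\<close>] .
    qed
  qed
  moreover have "?R \<subseteq> ?C"
  proof (cases "Z \<in> listset [\<X>, dual_qset \<X>] \<and> W = []")
    case True
    have "at_point r \<in> ?C" if r: "r \<in> F Z [pt \<alpha>]" for r
    proof -
      let ?s = "mat_unit [None] []"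
      have s: "?s \<in> ops [] [pt \<alpha> :: ('v, ennreal) atom]" by (intro mat_unit_ops) (auto simp: basis_single)
      have "mat_mult [pt \<alpha>] (mat_dagger ?s) r = at_point r"
        unfolding prod [OF s] by (simp add: mat_unit_def mat_scale_def)
      moreover have "mat_dagger ?s \<in> dagger_rel (dist_elem \<alpha>) [pt \<alpha>] W"
        using s True by (simp add: dagger_rel_def e)
      moreover have "[pt \<alpha>] \<in> listset [dists :: ('v, ennreal) qset]" unfolding listset_dists by blast
      ultimately show ?thesis
        unfolding comp_rel_def using r by (intro mat.span_base) (metis (mono_tags, lifting) mem_Collect_eq)
    qed
    then show ?thesis using True by auto
  next
    case False
    then show ?thesis by (auto simp: comp_rel_def mat.span_zero)
  qed
  ultimately show ?thesis by blast
qed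

text \<open>The relations \<open>R\<^sub>\<alpha>\<close> in the correspondence are determined by \<open>F\<close>, since \<open>flat\<close> is injective; they are
  the components of \<open>F\<close>.\<close>

lemma corresponds_iff:
  fixes A :: "'v::complex_inner set set"
  assumes F: "binary_relation [qset A, dual_qset (qset A)] [dists] F"
    and fin: "\<And>x :: ('v, ennreal) atom. x \<in> qset A \<Longrightarrow> finite (atom_basis x)"
    and dec: "\<And>x y. x \<in> qset A \<Longrightarrow> y \<in> qset A \<Longrightarrow> decomposition [x] [y] (component F x y)"
  shows "corresponds A V F \<longleftrightarrow> (\<forall>\<beta>\<ge>0. \<forall>X\<in>A. \<forall>Y\<in>A.
    level (component F (Prim (Sub X)) (Prim (Sub Y))) \<beta> = corner X Y ` V \<beta>)" (is "_ \<longleftrightarrow> ?r")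
proof -
  let ?X = "qset A"
  have comp: "R \<alpha> [x] [y] = component F x y \<alpha>"
    if R: "binary_relation [?X] [?X] (R \<alpha>)" "hat [?X] ?X (R \<alpha>) = comp_rel [dists] (dagger_rel (dist_elem \<alpha>)) F"
      and xy: "x \<in> ?X" "y \<in> ?X" for R \<alpha> x y
  proof -
    have Z: "[x, dual y] \<in> listset [?X, dual_qset ?X]" using xy unfolding listset_pair by blast
    then have "hat [?X] ?X (R \<alpha>) [x, dual y] [] = flat ` R \<alpha> [x] [y]"
      by (subst hat_eq [OF R(1)]) (use fin in \<open>simp_all del: listset.simps\<close>)
    moreover have "comp_rel [dists] (dagger_rel (dist_elem \<alpha>)) F [x, dual y] [] = fiber F x y \<alpha>"
      using Z by (subst dagger_dist_elem [OF F]) simp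
    moreover have "flat ` component F x y \<alpha> = fiber F x y \<alpha>" using F fin xy by (rule flat_component)
    ultimately have "flat ` R \<alpha> [x] [y] = flat ` component F x y \<alpha>" using R(2) by simp
    moreover have "[x] \<in> listset [?X]" using xy by (auto simp: set_Cons_def)
    then have "R \<alpha> [x] [y] \<subseteq> ops [x] [y]" by (rule binary_relation_ops [OF R(1) _ xy(2)])
    moreover have "component F x y \<alpha> \<subseteq> ops [x] [y]" by (auto simp: component_def)
    ultimately show ?thesis using inj_on_image_eq_iff [OF inj_on_flat] by blast
  qed
  have mem: "Prim (Sub X) \<in> ?X" if "X \<in> A" for X :: "'v set" using that by (simp add: qset_def)
  show ?thesis
  proof
    assume "corresponds A V F"
    then obtain R where R: "\<And>\<alpha>. binary_relation [?X] [?X] (R \<alpha>)"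
        "\<And>\<alpha>. hat [?X] ?X (R \<alpha>) = comp_rel [dists] (dagger_rel (dist_elem \<alpha>)) F"
      and V: "\<And>\<beta> X Y. \<beta> \<ge> 0 \<Longrightarrow> X \<in> A \<Longrightarrow> Y \<in> A \<Longrightarrow>
        mat.span (\<Union>\<alpha>\<in>{0..ennreal \<beta>}. R \<alpha> [Prim (Sub X)] [Prim (Sub Y)]) = corner X Y ` V \<beta>"
      unfolding corresponds_def by blast
    show ?r
    proof (intro allI impI ballI)
      fix \<beta> :: real and X Y assume b: "0 \<le> \<beta>" "X \<in> A" "Y \<in> A"
      have "R \<alpha> [Prim (Sub X)] [Prim (Sub Y)] = component F (Prim (Sub X)) (Prim (Sub Y)) \<alpha>" for \<alpha>
        by (rule comp [OF R mem [OF b(2)] mem [OF b(3)]])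
      then show "level (component F (Prim (Sub X)) (Prim (Sub Y))) \<beta> = corner X Y ` V \<beta>"
        using V [OF b] by (simp add: level_def)
    qed
  next
    assume r: ?r
    define R where "R \<alpha> = (\<lambda>P Q. insert 0 (\<Union>x\<in>?X. \<Union>y\<in>?X. if P = [x] \<and> Q = [y] then component F x y \<alpha> else {}))" for \<alpha>
    have sub: "mat.subspace (component F x y \<alpha>)" if xy: "x \<in> ?X" "y \<in> ?X" for x y \<alpha>
      by (rule decompositionD(1) [OF dec [OF xy]])
    have Rxy: "R \<alpha> [x] [y] = component F x y \<alpha>" if xy: "x \<in> ?X" "y \<in> ?X" for x y \<alpha>
      using mat.subspace_0 [OF sub [OF xy]] xy by (auto simp: R_def split: if_splits)
    have R: "binary_relation [?X] [?X] (R \<alpha>)" for \<alpha>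
      unfolding binary_relation_def
    proof (intro allI)
      fix P Q :: "('v, ennreal) atom list"
      show "if P \<in> listset [?X] \<and> Q \<in> listset [?X] then R \<alpha> P Q \<subseteq> ops P Q \<and> mat.subspace (R \<alpha> P Q) else R \<alpha> P Q = {0}"
      proof (cases "P \<in> listset [?X] \<and> Q \<in> listset [?X]")
        case True
        then obtain x y where "P = [x]" "Q = [y]" "x \<in> ?X" "y \<in> ?X" by (auto simp: set_Cons_def)
        then show ?thesis using Rxy sub True by (auto simp: component_def)
      next
        case False
        then have "R \<alpha> P Q = {0}" unfolding R_def by (auto simp: set_Cons_def)
        then show ?thesis using False by (simp only: if_False)
      qed
    qed
    have "hat [?X] ?X (R \<alpha>) = comp_rel [dists] (dagger_rel (dist_elem \<alpha>)) F" for \<alpha>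
    proof (intro ext)
      fix Z W
      show "hat [?X] ?X (R \<alpha>) Z W = comp_rel [dists] (dagger_rel (dist_elem \<alpha>)) F Z W"
      proof (cases "Z \<in> listset [?X, dual_qset ?X] \<and> W = []")
        case True
        then obtain x y where xy: "x \<in> ?X" "y \<in> ?X" "Z = [x, dual y]" unfolding listset_pair by blast
        have "hat [?X] ?X (R \<alpha>) Z W = flat ` R \<alpha> [x] [y]"
          using fin True by (subst hat_eq [OF R]) (simp_all add: xy(3) del: listset.simps)
        also have "\<dots> = fiber F x y \<alpha>"
          unfolding Rxy [OF xy(1,2)] using F fin xy(1,2) by (rule flat_component)
        also have "\<dots> = comp_rel [dists] (dagger_rel (dist_elem \<alpha>)) F Z W"
          using True by (subst dagger_dist_elem [OF F]) (simp add: xy(3) del: listset.simps)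
        finally show ?thesis .
      next
        case False
        have "hat [?X] ?X (R \<alpha>) Z W = {0}"
          by (subst hat_eq [OF R]) (use fin False in \<open>auto simp del: listset.simps\<close>)
        moreover have "comp_rel [dists] (dagger_rel (dist_elem \<alpha>)) F Z W = {0}"
          by (subst dagger_dist_elem [OF F]) (use False in \<open>auto simp del: listset.simps\<close>)
        ultimately show ?thesis by simp
      qed
    qed
    moreover have "mat.span (\<Union>\<alpha>\<in>{0..ennreal \<beta>}. R \<alpha> [Prim (Sub X)] [Prim (Sub Y)]) = corner X Y ` V \<beta>"
      if b: "0 \<le> \<beta>" and X: "X \<in> A" and Y: "Y \<in> A" for \<beta> X Y
    proof -
      have "R \<alpha> [Prim (Sub X)] [Prim (Sub Y)] = component F (Prim (Sub X)) (Prim (Sub Y)) \<alpha>" for \<alpha>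
        by (rule Rxy [OF mem [OF X] mem [OF Y]])
      moreover have "level (component F (Prim (Sub X)) (Prim (Sub Y))) \<beta> = corner X Y ` V \<beta>"
        using r b X Y by blast
      ultimately show ?thesis by (simp add: level_def)
    qed
    ultimately show "corresponds A V F" unfolding corresponds_def using R by blast
  qed
qed

section \<open>Square summable families\<close>

lemma l2_eqI: "(\<And>X. coord \<xi> X = coord \<eta> X) \<Longrightarrow> \<xi> = \<eta>" by (metis coord_inject ext)

lemma coord_simps [simp]: "coord 0 X = 0" "coord (\<xi> + \<eta>) X = coord \<xi> X + coord \<eta> X"
  "coord (c *\<^sub>C \<xi>) X = c *\<^sub>C coord \<xi> X" "coord (- \<xi>) X = - coord \<xi> X" "coord (\<xi> - \<eta>) X = coord \<xi> X - coord \<eta> X"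
  unfolding minus_l2_def by (simp_all only: zero_l2.rep_eq plus_l2.rep_eq scaleC_l2.rep_eq uminus_l2.rep_eq) simp

lemma coord_sum: "coord (sum f S) X = (\<Sum>i\<in>S. coord (f i) X)" by (induction S rule: infinite_finite_induct) auto

lemma coord_inc: "coord (inc X x) Y = (if Y = X then x else 0)"
proof -
  have "(\<lambda>i. (norm (if i = X then x else 0))\<^sup>2) summable_on UNIV"
    by (rule finite_nonzero_values_imp_summable_on, rule finite_subset [of _ "{X}"]) auto
  then show ?thesis by (simp add: inc_def Abs_l2_inverse)
qed

lemma inc_add: "inc X (x + y) = inc X x + inc X y" by (rule l2_eqI) (simp add: coord_inc)

lemma inc_scaleC: "inc X (c *\<^sub>C x) = c *\<^sub>C inc X x" by (rule l2_eqI) (simp add: coord_inc)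

lemma inc_0: "inc X 0 = 0" by (rule l2_eqI) (simp add: coord_inc)

lemma inc_sum: "inc X (sum f S) = (\<Sum>i\<in>S. inc X (f i))" by (rule l2_eqI) (simp add: coord_inc coord_sum)

lemma has_sum_cinner: "((\<lambda>X. cinner (coord \<xi> X) (coord \<eta> X)) has_sum cinner \<xi> \<eta>) UNIV"
  unfolding cinner_l2_def by (intro has_sum_infsum summable_cinner)

lemma cinner_inc: "cinner (inc X x) \<xi> = cinner x (coord \<xi> X)"
proof -
  have "((\<lambda>Y. cinner (coord (inc X x) Y) (coord \<xi> Y)) has_sum cinner x (coord \<xi> X)) {X}"
    using has_sum_finite [of "{X}" "\<lambda>Y. cinner (coord (inc X x) Y) (coord \<xi> Y)"] by (simp add: coord_inc)
  then have "((\<lambda>Y. cinner (coord (inc X x) Y) (coord \<xi> Y)) has_sum cinner x (coord \<xi> X)) UNIV"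
    by (rule has_sum_cong_neutral [THEN iffD1, rotated -1]) (auto simp: coord_inc)
  then show ?thesis using has_sum_cinner has_sum_unique by blast
qed

lemma cinner_self_norm: "Re (cinner x x) = (norm x)\<^sup>2" by (simp add: cinner_self)

lemma has_sum_norm: "((\<lambda>X. (norm (coord \<xi> X))\<^sup>2) has_sum (norm \<xi>)\<^sup>2) UNIV"
  using has_sum_Re [OF has_sum_cinner [of \<xi> \<xi>]] by (simp add: cinner_self_norm)

lemma norm_inc: "norm (inc X x) = norm x"
proof -
  have "(norm (inc X x))\<^sup>2 = (norm x)\<^sup>2"
    unfolding cinner_self_norm [symmetric] cinner_inc by (simp add: coord_inc)
  then show ?thesis by (simp add: power2_eq_iff_nonneg)
qed

lemma cinner_sum_left: "cinner (sum f S) x = (\<Sum>i\<in>S. cinner (f i) x)"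
  by (induction S rule: infinite_finite_induct) (simp_all add: cinner_add_left)

lemma cinner_diff_left: "cinner (x - y) z = cinner x z - cinner y z" using cinner_add_left [of "x - y" y z] by simp

lemma complex_Cauchy_Schwarz: "cmod (cinner x y) \<le> norm x * norm y"
proof (cases "cinner x y = 0")
  case False
  \<comment> \<open>rotating \<open>y\<close> by this phase makes the inner product real\<close>
  define c where "c = cnj (cinner x y) / cmod (cinner x y)"
  have c: "cmod c = 1" using False by (simp add: c_def norm_divide)
  have "c * cinner x y = complex_of_real (cmod (cinner x y))" using False complex_norm_square [of "cinner x y"]
    by (simp add: c_def field_simps power2_eq_square)
  then have "cmod (cinner x y) = Re (cinner x (c *\<^sub>C y))" by (simp add: cinner_scaleC_right)
  also have "\<dots> \<le> norm x * norm (c *\<^sub>C y)"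
    unfolding Re_cinner using Cauchy_Schwarz_ineq2 [of x "c *\<^sub>C y"] by linarith
  finally show ?thesis by (simp add: norm_scaleC c)
qed simp

section \<open>Operators on the direct sum of the atoms\<close>

abbreviation sub_atom :: "'v set \<Rightarrow> ('v, ennreal) atom" where
  "sub_atom X \<equiv> Prim (Sub X)"

definition truncate :: "'v::complex_inner set set \<Rightarrow> ('v set, 'v) l2 \<Rightarrow> ('v set, 'v) l2" where
  "truncate F \<xi> = (\<Sum>X\<in>F. inc X (coord \<xi> X))"

lemma coord_truncate: "finite F \<Longrightarrow> coord (truncate F \<xi>) X = (if X \<in> F then coord \<xi> X else 0)"
  by (simp add: truncate_def coord_sum coord_inc)

lemma cinner_truncate: "cinner (truncate F \<xi>) \<zeta> = (\<Sum>X\<in>F. cinner (coord \<xi> X) (coord \<zeta> X))"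
  by (simp add: truncate_def cinner_sum_left cinner_inc)

lemma norm_truncate_le: "norm (truncate F \<xi>) \<le> norm \<xi>"
proof (cases "finite F \<and> truncate F \<xi> \<noteq> 0")
  case True
  then have "cinner (truncate F \<xi>) (truncate F \<xi>) = cinner (truncate F \<xi>) \<xi>"
    by (simp add: cinner_truncate coord_truncate)
  then have "(norm (truncate F \<xi>))\<^sup>2 = Re (cinner (truncate F \<xi>) \<xi>)" by (simp flip: cinner_self_norm)
  also have "\<dots> \<le> norm (truncate F \<xi>) * norm \<xi>" using complex_Cauchy_Schwarz complex_Re_le_cmod order_trans by blast
  finally show ?thesis using True by (simp add: power2_eq_square)
qed (auto simp: truncate_def)

lemma cinner_continuous:
  assumes "(f \<longlongrightarrow> \<xi>) G"
  shows "((\<lambda>i. cinner \<zeta> (f i)) \<longlongrightarrow> cinner \<zeta> \<xi>) G"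
proof -
  have "((\<lambda>i. norm \<zeta> * norm (f i - \<xi>)) \<longlongrightarrow> norm \<zeta> * 0) G"
    using assms by (intro tendsto_mult_left) (simp add: tendsto_norm_zero_iff LIM_zero_iff)
  then have t: "((\<lambda>i. norm \<zeta> * norm (f i - \<xi>)) \<longlongrightarrow> 0) G" by simp
  have "((\<lambda>i. cinner \<zeta> (f i) - cinner \<zeta> \<xi>) \<longlongrightarrow> 0) G"
    by (rule Lim_null_comparison [OF always_eventually t])
      (simp add: complex_Cauchy_Schwarz cinner_diff_right [symmetric])
  then show ?thesis by (simp add: LIM_zero_iff)
qed

lemma orthonormal_expansion:
  assumes B: "orthonormal_basis X B" and x: "x \<in> X"
  shows "x = (\<Sum>e\<in>B. cinner e x *\<^sub>C e)"
proof -
  define y where "y = (\<Sum>e\<in>B. cinner e x *\<^sub>C e)"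
  have fB: "finite B" and sB: "complex_vector.span B = X"
    and on: "\<And>e e'. e \<in> B \<Longrightarrow> e' \<in> B \<Longrightarrow> cinner e e' = (if e = e' then 1 else 0)"
    using B by (simp_all add: orthonormal_basis_def)
  have "cinner e (x - y) = 0" if e: "e \<in> B" for e
  proof -
    have "cinner e y = (\<Sum>e'\<in>B. if e' = e then cinner e x else 0)"
      unfolding y_def cinner_sum_right using e by (intro sum.cong) (auto simp: cinner_scaleC_right on)
    then show ?thesis using e fB by (simp add: cinner_diff_right)
  qed
  then have "complex_vector.span B \<subseteq> {z. cinner z (x - y) = 0}"
    by (intro complex_vector.span_minimal complex_vector.subspaceI)
      (auto simp: cinner_add_left cinner_scaleC_left)
  moreover have xB: "x \<in> complex_vector.span B" using x sB by simp
  have "x - y \<in> complex_vector.span B"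
    unfolding y_def
    by (intro complex_vector.span_diff [OF xB] complex_vector.span_sum complex_vector.span_scale)
      (rule complex_vector.span_base)
  ultimately have "cinner (x - y) (x - y) = 0" by blast
  then have "x - y = 0" by (simp add: cinner_self)
  then show ?thesis by (simp add: y_def)
qed

locale atom_set =
  fixes A :: "'v::complex_inner set set"
  assumes qs: "quantum_set A"
begin

abbreviation "H \<equiv> direct_sum A"

lemma onb: assumes "X \<in> A"
  shows "orthonormal_basis X (onb X)" "finite (onb X)" "complex_vector.span (onb X) = X"
    "e \<in> onb X \<Longrightarrow> e \<in> X" "e \<in> onb X \<Longrightarrow> e' \<in> onb X \<Longrightarrow> cinner e e' = (if e = e' then 1 else 0)"
    "e \<in> onb X \<Longrightarrow> norm e = 1"
proof -
  obtain B where "finite B" "X = complex_vector.span B" using qs assms by (auto simp: quantum_set_def)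
  then have "\<exists>C. orthonormal_basis X C" using orthonormal_basis_exists by blast
  then show o: "orthonormal_basis X (onb X)" unfolding onb_def by (rule someI_ex)
  then show "finite (onb X)" and sp: "complex_vector.span (onb X) = X"
    and on: "e \<in> onb X \<Longrightarrow> e' \<in> onb X \<Longrightarrow> cinner e e' = (if e = e' then 1 else 0)" for e e'
    by (auto simp: orthonormal_basis_def)
  show "e \<in> onb X \<Longrightarrow> e \<in> X" using complex_vector.span_base sp by blast
  assume e: "e \<in> onb X"
  have "(norm e)\<^sup>2 = 1" using on [OF e e] cinner_self_norm [of e] by simp
  then show "norm e = 1" by (simp add: power2_eq_1_iff) (use norm_ge_zero [of e] in linarith)
qed

lemma atom_subspace: "X \<in> A \<Longrightarrow> complex_vector.subspace X"
  using onb(3) complex_vector.subspace_span by metis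

lemma expand: "X \<in> A \<Longrightarrow> x \<in> X \<Longrightarrow> x = (\<Sum>e\<in>onb X. cinner e x *\<^sub>C e)"
  using onb(1) by (rule orthonormal_expansion)

lemma subspace_direct_sum: "complex_vector.subspace H"
  using atom_subspace unfolding complex_vector.subspace_def direct_sum_def by auto

lemma inc_in [simp]: "X \<in> A \<Longrightarrow> x \<in> X \<Longrightarrow> inc X x \<in> H"
  using atom_subspace by (auto simp: direct_sum_def coord_inc complex_vector.subspace_0)

lemma coord_in: "\<xi> \<in> H \<Longrightarrow> X \<in> A \<Longrightarrow> coord \<xi> X \<in> X"
  by (auto simp: direct_sum_def)

lemma coord_out: "\<xi> \<in> H \<Longrightarrow> X \<notin> A \<Longrightarrow> coord \<xi> X = 0"
  by (auto simp: direct_sum_def)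

lemma truncate_in: "F \<subseteq> A \<Longrightarrow> \<xi> \<in> H \<Longrightarrow> truncate F \<xi> \<in> H"
  unfolding truncate_def by (intro complex_vector.subspace_sum subspace_direct_sum inc_in coord_in) auto

lemma truncate_tendsto:
  assumes \<xi>: "\<xi> \<in> H"
  shows "((\<lambda>F. truncate F \<xi>) \<longlongrightarrow> \<xi>) (finite_subsets_at_top A)"
proof -
  have "((\<lambda>X. (norm (coord \<xi> X))\<^sup>2) has_sum (norm \<xi>)\<^sup>2) A"
    by (rule has_sum_cong_neutral [THEN iffD1, OF _ _ _ has_sum_norm]) (use coord_out [OF \<xi>] in auto)
  then have "((\<lambda>F. (norm \<xi>)\<^sup>2 - (\<Sum>X\<in>F. (norm (coord \<xi> X))\<^sup>2)) \<longlongrightarrow> (norm \<xi>)\<^sup>2 - (norm \<xi>)\<^sup>2) (finite_subsets_at_top A)"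
    unfolding has_sum_def by (intro tendsto_diff tendsto_const)
  then have t: "((\<lambda>F. (norm \<xi>)\<^sup>2 - (\<Sum>X\<in>F. (norm (coord \<xi> X))\<^sup>2)) \<longlongrightarrow> 0) (finite_subsets_at_top A)" by simp
  have n: "(norm (truncate F \<xi> - \<xi>))\<^sup>2 = (norm \<xi>)\<^sup>2 - (\<Sum>X\<in>F. (norm (coord \<xi> X))\<^sup>2)" if F: "finite F" for F
  proof -
    have "cinner (truncate F \<xi>) \<xi> = complex_of_real (\<Sum>X\<in>F. (norm (coord \<xi> X))\<^sup>2)"
      by (simp add: cinner_truncate cinner_self)
    moreover have "cinner (truncate F \<xi>) (truncate F \<xi>) = cinner (truncate F \<xi>) \<xi>"
      using F by (simp add: cinner_truncate coord_truncate)
    moreover have "cinner \<xi> (truncate F \<xi>) = cnj (cinner (truncate F \<xi>) \<xi>)" by (rule cinner_commute)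
    ultimately have "cinner (truncate F \<xi> - \<xi>) (truncate F \<xi> - \<xi>) =
        complex_of_real ((norm \<xi>)\<^sup>2 - (\<Sum>X\<in>F. (norm (coord \<xi> X))\<^sup>2))"
      by (simp add: cinner_diff_left cinner_diff_right cinner_self [of \<xi>])
    then show ?thesis unfolding cinner_self [of "truncate F \<xi> - \<xi>"] of_real_eq_iff .
  qed
  have "((\<lambda>F. (norm (truncate F \<xi> - \<xi>))\<^sup>2) \<longlongrightarrow> 0) (finite_subsets_at_top A)"
    by (rule Lim_transform_eventually [OF t], rule eventually_finite_subsets_at_top_weakI) (simp add: n)
  then have "((\<lambda>F. sqrt ((norm (truncate F \<xi> - \<xi>))\<^sup>2)) \<longlongrightarrow> sqrt 0) (finite_subsets_at_top A)"
    by (rule tendsto_real_sqrt)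
  then show ?thesis by (simp add: tendsto_norm_zero_iff LIM_zero_iff)
qed

lemma bounded_opsD:
  assumes "v \<in> bounded_ops H H"
  shows "\<xi> \<in> H \<Longrightarrow> v \<xi> \<in> H" "\<xi> \<notin> H \<Longrightarrow> v \<xi> = 0" "\<xi> \<in> H \<Longrightarrow> \<eta> \<in> H \<Longrightarrow> v (\<xi> + \<eta>) = v \<xi> + v \<eta>"
    "\<xi> \<in> H \<Longrightarrow> v (c *\<^sub>C \<xi>) = c *\<^sub>C v \<xi>"
  using assms by (auto simp: bounded_ops_def)

lemma bounded_ops_bound:
  assumes "v \<in> bounded_ops H H"
  obtains C where "0 \<le> C" "\<And>\<xi>. \<xi> \<in> H \<Longrightarrow> norm (v \<xi>) \<le> C * norm \<xi>"
proof -
  obtain C where C: "\<forall>\<xi>\<in>H. norm (v \<xi>) \<le> C * norm \<xi>" using assms by (auto simp: bounded_ops_def)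
  have "norm (v \<xi>) \<le> max C 0 * norm \<xi>" if "\<xi> \<in> H" for \<xi>
    using C that by (meson max.cobounded1 mult_right_mono norm_ge_zero order_trans)
  then show ?thesis using that [of "max C 0"] by simp
qed

lemma bounded_ops_0: "v \<in> bounded_ops H H \<Longrightarrow> v 0 = 0"
  using bounded_opsD(4) [of v 0 0] subspace_direct_sum by (simp add: complex_vector.subspace_0)

lemma bounded_ops_sum:
  assumes v: "v \<in> bounded_ops H H" and f: "\<And>i. i \<in> S \<Longrightarrow> f i \<in> H"
  shows "v (sum f S) = (\<Sum>i\<in>S. v (f i))" using f
proof (induction S rule: infinite_finite_induct)
  case (insert x S)
  then have "sum f S \<in> H" by (intro complex_vector.subspace_sum subspace_direct_sum) auto
  then show ?case using insert bounded_opsD(3) [OF v] by simp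
qed (simp_all add: bounded_ops_0 [OF v])

lemma bounded_ops_diff:
  assumes v: "v \<in> bounded_ops H H" and "\<xi> \<in> H" "\<eta> \<in> H"
  shows "v (\<xi> - \<eta>) = v \<xi> - v \<eta>"
proof -
  have "\<xi> - \<eta> \<in> H" using assms subspace_direct_sum by (auto intro: complex_vector.subspace_diff)
  then have "v ((\<xi> - \<eta>) + \<eta>) = v (\<xi> - \<eta>) + v \<eta>" using assms by (intro bounded_opsD(3)) auto
  then show ?thesis by simp
qed

lemma bounded_ops_continuous:
  assumes v: "v \<in> bounded_ops H H" and f: "(f \<longlongrightarrow> \<xi>) G" "\<And>i. i \<in> S \<Longrightarrow> f i \<in> H" "eventually (\<lambda>i. i \<in> S) G" and \<xi>: "\<xi> \<in> H"
  shows "((\<lambda>i. v (f i)) \<longlongrightarrow> v \<xi>) G"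
proof -
  obtain C where C: "0 \<le> C" "\<And>\<xi>. \<xi> \<in> H \<Longrightarrow> norm (v \<xi>) \<le> C * norm \<xi>" using bounded_ops_bound [OF v] by blast
  have "((\<lambda>i. C * norm (f i - \<xi>)) \<longlongrightarrow> C * 0) G"
    using f(1) by (intro tendsto_mult_left) (simp add: tendsto_norm_zero_iff LIM_zero_iff)
  moreover have "eventually (\<lambda>i. norm (v (f i) - v \<xi>) \<le> C * norm (f i - \<xi>)) G" using f(3)
  proof eventually_elim
    case (elim i)
    have "f i - \<xi> \<in> H" using f(2) [OF elim] \<xi> subspace_direct_sum by (auto intro: complex_vector.subspace_diff)
    then show ?case using C(2) bounded_ops_diff [OF v f(2) [OF elim] \<xi>] by metis
  qed
  ultimately have "((\<lambda>i. v (f i) - v \<xi>) \<longlongrightarrow> 0) G"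
    by (auto intro: Lim_null_comparison [of _ "\<lambda>i. C * norm (f i - \<xi>)"])
  then show ?thesis by (simp add: LIM_zero_iff)
qed

lemma direct_sum_scale: "\<xi> \<in> H \<Longrightarrow> c *\<^sub>C \<xi> \<in> H"
  using subspace_direct_sum by (rule complex_vector.subspace_scale)

lemma inc_onb: "X \<in> A \<Longrightarrow> x \<in> onb X \<Longrightarrow> inc X x \<in> H" by (simp add: onb(4))

lemma image_inc_expand:
  assumes v: "v \<in> bounded_ops H H" and X: "X \<in> A" and x: "x \<in> X"
  shows "v (inc X x) = (\<Sum>e\<in>onb X. cinner e x *\<^sub>C v (inc X e))"
proof -
  have "inc X x = (\<Sum>e\<in>onb X. cinner e x *\<^sub>C inc X e)"
    by (subst expand [OF X x]) (simp add: inc_sum inc_scaleC)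
  then have "v (inc X x) = (\<Sum>e\<in>onb X. v (cinner e x *\<^sub>C inc X e))"
    using bounded_ops_sum [OF v, of "onb X" "\<lambda>e. cinner e x *\<^sub>C inc X e"] inc_onb [OF X] direct_sum_scale by simp
  also have "\<dots> = (\<Sum>e\<in>onb X. cinner e x *\<^sub>C v (inc X e))"
    using inc_onb [OF X] by (intro sum.cong refl bounded_opsD(4) [OF v])
  finally show ?thesis .
qed

text \<open>The truncations of \<open>\<xi>\<close> to finitely many atoms converge to \<open>\<xi>\<close>, and \<open>v\<close> is continuous.\<close>

lemma entry_expansion:
  assumes v: "v \<in> bounded_ops H H" and \<xi>: "\<xi> \<in> H"
  shows "((\<lambda>Y. \<Sum>e\<in>onb Y. cinner \<zeta> (v (inc Y e)) * cinner e (coord \<xi> Y)) has_sum cinner \<zeta> (v \<xi>)) A"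
proof -
  have s: "cinner \<zeta> (v (truncate F \<xi>)) = (\<Sum>Y\<in>F. \<Sum>e\<in>onb Y. cinner \<zeta> (v (inc Y e)) * cinner e (coord \<xi> Y))"
    if F: "finite F" "F \<subseteq> A" for F
  proof -
    have "v (truncate F \<xi>) = (\<Sum>Y\<in>F. v (inc Y (coord \<xi> Y)))"
      unfolding truncate_def using F coord_in [OF \<xi>] by (intro bounded_ops_sum [OF v] inc_in) auto
    moreover have "v (inc Y (coord \<xi> Y)) = (\<Sum>e\<in>onb Y. cinner e (coord \<xi> Y) *\<^sub>C v (inc Y e))" if "Y \<in> F" for Y
      using image_inc_expand [OF v _ coord_in [OF \<xi>]] that F by blast
    ultimately show ?thesis by (simp add: cinner_sum_right cinner_scaleC_right mult.commute)
  qed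
  have "((\<lambda>F. cinner \<zeta> (v (truncate F \<xi>))) \<longlongrightarrow> cinner \<zeta> (v \<xi>)) (finite_subsets_at_top A)"
    by (rule cinner_continuous, rule bounded_ops_continuous [OF v truncate_tendsto [OF \<xi>], where S = "{F. F \<subseteq> A}"])
      (use truncate_in \<xi> in \<open>auto intro!: eventually_finite_subsets_at_top_weakI\<close>)
  then show ?thesis
    unfolding has_sum_def
    by (rule Lim_transform_eventually) (rule eventually_finite_subsets_at_top_weakI, simp add: s)
qed

lemma coord_eqI:
  assumes X: "X \<in> A" and xy: "x \<in> X" "y \<in> X" and e: "\<And>e. e \<in> onb X \<Longrightarrow> cinner e x = cinner e y"
  shows "x = y"
proof -
  have "x = (\<Sum>e\<in>onb X. cinner e x *\<^sub>C e)" by (rule expand [OF X xy(1)])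
  also have "\<dots> = (\<Sum>e\<in>onb X. cinner e y *\<^sub>C e)" using e by (intro sum.cong) simp_all
  also have "\<dots> = y" by (rule expand [OF X xy(2), symmetric])
  finally show ?thesis .
qed

text \<open>The components of \<open>a y\<close> are given by duality on each atom.  They are square summable: the finite
  partial sum \<open>z\<close> satisfies \<open>\<parallel>z\<parallel>\<^sup>2 = \<langle>b z | y\<rangle>\<close> and hence \<open>\<parallel>z\<parallel> \<le> C \<parallel>y\<parallel>\<close>.\<close>

lemma adjoint_exists:
  assumes b: "b \<in> bounded_ops H H"
  obtains a where "a \<in> bounded_ops H H" "\<And>x y. x \<in> H \<Longrightarrow> y \<in> H \<Longrightarrow> cinner (a x) y = cinner x (b y)"
proof -
  obtain C where C: "0 \<le> C" "\<And>\<xi>. \<xi> \<in> H \<Longrightarrow> norm (b \<xi>) \<le> C * norm \<xi>" using bounded_ops_bound [OF b] by blast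
  define c where "c y X = (if X \<in> A then \<Sum>e\<in>onb X. cinner (b (inc X e)) y *\<^sub>C e else 0)" for y X
  have cX: "c y X \<in> X" if "X \<in> A" for y X using that onb(4) atom_subspace
    by (auto simp: c_def intro!: complex_vector.subspace_sum complex_vector.subspace_scale)
  have cin: "cinner x (c y X) = cinner (b (inc X x)) y" if X: "X \<in> A" and x: "x \<in> X" for x y X
  proof -
    have "cinner x (c y X) = (\<Sum>e\<in>onb X. cinner (b (inc X e)) y * cinner x e)"
      using X by (simp add: c_def cinner_sum_right cinner_scaleC_right)
    also have "\<dots> = cinner (\<Sum>e\<in>onb X. cinner e x *\<^sub>C b (inc X e)) y"
      unfolding cinner_sum_left cinner_scaleC_left by (simp add: mult.commute flip: cinner_commute)
    also have "(\<Sum>e\<in>onb X. cinner e x *\<^sub>C b (inc X e)) = b (inc X x)" by (rule image_inc_expand [OF b X x, symmetric])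
    finally show ?thesis .
  qed
  have summ: "(\<lambda>X. (norm (c y X))\<^sup>2) summable_on UNIV" if y: "y \<in> H" for y
  proof (rule nonneg_bdd_above_summable_on)
    show "bdd_above (sum (\<lambda>X. (norm (c y X))\<^sup>2) ` {F. F \<subseteq> UNIV \<and> finite F})"
    proof (rule bdd_aboveI2)
      fix F :: "'v set set" assume "F \<in> {F. F \<subseteq> UNIV \<and> finite F}"
      then have F: "finite F" by simp
      define G where "G = F \<inter> A"
      have G: "finite G" "G \<subseteq> A" using F by (auto simp: G_def)
      define z where "z = (\<Sum>X\<in>G. inc X (c y X))"
      have zH: "z \<in> H" unfolding z_def using G cX by (intro complex_vector.subspace_sum subspace_direct_sum inc_in) auto
      have "cinner z z = (\<Sum>X\<in>G. cinner (c y X) (coord z X))"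
        by (subst (1) z_def) (simp add: cinner_sum_left cinner_inc)
      also have "\<dots> = (\<Sum>X\<in>G. cinner (c y X) (c y X))"
        using G by (intro sum.cong refl) (simp add: z_def coord_sum coord_inc)
      finally have zz: "cinner z z = (\<Sum>X\<in>G. cinner (c y X) (c y X))" .
      then have "complex_of_real ((norm z)\<^sup>2) = complex_of_real (\<Sum>X\<in>G. (norm (c y X))\<^sup>2)"
        by (simp add: cinner_self)
      then have n1: "(norm z)\<^sup>2 = (\<Sum>X\<in>G. (norm (c y X))\<^sup>2)" unfolding of_real_eq_iff .
      have "cinner z z = (\<Sum>X\<in>G. cinner (b (inc X (c y X))) y)"
        unfolding zz using G cX by (intro sum.cong refl cin) auto
      also have "\<dots> = cinner (b z) y"
        unfolding z_def cinner_sum_left [symmetric] using G cX by (subst bounded_ops_sum [OF b]) auto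
      finally have "(norm z)\<^sup>2 = Re (cinner (b z) y)" by (simp flip: cinner_self_norm)
      also have "\<dots> \<le> norm (b z) * norm y" using complex_Cauchy_Schwarz complex_Re_le_cmod order_trans by blast
      also have "\<dots> \<le> C * norm z * norm y" using C(2) [OF zH] by (intro mult_right_mono) auto
      finally have "norm z * norm z \<le> norm z * (C * norm y)" by (simp add: power2_eq_square mult_ac)
      then have "norm z \<le> C * norm y" using C(1) by (cases "norm z = 0") (auto simp: mult_le_cancel_left)
      then have "(norm z)\<^sup>2 \<le> (C * norm y)\<^sup>2" by (intro power_mono) auto
      moreover have "(\<Sum>X\<in>F. (norm (c y X))\<^sup>2) = (\<Sum>X\<in>G. (norm (c y X))\<^sup>2)"
        using F by (intro sum.mono_neutral_right) (auto simp: G_def c_def)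
      ultimately show "(\<Sum>X\<in>F. (norm (c y X))\<^sup>2) \<le> (C * norm y)\<^sup>2" using n1 by simp
    qed
  qed auto
  define a where "a y = (if y \<in> H then Abs_l2 (c y) else 0)" for y
  have coord_a: "coord (a y) X = c y X" if "y \<in> H" for y X
    using summ [OF that] that by (simp add: a_def Abs_l2_inverse)
  have aH: "a y \<in> H" if y: "y \<in> H" for y
  proof -
    have "coord (a y) X \<in> X" if "X \<in> A" for X using that cX by (simp add: coord_a [OF y])
    moreover have "coord (a y) X = 0" if "X \<notin> A" for X using that by (simp add: coord_a [OF y] c_def)
    ultimately show ?thesis by (simp add: direct_sum_def)
  qed
  have adj: "cinner x (a y) = cinner (b x) y" if x: "x \<in> H" and y: "y \<in> H" for x y
  proof -
    have "((\<lambda>F. cinner (a y) (truncate F x)) \<longlongrightarrow> cinner (a y) x) (finite_subsets_at_top A)"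
      by (intro cinner_continuous truncate_tendsto x)
    moreover have "((\<lambda>F. cinner y (b (truncate F x))) \<longlongrightarrow> cinner y (b x)) (finite_subsets_at_top A)"
      by (rule cinner_continuous, rule bounded_ops_continuous [OF b truncate_tendsto [OF x], where S = "{F. F \<subseteq> A}"])
        (use truncate_in x in \<open>auto intro!: eventually_finite_subsets_at_top_weakI\<close>)
    moreover have e: "cinner (a y) (truncate F x) = cinner y (b (truncate F x))" if F: "finite F" "F \<subseteq> A" for F
    proof -
      have "cinner (truncate F x) (a y) = (\<Sum>X\<in>F. cinner (b (inc X (coord x X))) y)"
        unfolding truncate_def cinner_sum_left using F coord_in [OF x] y
        by (intro sum.cong refl) (auto simp: cinner_inc coord_a cin)
      also have "\<dots> = cinner (b (truncate F x)) y"
        unfolding truncate_def cinner_sum_left [symmetric] using F coord_in [OF x]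
        by (subst bounded_ops_sum [OF b]) auto
      finally show ?thesis by (metis cinner_commute)
    qed
    have "((\<lambda>F. cinner (a y) (truncate F x)) \<longlongrightarrow> cinner y (b x)) (finite_subsets_at_top A)"
      by (rule Lim_transform_eventually [OF calculation(2)], rule eventually_finite_subsets_at_top_weakI) (simp add: e)
    then have "cinner (a y) x = cinner y (b x)"
      using calculation(1) by (intro tendsto_unique [OF finite_subsets_at_top_neq_bot])
    then show ?thesis by (metis cinner_commute)
  qed
  have "a \<in> bounded_ops H H"
    unfolding bounded_ops_def
  proof (intro CollectI conjI ballI allI impI)
    show "a x \<in> H" if "x \<in> H" for x using aH that .
    show "a x = 0" if "x \<notin> H" for x using that by (simp add: a_def)
    have add: "x + y \<in> H" if "x \<in> H" "y \<in> H" for x y using that subspace_direct_sum by (intro complex_vector.subspace_add)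
    have scl: "k *\<^sub>C x \<in> H" if "x \<in> H" for x k using that subspace_direct_sum by (intro complex_vector.subspace_scale)
    show "a (x + y) = a x + a y" if "x \<in> H" "y \<in> H" for x y
      using that add by (intro l2_eqI) (simp add: coord_a c_def cinner_add_right scaleC_add_left sum.distrib)
    show "a (k *\<^sub>C x) = k *\<^sub>C a x" if "x \<in> H" for x k
      using that scl by (intro l2_eqI) (simp add: coord_a c_def cinner_scaleC_right complex_vector.scale_sum_right scaleC_scaleC)
    show "\<exists>C. \<forall>x\<in>H. norm (a x) \<le> C * norm x"
    proof (intro exI ballI)
      fix y assume y: "y \<in> H"
      have "(norm (a y))\<^sup>2 = Re (cinner (b (a y)) y)" using adj [OF aH [OF y] y] by (simp flip: cinner_self_norm)
      also have "\<dots> \<le> norm (b (a y)) * norm y" using complex_Cauchy_Schwarz complex_Re_le_cmod order_trans by blast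
      also have "\<dots> \<le> C * norm (a y) * norm y" using C(2) [OF aH [OF y]] by (intro mult_right_mono) auto
      finally have "norm (a y) * norm (a y) \<le> norm (a y) * (C * norm y)" by (simp add: power2_eq_square mult_ac)
      then show "norm (a y) \<le> C * norm y" using C(1) by (cases "norm (a y) = 0") (auto simp: mult_le_cancel_left)
    qed
  qed
  moreover have "cinner (a x) y = cinner x (b y)" if "x \<in> H" "y \<in> H" for x y
    using adj [OF that(2,1)] by (metis cinner_commute)
  ultimately show ?thesis using that by blast
qed

end

section \<open>Matrices of operators on the direct sum\<close>

lemma basis_sub: "basis [sub_atom X] = (\<lambda>e. [Some e]) ` onb X" by (auto simp: basis_Cons)

lemma sum_basis_sub: "(\<Sum>j\<in>basis [sub_atom X]. f j) = (\<Sum>e\<in>onb X. f [Some e])"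
  unfolding basis_sub by (subst sum.reindex) (auto simp: inj_on_def)

lemma hs_sub: "hs [sub_atom X] [sub_atom Y] a b =
    (\<Sum>x\<in>onb X. \<Sum>y\<in>onb Y. cnj (a [Some y] [Some x]) * b [Some y] [Some x])"
  by (simp add: hs_eq sum_basis_sub)

lemma mat_mult_sub: "mat_mult [sub_atom Y] a b i j = (\<Sum>e\<in>onb Y. a i [Some e] * b [Some e] j)"
  by (simp add: mat_mult_def sum_basis_sub)

lemma ops_sub_eqI:
  assumes "a \<in> ops [sub_atom X] [sub_atom Y]" "b \<in> ops [sub_atom X] [sub_atom Y]"
    and "\<And>x y. x \<in> onb X \<Longrightarrow> y \<in> onb Y \<Longrightarrow> a [Some y] [Some x] = b [Some y] [Some x]"
  shows "a = b" using assms(1,2) by (rule ops_ext) (auto simp: basis_sub assms(3))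

lemma corner_entry [simp]:
  "x \<in> onb X \<Longrightarrow> y \<in> onb Y \<Longrightarrow> corner X Y v [Some y] [Some x] = cinner (inc Y y) (v (inc X x))"
  by (simp add: corner_def)

lemma corner_ops: "corner X Y v \<in> ops [sub_atom X] [sub_atom Y]" by (auto simp: ops_def corner_def basis_sub)

lemma corner_add: "corner X Y (u + v) = corner X Y u + corner X Y v"
  by (auto simp: corner_def fun_eq_iff cinner_add_right)

lemma corner_scale: "corner X Y (op_scale c v) = mat_scale c (corner X Y v)"
  by (auto simp: corner_def fun_eq_iff mat_scale_def op_scale_def cinner_scaleC_right)

lemma corner_zero: "corner X Y 0 = 0" by (auto simp: corner_def fun_eq_iff)

lemma mat_one_ops: "mat_one X \<in> ops X X" by (auto simp: mat_one_def ops_def)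

lemma dagger_ops: "a \<in> ops X Y \<Longrightarrow> mat_dagger a \<in> ops Y X" by (auto simp: mat_dagger_def ops_def)

lemma mat_mult_ops: "a \<in> ops Y Z \<Longrightarrow> b \<in> ops X Y \<Longrightarrow> mat_mult Y a b \<in> ops X Z"
  unfolding ops_def mat_mult_def mem_Collect_eq
  by (intro allI impI, erule sum.not_neutral_contains_not_neutral) auto

lemma has_sum_sum:
  fixes f :: "'i \<Rightarrow> 'a \<Rightarrow> 'b::topological_comm_monoid_add"
  assumes "\<And>i. i \<in> S \<Longrightarrow> (f i has_sum c i) B"
  shows "((\<lambda>x. \<Sum>i\<in>S. f i x) has_sum (\<Sum>i\<in>S. c i)) B"
  using assms by (induction S rule: infinite_finite_induct) (auto intro: has_sum_add)

definition identity_block :: "'v::complex_inner set \<Rightarrow> 'v set \<Rightarrow> 'v mat set" where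
  "identity_block X Y = (if X = Y then mat.span {mat_one [sub_atom X]} else {0})"

text \<open>The properties that characterize the corners of quantum pseudometrics.\<close>

definition metric_blocks ::
  "'v::complex_inner set set \<Rightarrow> (real \<Rightarrow> 'v set \<Rightarrow> 'v set \<Rightarrow> 'v mat set) \<Rightarrow> bool" where
  "metric_blocks A W \<longleftrightarrow>
     (\<forall>X\<in>A. \<forall>Y\<in>A. filtration [sub_atom X] [sub_atom Y] (\<lambda>\<beta>. W \<beta> X Y)) \<and>
     (\<forall>\<beta>\<ge>0. \<forall>X\<in>A. \<forall>Y\<in>A. \<forall>w\<in>W \<beta> X Y. mat_dagger w \<in> W \<beta> Y X) \<and>
     (\<forall>\<alpha>\<ge>0. \<forall>\<beta>\<ge>0. \<forall>X\<in>A. \<forall>Y\<in>A. \<forall>Z\<in>A. \<forall>a\<in>W \<alpha> Y Z. \<forall>b\<in>W \<beta> X Y.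
        mat_mult [sub_atom Y] a b \<in> W (\<alpha> + \<beta>) X Z) \<and>
     (\<forall>X\<in>A. mat_one [sub_atom X] \<in> W 0 X X)"

definition metric_of ::
  "'v::complex_inner set set \<Rightarrow> (real \<Rightarrow> 'v set \<Rightarrow> 'v set \<Rightarrow> 'v mat set) \<Rightarrow>
    real \<Rightarrow> (('v set, 'v) l2 \<Rightarrow> ('v set, 'v) l2) set" where
  "metric_of A W = restrict
     (\<lambda>\<beta>. {v \<in> bounded_ops (direct_sum A) (direct_sum A). \<forall>X\<in>A. \<forall>Y\<in>A. corner X Y v \<in> W \<beta> X Y}) {0..}"

context atom_set
begin

lemma finite_basis_sub: "X \<in> A \<Longrightarrow> finite (basis [sub_atom X])" by (simp add: basis_sub onb(2))

lemma direct_sum_0 [simp]: "0 \<in> H" using subspace_direct_sum by (rule complex_vector.subspace_0)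

lemma direct_sum_add: "\<xi> \<in> H \<Longrightarrow> \<eta> \<in> H \<Longrightarrow> \<xi> + \<eta> \<in> H"
  using subspace_direct_sum by (rule complex_vector.subspace_add)

lemma bounded_opsI:
  assumes "\<And>\<xi>. \<xi> \<in> H \<Longrightarrow> a \<xi> \<in> H" "\<And>\<xi>. \<xi> \<notin> H \<Longrightarrow> a \<xi> = 0"
    and "\<And>\<xi> \<eta>. \<xi> \<in> H \<Longrightarrow> \<eta> \<in> H \<Longrightarrow> a (\<xi> + \<eta>) = a \<xi> + a \<eta>"
    and "\<And>c \<xi>. \<xi> \<in> H \<Longrightarrow> a (c *\<^sub>C \<xi>) = c *\<^sub>C a \<xi>" "\<And>\<xi>. \<xi> \<in> H \<Longrightarrow> norm (a \<xi>) \<le> C * norm \<xi>"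
  shows "a \<in> bounded_ops H H" using assms unfolding bounded_ops_def by blast

lemma subspace_bounded_ops: "op.subspace (bounded_ops H H)"
proof (rule op.subspaceI)
  show "0 \<in> bounded_ops H H" by (rule bounded_opsI [of _ 0]) auto
next
  fix u v assume u: "u \<in> bounded_ops H H" and v: "v \<in> bounded_ops H H"
  obtain C where C: "\<And>\<xi>. \<xi> \<in> H \<Longrightarrow> norm (u \<xi>) \<le> C * norm \<xi>" using bounded_ops_bound [OF u] by blast
  obtain D where D: "\<And>\<xi>. \<xi> \<in> H \<Longrightarrow> norm (v \<xi>) \<le> D * norm \<xi>" using bounded_ops_bound [OF v] by blast
  show "u + v \<in> bounded_ops H H"
  proof (rule bounded_opsI [of _ "C + D"])
    show "norm ((u + v) \<xi>) \<le> (C + D) * norm \<xi>" if "\<xi> \<in> H" for \<xi>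
      using C [OF that] D [OF that] norm_triangle_ineq [of "u \<xi>" "v \<xi>"] by (simp add: algebra_simps)
  qed (simp_all add: bounded_opsD [OF u] bounded_opsD [OF v] direct_sum_add scaleC_add_right)
next
  fix c u assume u: "u \<in> bounded_ops H H"
  obtain C where C: "\<And>\<xi>. \<xi> \<in> H \<Longrightarrow> norm (u \<xi>) \<le> C * norm \<xi>" using bounded_ops_bound [OF u] by blast
  show "op_scale c u \<in> bounded_ops H H"
  proof (rule bounded_opsI [of _ "cmod c * C"])
    show "norm (op_scale c u \<xi>) \<le> (cmod c * C) * norm \<xi>" if "\<xi> \<in> H" for \<xi>
      using mult_left_mono [OF C [OF that], of "cmod c"] by (simp add: op_scale_def norm_scaleC mult.assoc)
  qed (simp_all add: op_scale_def bounded_opsD [OF u] direct_sum_scale scaleC_add_right scaleC_scaleC mult.commute)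
qed

lemma bounded_ops_compose:
  assumes u: "u \<in> bounded_ops H H" and v: "v \<in> bounded_ops H H"
  shows "u \<circ> v \<in> bounded_ops H H"
proof -
  obtain C where C: "0 \<le> C" "\<And>\<xi>. \<xi> \<in> H \<Longrightarrow> norm (u \<xi>) \<le> C * norm \<xi>" using bounded_ops_bound [OF u] by blast
  obtain D where D: "\<And>\<xi>. \<xi> \<in> H \<Longrightarrow> norm (v \<xi>) \<le> D * norm \<xi>" using bounded_ops_bound [OF v] by blast
  show ?thesis
  proof (rule bounded_opsI [of _ "C * D"])
    show "norm ((u \<circ> v) \<xi>) \<le> C * D * norm \<xi>" if "\<xi> \<in> H" for \<xi>
      using C(2) [of "v \<xi>"] mult_left_mono [OF D [OF that] C(1)] bounded_opsD(1) [OF v that] by (simp add: mult.assoc)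
  qed (simp_all add: bounded_opsD [OF u] bounded_opsD [OF v] bounded_ops_0 [OF u])
qed

definition rank_one :: "'v set \<Rightarrow> 'v \<Rightarrow> 'v set \<Rightarrow> 'v \<Rightarrow> ('v set, 'v) l2 \<Rightarrow> ('v set, 'v) l2" where
  "rank_one X x Y y \<xi> = (if \<xi> \<in> H then cinner x (coord \<xi> X) *\<^sub>C inc Y y else 0)"

lemma rank_one_bounded:
  assumes "Y \<in> A" "y \<in> Y"
  shows "rank_one X x Y y \<in> bounded_ops H H"
proof (rule bounded_opsI [of _ "norm x * norm y"])
  fix \<xi> assume "\<xi> \<in> H"
  moreover have "cmod (cinner x (coord \<xi> X)) \<le> norm x * norm \<xi>"
    using complex_Cauchy_Schwarz [of "inc X x" \<xi>] by (simp add: cinner_inc norm_inc)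
  then have "cmod (cinner x (coord \<xi> X)) * norm y \<le> (norm x * norm \<xi>) * norm y"
    by (rule mult_right_mono) simp
  ultimately show "norm (rank_one X x Y y \<xi>) \<le> norm x * norm y * norm \<xi>"
    by (simp add: rank_one_def norm_scaleC norm_inc mult_ac)
qed (simp_all add: rank_one_def assms direct_sum_add direct_sum_scale cinner_add_right scaleC_add_left
  cinner_scaleC_right scaleC_scaleC)

text \<open>The operator \<open>inc\<^sub>Y w inc\<^sub>X\<^sup>\<dagger>\<close>.\<close>

definition block :: "'v set \<Rightarrow> 'v set \<Rightarrow> 'v mat \<Rightarrow> ('v set, 'v) l2 \<Rightarrow> ('v set, 'v) l2" where
  "block X Y w = (\<Sum>y\<in>onb Y. \<Sum>x\<in>onb X. op_scale (w [Some y] [Some x]) (rank_one X x Y y))"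

lemma block_bounded: "X \<in> A \<Longrightarrow> Y \<in> A \<Longrightarrow> block X Y w \<in> bounded_ops H H"
  unfolding block_def
  by (intro op.subspace_sum [OF subspace_bounded_ops] op.subspace_scale [OF subspace_bounded_ops] rank_one_bounded)
    (simp_all add: onb(4))

lemma sum_apply: "(sum f S) x = (\<Sum>i\<in>S. f i x)" for f :: "'i \<Rightarrow> 'a \<Rightarrow> 'b::comm_monoid_add"
  by (induction S rule: infinite_finite_induct) auto

lemma block_apply:
  "\<xi> \<in> H \<Longrightarrow> block X Y w \<xi> = (\<Sum>y\<in>onb Y. (\<Sum>x\<in>onb X. w [Some y] [Some x] * cinner x (coord \<xi> X)) *\<^sub>C inc Y y)"
  by (simp add: block_def sum_apply op_scale_def rank_one_def scaleC_scaleC complex_vector.scale_sum_left)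

lemma corner_block:
  assumes X: "X \<in> A" "Y \<in> A" "X' \<in> A" "Y' \<in> A" and w: "w \<in> ops [sub_atom X] [sub_atom Y]"
  shows "corner X' Y' (block X Y w) = (if X' = X \<and> Y' = Y then w else 0)"
proof (rule ops_sub_eqI [OF corner_ops])
  show "(if X' = X \<and> Y' = Y then w else 0) \<in> ops [sub_atom X'] [sub_atom Y']"
    using w mat.subspace_0 [OF subspace_ops] by auto
  fix x' y' assume e: "x' \<in> onb X'" "y' \<in> onb Y'"
  have "cinner (inc Y' y') (block X Y w (inc X' x')) = (\<Sum>y\<in>onb Y.
      (\<Sum>x\<in>onb X. w [Some y] [Some x] * (if X' = X then if x = x' then 1 else 0 else 0)) * (if Y' = Y then if y' = y then 1 else 0 else 0))"
    unfolding block_apply [OF inc_onb [OF X(3) e(1)]] cinner_sum_right cinner_scaleC_right cinner_inc coord_inc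
    using e X by (intro sum.cong arg_cong2 [where f = "(*)"] refl) (auto simp: onb(5))
  also have "\<dots> = (if X' = X \<and> Y' = Y then w else 0) [Some y'] [Some x']"
  proof (cases "X' = X \<and> Y' = Y")
    case True
    then show ?thesis using e onb(2) [OF X(1)] onb(2) [OF X(2)] by (simp add: if_distrib [of "(*) _"] cong: if_cong)
  next
    case False
    then show ?thesis by (cases "X' = X") simp_all
  qed
  finally show "corner X' Y' (block X Y w) [Some y'] [Some x'] = (if X' = X \<and> Y' = Y then w else 0) [Some y'] [Some x']"
    using e by simp
qed

definition proj :: "'v set \<Rightarrow> ('v set, 'v) l2 \<Rightarrow> ('v set, 'v) l2" where
  "proj X \<xi> = (if \<xi> \<in> H then inc X (coord \<xi> X) else 0)"

lemma proj_bounded: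
  assumes "X \<in> A"
  shows "proj X \<in> bounded_ops H H"
proof (rule bounded_opsI [of _ 1])
  fix \<xi> assume "\<xi> \<in> H"
  then show "norm (proj X \<xi>) \<le> 1 * norm \<xi>" using norm_truncate_le [of "{X}" \<xi>] by (simp add: proj_def truncate_def)
qed (simp_all add: proj_def assms direct_sum_add direct_sum_scale inc_add inc_scaleC coord_in)

lemma proj_commutant:
  assumes X: "X \<in> A"
  shows "proj X \<in> commutant H (linfty A)"
  unfolding commutant_def
proof (intro CollectI conjI ballI proj_bounded X)
  fix a assume a: "a \<in> linfty A"
  then have ab: "a \<in> bounded_ops H H" by (simp add: linfty_def)
  obtain b where b: "\<And>Z. Z \<in> A \<Longrightarrow> b Z \<in> bounded_ops Z Z"
    and ac: "\<And>\<xi> Z. \<xi> \<in> H \<Longrightarrow> Z \<in> A \<Longrightarrow> coord (a \<xi>) Z = b Z (coord \<xi> Z)"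
    using a by (auto simp: linfty_def)
  have b0: "b Z 0 = 0" if Z: "Z \<in> A" for Z
  proof -
    have "coord (a 0) Z = b Z (coord 0 Z)" by (rule ac [OF direct_sum_0 Z])
    then show ?thesis by (simp add: bounded_ops_0 [OF ab])
  qed
  show "a \<circ> proj X = proj X \<circ> a"
  proof
    fix \<xi>
    show "(a \<circ> proj X) \<xi> = (proj X \<circ> a) \<xi>"
    proof (cases "\<xi> \<in> H")
      case True
      have i: "inc X (coord \<xi> X) \<in> H" using X True by (simp add: coord_in)
      have "coord (a (inc X (coord \<xi> X))) Z = coord (inc X (coord (a \<xi>) X)) Z" for Z
      proof (cases "Z \<in> A")
        case Z: True
        show ?thesis using ac [OF i Z] ac [OF True X] b0 [OF Z] by (auto simp: coord_inc)
      next
        case False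
        then have "Z \<noteq> X" using X by blast
        then show ?thesis using coord_out [OF bounded_opsD(1) [OF ab i] False] by (simp add: coord_inc)
      qed
      then have "a (inc X (coord \<xi> X)) = inc X (coord (a \<xi>) X)" by (rule l2_eqI)
      then show ?thesis using True bounded_opsD(1) [OF ab True] by (simp add: proj_def)
    next
      case False
      then show ?thesis by (simp add: proj_def bounded_ops_0 [OF ab] bounded_opsD(2) [OF ab] inc_0)
    qed
  qed
qed

lemma block_corner:
  assumes v: "v \<in> bounded_ops H H" and X: "X \<in> A" and Y: "Y \<in> A"
  shows "block X Y (corner X Y v) = proj Y \<circ> v \<circ> proj X"
proof
  fix \<xi>
  show "block X Y (corner X Y v) \<xi> = (proj Y \<circ> v \<circ> proj X) \<xi>"
  proof (cases "\<xi> \<in> H")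
    case True
    let ?\<eta> = "v (inc X (coord \<xi> X))"
    have \<eta>: "?\<eta> \<in> H" using X True by (intro bounded_opsD(1) [OF v]) (simp add: coord_in)
    have "(\<Sum>x\<in>onb X. cinner (inc Y y) (v (inc X x)) * cinner x (coord \<xi> X)) = cinner y (coord ?\<eta> Y)" for y
      unfolding image_inc_expand [OF v X coord_in [OF True X]]
      by (simp add: coord_sum cinner_sum_right cinner_scaleC_right cinner_inc mult.commute)
    then have "block X Y (corner X Y v) \<xi> = (\<Sum>y\<in>onb Y. cinner y (coord ?\<eta> Y) *\<^sub>C inc Y y)"
      by (simp add: block_apply [OF True])
    also have "\<dots> = inc Y (coord ?\<eta> Y)"
      by (subst (2) expand [OF Y coord_in [OF \<eta> Y]]) (simp add: inc_sum inc_scaleC)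
    finally show ?thesis using True \<eta> by (simp add: proj_def)
  next
    case False
    have "proj Y 0 = 0" by (simp add: proj_def inc_0)
    moreover have "proj X \<xi> = 0" using False by (simp add: proj_def)
    ultimately show ?thesis using False by (simp add: bounded_opsD(2) [OF block_bounded [OF X Y]] bounded_ops_0 [OF v])
  qed
qed

lemma corner_proj: "X \<in> A \<Longrightarrow> corner X X (proj X) = mat_one [sub_atom X]"
  by (rule ops_sub_eqI [OF corner_ops mat_one_ops])
    (auto simp: proj_def inc_onb coord_inc cinner_inc onb(5) mat_one_def basis_sub)

lemma corner_mult:
  assumes u: "u \<in> bounded_ops H H" and v: "v \<in> bounded_ops H H" and X: "X \<in> A" "Y \<in> A" "Z \<in> A"
  shows "mat_mult [sub_atom Y] (corner Y Z u) (corner X Y v) = corner X Z (u \<circ> (proj Y \<circ> v))"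
proof (rule ops_sub_eqI [OF mat_mult_ops [OF corner_ops corner_ops] corner_ops])
  fix x z assume e: "x \<in> onb X" "z \<in> onb Z"
  have i: "v (inc X x) \<in> H" using bounded_opsD(1) [OF v] inc_onb X(1) e by blast
  have "u (inc Y (coord (v (inc X x)) Y)) = (\<Sum>e\<in>onb Y. cinner e (coord (v (inc X x)) Y) *\<^sub>C u (inc Y e))"
    by (rule image_inc_expand [OF u X(2) coord_in [OF i X(2)]])
  then show "mat_mult [sub_atom Y] (corner Y Z u) (corner X Y v) [Some z] [Some x] = corner X Z (u \<circ> (proj Y \<circ> v)) [Some z] [Some x]"
    using e i by (simp add: mat_mult_sub proj_def cinner_sum_right cinner_scaleC_right cinner_inc [of Y] mult.commute)
qed

lemma corner_adjoint:
  assumes "\<And>\<xi> \<eta>. \<xi> \<in> H \<Longrightarrow> \<eta> \<in> H \<Longrightarrow> cinner (a \<xi>) \<eta> = cinner \<xi> (b \<eta>)" and X: "X \<in> A" "Y \<in> A"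
  shows "corner X Y b = mat_dagger (corner Y X a)"
proof (rule ops_sub_eqI [OF corner_ops dagger_ops [OF corner_ops]])
  fix x y assume e: "x \<in> onb X" "y \<in> onb Y"
  have "cinner (inc Y y) (b (inc X x)) = cnj (cinner (inc X x) (a (inc Y y)))"
    using assms(1) [OF inc_onb [OF X(2) e(2)] inc_onb [OF X(1) e(1)]] cinner_commute by metis
  then show "corner X Y b [Some y] [Some x] = mat_dagger (corner Y X a) [Some y] [Some x]"
    using e by (simp add: mat_dagger_def)
qed

text \<open>By expansion of the image of \<open>v\<close> in the bases of the intermediate atoms.\<close>

lemma hs_corner_compose:
  assumes u: "u \<in> bounded_ops H H" and v: "v \<in> bounded_ops H H" and X: "X \<in> A"
  shows "((\<lambda>Y. hs [sub_atom X] [sub_atom Z] k (mat_mult [sub_atom Y] (corner Y Z u) (corner X Y v)))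
    has_sum hs [sub_atom X] [sub_atom Z] k (corner X Z (u \<circ> v))) A"
proof -
  have "((\<lambda>Y. \<Sum>e\<in>onb Y. cinner (inc Z z) (u (inc Y e)) * cinner e (coord (v (inc X x)) Y)) has_sum
      cinner (inc Z z) (u (v (inc X x)))) A" if "x \<in> onb X" for x z
    by (rule entry_expansion [OF u bounded_opsD(1) [OF v inc_onb [OF X that]]])
  then have "((\<lambda>Y. \<Sum>x\<in>onb X. \<Sum>z\<in>onb Z. cnj (k [Some z] [Some x]) *
      (\<Sum>e\<in>onb Y. cinner (inc Z z) (u (inc Y e)) * cinner e (coord (v (inc X x)) Y))) has_sum
      (\<Sum>x\<in>onb X. \<Sum>z\<in>onb Z. cnj (k [Some z] [Some x]) * cinner (inc Z z) (u (v (inc X x))))) A"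
    by (intro has_sum_sum has_sum_cmult_right)
  then show ?thesis by (simp add: hs_sub mat_mult_sub cinner_inc cong: sum.cong)
qed

text \<open>Commuting with the rank one operators inside the atoms makes the corners scalar; conversely, an
  operator with scalar corners multiplies each component of a vector by a scalar.\<close>

lemma commutant_iff:
  "v \<in> commutant H (linfty A) \<longleftrightarrow> v \<in> bounded_ops H H \<and> (\<forall>X\<in>A. \<forall>Y\<in>A. corner X Y v \<in> identity_block X Y)"
proof (intro iffI conjI ballI)
  assume "v \<in> commutant H (linfty A)"
  then have v: "v \<in> bounded_ops H H" and comm: "\<And>a. a \<in> linfty A \<Longrightarrow> a \<circ> v = v \<circ> a"
    by (auto simp: commutant_def)
  show "v \<in> bounded_ops H H" by (rule v)
  fix X Y assume X: "X \<in> A" and Y: "Y \<in> A"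
  have r: "rank_one X x X x' \<in> linfty A" if x: "x \<in> onb X" "x' \<in> onb X" for x x'
  proof -
    define b where "b Z z = (if Z = X \<and> z \<in> X then cinner x z *\<^sub>C x' else 0)" for Z z
    have x'X: "x' \<in> X" using x onb(4) [OF X] by blast
    have "\<forall>Z\<in>A. b Z \<in> bounded_ops Z Z \<and> (\<forall>z\<in>Z. norm (b Z z) \<le> 1 * norm z)"
    proof (intro ballI conjI)
      fix Z assume Z: "Z \<in> A"
      show bd: "norm (b Z z) \<le> 1 * norm z" if "z \<in> Z" for z
        using complex_Cauchy_Schwarz [of x z] onb(6) [OF X] x by (simp add: b_def norm_scaleC)
      have "\<exists>C. \<forall>z\<in>Z. norm (b Z z) \<le> C * norm z" using bd by blast
      then show "b Z \<in> bounded_ops Z Z" using x'X atom_subspace [OF Z]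
        by (auto simp: bounded_ops_def b_def complex_vector.subspace_def cinner_add_right scaleC_add_left
          cinner_scaleC_right scaleC_scaleC)
    qed
    moreover have "\<forall>\<xi>\<in>H. \<forall>Z\<in>A. coord (rank_one X x X x' \<xi>) Z = b Z (coord \<xi> Z)"
      using coord_in by (auto simp: rank_one_def b_def coord_inc)
    ultimately show ?thesis using rank_one_bounded [OF X x'X] unfolding linfty_def by blast
  qed
  have c: "cinner (inc Y y) (v (inc X x')) = cinner x (coord (v (inc X x)) X) * (if Y = X then cinner y x' else 0)"
    if x: "x \<in> onb X" "x' \<in> onb X" for x x' y
  proof -
    have "rank_one X x X x' (v (inc X x)) = v (rank_one X x X x' (inc X x))"
      using fun_cong [OF comm [OF r [OF x]], of "inc X x"] by simp
    moreover have "rank_one X x X x' (inc X x) = inc X x'"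
      using x X by (simp add: rank_one_def inc_onb coord_inc onb(5))
    ultimately have "v (inc X x') = cinner x (coord (v (inc X x)) X) *\<^sub>C inc X x'"
      using bounded_opsD(1) [OF v inc_onb [OF X x(1)]] by (simp add: rank_one_def)
    then show ?thesis by (simp add: cinner_scaleC_right cinner_inc coord_inc)
  qed
  show "corner X Y v \<in> identity_block X Y"
  proof (cases "Y = X \<and> onb X \<noteq> {}")
    case True
    then obtain x where x: "x \<in> onb X" and YX: "Y = X" by blast
    have "corner X Y v = mat_scale (cinner x (coord (v (inc X x)) X)) (mat_one [sub_atom X])"
    proof (rule ops_sub_eqI [OF corner_ops])
      show "mat_scale (cinner x (coord (v (inc X x)) X)) (mat_one [sub_atom X]) \<in> ops [sub_atom X] [sub_atom Y]"
        using True mat.subspace_scale [OF subspace_ops mat_one_ops] by simp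
    qed (use True x X in \<open>auto simp: c [OF x, unfolded YX] mat_scale_def mat_one_def basis_sub onb(5)\<close>)
    then show ?thesis using True by (auto simp: identity_block_def intro: mat.span_scale mat.span_base)
  next
    case False
    have "corner X Y v = 0"
      using mat.subspace_0 [OF subspace_ops] by (rule ops_sub_eqI [OF corner_ops]) (use False c in auto)
    then show ?thesis by (auto simp: identity_block_def mat.span_zero)
  qed
next
  assume "v \<in> bounded_ops H H \<and> (\<forall>X\<in>A. \<forall>Y\<in>A. corner X Y v \<in> identity_block X Y)"
  then have v: "v \<in> bounded_ops H H" and d: "\<And>X Y. X \<in> A \<Longrightarrow> Y \<in> A \<Longrightarrow> corner X Y v \<in> identity_block X Y" by auto
  have "\<exists>c. corner X X v = mat_scale c (mat_one [sub_atom X])" if "X \<in> A" for X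
    using d [OF that that] by (auto simp: identity_block_def mat.span_singleton)
  then obtain c where c: "\<And>X. X \<in> A \<Longrightarrow> corner X X v = mat_scale (c X) (mat_one [sub_atom X])" by metis
  have e: "cinner (inc Z z) (v (inc Y y)) = (if Y = Z then c Z * cinner z y else 0)"
    if Z: "Z \<in> A" "z \<in> onb Z" and Y: "Y \<in> A" "y \<in> onb Y" for Z z Y y
  proof -
    have "corner Y Z v [Some z] [Some y] = (if Y = Z then c Z * cinner z y else 0)"
    proof (cases "Y = Z")
      case True
      then show ?thesis using c [OF Z(1)] Z Y by (simp del: corner_entry add: mat_scale_def mat_one_def basis_sub onb(5) image_iff)
    next
      case False
      then have "corner Y Z v = 0" using d [OF Y(1) Z(1)] by (simp add: identity_block_def)
      then show ?thesis using False by (simp del: corner_entry)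
    qed
    then show ?thesis using Z Y by simp
  qed
  have vc: "coord (v \<xi>) Z = c Z *\<^sub>C coord \<xi> Z" if \<xi>: "\<xi> \<in> H" and Z: "Z \<in> A" for \<xi> Z
  proof (rule coord_eqI [OF Z])
    show "coord (v \<xi>) Z \<in> Z" using coord_in [OF bounded_opsD(1) [OF v \<xi>] Z] .
    show "c Z *\<^sub>C coord \<xi> Z \<in> Z"
      using complex_vector.subspace_scale [OF atom_subspace [OF Z] coord_in [OF \<xi> Z]] .
    fix z assume z: "z \<in> onb Z"
    have "((\<lambda>Y. \<Sum>y\<in>onb Y. cinner (inc Z z) (v (inc Y y)) * cinner y (coord \<xi> Y)) has_sum
        (\<Sum>y\<in>onb Z. cinner (inc Z z) (v (inc Z y)) * cinner y (coord \<xi> Z))) A"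
      by (rule has_sum_finite_neutralI [of "{Z}"]) (use Z z e in auto)
    then have "cinner (inc Z z) (v \<xi>) = (\<Sum>y\<in>onb Z. cinner (inc Z z) (v (inc Z y)) * cinner y (coord \<xi> Z))"
      by (rule has_sum_unique [OF entry_expansion [OF v \<xi>]])
    also have "\<dots> = (\<Sum>y\<in>onb Z. if y = z then c Z * cinner z (coord \<xi> Z) else 0)"
      using Z z by (intro sum.cong refl) (auto simp: e onb(5))
    finally show "cinner z (coord (v \<xi>) Z) = cinner z (c Z *\<^sub>C coord \<xi> Z)"
      using z onb(2) [OF Z] by (simp add: cinner_inc cinner_scaleC_right)
  qed
  have "a \<circ> v = v \<circ> a" if a: "a \<in> linfty A" for a
  proof
    fix \<xi>
    have ab: "a \<in> bounded_ops H H" using a by (simp add: linfty_def)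
    obtain b where b: "\<And>Z. Z \<in> A \<Longrightarrow> b Z \<in> bounded_ops Z Z"
      and ac: "\<And>\<xi> Z. \<xi> \<in> H \<Longrightarrow> Z \<in> A \<Longrightarrow> coord (a \<xi>) Z = b Z (coord \<xi> Z)"
      using a by (auto simp: linfty_def)
    show "(a \<circ> v) \<xi> = (v \<circ> a) \<xi>"
    proof (cases "\<xi> \<in> H")
      case True
      have H: "v \<xi> \<in> H" "a \<xi> \<in> H" using bounded_opsD(1) [OF v True] bounded_opsD(1) [OF ab True] by auto
      have "coord (a (v \<xi>)) Z = coord (v (a \<xi>)) Z" for Z
      proof (cases "Z \<in> A")
        case Z: True
        have "b Z (c Z *\<^sub>C coord \<xi> Z) = c Z *\<^sub>C b Z (coord \<xi> Z)"
          using b [OF Z] coord_in [OF True Z] by (simp add: bounded_ops_def)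
        then show ?thesis by (simp add: ac [OF H(1) Z] ac [OF True Z] vc [OF True Z] vc [OF H(2) Z])
      next
        case False
        then show ?thesis
          using coord_out [OF bounded_opsD(1) [OF ab H(1)]] coord_out [OF bounded_opsD(1) [OF v H(2)]] by simp
      qed
      then show ?thesis unfolding comp_apply by (rule l2_eqI)
    next
      case False
      then show ?thesis by (simp add: bounded_opsD(2) [OF v] bounded_opsD(2) [OF ab] bounded_ops_0 [OF v] bounded_ops_0 [OF ab])
    qed
  qed
  then show "v \<in> commutant H (linfty A)" using v by (simp add: commutant_def)
qed

end

section \<open>Quantum pseudometrics as families of corners\<close>

lemma quantum_pseudometricD:
  assumes V: "quantum_pseudometric H M V"
  shows "V \<in> extensional {0..}"
    and "0 \<le> \<beta> \<Longrightarrow> V \<beta> \<subseteq> bounded_ops H H \<and> op.subspace (V \<beta>) \<and> closedin (ultraweak H) (V \<beta>)"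
    and "0 \<le> \<beta> \<Longrightarrow> adjoint_ops H (V \<beta>) = V \<beta>"
    and "0 \<le> \<alpha> \<Longrightarrow> 0 \<le> \<beta> \<Longrightarrow> op_prod (V \<alpha>) (V \<beta>) \<subseteq> V (\<alpha> + \<beta>)"
    and "0 \<le> \<alpha> \<Longrightarrow> V \<alpha> = (\<Inter>\<beta>\<in>{\<alpha><..}. V \<beta>)"
    and "commutant H M \<subseteq> V 0"
proof -
  note c = V [unfolded quantum_pseudometric_def]
  show "V \<in> extensional {0..}" by (rule c [THEN conjunct1])
  note c = c [THEN conjunct2]
  show "0 \<le> \<beta> \<Longrightarrow> V \<beta> \<subseteq> bounded_ops H H \<and> op.subspace (V \<beta>) \<and> closedin (ultraweak H) (V \<beta>)"
    by (rule c [THEN conjunct1, THEN spec, THEN mp])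
  note c = c [THEN conjunct2]
  show "0 \<le> \<beta> \<Longrightarrow> adjoint_ops H (V \<beta>) = V \<beta>" by (rule c [THEN conjunct1, THEN spec, THEN mp])
  note c = c [THEN conjunct2]
  show "0 \<le> \<alpha> \<Longrightarrow> 0 \<le> \<beta> \<Longrightarrow> op_prod (V \<alpha>) (V \<beta>) \<subseteq> V (\<alpha> + \<beta>)"
    by (rule c [THEN conjunct1, THEN spec, THEN mp, THEN spec, THEN mp])
  note c = c [THEN conjunct2]
  show "0 \<le> \<alpha> \<Longrightarrow> V \<alpha> = (\<Inter>\<beta>\<in>{\<alpha><..}. V \<beta>)" by (rule c [THEN conjunct1, THEN spec, THEN mp])
  show "commutant H M \<subseteq> V 0" by (rule c [THEN conjunct2])
qed

context atom_set
begin

lemma truncated_operator: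
  assumes v: "v \<in> bounded_ops H H" and F: "finite F" "F \<subseteq> A" and \<xi>: "\<xi> \<in> H"
  shows "(\<Sum>Y\<in>F. \<Sum>X\<in>F. block X Y (corner X Y v)) \<xi> = truncate F (v (truncate F \<xi>))"
proof -
  have i: "inc X (coord \<xi> X) \<in> H" if "X \<in> F" for X using that F \<xi> by (auto simp: coord_in)
  have "v (truncate F \<xi>) = (\<Sum>X\<in>F. v (inc X (coord \<xi> X)))"
    unfolding truncate_def using i by (intro bounded_ops_sum [OF v])
  then have "truncate F (v (truncate F \<xi>)) = (\<Sum>Y\<in>F. \<Sum>X\<in>F. inc Y (coord (v (inc X (coord \<xi> X))) Y))"
    by (simp add: truncate_def coord_sum inc_sum)
  also have "\<dots> = (\<Sum>Y\<in>F. \<Sum>X\<in>F. block X Y (corner X Y v) \<xi>)"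
  proof (intro sum.cong refl)
    fix X Y assume Y: "Y \<in> F" and X: "X \<in> F"
    have XA: "X \<in> A" "Y \<in> A" using X Y F by auto
    show "inc Y (coord (v (inc X (coord \<xi> X))) Y) = block X Y (corner X Y v) \<xi>"
      using bounded_opsD(1) [OF v i [OF X]] by (simp add: block_corner [OF v XA] proj_def \<xi>)
  qed
  finally show ?thesis by (simp add: sum_apply)
qed

lemma truncated_operator_tendsto:
  assumes v: "v \<in> bounded_ops H H" and \<xi>: "\<xi> \<in> H"
  shows "((\<lambda>F. truncate F (v (truncate F \<xi>))) \<longlongrightarrow> v \<xi>) (finite_subsets_at_top A)"
proof -
  have 1: "((\<lambda>F. v (truncate F \<xi>)) \<longlongrightarrow> v \<xi>) (finite_subsets_at_top A)"
    by (rule bounded_ops_continuous [OF v truncate_tendsto [OF \<xi>], where S = "{F. F \<subseteq> A}"])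
      (use truncate_in \<xi> in \<open>auto intro!: eventually_finite_subsets_at_top_weakI\<close>)
  have t: "truncate F (\<eta> - \<zeta>) = truncate F \<eta> - truncate F \<zeta>" for F \<eta> \<zeta>
    unfolding truncate_def sum_subtractf [symmetric] by (intro sum.cong refl l2_eqI) (simp add: coord_inc)
  have "((\<lambda>F. truncate F (v (truncate F \<xi>) - v \<xi>)) \<longlongrightarrow> 0) (finite_subsets_at_top A)"
  proof (rule Lim_null_comparison [OF always_eventually])
    show "\<forall>F. norm (truncate F (v (truncate F \<xi>) - v \<xi>)) \<le> norm (v (truncate F \<xi>) - v \<xi>)"
      by (simp add: norm_truncate_le)
    show "((\<lambda>F. norm (v (truncate F \<xi>) - v \<xi>)) \<longlongrightarrow> 0) (finite_subsets_at_top A)"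
      using 1 by (simp add: tendsto_norm_zero_iff LIM_zero_iff)
  qed
  from tendsto_add [OF this truncate_tendsto [OF bounded_opsD(1) [OF v \<xi>]]]
  show ?thesis by (simp add: t)
qed

text \<open>
  The truncations of an operator converge to it ultraweakly: each functional converges by
  dominated convergence, the summands being bounded by \<open>C (\<parallel>\<xi>\<^sub>n\<parallel>\<^sup>2 + \<parallel>\<eta>\<^sub>n\<parallel>\<^sup>2)\<close>.
\<close>

lemma truncated_operator_ultraweak:
  assumes v: "v \<in> bounded_ops H H" and U: "openin (ultraweak H) U" and vU: "v \<in> U"
  shows "eventually (\<lambda>F. (\<Sum>Y\<in>F. \<Sum>X\<in>F. block X Y (corner X Y v)) \<in> U) (finite_subsets_at_top A)"
proof -
  let ?v = "\<lambda>F. \<Sum>Y\<in>F. \<Sum>X\<in>F. block X Y (corner X Y v)"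
  have ev: "eventually (\<lambda>F. finite F \<and> F \<subseteq> A) (finite_subsets_at_top A)"
    by (rule eventually_finite_subsets_at_top_weakI) simp
  have vF: "?v F \<in> bounded_ops H H" if "F \<subseteq> A" for F
    using that by (intro op.subspace_sum [OF subspace_bounded_ops] block_bounded) auto
  obtain C where C: "0 \<le> C" "\<And>\<xi>. \<xi> \<in> H \<Longrightarrow> norm (v \<xi>) \<le> C * norm \<xi>" using bounded_ops_bound [OF v] by blast
  have base: "eventually (\<lambda>F. (\<Sum>n. cinner (\<xi> n) (?v F (\<eta> n))) \<in> T) (finite_subsets_at_top A)"
    if \<xi>: "range \<xi> \<subseteq> H" "summable (\<lambda>n. (norm (\<xi> n))\<^sup>2)" and \<eta>: "range \<eta> \<subseteq> H" "summable (\<lambda>n. (norm (\<eta> n))\<^sup>2)"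
      and T: "open T" "(\<Sum>n. cinner (\<xi> n) (v (\<eta> n))) \<in> T" for \<xi> \<eta> :: "nat \<Rightarrow> _" and T
  proof -
    have \<eta>H: "\<eta> n \<in> H" for n using \<eta> by blast
    have b: "norm (cinner (\<xi> n) (truncate F (v (truncate F (\<eta> n))))) \<le> C * ((norm (\<xi> n))\<^sup>2 + (norm (\<eta> n))\<^sup>2)"
      if "F \<subseteq> A" for n F
    proof -
      have "norm (truncate F (v (truncate F (\<eta> n)))) \<le> C * norm (\<eta> n)"
        using norm_truncate_le [of F "v (truncate F (\<eta> n))"] C(2) [OF truncate_in [OF that \<eta>H [of n]]]
          mult_left_mono [OF norm_truncate_le [of F "\<eta> n"] C(1)] by linarith
      then have "norm (cinner (\<xi> n) (truncate F (v (truncate F (\<eta> n))))) \<le> norm (\<xi> n) * (C * norm (\<eta> n))"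
        by (intro order_trans [OF complex_Cauchy_Schwarz] mult_left_mono) simp_all
      also have "\<dots> = C * (norm (\<xi> n) * norm (\<eta> n))" by simp
      also have "\<dots> \<le> C * ((norm (\<xi> n))\<^sup>2 + (norm (\<eta> n))\<^sup>2)"
      proof (rule mult_left_mono [OF _ C(1)])
        have "0 \<le> norm (\<xi> n) * norm (\<eta> n)" by simp
        then show "norm (\<xi> n) * norm (\<eta> n) \<le> (norm (\<xi> n))\<^sup>2 + (norm (\<eta> n))\<^sup>2"
          using sum_squares_bound [of "norm (\<xi> n)" "norm (\<eta> n)"] by linarith
      qed
      finally show ?thesis .
    qed
    have "((\<lambda>F. \<Sum>n. cinner (\<xi> n) (truncate F (v (truncate F (\<eta> n))))) \<longlongrightarrow> (\<Sum>n. cinner (\<xi> n) (v (\<eta> n)))) (finite_subsets_at_top A)"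
    proof (rule tannerys_theorem [THEN conjunct2, THEN conjunct2])
      show "((\<lambda>F. cinner (\<xi> n) (truncate F (v (truncate F (\<eta> n))))) \<longlongrightarrow> cinner (\<xi> n) (v (\<eta> n))) (finite_subsets_at_top A)" for n
        by (intro cinner_continuous truncated_operator_tendsto v \<eta>H)
      show "eventually (\<lambda>(n, F). norm (cinner (\<xi> n) (truncate F (v (truncate F (\<eta> n))))) \<le>
          C * ((norm (\<xi> n))\<^sup>2 + (norm (\<eta> n))\<^sup>2)) (at_top \<times>\<^sub>F finite_subsets_at_top A)"
        by (rule eventually_mono [OF eventually_prodI [OF eventually_True ev]]) (simp add: b case_prod_beta)
      show "summable (\<lambda>n. C * ((norm (\<xi> n))\<^sup>2 + (norm (\<eta> n))\<^sup>2))"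
        using \<xi>(2) \<eta>(2) by (intro summable_mult summable_add)
    qed simp
    from topological_tendstoD [OF this T] ev show ?thesis
      by eventually_elim (simp add: truncated_operator [OF v _ _ \<eta>H])
  qed
  from U have "generate_topology_on {{a \<in> bounded_ops H H. (\<Sum>n. cinner (\<xi> n) (a (\<eta> n))) \<in> U} | (\<xi> :: nat \<Rightarrow> _) \<eta> U.
        range \<xi> \<subseteq> H \<and> range \<eta> \<subseteq> H \<and>
        summable (\<lambda>n. (norm (\<xi> n))\<^sup>2) \<and> summable (\<lambda>n. (norm (\<eta> n))\<^sup>2) \<and> open U} U"
    by (simp add: ultraweak_def openin_topology_generated_by_iff)
  then show ?thesis using vU
  proof induction
    case (Int a b)
    then show ?case by (simp add: eventually_conj_iff)
  next
    case (UN K)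
    then obtain k where "k \<in> K" "v \<in> k" by blast
    from UN.IH [OF this] show ?case by eventually_elim (use \<open>k \<in> K\<close> in blast)
  next
    case (Basis s)
    then obtain \<xi> \<eta> :: "nat \<Rightarrow> _" and T where s: "s = {a \<in> bounded_ops H H. (\<Sum>n. cinner (\<xi> n) (a (\<eta> n))) \<in> T}"
      and h: "range \<xi> \<subseteq> H" "range \<eta> \<subseteq> H" "summable (\<lambda>n. (norm (\<xi> n))\<^sup>2)" "summable (\<lambda>n. (norm (\<eta> n))\<^sup>2)" "open T"
      by blast
    have "(\<Sum>n. cinner (\<xi> n) (v (\<eta> n))) \<in> T" using Basis(2) s by blast
    from base [OF h(1,3,2,4,5) this] ev show ?case by eventually_elim (simp add: s vF)
  qed simp
qed

lemma in_ultraweak_closed: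
  assumes V: "closedin (ultraweak H) V" and v: "v \<in> bounded_ops H H"
    and F: "\<And>F. finite F \<Longrightarrow> F \<subseteq> A \<Longrightarrow> (\<Sum>Y\<in>F. \<Sum>X\<in>F. block X Y (corner X Y v)) \<in> V"
    and top: "v \<in> topspace (ultraweak H)"
  shows "v \<in> V"
proof (rule ccontr)
  assume "v \<notin> V"
  then have "v \<in> topspace (ultraweak H) - V" using top by blast
  moreover have "openin (ultraweak H) (topspace (ultraweak H) - V)" using V by (simp add: closedin_def)
  ultimately have "eventually (\<lambda>F. (\<Sum>Y\<in>F. \<Sum>X\<in>F. block X Y (corner X Y v)) \<in> topspace (ultraweak H) - V) (finite_subsets_at_top A)"
    by (intro truncated_operator_ultraweak v)
  moreover have "eventually (\<lambda>F. (\<Sum>Y\<in>F. \<Sum>X\<in>F. block X Y (corner X Y v)) \<in> V) (finite_subsets_at_top A)"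
    by (rule eventually_finite_subsets_at_top_weakI) (rule F)
  ultimately have "eventually (\<lambda>F. False) (finite_subsets_at_top A)" by eventually_elim blast
  then show False by simp
qed

lemma ultraweak_functional:
  assumes "range \<xi> \<subseteq> H" "range \<eta> \<subseteq> H" "summable (\<lambda>n. (norm (\<xi> n))\<^sup>2)" "summable (\<lambda>n. (norm (\<eta> n))\<^sup>2)" "open T"
  shows "openin (ultraweak H) {a \<in> bounded_ops H H. (\<Sum>n. cinner (\<xi> n) (a (\<eta> n))) \<in> T}"
  unfolding ultraweak_def by (rule topology_generated_by_Basis) (use assms in blast)

lemma topspace_ultraweak: "topspace (ultraweak H) = bounded_ops H H"
proof
  show "topspace (ultraweak H) \<subseteq> bounded_ops H H" by (auto simp: ultraweak_def)
  have "openin (ultraweak H) {a \<in> bounded_ops H H. (\<Sum>n. cinner 0 (a 0)) \<in> UNIV}"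
    by (rule ultraweak_functional) auto
  from openin_subset [OF this] show "bounded_ops H H \<subseteq> topspace (ultraweak H)" by simp
qed

text \<open>
  \<open>a \<mapsto> \<langle>k | inc\<^sub>Y\<^sup>\<dagger> a inc\<^sub>X\<rangle>\<close> is a finite sum of the functionals defining the ultraweak topology.
\<close>

lemma openin_hs_corner:
  assumes X: "X \<in> A" and Y: "Y \<in> A"
  shows "openin (ultraweak H) {a \<in> bounded_ops H H. hs [sub_atom X] [sub_atom Y] k (corner X Y a) \<noteq> 0}"
proof -
  define n where "n = card (onb X)"
  obtain h where h: "bij_betw h {..<n} (onb X)"
    using ex_bij_betw_nat_finite [OF onb(2) [OF X]] by (auto simp: n_def atLeast0LessThan)
  have hX: "h i \<in> onb X" if "i < n" for i using h that by (auto simp: bij_betw_def)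
  define \<eta> where "\<eta> i = (if i < n then inc X (h i) else 0)" for i
  define \<xi> where "\<xi> i = (if i < n then \<Sum>y\<in>onb Y. k [Some y] [Some (h i)] *\<^sub>C inc Y y else 0)" for i
  have \<eta>H: "range \<eta> \<subseteq> H" using hX inc_onb [OF X] by (auto simp: \<eta>_def)
  have \<xi>H: "range \<xi> \<subseteq> H"
    using inc_onb [OF Y] by (auto simp: \<xi>_def intro!: complex_vector.subspace_sum [OF subspace_direct_sum] direct_sum_scale)
  have fin: "summable (\<lambda>i. (norm (\<xi> i))\<^sup>2)" "summable (\<lambda>i. (norm (\<eta> i))\<^sup>2)"
    by (rule summable_finite [of "{..<n}"], simp, simp add: \<xi>_def)
      (rule summable_finite [of "{..<n}"], simp, simp add: \<eta>_def)
  have "(\<Sum>i. cinner (\<xi> i) (a (\<eta> i))) = hs [sub_atom X] [sub_atom Y] k (corner X Y a)" for a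
  proof -
    have "(\<Sum>i. cinner (\<xi> i) (a (\<eta> i))) = (\<Sum>i<n. cinner (\<xi> i) (a (\<eta> i)))"
      by (rule suminf_finite) (auto simp: \<xi>_def)
    also have "\<dots> = (\<Sum>i<n. (\<lambda>x. \<Sum>y\<in>onb Y. cnj (k [Some y] [Some x]) * cinner (inc Y y) (a (inc X x))) (h i))"
      by (intro sum.cong refl) (simp add: \<xi>_def \<eta>_def cinner_sum_left cinner_scaleC_left)
    also have "\<dots> = (\<Sum>x\<in>onb X. \<Sum>y\<in>onb Y. cnj (k [Some y] [Some x]) * cinner (inc Y y) (a (inc X x)))"
      by (rule sum.reindex_bij_betw [OF h])
    finally show ?thesis by (simp add: hs_sub cong: sum.cong)
  qed
  moreover have "open (- {0 :: complex})" by (simp add: open_Compl)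
  ultimately show ?thesis using ultraweak_functional [OF \<xi>H \<eta>H fin, of "- {0}"] by simp
qed

text \<open>Products with the projections in \<open>V 0\<close> show that \<open>V \<beta>\<close> contains the block operators of its corners.
  This gives right continuity and closure under products for the corners, and, by ultraweak closedness,
  every bounded operator with the right corners.\<close>

lemma metric_blocks_corners:
  assumes V: "quantum_pseudometric H (linfty A) V"
  shows "metric_blocks A (\<lambda>\<beta> X Y. corner X Y ` V \<beta>)" and "V = metric_of A (\<lambda>\<beta> X Y. corner X Y ` V \<beta>)"
proof -
  note D = quantum_pseudometricD [OF V]
  have sub: "V \<beta> \<subseteq> bounded_ops H H" "op.subspace (V \<beta>)" "closedin (ultraweak H) (V \<beta>)" "adjoint_ops H (V \<beta>) = V \<beta>"
    if b: "0 \<le> \<beta>" for \<beta> using D(2) [OF b] D(3) [OF b] by blast+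
  note ext = D(1) and comm = D(6) and int = D(5)
  have prod: "a \<circ> b \<in> V (\<alpha> + \<beta>)" if "0 \<le> \<alpha>" "0 \<le> \<beta>" "a \<in> V \<alpha>" "b \<in> V \<beta>" for \<alpha> \<beta> a b
  proof -
    have "a \<circ> b \<in> op_prod (V \<alpha>) (V \<beta>)" unfolding op_prod_def using that by (intro op.span_base) blast
    then show ?thesis using D(4) [OF that(1,2)] by blast
  qed
  have P: "proj X \<in> V 0" if "X \<in> A" for X using proj_commutant [OF that] comm by blast
  have B: "block X Y w \<in> V \<beta>" if h: "0 \<le> \<beta>" "X \<in> A" "Y \<in> A" "w \<in> corner X Y ` V \<beta>" for \<beta> X Y w
  proof -
    obtain u where u: "u \<in> V \<beta>" "w = corner X Y u" using h by blast
    have "proj Y \<circ> u \<in> V (0 + \<beta>)" using h u P by (intro prod) auto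
    then have "proj Y \<circ> u \<circ> proj X \<in> V (\<beta> + 0)" using h P by (intro prod) auto
    then show ?thesis using block_corner [of u X Y] sub(1) [OF h(1)] h u by auto
  qed
  show "metric_blocks A (\<lambda>\<beta> X Y. corner X Y ` V \<beta>)"
    unfolding metric_blocks_def
  proof (intro conjI ballI allI impI)
    fix X Y assume X: "X \<in> A" and Y: "Y \<in> A"
    show "filtration [sub_atom X] [sub_atom Y] (\<lambda>\<beta>. corner X Y ` V \<beta>)"
      unfolding filtration_def
    proof (intro conjI allI impI)
      fix \<beta> :: real assume \<beta>: "0 \<le> \<beta>"
      show "corner X Y ` V \<beta> \<subseteq> ops [sub_atom X] [sub_atom Y]" using corner_ops by blast
      show "mat.subspace (corner X Y ` V \<beta>)"
      proof (rule mat.subspaceI)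
        show "0 \<in> corner X Y ` V \<beta>" using op.subspace_0 [OF sub(2) [OF \<beta>]] corner_zero by (metis imageI)
        show "x + y \<in> corner X Y ` V \<beta>" if h: "x \<in> corner X Y ` V \<beta>" "y \<in> corner X Y ` V \<beta>" for x y
          using h op.subspace_add [OF sub(2) [OF \<beta>]] by (auto simp flip: corner_add)
        show "mat_scale c x \<in> corner X Y ` V \<beta>" if h: "x \<in> corner X Y ` V \<beta>" for c x
          using h op.subspace_scale [OF sub(2) [OF \<beta>]] by (auto simp flip: corner_scale)
      qed
      show "corner X Y ` V \<beta> = (\<Inter>\<gamma>\<in>{\<beta><..}. corner X Y ` V \<gamma>)"
      proof (intro equalityI subsetI)
        fix w assume w: "w \<in> corner X Y ` V \<beta>"
        have "V \<beta> \<subseteq> V \<gamma>" if "\<beta> < \<gamma>" for \<gamma> using int [OF \<beta>] that by blast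
        then show "w \<in> (\<Inter>\<gamma>\<in>{\<beta><..}. corner X Y ` V \<gamma>)" using w by blast
      next
        fix w assume w: "w \<in> (\<Inter>\<gamma>\<in>{\<beta><..}. corner X Y ` V \<gamma>)"
        have "block X Y w \<in> V \<gamma>" if "\<beta> < \<gamma>" for \<gamma> using w that \<beta> by (intro B X Y) auto
        then have "block X Y w \<in> V \<beta>" unfolding int [OF \<beta>] by blast
        moreover have "w \<in> ops [sub_atom X] [sub_atom Y]" using w corner_ops by (auto dest!: bspec [of _ _ "\<beta> + 1"])
        then have "corner X Y (block X Y w) = w" by (subst corner_block [OF X Y X Y]) auto
        ultimately show "w \<in> corner X Y ` V \<beta>" by (metis imageI)
      qed
    qed
  next
    fix \<beta> :: real and X Y w assume \<beta>: "0 \<le> \<beta>" and X: "X \<in> A" and Y: "Y \<in> A" and w: "w \<in> corner X Y ` V \<beta>"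
    then obtain u where u: "u \<in> V \<beta>" "w = corner X Y u" by blast
    have ub: "u \<in> bounded_ops H H" using u sub(1) [OF \<beta>] by blast
    obtain a where a: "a \<in> bounded_ops H H" "\<And>x y. x \<in> H \<Longrightarrow> y \<in> H \<Longrightarrow> cinner (a x) y = cinner x (u y)"
      using adjoint_exists [OF ub] by blast
    have ua: "cinner (u x) y = cinner x (a y)" if "x \<in> H" "y \<in> H" for x y
      using a(2) [OF that(2,1)] cinner_commute by metis
    have "a \<in> adjoint_ops H (V \<beta>)" unfolding adjoint_ops_def using a(1) u(1) ua by blast
    then have "a \<in> V \<beta>" using sub(4) [OF \<beta>] by simp
    moreover have "corner Y X a = mat_dagger w" unfolding u(2) by (rule corner_adjoint [OF ua Y X])
    ultimately show "mat_dagger w \<in> corner Y X ` V \<beta>" by (metis imageI)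
  next
    fix \<alpha> \<beta> :: real and X Y Z a b
    assume h: "0 \<le> \<alpha>" "0 \<le> \<beta>" and X: "X \<in> A" "Y \<in> A" "Z \<in> A" and a: "a \<in> corner Y Z ` V \<alpha>" and b: "b \<in> corner X Y ` V \<beta>"
    then obtain u v where u: "u \<in> V \<alpha>" "a = corner Y Z u" and v: "v \<in> V \<beta>" "b = corner X Y v" by blast
    have "proj Y \<circ> v \<in> V (0 + \<beta>)" using h v X P by (intro prod) auto
    then have "u \<circ> (proj Y \<circ> v) \<in> V (\<alpha> + \<beta>)" using h u by (intro prod) auto
    moreover have "mat_mult [sub_atom Y] a b = corner X Z (u \<circ> (proj Y \<circ> v))"
      unfolding u(2) v(2) using u v sub(1) h X by (intro corner_mult) auto
    ultimately show "mat_mult [sub_atom Y] a b \<in> corner X Z ` V (\<alpha> + \<beta>)" by (metis imageI)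
  next
    fix X assume "X \<in> A"
    then show "mat_one [sub_atom X] \<in> corner X X ` V 0" using P corner_proj by (metis imageI)
  qed
  show "V = metric_of A (\<lambda>\<beta> X Y. corner X Y ` V \<beta>)"
  proof
    fix \<beta>
    show "V \<beta> = metric_of A (\<lambda>\<beta> X Y. corner X Y ` V \<beta>) \<beta>"
    proof (cases "0 \<le> \<beta>")
      case True
      have "v \<in> V \<beta>" if v: "v \<in> bounded_ops H H" and c: "\<forall>X\<in>A. \<forall>Y\<in>A. corner X Y v \<in> corner X Y ` V \<beta>" for v
      proof (rule in_ultraweak_closed [OF sub(3) [OF True] v])
        show "v \<in> topspace (ultraweak H)" using v by (simp add: topspace_ultraweak)
        show "(\<Sum>Y\<in>F. \<Sum>X\<in>F. block X Y (corner X Y v)) \<in> V \<beta>" if F: "F \<subseteq> A" for F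
        proof (intro op.subspace_sum [OF sub(2) [OF True]] B True)
          fix X Y assume Y: "Y \<in> F" and X: "X \<in> F"
          show XA: "X \<in> A" "Y \<in> A" using X Y F by auto
          show "corner X Y v \<in> corner X Y ` V \<beta>" using c XA by blast
        qed
      qed
      then show ?thesis using True sub(1) [OF True] by (auto simp: metric_of_def)
    next
      case False
      then show ?thesis using ext by (simp add: metric_of_def extensional_def)
    qed
  qed
qed

text \<open>Membership of a corner in \<open>W \<beta> X Y\<close> is tested by the matrices orthogonal to that space.  As these tests
  are ultraweakly continuous, the spaces are closed; as they pass to the sum over the intermediate
  atom, they are closed under products.\<close>

lemma pseudometric_metric_of:
  assumes W: "metric_blocks A W"
  shows "quantum_pseudometric H (linfty A) (metric_of A W)"
    and "0 \<le> \<beta> \<Longrightarrow> X \<in> A \<Longrightarrow> Y \<in> A \<Longrightarrow> corner X Y ` metric_of A W \<beta> = W \<beta> X Y"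
proof -
  let ?V = "metric_of A W"
  have fil: "filtration [sub_atom X] [sub_atom Y] (\<lambda>\<beta>. W \<beta> X Y)" if "X \<in> A" "Y \<in> A" for X Y
    using W that by (simp add: metric_blocks_def)
  have dag: "mat_dagger w \<in> W \<beta> Y X" if "0 \<le> \<beta>" "X \<in> A" "Y \<in> A" "w \<in> W \<beta> X Y" for \<beta> X Y w
    using W that by (simp add: metric_blocks_def)
  have mul: "mat_mult [sub_atom Y] a b \<in> W (\<alpha> + \<beta>) X Z"
    if "0 \<le> \<alpha>" "0 \<le> \<beta>" "X \<in> A" "Y \<in> A" "Z \<in> A" "a \<in> W \<alpha> Y Z" "b \<in> W \<beta> X Y" for \<alpha> \<beta> X Y Z a b
    using W that by (simp add: metric_blocks_def)
  have one: "mat_one [sub_atom X] \<in> W 0 X X" if "X \<in> A" for X using W that by (simp add: metric_blocks_def)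
  have ws: "mat.subspace (W \<beta> X Y)" "W \<beta> X Y \<subseteq> ops [sub_atom X] [sub_atom Y]" if "0 \<le> \<beta>" "X \<in> A" "Y \<in> A" for \<beta> X Y
    using fil [OF that(2,3)] that(1) unfolding filtration_def by blast+
  have wint: "W \<alpha> X Y = (\<Inter>\<beta>\<in>{\<alpha><..}. W \<beta> X Y)" if "0 \<le> \<alpha>" "X \<in> A" "Y \<in> A" for \<alpha> X Y
    using fil [OF that(2,3)] that(1) unfolding filtration_def by blast
  have V: "?V \<beta> = {v \<in> bounded_ops H H. \<forall>X\<in>A. \<forall>Y\<in>A. corner X Y v \<in> W \<beta> X Y}" if "0 \<le> \<beta>" for \<beta>
    using that by (simp add: metric_of_def)
  have sub: "op.subspace (?V \<beta>)" if h: "0 \<le> \<beta>" for \<beta>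
    unfolding V [OF h]
    by (rule op.subspaceI)
      (use op.subspace_0 [OF subspace_bounded_ops] mat.subspace_0 [OF ws(1) [OF h]]
        op.subspace_add [OF subspace_bounded_ops] mat.subspace_add [OF ws(1) [OF h]]
        op.subspace_scale [OF subspace_bounded_ops] mat.subspace_scale [OF ws(1) [OF h]]
        in \<open>simp_all add: corner_zero corner_add corner_scale\<close>)
  have test: "corner X Y v \<in> W \<beta> X Y \<longleftrightarrow> (\<forall>k\<in>perp [sub_atom X] [sub_atom Y] (W \<beta> X Y). hs [sub_atom X] [sub_atom Y] k (corner X Y v) = 0)"
    if "0 \<le> \<beta>" "X \<in> A" "Y \<in> A" for \<beta> X Y v
  proof
    assume "corner X Y v \<in> W \<beta> X Y"
    then show "\<forall>k\<in>perp [sub_atom X] [sub_atom Y] (W \<beta> X Y). hs [sub_atom X] [sub_atom Y] k (corner X Y v) = 0"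
      by (auto simp: perp_def hs_eq_0_commute)
  next
    assume "\<forall>k\<in>perp [sub_atom X] [sub_atom Y] (W \<beta> X Y). hs [sub_atom X] [sub_atom Y] k (corner X Y v) = 0"
    then show "corner X Y v \<in> W \<beta> X Y"
      using perp_eqI [OF finite_basis_sub [OF that(2)] finite_basis_sub [OF that(3)] ws [OF that] corner_ops] by blast
  qed
  show "quantum_pseudometric H (linfty A) ?V"
    unfolding quantum_pseudometric_def
  proof (intro conjI allI impI)
    show "?V \<in> extensional {0..}" by (simp add: metric_of_def)
  next
    fix \<beta> :: real assume \<beta>: "0 \<le> \<beta>"
    show "?V \<beta> \<subseteq> bounded_ops H H" using V [OF \<beta>] by blast
    show "op.subspace (?V \<beta>)" by (rule sub [OF \<beta>])
    show "closedin (ultraweak H) (?V \<beta>)"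
      unfolding closedin_def
    proof
      show "?V \<beta> \<subseteq> topspace (ultraweak H)" using V [OF \<beta>] by (auto simp: topspace_ultraweak)
      have "?V \<beta> = {v \<in> bounded_ops H H. \<forall>X\<in>A. \<forall>Y\<in>A. \<forall>k\<in>perp [sub_atom X] [sub_atom Y] (W \<beta> X Y).
          hs [sub_atom X] [sub_atom Y] k (corner X Y v) = 0}"
        unfolding V [OF \<beta>] by (intro Collect_cong conj_cong ball_cong refl test \<beta>)
      then have "topspace (ultraweak H) - ?V \<beta> = (\<Union>X\<in>A. \<Union>Y\<in>A. \<Union>k\<in>perp [sub_atom X] [sub_atom Y] (W \<beta> X Y).
          {a \<in> bounded_ops H H. hs [sub_atom X] [sub_atom Y] k (corner X Y a) \<noteq> 0})"
        by (auto simp: topspace_ultraweak)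
      then show "openin (ultraweak H) (topspace (ultraweak H) - ?V \<beta>)"
        using openin_hs_corner by (simp only:) (intro openin_Union, blast)
    qed
    show "adjoint_ops H (?V \<beta>) = ?V \<beta>"
    proof (intro equalityI subsetI)
      fix b assume "b \<in> adjoint_ops H (?V \<beta>)"
      then obtain a where b: "b \<in> bounded_ops H H" and a: "a \<in> ?V \<beta>"
        and ab: "\<And>x y. x \<in> H \<Longrightarrow> y \<in> H \<Longrightarrow> cinner (a x) y = cinner x (b y)"
        by (auto simp: adjoint_ops_def)
      have "corner X Y b \<in> W \<beta> X Y" if X: "X \<in> A" and Y: "Y \<in> A" for X Y
      proof -
        have "corner X Y b = mat_dagger (corner Y X a)" by (rule corner_adjoint [OF ab X Y])
        moreover have "corner Y X a \<in> W \<beta> Y X" using a V [OF \<beta>] X Y by blast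
        ultimately show ?thesis using dag [OF \<beta> Y X] by simp
      qed
      then show "b \<in> ?V \<beta>" using b V [OF \<beta>] by blast
    next
      fix b assume b: "b \<in> ?V \<beta>"
      then have bb: "b \<in> bounded_ops H H" using V [OF \<beta>] by blast
      obtain a where a: "a \<in> bounded_ops H H" and ab: "\<And>x y. x \<in> H \<Longrightarrow> y \<in> H \<Longrightarrow> cinner (a x) y = cinner x (b y)"
        using adjoint_exists [OF bb] by blast
      have ba: "cinner (b x) y = cinner x (a y)" if "x \<in> H" "y \<in> H" for x y
        using ab [OF that(2,1)] cinner_commute by metis
      have "corner X Y a \<in> W \<beta> X Y" if X: "X \<in> A" and Y: "Y \<in> A" for X Y
      proof -
        have "corner X Y a = mat_dagger (corner Y X b)" by (rule corner_adjoint [OF ba X Y])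
        moreover have "corner Y X b \<in> W \<beta> Y X" using b V [OF \<beta>] X Y by blast
        ultimately show ?thesis using dag [OF \<beta> Y X] by simp
      qed
      then have "a \<in> ?V \<beta>" using a V [OF \<beta>] by blast
      then show "b \<in> adjoint_ops H (?V \<beta>)" unfolding adjoint_ops_def using bb ab by blast
    qed
  next
    fix \<alpha> \<beta> :: real assume h: "0 \<le> \<alpha>" "0 \<le> \<beta>"
    have h': "0 \<le> \<alpha> + \<beta>" using h by simp
    have "u \<circ> v \<in> ?V (\<alpha> + \<beta>)" if u: "u \<in> ?V \<alpha>" and v: "v \<in> ?V \<beta>" for u v
    proof -
      have ub: "u \<in> bounded_ops H H" and uc: "\<And>X Y. X \<in> A \<Longrightarrow> Y \<in> A \<Longrightarrow> corner X Y u \<in> W \<alpha> X Y"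
        using u V [OF h(1)] by blast+
      have vb: "v \<in> bounded_ops H H" and vc: "\<And>X Y. X \<in> A \<Longrightarrow> Y \<in> A \<Longrightarrow> corner X Y v \<in> W \<beta> X Y"
        using v V [OF h(2)] by blast+
      have "corner X Z (u \<circ> v) \<in> W (\<alpha> + \<beta>) X Z" if X: "X \<in> A" and Z: "Z \<in> A" for X Z
        unfolding test [OF h' X Z]
      proof
        fix k assume k: "k \<in> perp [sub_atom X] [sub_atom Z] (W (\<alpha> + \<beta>) X Z)"
        have "((\<lambda>Y. hs [sub_atom X] [sub_atom Z] k (mat_mult [sub_atom Y] (corner Y Z u) (corner X Y v))) has_sum 0) A"
        proof (rule has_sum_0)
          fix Y assume Y: "Y \<in> A"
          have "mat_mult [sub_atom Y] (corner Y Z u) (corner X Y v) \<in> W (\<alpha> + \<beta>) X Z"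
            by (rule mul [OF h X Y Z uc [OF Y Z] vc [OF X Y]])
          then show "hs [sub_atom X] [sub_atom Z] k (mat_mult [sub_atom Y] (corner Y Z u) (corner X Y v)) = 0"
            using k by (auto simp: perp_def hs_eq_0_commute)
        qed
        then show "hs [sub_atom X] [sub_atom Z] k (corner X Z (u \<circ> v)) = 0"
          by (rule has_sum_unique [OF hs_corner_compose [OF ub vb X]])
      qed
      then show ?thesis using bounded_ops_compose [OF ub vb] V [OF h'] by blast
    qed
    then show "op_prod (?V \<alpha>) (?V \<beta>) \<subseteq> ?V (\<alpha> + \<beta>)"
      unfolding op_prod_def by (intro op.span_minimal sub [OF h']) blast
  next
    fix \<alpha> :: real assume \<alpha>: "0 \<le> \<alpha>"
    have "v \<in> ?V \<alpha> \<longleftrightarrow> (\<forall>\<beta>\<in>{\<alpha><..}. v \<in> ?V \<beta>)" for v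
    proof
      assume v: "v \<in> ?V \<alpha>"
      show "\<forall>\<beta>\<in>{\<alpha><..}. v \<in> ?V \<beta>"
      proof
        fix \<beta> assume b: "\<beta> \<in> {\<alpha><..}"
        have "corner X Y v \<in> W \<beta> X Y" if "X \<in> A" "Y \<in> A" for X Y
          using v V [OF \<alpha>] wint [OF \<alpha> that] b that by blast
        then show "v \<in> ?V \<beta>" using v V [OF \<alpha>] V [of \<beta>] \<alpha> b by auto
      qed
    next
      assume v: "\<forall>\<beta>\<in>{\<alpha><..}. v \<in> ?V \<beta>"
      then have "v \<in> ?V (\<alpha> + 1)" by simp
      then have vb: "v \<in> bounded_ops H H" using V [of "\<alpha> + 1"] \<alpha> by auto
      have "corner X Y v \<in> W \<alpha> X Y" if X: "X \<in> A" "Y \<in> A" for X Y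
      proof -
        have "corner X Y v \<in> W \<beta> X Y" if b: "\<beta> > \<alpha>" for \<beta>
          using v V [of \<beta>] \<alpha> b X by auto
        then show ?thesis unfolding wint [OF \<alpha> X] by blast
      qed
      then show "v \<in> ?V \<alpha>" using vb V [OF \<alpha>] by blast
    qed
    then show "?V \<alpha> = (\<Inter>\<beta>\<in>{\<alpha><..}. ?V \<beta>)" by blast
  next
    have "identity_block X Y \<subseteq> W 0 X Y" if X: "X \<in> A" and Y: "Y \<in> A" for X Y
      using mat.span_minimal [OF _ ws(1) [OF order_refl X Y], of "{mat_one [sub_atom X]}"]
        mat.subspace_0 [OF ws(1) [OF order_refl X Y]] one [OF X]
      by (cases "X = Y") (simp_all add: identity_block_def)
    then show "commutant H (linfty A) \<subseteq> ?V 0" using commutant_iff V [of 0] by blast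
  qed
  assume \<beta>: "0 \<le> \<beta>" and X: "X \<in> A" and Y: "Y \<in> A"
  show "corner X Y ` ?V \<beta> = W \<beta> X Y"
  proof (intro equalityI subsetI)
    fix w assume "w \<in> corner X Y ` ?V \<beta>"
    then show "w \<in> W \<beta> X Y" using V [OF \<beta>] X Y by blast
  next
    fix w assume w: "w \<in> W \<beta> X Y"
    have c: "corner X' Y' (block X Y w) = (if X' = X \<and> Y' = Y then w else 0)" if "X' \<in> A" "Y' \<in> A" for X' Y'
      using w ws(2) [OF \<beta> X Y] by (intro corner_block X Y that) blast
    have "corner X' Y' (block X Y w) \<in> W \<beta> X' Y'" if "X' \<in> A" "Y' \<in> A" for X' Y'
      using c [OF that] w mat.subspace_0 [OF ws(1) [OF \<beta> that]] by auto
    then have "block X Y w \<in> ?V \<beta>" using V [OF \<beta>] block_bounded [OF X Y] by blast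
    moreover have "corner X Y (block X Y w) = w" using c [OF X Y] by simp
    ultimately show "w \<in> corner X Y ` ?V \<beta>" by (metis imageI)
  qed
qed

lemma metric_iff_corners:
  assumes V: "quantum_pseudometric H (linfty A) V"
  shows "quantum_metric H (linfty A) V \<longleftrightarrow> (\<forall>X\<in>A. \<forall>Y\<in>A. corner X Y ` V 0 \<subseteq> identity_block X Y)"
proof -
  have "commutant H (linfty A) \<subseteq> V 0" "V 0 \<subseteq> bounded_ops H H" using quantum_pseudometricD(2) [OF V order_refl] quantum_pseudometricD(6) [OF V] by blast+
  then have "V 0 = commutant H (linfty A) \<longleftrightarrow> (\<forall>v\<in>V 0. \<forall>X\<in>A. \<forall>Y\<in>A. corner X Y v \<in> identity_block X Y)"
    using commutant_iff by blast
  then show ?thesis using V unfolding quantum_metric_def by blast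
qed

end

section \<open>The correspondence\<close>

lemma level_0: "decomposition X Y D \<Longrightarrow> level D 0 = D 0"
  by (simp add: level_def mat.span_eq_iff decompositionD(1))

lemma hs_dagger: "hs Y X (mat_dagger a) (mat_dagger b) = hs X Y b a"
  unfolding hs_eq mat_dagger_def by (subst sum.swap) (simp add: mult.commute)

lemma mat_dagger_dagger [simp]: "mat_dagger (mat_dagger a) = a" by (simp add: mat_dagger_def)

lemma mat_mult_bilinear:
  "mat_mult Y (a + a') b = mat_mult Y a b + mat_mult Y a' b" "mat_mult Y a (b + b') = mat_mult Y a b + mat_mult Y a b'"
  "mat_mult Y (mat_scale c a) b = mat_scale c (mat_mult Y a b)" "mat_mult Y a (mat_scale c b) = mat_scale c (mat_mult Y a b)"
  by (simp_all add: mat_mult_def fun_eq_iff mat_scale_def distrib_left distrib_right sum.distrib sum_distrib_left mult_ac)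

lemma piece_in_level: "r \<in> D \<alpha> \<Longrightarrow> \<alpha> \<le> ennreal \<beta> \<Longrightarrow> r \<in> level D \<beta>"
  unfolding level_def by (intro mat.span_base) auto

lemma dagger_levels_orthogonal:
  assumes fin: "finite (basis X)" "finite (basis Y)" and E: "decomposition Y X E"
    and L: "\<And>\<beta> w. 0 \<le> \<beta> \<Longrightarrow> w \<in> level D \<beta> \<Longrightarrow> mat_dagger w \<in> level E \<beta>"
    and r: "r \<in> D \<alpha>" "s \<in> E \<beta>" "\<alpha> < \<beta>"
  shows "hs Y X (mat_dagger r) s = 0"
proof -
  have "\<alpha> \<noteq> \<infinity>" using r(3) by auto
  then obtain a where a: "0 \<le> a" "\<alpha> = ennreal a" by (cases \<alpha>) auto
  have "mat_dagger r \<in> level E a" using a r(1) by (intro L piece_in_level) auto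
  then show ?thesis using in_level [OF fin(2,1) E] r a hs_eq_0_commute by blast
qed

lemma dagger_levels_closed:
  assumes fin: "finite (basis X)" "finite (basis Y)"
    and D: "decomposition X Y D" and E: "decomposition Y X E"
    and R: "\<And>\<alpha> \<beta> r s. \<alpha> \<noteq> \<beta> \<Longrightarrow> r \<in> D \<alpha> \<Longrightarrow> s \<in> E \<beta> \<Longrightarrow> hs Y X (mat_dagger r) s = 0"
    and w: "w \<in> level D \<beta>"
  shows "mat_dagger w \<in> level E \<beta>"
  unfolding in_level [OF fin(2,1) E]
proof (intro conjI allI impI ballI)
  show "mat_dagger w \<in> ops Y X" using w in_level [OF fin D] dagger_ops by blast
  fix \<alpha> s assume a: "ennreal \<beta> < \<alpha>" and s: "s \<in> E \<alpha>"
  have "hs X Y w (mat_dagger s) = 0"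
  proof (rule hs_span_0 [OF w [unfolded level_def]])
    fix r assume "r \<in> (\<Union>\<gamma>\<in>{0..ennreal \<beta>}. D \<gamma>)"
    then obtain \<gamma> where g: "\<gamma> \<le> ennreal \<beta>" "r \<in> D \<gamma>" by auto
    then have "\<gamma> \<noteq> \<alpha>" using a by auto
    then have "hs Y X (mat_dagger r) (mat_dagger (mat_dagger s)) = 0" using R g s by simp
    then show "hs X Y r (mat_dagger s) = 0" unfolding hs_dagger hs_eq_0_commute [of X Y r] .
  qed
  then have "hs Y X (mat_dagger (mat_dagger s)) (mat_dagger w) = 0" unfolding hs_dagger .
  then show "hs Y X s (mat_dagger w) = 0" by simp
qed

text \<open>Closure of the levels of \<open>D\<close> gives orthogonality to the pieces of \<open>E\<close> with larger index.  For those with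
  smaller index the adjoints of both elements are taken, which needs closure of the levels of \<open>E\<close>.\<close>

lemma dagger_levels_iff:
  assumes fin: "finite (basis X)" "finite (basis Y)"
    and D: "decomposition X Y D" and E: "decomposition Y X E"
  shows "(\<forall>\<beta>\<ge>0. (\<forall>w\<in>level D \<beta>. mat_dagger w \<in> level E \<beta>) \<and> (\<forall>w\<in>level E \<beta>. mat_dagger w \<in> level D \<beta>)) \<longleftrightarrow>
    (\<forall>\<alpha> \<beta>. \<alpha> \<noteq> \<beta> \<longrightarrow> (\<forall>r\<in>D \<alpha>. \<forall>s\<in>E \<beta>. hs Y X (mat_dagger r) s = 0))"
    (is "?L \<longleftrightarrow> ?R")
proof
  assume L: ?L
  show ?R
  proof (intro allI impI ballI)
    fix \<alpha> \<beta> r s assume h: "\<alpha> \<noteq> \<beta>" "r \<in> D \<alpha>" "s \<in> E \<beta>"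
    show "hs Y X (mat_dagger r) s = 0"
    proof (cases "\<alpha> < \<beta>")
      case True
      show ?thesis by (rule dagger_levels_orthogonal [where D = D and E = E, OF fin E _ h(2,3) True]) (use L in blast)
    next
      case False
      then have "\<beta> < \<alpha>" using h by simp
      have "hs X Y (mat_dagger s) r = 0"
        by (rule dagger_levels_orthogonal [where D = E and E = D, OF fin(2,1) D _ h(3,2) \<open>\<beta> < \<alpha>\<close>]) (use L in blast)
      then have "hs Y X (mat_dagger r) (mat_dagger (mat_dagger s)) = 0" unfolding hs_dagger .
      then show ?thesis by simp
    qed
  qed
next
  assume R: ?R
  have R': "hs X Y (mat_dagger s) r = 0" if h: "\<beta> \<noteq> \<alpha>" "s \<in> E \<beta>" "r \<in> D \<alpha>" for \<alpha> \<beta> r s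
  proof -
    have "hs Y X (mat_dagger r) (mat_dagger (mat_dagger s)) = 0" using R h unfolding mat_dagger_dagger by metis
    then show ?thesis unfolding hs_dagger .
  qed
  have "mat_dagger w \<in> level E \<beta>" if w: "w \<in> level D \<beta>" for w \<beta>
    by (rule dagger_levels_closed [where D = D and E = E, OF fin D E _ w]) (use R in blast)
  moreover have "mat_dagger w \<in> level D \<beta>" if w: "w \<in> level E \<beta>" for w \<beta>
    by (rule dagger_levels_closed [where D = E and E = D, OF fin(2,1) E D _ w]) (rule R')
  ultimately show ?L by blast
qed

text \<open>If \<open>\<alpha> > \<beta> + \<delta>\<close>, then \<open>\<beta>\<close> and \<open>\<delta>\<close> are finite and \<open>D \<alpha>\<close> is orthogonal to the level at \<open>\<beta> + \<delta>\<close>; conversely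
  products of pieces suffice, by bilinearity.\<close>

lemma mult_levels_iff:
  assumes fin: "finite (basis X)" "finite (basis Y)"
    and D: "decomposition X Y D" and E: "decomposition X Z E" and G: "decomposition Z Y G"
  shows "(\<forall>\<beta>\<ge>0. \<forall>\<delta>\<ge>0. \<forall>u\<in>level E \<beta>. \<forall>w\<in>level G \<delta>. mat_mult Z w u \<in> level D (\<delta> + \<beta>)) \<longleftrightarrow>
    (\<forall>\<alpha> \<beta> \<delta>. \<not> \<alpha> \<le> \<beta> + \<delta> \<longrightarrow> (\<forall>r\<in>D \<alpha>. \<forall>u\<in>E \<beta>. \<forall>w\<in>G \<delta>. hs X Y r (mat_mult Z w u) = 0))"
    (is "?L \<longleftrightarrow> ?R")
proof
  assume L: ?L
  show ?R
  proof (intro allI impI ballI)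
    fix \<alpha> \<beta> \<delta> r u w assume h: "\<not> \<alpha> \<le> \<beta> + \<delta>" "r \<in> D \<alpha>" "u \<in> E \<beta>" "w \<in> G \<delta>"
    have "\<beta> \<noteq> \<infinity>" "\<delta> \<noteq> \<infinity>" using h(1) by auto
    then obtain b d where b: "0 \<le> b" "\<beta> = ennreal b" "0 \<le> d" "\<delta> = ennreal d" by (cases \<beta>; cases \<delta>) auto
    have "u \<in> level E b" "w \<in> level G d" using b h by (auto intro: piece_in_level)
    then have "mat_mult Z w u \<in> level D (d + b)" using L b by blast
    moreover have "ennreal (d + b) < \<alpha>" using h(1) b by (simp add: add.commute)
    ultimately show "hs X Y r (mat_mult Z w u) = 0" using in_level [OF fin D] h(2) by blast
  qed
next
  assume R: ?R
  show ?L
  proof (intro allI impI ballI)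
    fix \<beta> \<delta> :: real and u w assume h: "0 \<le> \<beta>" "0 \<le> \<delta>" and u: "u \<in> level E \<beta>" and w: "w \<in> level G \<delta>"
    let ?P = "{mat_mult Z b a | b a. b \<in> (\<Union>\<gamma>\<in>{0..ennreal \<delta>}. G \<gamma>) \<and> a \<in> (\<Union>\<gamma>\<in>{0..ennreal \<beta>}. E \<gamma>)}"
    have "mat_mult Z w u \<in> mat.span ?P"
      by (rule span_bilinear [OF w [unfolded level_def] u [unfolded level_def]]) (simp_all only: mat_mult_bilinear)
    moreover have "?P \<subseteq> level D (\<delta> + \<beta>)"
    proof clarify
      fix b a \<gamma> \<gamma>' assume b: "\<gamma> \<in> {0..ennreal \<delta>}" "b \<in> G \<gamma>" and a: "\<gamma>' \<in> {0..ennreal \<beta>}" "a \<in> E \<gamma>'"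
      show "mat_mult Z b a \<in> level D (\<delta> + \<beta>)"
        unfolding in_level [OF fin D]
      proof (intro conjI allI impI ballI)
        show "mat_mult Z b a \<in> ops X Y"
          using a b decompositionD(2) [OF E] decompositionD(2) [OF G] mat_mult_ops by blast
        fix \<alpha> r assume \<alpha>: "ennreal (\<delta> + \<beta>) < \<alpha>" and r: "r \<in> D \<alpha>"
        have "\<gamma>' + \<gamma> \<le> ennreal \<beta> + ennreal \<delta>" using a b by (intro add_mono) auto
        also have "\<dots> = ennreal (\<delta> + \<beta>)" using h by (simp add: add.commute)
        finally have "\<not> \<alpha> \<le> \<gamma>' + \<gamma>" using \<alpha> by simp
        then show "hs X Y r (mat_mult Z b a) = 0" using R r a b by blast
      qed
    qed
    then have "mat.span ?P \<subseteq> level D (\<delta> + \<beta>)"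
      by (rule mat.span_minimal) (simp add: level_def mat.subspace_span)
    ultimately show "mat_mult Z w u \<in> level D (\<delta> + \<beta>)" by blast
  qed
qed

context atom_set
begin

abbreviation pieces :: "'v drel \<Rightarrow> 'v set \<Rightarrow> 'v set \<Rightarrow> ennreal \<Rightarrow> 'v mat set" where
  "pieces F X Y \<equiv> component F (sub_atom X) (sub_atom Y)"

abbreviation blocks :: "'v drel \<Rightarrow> real \<Rightarrow> 'v set \<Rightarrow> 'v set \<Rightarrow> 'v mat set" where
  "blocks F \<beta> X Y \<equiv> level (pieces F X Y) \<beta>"

definition distance_function :: "'v drel \<Rightarrow> bool" where
  "distance_function F \<longleftrightarrow> is_function [qset A, dual_qset (qset A)] [dists] F \<and>
     holds (refl_formula (qset A) F) \<and> holds (sym_formula (qset A) F) \<and> holds (triangle_formula (qset A) F)"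

lemma finite_atom_basis: "x \<in> qset A \<Longrightarrow> finite (atom_basis (x :: ('v, ennreal) atom))"
  by (auto simp: qset_def onb(2))

lemma is_function_pieces:
  assumes F: "binary_relation [qset A, dual_qset (qset A)] [dists] F"
  shows "is_function [qset A, dual_qset (qset A)] [dists] F \<longleftrightarrow>
    (\<forall>X\<in>A. \<forall>Y\<in>A. decomposition [sub_atom X] [sub_atom Y] (pieces F X Y))"
proof -
  have "is_function [qset A, dual_qset (qset A)] [dists] F \<longleftrightarrow>
      (\<forall>x\<in>qset A. \<forall>y\<in>qset A. decomposition [x] [y] (component F x y))"
    using F finite_atom_basis by (rule is_function_iff)
  then show ?thesis by (simp add: qset_def)
qed

lemma distance_function_iff:
  assumes F: "binary_relation [qset A, dual_qset (qset A)] [dists] F"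
    and dec: "\<And>X Y. X \<in> A \<Longrightarrow> Y \<in> A \<Longrightarrow> decomposition [sub_atom X] [sub_atom Y] (pieces F X Y)"
  shows "distance_function F \<longleftrightarrow> metric_blocks A (blocks F)"
    and "holds (separation_formula (qset A) F) \<longleftrightarrow> (\<forall>X\<in>A. \<forall>Y\<in>A. blocks F 0 X Y \<subseteq> identity_block X Y)"
    and "corresponds A V F \<longleftrightarrow> (\<forall>\<beta>\<ge>0. \<forall>X\<in>A. \<forall>Y\<in>A. blocks F \<beta> X Y = corner X Y ` V \<beta>)"
proof -
  note fin = finite_basis_sub
  have dec': "decomposition [x] [y] (component F x y)" if "x \<in> qset A" "y \<in> qset A" for x y
    using that dec by (auto simp: qset_def)
  have "holds (refl_formula (qset A) F) \<longleftrightarrow> (\<forall>x\<in>qset A. mat_one [x] \<in> component F x x 0)"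
    using F finite_atom_basis dec' by (rule refl_iff)
  also have "\<dots> \<longleftrightarrow> (\<forall>X\<in>A. mat_one [sub_atom X] \<in> blocks F 0 X X)"
    by (simp add: qset_def level_0 [OF dec])
  finally have 1: "holds (refl_formula (qset A) F) \<longleftrightarrow> (\<forall>X\<in>A. mat_one [sub_atom X] \<in> blocks F 0 X X)" .
  have "holds (sym_formula (qset A) F) \<longleftrightarrow> (\<forall>x\<in>qset A. \<forall>y\<in>qset A. \<forall>\<alpha> \<beta>. \<alpha> \<noteq> \<beta> \<longrightarrow>
      (\<forall>r\<in>component F x y \<alpha>. \<forall>s\<in>component F y x \<beta>. hs [y] [x] (mat_dagger r) s = 0))"
    using F finite_atom_basis dec' by (rule sym_iff)
  also have "\<dots> \<longleftrightarrow> (\<forall>X\<in>A. \<forall>Y\<in>A. \<forall>\<alpha> \<beta>. \<alpha> \<noteq> \<beta> \<longrightarrow>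
      (\<forall>r\<in>pieces F X Y \<alpha>. \<forall>s\<in>pieces F Y X \<beta>. hs [sub_atom Y] [sub_atom X] (mat_dagger r) s = 0))"
    by (simp add: qset_def)
  also have "\<dots> \<longleftrightarrow> (\<forall>X\<in>A. \<forall>Y\<in>A. \<forall>\<beta>\<ge>0. (\<forall>w\<in>blocks F \<beta> X Y. mat_dagger w \<in> blocks F \<beta> Y X) \<and>
      (\<forall>w\<in>blocks F \<beta> Y X. mat_dagger w \<in> blocks F \<beta> X Y))"
    using dagger_levels_iff [OF fin fin dec dec] by (intro ball_cong refl) (rule sym, assumption)
  also have "\<dots> \<longleftrightarrow> (\<forall>\<beta>\<ge>0. \<forall>X\<in>A. \<forall>Y\<in>A. \<forall>w\<in>blocks F \<beta> X Y. mat_dagger w \<in> blocks F \<beta> Y X)" by blast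
  finally have 2: "holds (sym_formula (qset A) F) \<longleftrightarrow>
      (\<forall>\<beta>\<ge>0. \<forall>X\<in>A. \<forall>Y\<in>A. \<forall>w\<in>blocks F \<beta> X Y. mat_dagger w \<in> blocks F \<beta> Y X)" .
  have "holds (triangle_formula (qset A) F) \<longleftrightarrow> (\<forall>x\<in>qset A. \<forall>y\<in>qset A. \<forall>z\<in>qset A. \<forall>\<alpha> \<beta> \<delta>. \<not> \<alpha> \<le> \<beta> + \<delta> \<longrightarrow>
    (\<forall>r\<in>component F x y \<alpha>. \<forall>u\<in>component F x z \<beta>. \<forall>w\<in>component F z y \<delta>. hs [x] [y] r (mat_mult [z] w u) = 0))"
    using F finite_atom_basis dec' by (rule triangle_iff)
  also have "\<dots> \<longleftrightarrow> (\<forall>X\<in>A. \<forall>Y\<in>A. \<forall>Z\<in>A. \<forall>\<alpha> \<beta> \<delta>. \<not> \<alpha> \<le> \<beta> + \<delta> \<longrightarrow>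
    (\<forall>r\<in>pieces F X Y \<alpha>. \<forall>u\<in>pieces F X Z \<beta>. \<forall>w\<in>pieces F Z Y \<delta>.
      hs [sub_atom X] [sub_atom Y] r (mat_mult [sub_atom Z] w u) = 0))" by (simp only: qset_def ball_simps)
  also have "\<dots> \<longleftrightarrow> (\<forall>X\<in>A. \<forall>Y\<in>A. \<forall>Z\<in>A. \<forall>\<beta>\<ge>0. \<forall>\<delta>\<ge>0. \<forall>u\<in>blocks F \<beta> X Z. \<forall>w\<in>blocks F \<delta> Z Y.
      mat_mult [sub_atom Z] w u \<in> blocks F (\<delta> + \<beta>) X Y)"
    using mult_levels_iff [OF fin fin dec dec dec] by (intro ball_cong refl) (rule sym, assumption)
  also have "\<dots> \<longleftrightarrow> (\<forall>\<alpha>\<ge>0. \<forall>\<beta>\<ge>0. \<forall>X\<in>A. \<forall>Y\<in>A. \<forall>Z\<in>A. \<forall>a\<in>blocks F \<alpha> Y Z. \<forall>b\<in>blocks F \<beta> X Y.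
        mat_mult [sub_atom Y] a b \<in> blocks F (\<alpha> + \<beta>) X Z)" by blast
  finally have 3: "holds (triangle_formula (qset A) F) \<longleftrightarrow>
      (\<forall>\<alpha>\<ge>0. \<forall>\<beta>\<ge>0. \<forall>X\<in>A. \<forall>Y\<in>A. \<forall>Z\<in>A. \<forall>a\<in>blocks F \<alpha> Y Z. \<forall>b\<in>blocks F \<beta> X Y.
        mat_mult [sub_atom Y] a b \<in> blocks F (\<alpha> + \<beta>) X Z)" .
  have 4: "\<forall>X\<in>A. \<forall>Y\<in>A. filtration [sub_atom X] [sub_atom Y] (\<lambda>\<beta>. blocks F \<beta> X Y)"
    using filtration_level [OF fin fin dec] by simp
  have 5: "is_function [qset A, dual_qset (qset A)] [dists] F" using is_function_pieces [OF F] dec by blast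
  show "distance_function F \<longleftrightarrow> metric_blocks A (blocks F)"
    unfolding distance_function_def metric_blocks_def 1 2 3 using 4 5 by blast
  have "holds (separation_formula (qset A) F) \<longleftrightarrow>
      (\<forall>x\<in>qset A. \<forall>y\<in>qset A. component F x y 0 \<subseteq> (if x = y then mat.span {mat_one [x]} else {0}))"
    using F finite_atom_basis dec' by (rule separation_iff)
  then show "holds (separation_formula (qset A) F) \<longleftrightarrow> (\<forall>X\<in>A. \<forall>Y\<in>A. blocks F 0 X Y \<subseteq> identity_block X Y)"
    by (simp add: qset_def identity_block_def level_0 [OF dec])
  show "corresponds A V F \<longleftrightarrow> (\<forall>\<beta>\<ge>0. \<forall>X\<in>A. \<forall>Y\<in>A. blocks F \<beta> X Y = corner X Y ` V \<beta>)"
    using F finite_atom_basis dec' by (rule corresponds_iff)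
qed

lemma distance_functionD:
  assumes "distance_function F"
  shows "binary_relation [qset A, dual_qset (qset A)] [dists] F"
    and "X \<in> A \<Longrightarrow> Y \<in> A \<Longrightarrow> decomposition [sub_atom X] [sub_atom Y] (pieces F X Y)"
proof -
  have f: "is_function [qset A, dual_qset (qset A)] [dists] F" using assms by (simp add: distance_function_def)
  then show b: "binary_relation [qset A, dual_qset (qset A)] [dists] F" by (simp add: is_function_def)
  show "X \<in> A \<Longrightarrow> Y \<in> A \<Longrightarrow> decomposition [sub_atom X] [sub_atom Y] (pieces F X Y)"
    using is_function_pieces [OF b] f by blast
qed

lemma distance_function_eqI:
  assumes F: "distance_function F" and G: "distance_function G"
    and eq: "\<And>\<beta> X Y. 0 \<le> \<beta> \<Longrightarrow> X \<in> A \<Longrightarrow> Y \<in> A \<Longrightarrow> blocks F \<beta> X Y = blocks G \<beta> X Y"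
  shows "F = G"
proof (rule relation_eqI [OF distance_functionD(1) [OF F] distance_functionD(1) [OF G] finite_atom_basis])
  fix x y :: "('v, ennreal) atom" assume "x \<in> qset A" "y \<in> qset A"
  then obtain X Y where X: "X \<in> A" "Y \<in> A" and xy: "x = sub_atom X" "y = sub_atom Y" by (auto simp: qset_def)
  note fin = finite_basis_sub [OF X(1)] finite_basis_sub [OF X(2)]
  show "component F x y = component G x y"
  proof
    fix \<alpha>
    have "component F x y \<alpha> = graded_piece [x] [y] (\<lambda>\<beta>. blocks F \<beta> X Y) \<alpha>"
      unfolding xy using graded_piece_level [OF fin distance_functionD(2) [OF F X]] by simp
    also have "\<dots> = graded_piece [x] [y] (\<lambda>\<beta>. blocks G \<beta> X Y) \<alpha>"
      using eq X by (auto simp: graded_piece_def)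
    also have "\<dots> = component G x y \<alpha>"
      unfolding xy using graded_piece_level [OF fin distance_functionD(2) [OF G X]] by simp
    finally show "component F x y \<alpha> = component G x y \<alpha>" .
  qed
qed

text \<open>The definite descriptions recover the Hilbert spaces from the atoms.\<close>

definition function_of :: "(real \<Rightarrow> 'v set \<Rightarrow> 'v set \<Rightarrow> 'v mat set) \<Rightarrow> 'v drel" where
  "function_of W = rel_of_components (qset A)
     (\<lambda>x y. graded_piece [x] [y] (\<lambda>\<beta>. W \<beta> (THE X. x = sub_atom X) (THE Y. y = sub_atom Y)))"

lemma function_of:
  assumes W: "metric_blocks A W"
  shows "distance_function (function_of W)"
    and "0 \<le> \<beta> \<Longrightarrow> X \<in> A \<Longrightarrow> Y \<in> A \<Longrightarrow> blocks (function_of W) \<beta> X Y = W \<beta> X Y"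
proof -
  let ?D = "\<lambda>x y :: ('v, ennreal) atom. graded_piece [x] [y] (\<lambda>\<beta>. W \<beta> (THE X. x = sub_atom X) (THE Y. y = sub_atom Y))"
  have fil: "filtration [sub_atom X] [sub_atom Y] (\<lambda>\<beta>. W \<beta> X Y)" if "X \<in> A" "Y \<in> A" for X Y
    using W that by (simp add: metric_blocks_def)
  have dec: "decomposition [x] [y] (?D x y)" if "x \<in> qset A" "y \<in> qset A" for x y
    using that by (auto simp: qset_def intro!: graded_piece_decomposition finite_basis_sub fil)
  have F: "binary_relation [qset A, dual_qset (qset A)] [dists] (function_of W)"
    unfolding function_of_def using dec by (rule binary_relation_of_components)
  have p: "pieces (function_of W) X Y = graded_piece [sub_atom X] [sub_atom Y] (\<lambda>\<beta>. W \<beta> X Y)" if X: "X \<in> A" "Y \<in> A" for X Y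
  proof -
    have m: "sub_atom X \<in> qset A" "sub_atom Y \<in> qset A" using X by (auto simp: qset_def)
    have "component (rel_of_components (qset A) ?D) (sub_atom X) (sub_atom Y) = ?D (sub_atom X) (sub_atom Y)"
      using dec m by (rule component_of_components)
    then show ?thesis unfolding function_of_def by simp
  qed
  have bl: "blocks (function_of W) \<beta> X Y = W \<beta> X Y" if "0 \<le> \<beta>" "X \<in> A" "Y \<in> A" for \<beta> X Y
    unfolding p [OF that(2,3)]
    by (rule graded_piece_decomposition(2) [OF finite_basis_sub finite_basis_sub fil]) (use that in auto)
  then show "0 \<le> \<beta> \<Longrightarrow> X \<in> A \<Longrightarrow> Y \<in> A \<Longrightarrow> blocks (function_of W) \<beta> X Y = W \<beta> X Y" .
  have d: "decomposition [sub_atom X] [sub_atom Y] (pieces (function_of W) X Y)" if X: "X \<in> A" "Y \<in> A" for X Y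
    unfolding p [OF X] by (intro graded_piece_decomposition finite_basis_sub fil X)
  have f: "filtration [sub_atom X] [sub_atom Y] (\<lambda>\<beta>. blocks (function_of W) \<beta> X Y)" if X: "X \<in> A" "Y \<in> A" for X Y
    using filtration_level [OF finite_basis_sub finite_basis_sub d] X by simp
  have "metric_blocks A (blocks (function_of W))"
    using W f bl unfolding metric_blocks_def by (simp add: add_nonneg_nonneg)
  then show "distance_function (function_of W)" by (simp add: distance_function_iff(1) [OF F d])
qed

lemma distance_function_corresponds:
  assumes F: "distance_function F"
  shows "metric_blocks A (blocks F)"
    and "corresponds A V F \<longleftrightarrow> (\<forall>\<beta>\<ge>0. \<forall>X\<in>A. \<forall>Y\<in>A. blocks F \<beta> X Y = corner X Y ` V \<beta>)"
    and "holds (separation_formula (qset A) F) \<longleftrightarrow> (\<forall>X\<in>A. \<forall>Y\<in>A. blocks F 0 X Y \<subseteq> identity_block X Y)"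
proof -
  note i = distance_function_iff [OF distance_functionD [OF F]]
  show "metric_blocks A (blocks F)" using i(1) F by blast
  show "corresponds A V F \<longleftrightarrow> (\<forall>\<beta>\<ge>0. \<forall>X\<in>A. \<forall>Y\<in>A. blocks F \<beta> X Y = corner X Y ` V \<beta>)" by (rule i(3))
  show "holds (separation_formula (qset A) F) \<longleftrightarrow> (\<forall>X\<in>A. \<forall>Y\<in>A. blocks F 0 X Y \<subseteq> identity_block X Y)" by (rule i(2))
qed

lemma metric_of_cong:
  assumes "\<And>\<beta> X Y. 0 \<le> \<beta> \<Longrightarrow> X \<in> A \<Longrightarrow> Y \<in> A \<Longrightarrow> W \<beta> X Y = W' \<beta> X Y"
  shows "metric_of A W = metric_of A W'"
  unfolding metric_of_def by (rule restrict_ext) (use assms in auto)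

lemma correspondence:
  shows "\<exists>\<Phi>. bij_betw \<Phi> {V. quantum_pseudometric H (linfty A) V} {F. distance_function F} \<and>
     (\<forall>V F. quantum_pseudometric H (linfty A) V \<and> distance_function F \<longrightarrow> (\<Phi> V = F \<longleftrightarrow> corresponds A V F)) \<and>
     bij_betw \<Phi> {V. quantum_metric H (linfty A) V}
       {F. distance_function F \<and> holds (separation_formula (qset A) F)}"
proof -
  let ?M = "{V. quantum_pseudometric H (linfty A) V}" and ?F = "{F. distance_function F}"
  let ?c = "\<lambda>V \<beta> X Y. corner X Y ` V \<beta>"
  define \<Phi> where "\<Phi> V = function_of (?c V)" for V
  have \<Phi>: "distance_function (\<Phi> V)" "\<And>\<beta> X Y. 0 \<le> \<beta> \<Longrightarrow> X \<in> A \<Longrightarrow> Y \<in> A \<Longrightarrow> blocks (\<Phi> V) \<beta> X Y = corner X Y ` V \<beta>"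
    if V: "quantum_pseudometric H (linfty A) V" for V
    using function_of [OF metric_blocks_corners(1) [OF V]] by (simp_all add: \<Phi>_def)
  have corr: "\<Phi> V = F \<longleftrightarrow> corresponds A V F" if V: "quantum_pseudometric H (linfty A) V" and F: "distance_function F" for V F
  proof
    assume "\<Phi> V = F"
    then show "corresponds A V F" using \<Phi>(2) [OF V] distance_function_corresponds(2) [OF F] by blast
  next
    assume "corresponds A V F"
    then show "\<Phi> V = F"
      using \<Phi>(2) [OF V] distance_function_corresponds(2) [OF F] by (intro distance_function_eqI \<Phi>(1) [OF V] F) auto
  qed
  have bij: "bij_betw \<Phi> ?M ?F"
    unfolding bij_betw_def
  proof
    show "inj_on \<Phi> ?M"
    proof (rule inj_onI, clarify)
      fix V V' assume V: "quantum_pseudometric H (linfty A) V" and V': "quantum_pseudometric H (linfty A) V'" and eq: "\<Phi> V = \<Phi> V'"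
      have "metric_of A (?c V) = metric_of A (?c V')"
        using \<Phi>(2) [OF V] \<Phi>(2) [OF V'] eq by (intro metric_of_cong) auto
      then show "V = V'" using metric_blocks_corners(2) [OF V] metric_blocks_corners(2) [OF V'] by simp
    qed
    show "\<Phi> ` ?M = ?F"
    proof (intro equalityI subsetI)
      fix F assume "F \<in> \<Phi> ` ?M"
      then show "F \<in> ?F" using \<Phi>(1) by blast
    next
      fix F assume "F \<in> ?F"
      then have F: "distance_function F" by simp
      define V where "V = metric_of A (blocks F)"
      have V: "quantum_pseudometric H (linfty A) V"
        unfolding V_def by (rule pseudometric_metric_of(1) [OF distance_function_corresponds(1) [OF F]])
      have "corresponds A V F"
        unfolding distance_function_corresponds(2) [OF F] V_def
        using pseudometric_metric_of(2) [OF distance_function_corresponds(1) [OF F]] by blast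
      then have "\<Phi> V = F" using corr [OF V F] by blast
      then show "F \<in> \<Phi> ` ?M" using V by blast
    qed
  qed
  have sep: "quantum_metric H (linfty A) V \<longleftrightarrow> holds (separation_formula (qset A) (\<Phi> V))"
    if V: "quantum_pseudometric H (linfty A) V" for V
    using \<Phi>(2) [OF V order_refl] by (simp add: metric_iff_corners [OF V] distance_function_corresponds(3) [OF \<Phi>(1) [OF V]])
  have m: "{V. quantum_metric H (linfty A) V} = {V \<in> ?M. holds (separation_formula (qset A) (\<Phi> V))}"
    using sep by (auto simp: quantum_metric_def)
  have "bij_betw \<Phi> {V. quantum_metric H (linfty A) V} {F. distance_function F \<and> holds (separation_formula (qset A) F)}"
    unfolding m
  proof (rule bij_betw_subset [OF bij])
    show "{V \<in> ?M. holds (separation_formula (qset A) (\<Phi> V))} \<subseteq> ?M" by blast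
    show "\<Phi> ` {V \<in> ?M. holds (separation_formula (qset A) (\<Phi> V))} = {F. distance_function F \<and> holds (separation_formula (qset A) F)}"
      using bij unfolding bij_betw_def by auto
  qed
  then show ?thesis using bij corr by blast
qed

end

theorem corollary4p5p6:
  fixes A :: "'v::complex_inner set set"
    and \<X> :: "('v, ennreal) qset"
  assumes "quantum_set A"
    and "\<X> = qset A"
  shows "\<exists>\<Phi>.
     bij_betw \<Phi>
       {V. quantum_pseudometric (direct_sum A) (linfty A) V}
       {F. is_function [\<X>, dual_qset \<X>] [dists] F \<and>
           holds (refl_formula \<X> F) \<and> holds (sym_formula \<X> F) \<and> holds (triangle_formula \<X> F)} \<and>
     (\<forall>V F. quantum_pseudometric (direct_sum A) (linfty A) V \<and>
         is_function [\<X>, dual_qset \<X>] [dists] F \<and>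
         holds (refl_formula \<X> F) \<and> holds (sym_formula \<X> F) \<and> holds (triangle_formula \<X> F) \<longrightarrow>
         (\<Phi> V = F \<longleftrightarrow> corresponds A V F)) \<and>
     bij_betw \<Phi>
       {V. quantum_metric (direct_sum A) (linfty A) V}
       {F. is_function [\<X>, dual_qset \<X>] [dists] F \<and>
           holds (refl_formula \<X> F) \<and> holds (sym_formula \<X> F) \<and> holds (triangle_formula \<X> F) \<and>
           holds (separation_formula \<X> F)}"
proof -
  interpret atom_set A by unfold_locales (rule assms(1))
  show ?thesis using correspondence unfolding distance_function_def assms(2) by (simp only: conj_assoc)
qed

end
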